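(* Let $p:E\to M$ be a smooth fiber bundle over a smooth manifold $M$, let $\mathcal F$ be the sheaf of sections of $E$, and let $\mathcal F^\bullet$ be its Gromov diagonal normal sheaf. For any $r\in\mathbb N$, the morphism $\Psi_r:\mathcal F^\bullet\to\mathcal J^r_E$ is a weak homotopy equivalence of sheaves. Equivalently, for any $r>0$, the Gromov diagonal normal sheaf $\mathcal F^\bullet$ is naturally homotopy equivalent to the sheaf $\mathcal J^r_E$ of $r$-jets of sections of $E$.
   Context: A quasitopological space is a set $A$ with, for each topological space $Z$, a chosen set $A(Z)$ of "continuous" maps $Z\to A$, closed under precomposition with continuous maps and under gluing over open covers and over covers by two closed sets. $\mathrm{Maps}(W,A)$ is $A(W)$ with $\mathrm{Maps}(W,A)(Z)=A(W\times Z)$. Sections of the smooth bundle $E$ are smooth; $\mathcal F(U)=\Gamma(U;E)$ with the quasitopology inherited from $\mathrm{Maps}(U,E)$. Let $\mathcal P$ be the sheaf on $M\times M$ with $\mathcal P(U\times V)=\mathrm{Maps}(U,\mathcal F(V))$ on basic open sets; $\mathcal F^\bullet=\mathrm{diag}^*\mathcal P$, where $\mathrm{diag}:M\to M\times M$ is the diagonal embedding. Thus an element of $\mathcal F^\bullet(U)$ is a germ along the diagonal of a map from a neighbourhood of $\mathrm{diag}(U)\subset U\times U$ to $E$, which restricts on $\mathrm{diag}(U)$ to a section $s$ of $E$ over $U$ and on each $\{p\}\times U$ (near $(p,p)$) to a germ $g_p$ at $p$ of a section of $E$ with $g_p(p)=s(p)$; it is written $(s,\{g_p:p\in U\})$.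 $\mathcal J^r_E$ is the sheaf of sections of the bundle of $r$-jets of sections of $E$ (formal $r$-jets). $\Psi_r(s,\{g_p:p\in U\})\in\mathcal J^r_E(U)$ is the section of the $r$-jet bundle whose value at $p\in U$ is $J^r_pg_p$. A morphism of sheaves is a weak homotopy equivalence if it induces a weak homotopy equivalence on sections over every open set.
   Formalization: The smooth sections F(U) carry the C^∞ quasitopology (all jets of a family vary continuously), not merely the one inherited from Maps(U,E), under which Ψ_r (r≥1) need not give continuous jets: g_p(q)=p sin((q−p)/p), g_0=0. *)

theory Defs
  imports "HOL-Analysis.Analysis"
begin

section \<open>Smooth functions\<close>

primrec iter_deriv ::
  "'a::real_normed_vector list \<Rightarrow> ('a \<Rightarrow> 'b::real_normed_vector) \<Rightarrow> 'a \<Rightarrow> 'b" where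
  "iter_deriv [] f = f"
| "iter_deriv (v # vs) f = iter_deriv vs (\<lambda>x. frechet_derivative f (at x) v)"

text \<open>On an open set of a finite-dimensional space this is \<open>C\<^sup>\<infinity>\<close>: differentiability of all
  iterated directional derivatives already forces their continuity.\<close>

definition smooth_on ::
  "'a::real_normed_vector set \<Rightarrow> ('a \<Rightarrow> 'b::real_normed_vector) \<Rightarrow> bool" where
  "smooth_on S f \<longleftrightarrow> (\<forall>vs. \<forall>x\<in>S. iter_deriv vs f differentiable (at x))"


section \<open>Smooth manifolds and fiber bundles\<close>

text \<open>A chart is a pair of its domain and its coordinate map; the values of the coordinate map
  outside the domain are irrelevant.  The model space is any finite-dimensional normed space
  rather than a type of class \<open>euclidean_space\<close>, since the latter excludes dimension 0.\<close>

type_synonym ('a, 'b) chart = "'a set \<times> ('a \<Rightarrow> 'b)"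

record ('a, 'b) manifold =
  mtop :: "'a topology"
  atlas :: "('a, 'b) chart set"

definition topological_chart :: "'a topology \<Rightarrow> ('a, 'b::real_normed_vector) chart \<Rightarrow> bool" where
  "topological_chart T = (\<lambda>(U, \<phi>). openin T U \<and> open (\<phi> ` U) \<and>
     homeomorphic_map (subtopology T U) (top_of_set (\<phi> ` U)) \<phi>)"

definition chart_compatible ::
  "('a, 'b::real_normed_vector) chart \<Rightarrow> ('a, 'b) chart \<Rightarrow> bool" where
  "chart_compatible = (\<lambda>(U, \<phi>) (V, \<psi>).
     smooth_on (\<phi> ` (U \<inter> V)) (\<psi> \<circ> inv_into U \<phi>) \<and>
     smooth_on (\<psi> ` (U \<inter> V)) (\<phi> \<circ> inv_into V \<psi>))"

text \<open>The atlas is the maximal one.\<close>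

definition smooth_manifold :: "('a, 'b::real_normed_vector) manifold \<Rightarrow> bool" where
  "smooth_manifold M \<longleftrightarrow>
     (\<exists>B::'b set. finite B \<and> span B = UNIV) \<and>
     Hausdorff_space (mtop M) \<and> second_countable (mtop M) \<and>
     (\<forall>c\<in>atlas M. topological_chart (mtop M) c) \<and>
     topspace (mtop M) = (\<Union>c\<in>atlas M. fst c) \<and>
     (\<forall>c\<in>atlas M. \<forall>d\<in>atlas M. chart_compatible c d) \<and>
     (\<forall>c. topological_chart (mtop M) c \<and> (\<forall>d\<in>atlas M. chart_compatible c d) \<longrightarrow> c \<in> atlas M)"

definition open_submanifold :: "('a, 'b) manifold \<Rightarrow> 'a set \<Rightarrow> ('a, 'b) manifold" where
  "open_submanifold M U =
     \<lparr>mtop = subtopology (mtop M) U, atlas = {c \<in> atlas M. fst c \<subseteq> U}\<rparr>"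

definition prod_manifold ::
  "('a, 'b::real_normed_vector) manifold \<Rightarrow> ('c, 'd::real_normed_vector) manifold \<Rightarrow>
   ('a \<times> 'c, 'b \<times> 'd) manifold" where
  "prod_manifold M N =
     \<lparr>mtop = prod_topology (mtop M) (mtop N),
      atlas = {c. topological_chart (prod_topology (mtop M) (mtop N)) c \<and>
        (\<forall>(U, \<phi>)\<in>atlas M. \<forall>(V, \<psi>)\<in>atlas N. chart_compatible c (U \<times> V, map_prod \<phi> \<psi>))}\<rparr>"

definition smooth_map ::
  "('a, 'b::real_normed_vector) manifold \<Rightarrow> ('c, 'd::real_normed_vector) manifold \<Rightarrow>
   ('a \<Rightarrow> 'c) \<Rightarrow> bool" where
  "smooth_map M N f \<longleftrightarrow> continuous_map (mtop M) (mtop N) f \<and>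
     (\<forall>(U, \<phi>)\<in>atlas M. \<forall>(V, \<psi>)\<in>atlas N.
        smooth_on (\<phi> ` {x\<in>U. f x \<in> V}) (\<psi> \<circ> f \<circ> inv_into U \<phi>))"

definition diffeomorphism ::
  "('a, 'b::real_normed_vector) manifold \<Rightarrow> ('c, 'd::real_normed_vector) manifold \<Rightarrow>
   ('a \<Rightarrow> 'c) \<Rightarrow> bool" where
  "diffeomorphism M N f \<longleftrightarrow> smooth_map M N f \<and>
     (\<exists>g. smooth_map N M g \<and> (\<forall>x\<in>topspace (mtop M). g (f x) = x) \<and>
          (\<forall>y\<in>topspace (mtop N). f (g y) = y))"

definition smooth_fiber_bundle ::
  "('m, 'b::real_normed_vector) manifold \<Rightarrow> ('e, 'b \<times> 'c) manifold \<Rightarrow>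
   ('f, 'c::real_normed_vector) manifold \<Rightarrow> ('e \<Rightarrow> 'm) \<Rightarrow> bool" where
  "smooth_fiber_bundle M E F p \<longleftrightarrow>
     smooth_manifold M \<and> smooth_manifold E \<and> smooth_manifold F \<and> smooth_map E M p \<and>
     (\<forall>b\<in>topspace (mtop M). \<exists>U \<tau>. openin (mtop M) U \<and> b \<in> U \<and>
        diffeomorphism (open_submanifold E {x\<in>topspace (mtop E). p x \<in> U})
          (prod_manifold (open_submanifold M U) F) \<tau> \<and>
        (\<forall>x\<in>topspace (mtop E). p x \<in> U \<longrightarrow> fst (\<tau> x) = p x))"


section \<open>Quasitopological spaces\<close>

text \<open>HOL cannot quantify over the spaces of all types inside a definition, so the admissible maps
  are given for the test spaces on one type \<open>'z\<close>; the quasitopologies below are polymorphic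
  in \<open>'z\<close>.  Maps out of a test space are HOL functions whose values off its \<open>topspace\<close>
  are ignored.\<close>

type_synonym ('z, 'a) quasitopology = "'z topology \<Rightarrow> ('z \<Rightarrow> 'a) set"

definition quasitopology_on :: "'a set \<Rightarrow> ('z, 'a) quasitopology \<Rightarrow> bool" where
  "quasitopology_on X A \<longleftrightarrow>
     (\<forall>Z. \<forall>f\<in>A Z. f ` topspace Z \<subseteq> X) \<and>
     (\<forall>Z f. \<forall>g\<in>A Z. (\<forall>z\<in>topspace Z. f z = g z) \<longrightarrow> f \<in> A Z) \<and>
     (\<forall>Z Z' \<phi>. \<forall>f\<in>A Z. continuous_map Z' Z \<phi> \<longrightarrow> f \<circ> \<phi> \<in> A Z') \<and>
     (\<forall>Z \<C> f. (\<forall>C\<in>\<C>. openin Z C \<and> f \<in> A (subtopology Z C)) \<and> \<Union>\<C> = topspace Z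
        \<longrightarrow> f \<in> A Z) \<and>
     (\<forall>Z C D f. closedin Z C \<and> closedin Z D \<and> C \<union> D = topspace Z \<and>
        f \<in> A (subtopology Z C) \<and> f \<in> A (subtopology Z D) \<longrightarrow> f \<in> A Z)"

definition top_quasitopology :: "'a topology \<Rightarrow> ('z, 'a) quasitopology" where
  "top_quasitopology T Z = {f. continuous_map Z T f}"

definition Maps ::
  "'w topology \<Rightarrow> ('w \<times> 'z, 'a) quasitopology \<Rightarrow> ('z, 'w \<Rightarrow> 'a) quasitopology" where
  "Maps W A Z = {g. (\<forall>z\<in>topspace Z. g z \<in> extensional (topspace W)) \<and>
     (\<lambda>(w, z). g z w) \<in> A (prod_topology W Z)}"


subsection \<open>Weak homotopy equivalences\<close>

text \<open>The cube \<open>I\<^sup>n\<close>, realised in the space of real sequences with the product topology.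
  A homotopy on \<open>I\<^sup>n\<close> is a map on \<open>I\<^sup>n\<^sup>+\<^sup>1\<close> whose time variable is coordinate \<open>n\<close>.\<close>

definition cube_set :: "nat \<Rightarrow> (nat \<Rightarrow> real) set" where
  "cube_set n = {x. (\<forall>i<n. 0 \<le> x i \<and> x i \<le> 1) \<and> (\<forall>i\<ge>n. x i = 0)}"

definition cube :: "nat \<Rightarrow> (nat \<Rightarrow> real) topology" where
  "cube n = top_of_set (cube_set n)"

definition cube_boundary :: "nat \<Rightarrow> (nat \<Rightarrow> real) set" where
  "cube_boundary n = {x \<in> cube_set n. \<exists>i<n. x i = 0 \<or> x i = 1}"

definition path_rel :: "'a set \<Rightarrow> (nat \<Rightarrow> real, 'a) quasitopology \<Rightarrow> 'a rel" where
  "path_rel X A = {(x, y). x \<in> X \<and> y \<in> X \<and>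
     (\<exists>\<gamma>\<in>A (cube 1). \<gamma> (\<lambda>_. 0) = x \<and> \<gamma> ((\<lambda>_. 0)(0 := 1)) = y)}"

definition pi0 :: "'a set \<Rightarrow> (nat \<Rightarrow> real, 'a) quasitopology \<Rightarrow> 'a set set" where
  "pi0 X A = X // path_rel X A"

definition spheroids ::
  "(nat \<Rightarrow> real, 'a) quasitopology \<Rightarrow> nat \<Rightarrow> 'a \<Rightarrow> ((nat \<Rightarrow> real) \<Rightarrow> 'a) set" where
  "spheroids A n a = {f \<in> A (cube n). \<forall>x\<in>cube_boundary n. f x = a}"

definition spheroid_homotopy ::
  "(nat \<Rightarrow> real, 'a) quasitopology \<Rightarrow> nat \<Rightarrow> 'a \<Rightarrow> ((nat \<Rightarrow> real) \<Rightarrow> 'a) rel" where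
  "spheroid_homotopy A n a = {(f, g). f \<in> spheroids A n a \<and> g \<in> spheroids A n a \<and>
     (\<exists>H\<in>A (cube (Suc n)).
        (\<forall>x\<in>cube_set n. H x = f x \<and> H (x(n := 1)) = g x) \<and>
        (\<forall>x\<in>cube_boundary n. \<forall>t\<in>{0..1}. H (x(n := t)) = a))}"

definition pi_n ::
  "(nat \<Rightarrow> real, 'a) quasitopology \<Rightarrow> nat \<Rightarrow> 'a \<Rightarrow> ((nat \<Rightarrow> real) \<Rightarrow> 'a) set set" where
  "pi_n A n a = spheroids A n a // spheroid_homotopy A n a"

definition quasi_continuous ::
  "'a set \<Rightarrow> ('z, 'a) quasitopology \<Rightarrow> 'b set \<Rightarrow> ('z, 'b) quasitopology \<Rightarrow> ('a \<Rightarrow> 'b) \<Rightarrow> bool" where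
  "quasi_continuous X A Y B f \<longleftrightarrow> f ` X \<subseteq> Y \<and> (\<forall>Z. \<forall>g\<in>A Z. f \<circ> g \<in> B Z)"

definition weak_homotopy_equivalence ::
  "'a set \<Rightarrow> (nat \<Rightarrow> real, 'a) quasitopology \<Rightarrow> 'b set \<Rightarrow> (nat \<Rightarrow> real, 'b) quasitopology \<Rightarrow>
   ('a \<Rightarrow> 'b) \<Rightarrow> bool" where
  "weak_homotopy_equivalence X A Y B f \<longleftrightarrow>
     quasi_continuous X A Y B f \<and>
     bij_betw (\<lambda>C. path_rel Y B `` (f ` C)) (pi0 X A) (pi0 Y B) \<and>
     (\<forall>n\<ge>1. \<forall>a\<in>X. bij_betw (\<lambda>C. spheroid_homotopy B n (f a) `` ((\<circ>) f ` C))
        (pi_n A n a) (pi_n B n (f a)))"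


subsection \<open>Sheaves of quasitopological spaces\<close>

text \<open>All sheaves here consist of functions on open subsets of a space, extended by
  \<open>undefined\<close>; \<open>restrict\<close> is the restriction map.  \<open>X U\<close> is the set of sections over
  \<open>U\<close> and \<open>A U\<close> its quasitopology.\<close>

definition sheaf_morphism ::
  "'m topology \<Rightarrow>
   ('m set \<Rightarrow> ('m \<Rightarrow> 'a) set) \<Rightarrow> ('m set \<Rightarrow> ('z, 'm \<Rightarrow> 'a) quasitopology) \<Rightarrow>
   ('m set \<Rightarrow> ('m \<Rightarrow> 'b) set) \<Rightarrow> ('m set \<Rightarrow> ('z, 'm \<Rightarrow> 'b) quasitopology) \<Rightarrow>
   ('m set \<Rightarrow> ('m \<Rightarrow> 'a) \<Rightarrow> ('m \<Rightarrow> 'b)) \<Rightarrow> bool" where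
  "sheaf_morphism T X A Y B \<Phi> \<longleftrightarrow>
     (\<forall>U. openin T U \<longrightarrow> quasi_continuous (X U) (A U) (Y U) (B U) (\<Phi> U)) \<and>
     (\<forall>U V. openin T U \<and> openin T V \<and> V \<subseteq> U \<longrightarrow>
        (\<forall>x\<in>X U. \<Phi> V (restrict x V) = restrict (\<Phi> U x) V))"

definition sheaf_weak_equivalence ::
  "'m topology \<Rightarrow>
   ('m set \<Rightarrow> ('m \<Rightarrow> 'a) set) \<Rightarrow> ('m set \<Rightarrow> (nat \<Rightarrow> real, 'm \<Rightarrow> 'a) quasitopology) \<Rightarrow>
   ('m set \<Rightarrow> ('m \<Rightarrow> 'b) set) \<Rightarrow> ('m set \<Rightarrow> (nat \<Rightarrow> real, 'm \<Rightarrow> 'b) quasitopology) \<Rightarrow>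
   ('m set \<Rightarrow> ('m \<Rightarrow> 'a) \<Rightarrow> ('m \<Rightarrow> 'b)) \<Rightarrow> bool" where
  "sheaf_weak_equivalence T X A Y B \<Phi> \<longleftrightarrow>
     sheaf_morphism T X A Y B \<Phi> \<and>
     (\<forall>U. openin T U \<longrightarrow> weak_homotopy_equivalence (X U) (A U) (Y U) (B U) (\<Phi> U))"


section \<open>Jets, the diagonal normal sheaf and the comparison map\<close>

definition germ_at :: "'a topology \<Rightarrow> 'a \<Rightarrow> ('a \<Rightarrow> 'b) \<Rightarrow> ('a \<Rightarrow> 'b) set" where
  "germ_at T x h = {h'. \<exists>W. openin T W \<and> x \<in> W \<and> (\<forall>y\<in>W. h' y = h y)}"

context
  fixes M :: "('m, 'b::real_normed_vector) manifold"
    and E :: "('e, 'b \<times> 'c::real_normed_vector) manifold"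
    and p :: "'e \<Rightarrow> 'm"
begin

definition smooth_sections :: "'m set \<Rightarrow> ('m \<Rightarrow> 'e) set" where
  "smooth_sections V =
     {s \<in> extensional V. smooth_map (open_submanifold M V) E s \<and> (\<forall>q\<in>V. p (s q) = q)}"

definition local_sections_at :: "'m \<Rightarrow> ('m \<Rightarrow> 'e) set" where
  "local_sections_at q = (\<Union>V\<in>{V. openin (mtop M) V \<and> q \<in> V}. smooth_sections V)"

text \<open>Charts of the total space that lie over a chart of the base.\<close>

definition adapted_charts :: "(('m, 'b) chart \<times> ('e, 'b \<times> 'c) chart) set" where
  "adapted_charts = {((U, \<phi>), (N, \<eta>)). (U, \<phi>) \<in> atlas M \<and> (N, \<eta>) \<in> atlas E \<and>
     (\<forall>x\<in>N. p x \<in> U \<and> fst (\<eta> x) = \<phi> (p x))}"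

definition local_rep ::
  "('m, 'b) chart \<Rightarrow> ('e, 'b \<times> 'c) chart \<Rightarrow> ('m \<Rightarrow> 'e) \<Rightarrow> 'b \<Rightarrow> 'c" where
  "local_rep = (\<lambda>(U, \<phi>) (N, \<eta>) s x. snd (\<eta> (s (inv_into U \<phi> x))))"

definition same_jet :: "nat \<Rightarrow> 'm \<Rightarrow> ('m \<Rightarrow> 'e) \<Rightarrow> ('m \<Rightarrow> 'e) \<Rightarrow> bool" where
  "same_jet r q s s' \<longleftrightarrow> s q = s' q \<and>
     (\<forall>(c, d)\<in>adapted_charts. s q \<in> fst d \<longrightarrow> (\<forall>vs. length vs \<le> r \<longrightarrow>
        iter_deriv vs (local_rep c d s) (snd c q) = iter_deriv vs (local_rep c d s') (snd c q)))"

text \<open>An \<open>r\<close>-jet is recorded together with its source.\<close>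

definition jet :: "nat \<Rightarrow> 'm \<Rightarrow> ('m \<Rightarrow> 'e) \<Rightarrow> 'm \<times> ('m \<Rightarrow> 'e) set" where
  "jet r q s = (q, {s' \<in> local_sections_at q. same_jet r q s s'})"

text \<open>The total space of the bundle of \<open>r\<close>-jets, with the topology for which the source and the
  coordinates induced by adapted charts (the iterated directional derivatives of order at most
  \<open>r\<close> of the fiber coordinate) are local coordinates.\<close>

definition jet_space :: "nat \<Rightarrow> ('m \<times> ('m \<Rightarrow> 'e) set) topology" where
  "jet_space r = topology_generated_by
     ({{jet r q s | q s. q \<in> U \<and> s \<in> local_sections_at q} | U. openin (mtop M) U} \<union>
      {{jet r q s | q s. q \<in> topspace (mtop M) \<and> s \<in> local_sections_at q \<and> s q \<in> fst d \<and>
          iter_deriv vs (local_rep c d s) (snd c q) \<in> G} | c d vs G.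
        (c, d) \<in> adapted_charts \<and> length vs \<le> r \<and> open G})"

text \<open>\<open>\<F>(V)\<close>: a family of smooth sections is admissible if it is admissible in \<open>Maps(V, E)\<close>
  and so are all its jet prolongations, i.e. the quasitopology is the \<open>C\<^sup>\<infinity>\<close> one.  Joint
  continuity of the sections alone would not even make the jet of a family continuous.\<close>

definition section_quasitopology :: "'m set \<Rightarrow> ('z, 'm \<Rightarrow> 'e) quasitopology" where
  "section_quasitopology V Z =
     {f \<in> Maps (subtopology (mtop M) V) (top_quasitopology (mtop E)) Z.
        (\<forall>z\<in>topspace Z. f z \<in> smooth_sections V) \<and>
        (\<forall>k. (\<lambda>z. \<lambda>q\<in>V. jet k q (f z)) \<in>
               Maps (subtopology (mtop M) V) (top_quasitopology (jet_space k)) Z)}"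

text \<open>The sheaf \<open>\<P>\<close> on \<open>M \<times> M\<close>.  A section over a general open set \<open>W\<close> is a compatible family
  of sections over the boxes \<open>U \<times> V \<subseteq> W\<close>, that is, one function on \<open>W\<close>.\<close>

definition P_sections :: "('m \<times> 'm) set \<Rightarrow> ('m \<times> 'm \<Rightarrow> 'e) set" where
  "P_sections W = {h \<in> extensional W.
     \<forall>U V. openin (mtop M) U \<and> openin (mtop M) V \<and> U \<times> V \<subseteq> W \<longrightarrow>
       (\<lambda>a. \<lambda>q\<in>V. h (a, q)) \<in> section_quasitopology V (subtopology (mtop M) U)}"

definition P_quasitopology :: "('m \<times> 'm) set \<Rightarrow> ('z, 'm \<times> 'm \<Rightarrow> 'e) quasitopology" where
  "P_quasitopology W Z = {h. (\<forall>z\<in>topspace Z. h z \<in> extensional W) \<and>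
     (\<forall>U V. openin (mtop M) U \<and> openin (mtop M) V \<and> U \<times> V \<subseteq> W \<longrightarrow>
       (\<lambda>z. \<lambda>a\<in>U. \<lambda>q\<in>V. h z (a, q)) \<in>
         Maps (subtopology (mtop M) U) (section_quasitopology V) Z)}"

abbreviation diag_germ :: "'m \<Rightarrow> ('m \<times> 'm \<Rightarrow> 'e) \<Rightarrow> ('m \<times> 'm \<Rightarrow> 'e) set" where
  "diag_germ a \<equiv> germ_at (prod_topology (mtop M) (mtop M)) (a, a)"

text \<open>\<open>\<F>\<^sup>\<bullet> = diag\<^sup>* \<P>\<close>: functions to the stalks of \<open>\<P>\<close> along the diagonal that are locally
  represented by sections of \<open>\<P>\<close>.\<close>

definition diag_sections :: "'m set \<Rightarrow> ('m \<Rightarrow> ('m \<times> 'm \<Rightarrow> 'e) set) set" where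
  "diag_sections U = {\<gamma> \<in> extensional U. \<forall>a\<in>U. \<exists>V W. \<exists>h\<in>P_sections W.
     openin (mtop M) V \<and> a \<in> V \<and> V \<subseteq> U \<and>
     openin (prod_topology (mtop M) (mtop M)) W \<and> (\<forall>b\<in>V. (b, b) \<in> W) \<and>
     (\<forall>b\<in>V. \<gamma> b = diag_germ b h)}"

text \<open>The pullback quasitopology is the smallest one, local on the base, for which the canonical
  maps from \<open>\<P>(W)\<close>, \<open>W\<close> a neighbourhood of the diagonal of \<open>U\<close>, are continuous.  Closure under
  precomposition is inherited from the rule \<open>germs\<close> (see \<open>diag_family_compose\<close>).\<close>

inductive diag_family ::
  "'m set \<Rightarrow> 'z topology \<Rightarrow> ('z \<Rightarrow> 'm \<Rightarrow> ('m \<times> 'm \<Rightarrow> 'e) set) \<Rightarrow> bool" where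
  germs: "diag_family U Z f"
    if "openin (mtop M) U" "openin (prod_topology (mtop M) (mtop M)) W" "\<forall>a\<in>U. (a, a) \<in> W"
       "h \<in> P_quasitopology W Z" "\<forall>z\<in>topspace Z. f z = (\<lambda>a\<in>U. diag_germ a (h z))"
| open_cover: "diag_family U Z f"
    if "openin (mtop M) U" "\<Union>\<C> = topspace Z"
       "\<forall>C\<in>\<C>. openin Z C \<and> diag_family U (subtopology Z C) f"
| closed_cover: "diag_family U Z f"
    if "closedin Z C" "closedin Z D" "C \<union> D = topspace Z"
       "diag_family U (subtopology Z C) f" "diag_family U (subtopology Z D) f"
| base_cover: "diag_family U Z f"
    if "openin (mtop M) U" "\<Union>\<U> = U" "\<forall>z\<in>topspace Z. f z \<in> extensional U"
       "\<forall>V\<in>\<U>. openin (mtop M) V \<and> diag_family V Z (\<lambda>z. restrict (f z) V)"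

definition diag_quasitopology ::
  "'m set \<Rightarrow> ('z, 'm \<Rightarrow> ('m \<times> 'm \<Rightarrow> 'e) set) quasitopology" where
  "diag_quasitopology U Z = {f. diag_family U Z f}"

text \<open>Sanity check: \<open>\<F>\<^sup>\<bullet>(U)\<close> is a quasitopological space.\<close>

lemma Maps_top_compose:
  assumes "f \<in> Maps W (top_quasitopology T) Z" "continuous_map Z' Z \<phi>"
  shows "f \<circ> \<phi> \<in> Maps W (top_quasitopology T) Z'"
proof -
  have "continuous_map (prod_topology W Z') (prod_topology W Z) (\<lambda>(w, z). (w, \<phi> z))"
    using assms(2) continuous_map_prod_top[of W Z' W Z "\<lambda>w. w" \<phi>] by simp
  then have "continuous_map (prod_topology W Z') T
      ((\<lambda>(w, z). f z w) \<circ> (\<lambda>(w, z). (w, \<phi> z)))"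
    using assms(1) by (intro continuous_map_compose) (auto simp: Maps_def top_quasitopology_def)
  moreover have "((\<lambda>(w, z). f z w) \<circ> (\<lambda>(w, z). (w, \<phi> z))) = (\<lambda>(w, z). (f \<circ> \<phi>) z w)"
    by auto
  ultimately show ?thesis
    using assms continuous_map_image_subset_topspace[OF assms(2)]
    by (auto simp: Maps_def top_quasitopology_def)
qed

lemma Maps_top_cong:
  assumes "f \<in> Maps W (top_quasitopology T) Z" "\<And>z. z \<in> topspace Z \<Longrightarrow> g z = f z"
  shows "g \<in> Maps W (top_quasitopology T) Z"
proof -
  have "continuous_map (prod_topology W Z) T (\<lambda>(w, z). g z w)"
  proof (rule continuous_map_eq)
    show "continuous_map (prod_topology W Z) T (\<lambda>(w, z). f z w)"
      using assms(1) by (simp add: Maps_def top_quasitopology_def)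
    show "(case x of (w, z) \<Rightarrow> f z w) = (case x of (w, z) \<Rightarrow> g z w)"
      if "x \<in> topspace (prod_topology W Z)" for x
      using that assms(2) by auto
  qed
  moreover have "g z \<in> extensional (topspace W)" if "z \<in> topspace Z" for z
    using that assms by (simp add: Maps_def)
  ultimately show ?thesis
    by (simp add: Maps_def top_quasitopology_def)
qed

lemma section_quasitopology_compose:
  assumes "f \<in> section_quasitopology V Z" "continuous_map Z' Z \<phi>"
  shows "f \<circ> \<phi> \<in> section_quasitopology V Z'"
proof -
  have "(\<lambda>z. \<lambda>q\<in>V. jet k q ((f \<circ> \<phi>) z)) = (\<lambda>z. \<lambda>q\<in>V. jet k q (f z)) \<circ> \<phi>" for k
    by auto
  with assms continuous_map_image_subset_topspace[OF assms(2)] show ?thesis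
    unfolding section_quasitopology_def by (auto intro!: Maps_top_compose)
qed

lemma section_quasitopology_cong:
  assumes "f \<in> section_quasitopology V Z" "\<And>z. z \<in> topspace Z \<Longrightarrow> g z = f z"
  shows "g \<in> section_quasitopology V Z"
proof -
  have "(\<lambda>z. \<lambda>q\<in>V. jet k q (g z)) \<in>
      Maps (subtopology (mtop M) V) (top_quasitopology (jet_space k)) Z" for k
    by (rule Maps_top_cong[where f = "\<lambda>z. \<lambda>q\<in>V. jet k q (f z)"])
      (use assms in \<open>auto simp: section_quasitopology_def\<close>)
  then show ?thesis
    using assms Maps_top_cong[where f = f and g = g]
    by (auto simp: section_quasitopology_def)
qed

lemma P_quasitopology_compose:
  assumes "h \<in> P_quasitopology W Z" "continuous_map Z' Z \<phi>"
  shows "h \<circ> \<phi> \<in> P_quasitopology W Z'"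
proof -
  have im: "\<phi> z \<in> topspace Z" if "z \<in> topspace Z'" for z
    using continuous_map_image_subset_topspace[OF assms(2)] that by blast
  have "(\<lambda>z. \<lambda>a\<in>U. \<lambda>q\<in>V. (h \<circ> \<phi>) z (a, q)) \<in>
      Maps (subtopology (mtop M) U) (section_quasitopology V) Z'"
    if "openin (mtop M) U" "openin (mtop M) V" "U \<times> V \<subseteq> W" for U V
  proof -
    have *: "(\<lambda>z. \<lambda>a\<in>U. \<lambda>q\<in>V. h z (a, q)) \<in>
        Maps (subtopology (mtop M) U) (section_quasitopology V) Z"
      using assms(1) that by (auto simp: P_quasitopology_def)
    have c: "continuous_map (prod_topology (subtopology (mtop M) U) Z')
        (prod_topology (subtopology (mtop M) U) Z) (\<lambda>(w, z). (w, \<phi> z))"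
      using assms(2) continuous_map_prod_top[of "subtopology (mtop M) U" Z'
        "subtopology (mtop M) U" Z "\<lambda>w. w" \<phi>] by simp
    have "(\<lambda>(a, z). (\<lambda>a\<in>U. \<lambda>q\<in>V. h z (a, q)) a) \<circ> (\<lambda>(w, z). (w, \<phi> z)) \<in>
        section_quasitopology V (prod_topology (subtopology (mtop M) U) Z')"
      using * by (intro section_quasitopology_compose[OF _ c]) (auto simp: Maps_def)
    moreover have "(\<lambda>(a, z). (\<lambda>a\<in>U. \<lambda>q\<in>V. h z (a, q)) a) \<circ> (\<lambda>(w, z). (w, \<phi> z)) =
        (\<lambda>(a, z). (\<lambda>a\<in>U. \<lambda>q\<in>V. (h \<circ> \<phi>) z (a, q)) a)"
      by auto
    ultimately show ?thesis
      using * im by (auto simp: Maps_def)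
  qed
  then show ?thesis
    using assms(1) im by (auto simp: P_quasitopology_def)
qed

lemma diag_family_compose:
  fixes Z :: "'z topology" and Z' :: "'y topology"
  assumes "diag_family U Z f" "continuous_map Z' Z \<phi>"
  shows "diag_family U Z' (f \<circ> \<phi>)"
  using assms
proof (induction arbitrary: Z' rule: diag_family.induct)
  case (germs U W h Z f)
  show ?case
  proof (rule diag_family.germs[OF germs.hyps(1-3) P_quasitopology_compose[OF germs.hyps(4)]])
    show "continuous_map Z' Z \<phi>" by fact
    show "\<forall>z\<in>topspace Z'. (f \<circ> \<phi>) z = (\<lambda>a\<in>U. diag_germ a ((h \<circ> \<phi>) z))"
      using germs.hyps(5) continuous_map_image_subset_topspace[OF germs.prems] by auto
  qed
next
  case (open_cover U \<C> Z f)
  let ?pre = "\<lambda>C. {z \<in> topspace Z'. \<phi> z \<in> C}"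
  show ?case
  proof (rule diag_family.open_cover)
    show "openin (mtop M) U" by fact
    have "\<phi> z \<in> \<Union>\<C>" if "z \<in> topspace Z'" for z
      unfolding open_cover.hyps(2)
      using continuous_map_image_subset_topspace[OF open_cover.prems] that by blast
    then show "\<Union>(?pre ` \<C>) = topspace Z'"
      by blast
    show "\<forall>D\<in>?pre ` \<C>. openin Z' D \<and> diag_family U (subtopology Z' D) (f \<circ> \<phi>)"
    proof
      fix D assume "D \<in> ?pre ` \<C>"
      then obtain C where C: "C \<in> \<C>" "D = ?pre C" by auto
      have "openin Z' D"
        unfolding C(2) using open_cover.IH C(1)
        by (intro openin_continuous_map_preimage[OF open_cover.prems]) blast
      moreover have "continuous_map (subtopology Z' D) (subtopology Z C) \<phi>"
        using open_cover.prems C(2)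
        by (auto simp: continuous_map_in_subtopology continuous_map_from_subtopology)
      ultimately show "openin Z' D \<and> diag_family U (subtopology Z' D) (f \<circ> \<phi>)"
        using open_cover.IH C(1) by blast
    qed
  qed
next
  case (closed_cover Z C D U f)
  let ?pre = "\<lambda>C. {z \<in> topspace Z'. \<phi> z \<in> C}"
  have c: "continuous_map (subtopology Z' (?pre B)) (subtopology Z B) \<phi>" for B
    using closed_cover.prems
    by (auto simp: continuous_map_in_subtopology continuous_map_from_subtopology)
  show ?case
  proof (rule diag_family.closed_cover)
    show "closedin Z' (?pre C)" "closedin Z' (?pre D)"
      by (rule closedin_continuous_map_preimage[OF closed_cover.prems], fact)+
    have "\<phi> z \<in> C \<union> D" if "z \<in> topspace Z'" for z
      unfolding closed_cover.hyps(3)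
      using continuous_map_image_subset_topspace[OF closed_cover.prems] that by blast
    then show "?pre C \<union> ?pre D = topspace Z'"
      by blast
    show "diag_family U (subtopology Z' (?pre C)) (f \<circ> \<phi>)"
      "diag_family U (subtopology Z' (?pre D)) (f \<circ> \<phi>)"
      by (rule closed_cover.IH(1)[OF c], rule closed_cover.IH(2)[OF c])
  qed
next
  case (base_cover U \<U> Z f)
  show ?case
  proof (rule diag_family.base_cover)
    show "openin (mtop M) U" "\<Union>\<U> = U" by fact+
    show "\<forall>z\<in>topspace Z'. (f \<circ> \<phi>) z \<in> extensional U"
      using base_cover.hyps(3) continuous_map_image_subset_topspace[OF base_cover.prems] by auto
    show "\<forall>V\<in>\<U>. openin (mtop M) V \<and> diag_family V Z' (\<lambda>z. restrict ((f \<circ> \<phi>) z) V)"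
    proof
      fix V assume "V \<in> \<U>"
      then have "openin (mtop M) V \<and> diag_family V Z' ((\<lambda>z. restrict (f z) V) \<circ> \<phi>)"
        using base_cover.IH base_cover.prems by blast
      then show "openin (mtop M) V \<and> diag_family V Z' (\<lambda>z. restrict ((f \<circ> \<phi>) z) V)"
        unfolding comp_def .
    qed
  qed
qed

lemma diag_family_cong:
  assumes "diag_family U Z f" "\<And>z. z \<in> topspace Z \<Longrightarrow> g z = f z"
  shows "diag_family U Z g"
  using assms
proof (induction arbitrary: g rule: diag_family.induct)
  case (germs U W h Z f)
  then show ?case by (intro diag_family.germs[where h = h and W = W]) auto
next
  case (open_cover U \<C> Z f)
  then show ?case by (intro diag_family.open_cover[where \<C> = \<C>]) auto
next
  case (closed_cover Z C D U f)
  show ?case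
    by (rule diag_family.closed_cover[OF closed_cover.hyps(1-3)];
        rule closed_cover.IH, rule closed_cover.prems, simp)
next
  case (base_cover U \<U> Z f)
  show ?case
  proof (rule diag_family.base_cover[OF base_cover.hyps(1,2)])
    show "\<forall>z\<in>topspace Z. g z \<in> extensional U"
      using base_cover.hyps(3) base_cover.prems by simp
    show "\<forall>V\<in>\<U>. openin (mtop M) V \<and> diag_family V Z (\<lambda>z. restrict (g z) V)"
      using base_cover.IH base_cover.prems by simp
  qed
qed

lemma P_quasitopology_point:
  assumes "h \<in> P_quasitopology W Z" "z \<in> topspace Z"
  shows "h z \<in> P_sections W"
proof -
  have "(\<lambda>a. \<lambda>q\<in>V. h z (a, q)) \<in> section_quasitopology V (subtopology (mtop M) U)"
    if "openin (mtop M) U" "openin (mtop M) V" "U \<times> V \<subseteq> W" for U V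
  proof -
    have *: "(\<lambda>(a, z). (\<lambda>a\<in>U. \<lambda>q\<in>V. h z (a, q)) a) \<in>
        section_quasitopology V (prod_topology (subtopology (mtop M) U) Z)"
      using assms(1) that by (auto simp: P_quasitopology_def Maps_def)
    have "continuous_map (subtopology (mtop M) U) (prod_topology (subtopology (mtop M) U) Z)
        (\<lambda>a. (a, z))"
      using assms(2) by (simp add: continuous_map_pairedI)
    from section_quasitopology_compose[OF * this] show ?thesis
      by (rule section_quasitopology_cong) auto
  qed
  then show ?thesis
    using assms by (auto simp: P_sections_def P_quasitopology_def)
qed

lemma diag_family_point:
  assumes "diag_family U Z f" "z \<in> topspace Z"
  shows "f z \<in> diag_sections U"
  using assms
proof (induction rule: diag_family.induct)
  case (germs U W h Z f)
  have "h z \<in> P_sections W"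
    using germs by (intro P_quasitopology_point)
  moreover have "f z = (\<lambda>a\<in>U. diag_germ a (h z))"
    using germs by blast
  moreover have "(\<lambda>a\<in>U. diag_germ a (h z)) \<in> diag_sections U" if "h z \<in> P_sections W"
    unfolding diag_sections_def mem_Collect_eq
  proof (intro conjI ballI)
    fix a assume "a \<in> U"
    show "\<exists>V W'. \<exists>h'\<in>P_sections W'. openin (mtop M) V \<and> a \<in> V \<and> V \<subseteq> U \<and>
      openin (prod_topology (mtop M) (mtop M)) W' \<and> (\<forall>b\<in>V. (b, b) \<in> W') \<and>
      (\<forall>b\<in>V. (\<lambda>a\<in>U. diag_germ a (h z)) b = diag_germ b h')"
      by (rule exI[of _ U], rule exI[of _ W], rule bexI[OF _ that])
        (use germs.hyps(1-3) \<open>a \<in> U\<close> in simp)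
  qed simp
  ultimately show ?case
    by metis
next
  case (open_cover U \<C> Z f)
  then show ?case by (auto simp: topspace_subtopology)
next
  case (closed_cover Z C D U f)
  then show ?case by (auto simp: topspace_subtopology)
next
  case (base_cover U \<U> Z f)
  have "\<exists>V W. \<exists>h\<in>P_sections W. openin (mtop M) V \<and> a \<in> V \<and> V \<subseteq> U \<and>
     openin (prod_topology (mtop M) (mtop M)) W \<and> (\<forall>b\<in>V. (b, b) \<in> W) \<and>
     (\<forall>b\<in>V. f z b = diag_germ b h)" if "a \<in> U" for a
  proof -
    obtain U' where U': "U' \<in> \<U>" "a \<in> U'" using \<open>a \<in> U\<close> base_cover.hyps by auto
    then have "restrict (f z) U' \<in> diag_sections U'"
      using base_cover by blast
    then obtain V W h where *: "h \<in> P_sections W" "openin (mtop M) V" "a \<in> V" "V \<subseteq> U'"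
      "openin (prod_topology (mtop M) (mtop M)) W" "\<forall>b\<in>V. (b, b) \<in> W"
      "\<forall>b\<in>V. restrict (f z) U' b = diag_germ b h"
      using U'(2) unfolding diag_sections_def by blast
    moreover have "\<forall>b\<in>V. f z b = diag_germ b h"
      using *(4,7) by (metis restrict_apply' subsetD)
    moreover have "V \<subseteq> U" using * U' base_cover.hyps by auto
    ultimately show ?thesis by blast
  qed
  moreover have "f z \<in> extensional U"
    using base_cover.hyps(3) base_cover.prems by blast
  ultimately show ?case
    unfolding diag_sections_def by simp
qed

lemma quasitopology_on_diag:
  assumes "openin (mtop M) U"
  shows "quasitopology_on (diag_sections U) (diag_quasitopology U)"
  unfolding quasitopology_on_def diag_quasitopology_def
proof (intro conjI allI ballI impI; (elim conjE)?)
  fix Z and f :: "'z \<Rightarrow> _" assume "f \<in> {f. diag_family U Z f}"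
  then show "f ` topspace Z \<subseteq> diag_sections U"
    by (auto intro: diag_family_point)
next
  fix Z f and g :: "'z \<Rightarrow> _"
  assume "g \<in> {f. diag_family U Z f}" "\<forall>z\<in>topspace Z. f z = g z"
  then show "f \<in> {f. diag_family U Z f}"
    by (auto intro: diag_family_cong)
next
  fix Z Z' :: "'z topology" and \<phi> f
  assume "f \<in> {f. diag_family U Z f}" "continuous_map Z' Z \<phi>"
  then show "f \<circ> \<phi> \<in> {f. diag_family U Z' f}"
    by (auto intro: diag_family_compose)
next
  fix Z \<C> and f :: "'z \<Rightarrow> _"
  assume "\<forall>C\<in>\<C>. openin Z C \<and> f \<in> {f. diag_family U (subtopology Z C) f}" "\<Union>\<C> = topspace Z"
  then show "f \<in> {f. diag_family U Z f}"
    using assms by (auto intro!: diag_family.open_cover[where \<C> = \<C>])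
next
  fix Z C D and f :: "'z \<Rightarrow> _"
  assume "closedin Z C" "closedin Z D" "C \<union> D = topspace Z"
    "f \<in> {f. diag_family U (subtopology Z C) f}" "f \<in> {f. diag_family U (subtopology Z D) f}"
  then show "f \<in> {f. diag_family U Z f}"
    by (auto intro: diag_family.closed_cover[where C = C and D = D])
qed

text \<open>\<open>\<J>\<^sup>r\<^sub>E\<close>: continuous (not necessarily holonomic) sections of the jet bundle, with the
  quasitopology of \<open>Maps(U, J\<^sup>r E)\<close>.\<close>

definition jet_sections :: "nat \<Rightarrow> 'm set \<Rightarrow> ('m \<Rightarrow> 'm \<times> ('m \<Rightarrow> 'e) set) set" where
  "jet_sections r U = {\<sigma> \<in> extensional U.
     continuous_map (subtopology (mtop M) U) (jet_space r) \<sigma> \<and> (\<forall>q\<in>U. fst (\<sigma> q) = q)}"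

definition jet_quasitopology ::
  "nat \<Rightarrow> 'm set \<Rightarrow> ('z, 'm \<Rightarrow> 'm \<times> ('m \<Rightarrow> 'e) set) quasitopology" where
  "jet_quasitopology r U Z =
     {f \<in> Maps (subtopology (mtop M) U) (top_quasitopology (jet_space r)) Z.
        \<forall>z\<in>topspace Z. f z \<in> jet_sections r U}"

text \<open>\<open>\<Psi>\<^sub>r(s, {g\<^sub>a}) = (a \<mapsto> J\<^sup>r\<^sub>a g\<^sub>a)\<close>, where \<open>g\<^sub>a\<close> is the germ at \<open>a\<close> of \<open>q \<mapsto> h (a, q)\<close> for any
  representative \<open>h\<close> of the germ at \<open>(a, a)\<close>.\<close>

definition Psi ::
  "nat \<Rightarrow> 'm set \<Rightarrow> ('m \<Rightarrow> ('m \<times> 'm \<Rightarrow> 'e) set) \<Rightarrow> 'm \<Rightarrow> 'm \<times> ('m \<Rightarrow> 'e) set" where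
  "Psi r U \<gamma> = (\<lambda>a\<in>U. jet r a (\<lambda>q. (SOME h. h \<in> \<gamma> a) (a, q)))"

end

end

(*
Psi_r has the strict relative lifting property with respect to cubes: a continuous family of
r-jets over I^n, together with a lift over an open subset of I^n, can be lifted over all of I^n
without changing the given lift on a prescribed closed part of that subset.  After deforming
spheroids and homotopies so that they are constant near the boundary of the cube, this gives
bijectivity on all homotopy sets.

The lift is built over the product of I^n and U.  In an adapted chart of E a family of jets is
lifted by Taylor polynomials.  Two germs of sections with the same r-jet at a point have the same
value there, so they take values in one convex part of a chart, where they can be interpolated
without changing the r-jet; a cut-off function depending on the parameter and the base point
therefore extends a partial lift over one more chart box.  Countably many boxes suffice, and each
point is changed only finitely often.
*)
theory Submission
  imports Defs
begin

section \<open>Coordinates on finite-dimensional normed spaces\<close>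


text \<open>The cut-off is a function of the base point and the parameter alone and is constant
  along \<open>q\<close>, the variable in which jets are taken. No derivative of it ever occurs, so
  a continuous Urysohn function does, and normality of the product of \<open>U\<close> and the cube
  provides it. A germ at \<open>(a, a)\<close> does involve nearby base points, so the cut-off has
  to be locally constant wherever the old or the new lift is to be recovered exactly. Extending over
  a box loses part of the old domain, since off the box the old lift survives only where the cut-off
  is 1; the countable induction therefore tracks closed sets on which the lift is frozen instead of
  growing domains. Compactness of the cube enters at the end: admissible families are glued over
  covers of the parameters and of the base separately, whereas the lift is built on boxes of their
  product. Statements on jets are reduced to one notion, \<open>smooth_family\<close>, read over
  different parameter spaces: a single point for smooth functions, the indiscrete two-point space
  for equality of jets, and the parameters of a lift for continuity into the jet space.\<close>

lemma continuous_map_linear_combination: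
  fixes C :: "'b::real_normed_vector set"
  assumes "finite C"
  shows "continuous_map (product_topology (\<lambda>_::'b. euclideanreal) C) euclidean (\<lambda>k. \<Sum>b\<in>C. k b *\<^sub>R b)"
proof (intro continuous_map_sum assms)
  fix b assume "b \<in> C"
  then have 1: "continuous_map (product_topology (\<lambda>_::'b. euclideanreal) C) euclideanreal (\<lambda>k. k b)"
    by (rule continuous_map_product_projection)
  have 2: "continuous_map euclideanreal euclidean (\<lambda>t. t *\<^sub>R b)"
    by (simp add: continuous_intros)
  show "continuous_map (product_topology (\<lambda>_::'b. euclideanreal) C) euclidean (\<lambda>k. k b *\<^sub>R b)"
    using continuous_map_compose[OF 1 2] by (simp add: o_def)
qed

text \<open>Takes the place of an orthonormal basis on the finite-dimensional model spaces, so that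
  dimension 0 (with \<open>C\<close> empty) is covered as well. The functionals are bounded for
  every index, also outside \<open>C\<close>, which spares membership side conditions.\<close>

definition linear_coordinates ::
  "'b::real_normed_vector set \<Rightarrow> ('b \<Rightarrow> 'b \<Rightarrow> real) \<Rightarrow> bool" where
  "linear_coordinates C c \<longleftrightarrow> finite C \<and> (\<forall>b. bounded_linear (c b)) \<and> (\<forall>v. (\<Sum>b\<in>C. c b v *\<^sub>R b) = v)"

text \<open>This is the argument that all norms on a finite-dimensional space are equivalent. The
  norm of a linear combination is continuous in the coefficients and attains a positive minimum
  \<open>m\<close> on the compact set of coefficient vectors of maximum norm 1; by scaling, every
  coordinate of \<open>v\<close> is bounded by \<open>norm v / m\<close>.\<close>

lemma finite_dim_coordinates:
  fixes B :: "'b::real_normed_vector set"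
  assumes "finite B" "span B = UNIV"
  shows "\<exists>C (c :: 'b \<Rightarrow> 'b \<Rightarrow> real). linear_coordinates C c"
proof -
  obtain C where C: "C \<subseteq> B" "independent C" "B \<subseteq> span C"
    using maximal_independent_subset[of B] by metis
  have fin: "finite C"
    using C(1) assms(1) finite_subset by blast
  have spanC: "span C = UNIV"
    using C(3) assms(2) by (metis span_mono span_span top.extremum_unique)
  let ?r = "representation C"
  have rep: "(\<Sum>b\<in>C. ?r v b *\<^sub>R b) = v" for v
    using sum_representation_eq[OF C(2) _ fin subset_refl] spanC by auto
  let ?P = "product_topology (\<lambda>_::'b. euclideanreal) C"
  let ?T = "\<lambda>k. \<Sum>b\<in>C. k b *\<^sub>R b"
  have contT: "continuous_map ?P euclidean ?T"
    by (rule continuous_map_linear_combination[OF fin])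
  have cb: "continuous_map ?P euclideanreal (\<lambda>k. \<bar>k b\<bar>)" if "b \<in> C" for b
    using continuous_map_compose[OF continuous_map_product_projection[of b C "\<lambda>_. euclideanreal"], of euclideanreal abs] that
    by (auto simp: o_def intro!: continuous_intros)
  define K where "K = PiE C (\<lambda>_. {-1..1::real})"
  \<comment> \<open>The union of the faces of the coefficient cube \<open>K\<close>, that is, the
    unit sphere of the maximum norm. Positivity of the norm on it is linear independence.\<close>
  define K1 where "K1 = (\<Union>b\<in>C. K \<inter> {k \<in> topspace ?P. \<bar>k b\<bar> \<in> {1}})"
  have "compactin ?P K"
    unfolding K_def by (simp add: compactin_PiE)
  moreover have "closedin ?P {k \<in> topspace ?P. \<bar>k b\<bar> \<in> {1}}" if "b \<in> C" for b
    by (rule closedin_continuous_map_preimage[OF cb[OF that]]) simp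
  ultimately have "compactin ?P (K \<inter> {k \<in> topspace ?P. \<bar>k b\<bar> \<in> {1}})" if "b \<in> C" for b
    using that by (intro compact_Int_closedin) auto
  then have "compactin ?P K1"
    unfolding K1_def using fin by (intro compactin_Union finite_imageI) auto
  then have cK1: "compact ((\<lambda>k. norm (?T k)) ` K1)"
  proof -
    have "continuous_map ?P euclideanreal (\<lambda>k. norm (?T k))"
      using contT by (rule continuous_map_norm)
    from image_compactin[OF \<open>compactin ?P K1\<close> this] show ?thesis by simp
  qed
  have pos: "norm (?T k) > 0" if "k \<in> K1" for k
  proof -
    obtain b where b: "b \<in> C" "\<bar>k b\<bar> = 1" using \<open>k \<in> K1\<close> by (auto simp: K1_def)
    have "?T k \<noteq> 0"
      using independentD[OF C(2) fin subset_refl _ b(1), of k] b(2) by auto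
    then show ?thesis by simp
  qed
  obtain m where m: "m > 0" "\<And>k. k \<in> K1 \<Longrightarrow> m \<le> norm (?T k)"
  \<comment> \<open>\<open>K1\<close> is empty only if \<open>C\<close> is, that is, in dimension 0;
    then any positive \<open>m\<close> will do.\<close>
  proof (cases "K1 = {}")
    case True then show ?thesis using that[of 1] by auto
  next
    case False
    then obtain k0 where "k0 \<in> K1" "\<forall>k\<in>K1. norm (?T k0) \<le> norm (?T k)"
      using compact_attains_inf[OF cK1] by blast
    then show ?thesis using that[of "norm (?T k0)"] pos by blast
  qed
  have bound: "\<bar>?r v b\<bar> \<le> norm v * (1/m)" if b: "b \<in> C" for v b
  proof -
    define R where "R = Max ((\<lambda>b. \<bar>?r v b\<bar>) ` C)"
    have R: "\<bar>?r v b'\<bar> \<le> R" if "b' \<in> C" for b'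
      unfolding R_def using fin that by simp
    show ?thesis
    proof (cases "R > 0")
      case False then 
        have "0 \<le> norm v * (1/m)" using m(1) by simp
        then show ?thesis using R[OF b] False by linarith
    next
      case True
      have "R \<in> (\<lambda>b. \<bar>?r v b\<bar>) ` C" unfolding R_def using fin b by (intro Max_in) auto
      then obtain b0 where b0: "b0 \<in> C" "\<bar>?r v b0\<bar> = R" by auto
      \<comment> \<open>Dividing by the largest absolute coordinate \<open>R\<close> moves the
        coefficient vector onto a face of the cube.\<close>
      define k where "k = restrict (\<lambda>b. ?r v b / R) C"
      have "k \<in> K1" unfolding K1_def
      proof (rule UN_I[OF b0(1)])
        show "k \<in> K \<inter> {k \<in> topspace ?P. \<bar>k b0\<bar> \<in> {1}}"
          using True b0(2) R[THEN abs_le_D1] R[THEN abs_le_D2] b0(1)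
          by (simp add: K_def k_def PiE_iff divide_le_eq_1 minus_le_iff le_divide_eq)
      qed
      then have "m \<le> norm (?T k)" by (rule m)
      also have "?T k = (1/R) *\<^sub>R (\<Sum>b\<in>C. ?r v b *\<^sub>R b)"
        unfolding k_def scaleR_sum_right by (intro sum.cong) auto
      also have "norm \<dots> = norm v / R" using True by (simp add: rep)
      finally have "R \<le> norm v * (1/m)" using True m(1) by (simp add: field_simps)
      then show ?thesis using R[OF b] by linarith
    qed
  qed
  have "bounded_linear (\<lambda>v. ?r v b)" if "b \<in> C" for b
  proof (rule bounded_linear_intro)
    show "?r (x + y) b = ?r x b + ?r y b" for x y
      using representation_add[OF C(2)] spanC by simp
    show "?r (s *\<^sub>R x) b = s *\<^sub>R ?r x b" for s x
      using representation_scale[OF C(2)] spanC by simp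
    show "norm (?r x b) \<le> norm x * (1/m)" for x using bound[OF that] by simp
  qed
  then have "bounded_linear (\<lambda>v. if b \<in> C then ?r v b else 0)" for b
    by (cases "b \<in> C") auto
  then show ?thesis
    by (intro exI[of _ C] exI[of _ "\<lambda>b v. if b \<in> C then ?r v b else 0"]) (simp add: fin rep linear_coordinates_def)
qed

text \<open>A closed ball is a closed subset of the image of a compact box of coefficients. Local
  compactness, and hence regularity, of the base manifold rests on this.\<close>

lemma finite_dim_compact_cball:
  fixes B :: "'b::real_normed_vector set"
  assumes "finite B" "span B = UNIV"
  shows "compact (cball (x::'b) R)"
proof -
  obtain C and c :: "'b \<Rightarrow> 'b \<Rightarrow> real" where "linear_coordinates C c"
    using finite_dim_coordinates[OF assms] by blast
  then have C: "finite C" "\<And>b. bounded_linear (c b)" "\<And>v. (\<Sum>b\<in>C. c b v *\<^sub>R b) = (v::'b)"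
    by (auto simp: linear_coordinates_def)
  let ?P = "product_topology (\<lambda>_::'b. euclideanreal) C"
  let ?T = "\<lambda>k. \<Sum>b\<in>C. k b *\<^sub>R b"
  have contT: "continuous_map ?P euclidean ?T"
    by (rule continuous_map_linear_combination[OF C(1)])
  define K where "K = PiE C (\<lambda>b. {- (onorm (c b) * \<bar>R\<bar>)..onorm (c b) * \<bar>R\<bar>})"
  have "compactin ?P K"
    unfolding K_def by (simp add: compactin_PiE)
  from image_compactin[OF this contT] have "compact (?T ` K)"
    by simp
  moreover have "cball 0 R \<subseteq> ?T ` K"
  proof
    fix v :: 'b assume v: "v \<in> cball 0 R"
    have "\<bar>c b v\<bar> \<le> onorm (c b) * \<bar>R\<bar>" for b
    proof -
      have "\<bar>c b v\<bar> \<le> onorm (c b) * norm v"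
        using onorm[OF C(2), of b v] by simp
      also have "\<dots> \<le> onorm (c b) * \<bar>R\<bar>"
        using v by (intro mult_left_mono onorm_pos_le[OF C(2)]) auto
      finally show ?thesis .
    qed
    from this[THEN abs_le_D1] this[THEN abs_le_D2] have "restrict (\<lambda>b. c b v) C \<in> K"
      by (simp add: K_def PiE_iff minus_le_iff)
    moreover have "?T (restrict (\<lambda>b. c b v) C) = v"
      using C(3)[of v] by simp
    ultimately show "v \<in> ?T ` K" by (intro image_eqI[of _ _ "restrict (\<lambda>b. c b v) C"]) simp_all
  qed
  ultimately have "compact (cball 0 R :: 'b set)"
    using compact_Int_closed[OF _ closed_cball, of "?T ` K" 0 R] by (simp add: Int_absorb1)
  then have "compact ((+) x ` cball 0 R)" by (rule compact_translation)
  then show ?thesis by simp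
qed

section \<open>Continuous families of smooth functions\<close>


text \<open>A family of functions with moving domains \<open>S y\<close> and moving base points
  \<open>pt y\<close>. Derivatives have to exist on all of \<open>S y\<close>, but their continuity
  in \<open>y\<close> is demanded only along \<open>pt\<close>, which is all that the coordinates of
  the jet space record. Nothing relates the domains for different \<open>y\<close>, so local
  sections may be chosen independently for each parameter.\<close>

definition smooth_family ::
  "nat \<Rightarrow> 'y topology \<Rightarrow> ('y \<Rightarrow> 'a::real_normed_vector set) \<Rightarrow> ('y \<Rightarrow> 'a \<Rightarrow> 'b::real_normed_vector) \<Rightarrow> ('y \<Rightarrow> 'a) \<Rightarrow> bool" where
  "smooth_family n Y S u pt \<longleftrightarrow>
     (\<forall>y\<in>topspace Y. open (S y) \<and> pt y \<in> S y) \<and>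
     (\<forall>vs. length vs \<le> n \<longrightarrow>
        (\<forall>y\<in>topspace Y. \<forall>x\<in>S y. iter_deriv vs (u y) differentiable (at x)) \<and>
        continuous_map Y euclidean (\<lambda>y. iter_deriv vs (u y) (pt y)))"

lemma differentiable_cong_open:
  assumes "open S" "\<And>x. x \<in> S \<Longrightarrow> f x = g x" "x \<in> S" "f differentiable (at x)"
  shows "g differentiable (at x)"
  using assms has_derivative_transform_within_open unfolding differentiable_def by metis

lemma frechet_derivative_cong_open:
  assumes "open S" "\<And>x. x \<in> S \<Longrightarrow> f x = g x" "x \<in> S"
  shows "frechet_derivative f (at x) = frechet_derivative g (at x)"
proof -
  have "(f has_derivative D) (at x) \<longleftrightarrow> (g has_derivative D) (at x)" for D
    using has_derivative_transform_within_open[of f D x UNIV S g]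
      has_derivative_transform_within_open[of g D x UNIV S f] assms by auto
  then show ?thesis by (simp add: frechet_derivative_def)
qed

lemma iter_deriv_cong:
  assumes "open S" "\<And>x. x \<in> S \<Longrightarrow> f x = g x" "x \<in> S"
  shows "iter_deriv vs f x = iter_deriv vs g x"
  using assms(2,3)
proof (induction vs arbitrary: f g x)
  case Nil then show ?case by simp
next
  case (Cons v vs)
  show ?case unfolding iter_deriv.simps
    by (rule Cons.IH) (use frechet_derivative_cong_open[OF assms(1)] Cons.prems in metis)+
qed

lemma smooth_family_0:
  "smooth_family 0 Y S u pt \<longleftrightarrow> (\<forall>y\<in>topspace Y. open (S y) \<and> pt y \<in> S y) \<and>
     (\<forall>y\<in>topspace Y. \<forall>x\<in>S y. u y differentiable (at x)) \<and> continuous_map Y euclidean (\<lambda>y. u y (pt y))"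
  by (auto simp: smooth_family_def)

lemma smooth_family_mono: "smooth_family n Y S u pt \<Longrightarrow> m \<le> n \<Longrightarrow> smooth_family m Y S u pt"
  unfolding smooth_family_def by (meson le_trans)

text \<open>Splitting off the first direction turns each closure property into an induction on
  \<open>n\<close> that needs only a formula for the first derivative.\<close>

lemma smooth_family_Suc:
  fixes u :: "'y \<Rightarrow> 'a::real_normed_vector \<Rightarrow> 'b::real_normed_vector"
  shows "smooth_family (Suc n) Y S u pt \<longleftrightarrow> smooth_family 0 Y S u pt \<and>
     (\<forall>v. smooth_family n Y S (\<lambda>y x. frechet_derivative (u y) (at x) v) pt)" (is "?L \<longleftrightarrow> ?R")
proof
  assume L: ?L
  then have "smooth_family 0 Y S u pt" by (rule smooth_family_mono) simp
  moreover have "smooth_family n Y S (\<lambda>y x. frechet_derivative (u y) (at x) v) pt" for v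
    unfolding smooth_family_def
  proof (intro conjI allI impI)
    show "\<forall>y\<in>topspace Y. open (S y) \<and> pt y \<in> S y" using L by (simp add: smooth_family_def)
    fix vs :: "'a list" assume "length vs \<le> n"
    then have "length (v # vs) \<le> Suc n" by simp
    from L[unfolded smooth_family_def, THEN conjunct2, rule_format, OF this]
    show "\<forall>y\<in>topspace Y. \<forall>x\<in>S y. iter_deriv vs (\<lambda>x. frechet_derivative (u y) (at x) v) differentiable at x"
      "continuous_map Y euclidean (\<lambda>y. iter_deriv vs (\<lambda>x. frechet_derivative (u y) (at x) v) (pt y))"
      by auto
  qed
  ultimately show ?R by blast
next
  assume R: ?R
  show ?L unfolding smooth_family_def
  proof (rule conjI)
    show "\<forall>y\<in>topspace Y. open (S y) \<and> pt y \<in> S y" using R by (simp add: smooth_family_0)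
    show "\<forall>vs. length vs \<le> Suc n \<longrightarrow>
      (\<forall>y\<in>topspace Y. \<forall>x\<in>S y. iter_deriv vs (u y) differentiable (at x)) \<and>
        continuous_map Y euclidean (\<lambda>y. iter_deriv vs (u y) (pt y))"
    proof (intro allI impI)
      fix vs :: "'a list" assume len: "length vs \<le> Suc n"
      show "(\<forall>y\<in>topspace Y. \<forall>x\<in>S y. iter_deriv vs (u y) differentiable (at x)) \<and>
        continuous_map Y euclidean (\<lambda>y. iter_deriv vs (u y) (pt y))"
      proof (cases vs)
        case Nil then show ?thesis using R by (simp add: smooth_family_0)
      next
        case (Cons v ws)
        have "smooth_family n Y S (\<lambda>y x. frechet_derivative (u y) (at x) v) pt" using R by blast
        then show ?thesis using len Cons unfolding smooth_family_def by simp
      qed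
    qed
  qed
qed

lemma smooth_family_cong:
  fixes u :: "'y \<Rightarrow> 'a::real_normed_vector \<Rightarrow> 'b::real_normed_vector"
  assumes u: "smooth_family n Y S u pt"
    and eq: "\<And>y x. y \<in> topspace Y \<Longrightarrow> x \<in> S y \<Longrightarrow> u y x = w y x"
  shows "smooth_family n Y S w pt"
proof -
  note u' = u[unfolded smooth_family_def]
  have *: "iter_deriv vs (u y) x = iter_deriv vs (w y) x"
    if "length vs \<le> n" "y \<in> topspace Y" "x \<in> S y" for vs y x
    by (rule iter_deriv_cong[where S="S y"]) (use u' eq that in auto)
  show ?thesis unfolding smooth_family_def
  proof (intro conjI allI impI ballI)
    fix vs :: "'a list" assume len: "length vs \<le> n"
    show "iter_deriv vs (w y) differentiable at x" if "y \<in> topspace Y" "x \<in> S y" for y x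
      by (rule differentiable_cong_open[where S="S y" and f="iter_deriv vs (u y)"])
        (use u' len that * in auto)
    show "continuous_map Y euclidean (\<lambda>y. iter_deriv vs (w y) (pt y))"
      by (rule continuous_map_eq[where f="\<lambda>y. iter_deriv vs (u y) (pt y)"]) (use u' len * in auto)
  qed (use u' in auto)
qed

lemma smooth_family_subset:
  assumes "smooth_family n Y S u pt"
    and "\<And>y. y \<in> topspace Y \<Longrightarrow> open (T y) \<and> pt y \<in> T y \<and> T y \<subseteq> S y"
  shows "smooth_family n Y T u pt"
  using assms unfolding smooth_family_def by blast

lemma smooth_familyI_smooth_on:
  fixes f :: "'a::real_normed_vector \<Rightarrow> 'b::real_normed_vector"
  assumes "open S" "smooth_on S f" "continuous_map Y euclidean pt" "\<And>y. y \<in> topspace Y \<Longrightarrow> pt y \<in> S"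
  shows "smooth_family n Y (\<lambda>_. S) (\<lambda>_. f) pt"
  unfolding smooth_family_def
proof (intro conjI allI impI ballI)
  fix vs :: "'a list"
  show "iter_deriv vs f differentiable at x" if "x \<in> S" for x
    using assms(2) that by (simp add: smooth_on_def)
  then have "continuous_on S (iter_deriv vs f)"
    by (simp add: differentiable_imp_continuous_within continuous_at_imp_continuous_on)
  moreover have "continuous_map Y (top_of_set S) pt"
    using assms(3,4) by (auto simp: continuous_map_in_subtopology)
  ultimately show "continuous_map Y euclidean (\<lambda>y. iter_deriv vs f (pt y))"
    using continuous_map_compose[of Y "top_of_set S" pt euclidean "iter_deriv vs f"] by (simp add: o_def)
qed (use assms in auto)

text \<open>A single function is a family over a one-point space, whose value \<open>x0\<close> is irrelevant; the closure
  properties of families thereby carry over to smooth functions.\<close>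

lemma smooth_on_family_iff:
  assumes "open S" "x0 \<in> S"
  shows "smooth_on S f \<longleftrightarrow> (\<forall>n. smooth_family n (discrete_topology {()}) (\<lambda>_. S) (\<lambda>_. f) (\<lambda>_. x0))"
proof
  assume "smooth_on S f"
  then show "\<forall>n. smooth_family n (discrete_topology {()}) (\<lambda>_. S) (\<lambda>_. f) (\<lambda>_. x0)"
    using assms by (auto intro!: smooth_familyI_smooth_on)
next
  assume "\<forall>n. smooth_family n (discrete_topology {()}) (\<lambda>_. S) (\<lambda>_. f) (\<lambda>_. x0)"
  then show "smooth_on S f"
    unfolding smooth_on_def smooth_family_def by force
qed

lemma smooth_on_iff_differentiable:
  assumes "open S"
  shows "smooth_on S f \<longleftrightarrow> (\<forall>x\<in>S. f differentiable (at x)) \<and> (\<forall>v. smooth_on S (\<lambda>x. frechet_derivative f (at x) v))"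
proof (intro iffI conjI allI)
  assume L: "smooth_on S f"
  show "\<forall>x\<in>S. f differentiable (at x)" using L[unfolded smooth_on_def, THEN spec[of _ "[]"]] by simp
  show "smooth_on S (\<lambda>x. frechet_derivative f (at x) v)" for v
    unfolding smooth_on_def using L[unfolded smooth_on_def, THEN spec[of _ "v # vs" for vs]] by simp
next
  assume R: "(\<forall>x\<in>S. f differentiable (at x)) \<and> (\<forall>v. smooth_on S (\<lambda>x. frechet_derivative f (at x) v))"
  show "smooth_on S f" unfolding smooth_on_def
  proof (intro allI ballI)
    fix vs x assume "x \<in> S"
    then show "iter_deriv vs f differentiable at x"
      using R unfolding smooth_on_def by (cases vs) auto
  qed
qed

lemma smooth_family_const:
  assumes "\<And>y. y \<in> topspace Y \<Longrightarrow> open (S y) \<and> pt y \<in> S y" "continuous_map Y euclidean k"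
  shows "smooth_family n Y S (\<lambda>y x. k y) pt"
  using assms
proof (induction n arbitrary: k)
  case 0 then show ?case by (simp add: smooth_family_0)
next
  case (Suc n) then show ?case by (simp add: smooth_family_Suc smooth_family_0)
qed

lemma smooth_family_bounded_linear:
  assumes "bounded_linear L" "smooth_family n Y S u pt"
  shows "smooth_family n Y S (\<lambda>y x. L (u y x)) pt"
  using assms(2)
proof (induction n arbitrary: u)
  case 0
  have L: "continuous_map euclidean euclidean L" by (simp add: linear_continuous_on assms(1))
  have "continuous_map Y euclidean (\<lambda>y. u y (pt y))" using 0 by (simp add: smooth_family_0)
  from continuous_map_compose[OF this L] 0 show ?case
    unfolding smooth_family_0 o_def differentiable_def using bounded_linear.has_derivative[OF assms(1)] by blast
next
  case (Suc n)
  have 0: "smooth_family 0 Y S (\<lambda>y x. L (u y x)) pt"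
  proof -
    have 1: "smooth_family 0 Y S u pt" using Suc.prems by (rule smooth_family_mono) simp
    have L: "continuous_map euclidean euclidean L" by (simp add: linear_continuous_on assms(1))
    have "continuous_map Y euclidean (\<lambda>y. u y (pt y))" using 1 by (simp add: smooth_family_0)
    from continuous_map_compose[OF this L] 1 show ?thesis
      unfolding smooth_family_0 o_def differentiable_def using bounded_linear.has_derivative[OF assms(1)] by blast
  qed
  show ?case unfolding smooth_family_Suc
  proof (intro conjI allI 0)
    fix v
    have "smooth_family n Y S (\<lambda>y x. L (frechet_derivative (u y) (at x) v)) pt"
      using Suc by (simp add: smooth_family_Suc)
    then show "smooth_family n Y S (\<lambda>y x. frechet_derivative (\<lambda>x. L (u y x)) (at x) v) pt"
    proof (rule smooth_family_cong)
      fix y x assume "y \<in> topspace Y" "x \<in> S y"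
      then have "u y differentiable at x" using Suc.prems by (simp add: smooth_family_Suc smooth_family_0)
      then have "(u y has_derivative frechet_derivative (u y) (at x)) (at x)"
        by (simp add: frechet_derivative_works)
      from bounded_linear.has_derivative[OF assms(1) this, THEN frechet_derivative_at]
      show "L (frechet_derivative (u y) (at x) v) = frechet_derivative (\<lambda>x. L (u y x)) (at x) v"
        by metis
    qed
  qed
qed

lemma smooth_family_add:
  assumes "smooth_family n Y S u pt" "smooth_family n Y S w pt"
  shows "smooth_family n Y S (\<lambda>y x. u y x + w y x) pt"
  using assms
proof (induction n arbitrary: u w)
  case 0
  then show ?case by (auto simp: smooth_family_0 intro!: continuous_map_add)
next
  case (Suc n)
  have 0: "smooth_family 0 Y S (\<lambda>y x. u y x + w y x) pt"
    using Suc.prems by (auto simp: smooth_family_Suc smooth_family_0 intro!: continuous_map_add)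
  show ?case unfolding smooth_family_Suc
  proof (intro conjI allI 0)
    fix v
    have "smooth_family n Y S (\<lambda>y x. frechet_derivative (u y) (at x) v + frechet_derivative (w y) (at x) v) pt"
      using Suc by (simp add: smooth_family_Suc)
    then show "smooth_family n Y S (\<lambda>y x. frechet_derivative (\<lambda>x. u y x + w y x) (at x) v) pt"
    proof (rule smooth_family_cong)
      fix y x assume "y \<in> topspace Y" "x \<in> S y"
      then have "u y differentiable at x" "w y differentiable at x"
        using Suc.prems by (simp_all add: smooth_family_Suc smooth_family_0)
      then have "(u y has_derivative frechet_derivative (u y) (at x)) (at x)" "(w y has_derivative frechet_derivative (w y) (at x)) (at x)"
        by (simp_all add: frechet_derivative_works)
      from has_derivative_add[OF this, THEN frechet_derivative_at]
      show "frechet_derivative (u y) (at x) v + frechet_derivative (w y) (at x) v = frechet_derivative (\<lambda>x. u y x + w y x) (at x) v"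
        by metis
    qed
  qed
qed

lemma smooth_family_sum:
  assumes "finite C" "\<And>i. i \<in> C \<Longrightarrow> smooth_family n Y S (u i) pt"
    "\<And>y. y \<in> topspace Y \<Longrightarrow> open (S y) \<and> pt y \<in> S y"
  shows "smooth_family n Y S (\<lambda>y x. \<Sum>i\<in>C. u i y x) pt"
  using assms
proof (induction C)
  case empty then show ?case by (simp add: smooth_family_const)
next
  case (insert i C)
  then show ?case by (simp add: smooth_family_add)
qed

lemma continuous_map_bounded_bilinear:
  assumes "bounded_bilinear B" "continuous_map Y euclidean f" "continuous_map Y euclidean g"
  shows "continuous_map Y euclidean (\<lambda>y. B (f y) (g y))"
proof -
  have 1: "continuous_map Y (prod_topology euclidean euclidean) (\<lambda>y. (f y, g y))"
    using assms by (intro continuous_map_pairedI)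
  have "continuous_on UNIV (\<lambda>p. B (fst p) (snd p))"
    by (intro bounded_bilinear.continuous_on[OF assms(1)] continuous_intros)
  then have 2: "continuous_map (prod_topology euclidean euclidean) euclidean (\<lambda>p. B (fst p) (snd p))"
    by simp
  from continuous_map_compose[OF 1 2] show ?thesis by (simp add: o_def)
qed

lemma smooth_family_bilinear:
  assumes "bounded_bilinear B" "smooth_family n Y S u pt" "smooth_family n Y S w pt"
  shows "smooth_family n Y S (\<lambda>y x. B (u y x) (w y x)) pt"
  using assms(2,3)
proof (induction n arbitrary: u w)
  case 0
  then show ?case
    unfolding smooth_family_0 differentiable_def
    using bounded_bilinear.FDERIV[OF assms(1)] continuous_map_bounded_bilinear[OF assms(1)] by blast
next
  case (Suc n)
  have 0: "smooth_family 0 Y S (\<lambda>y x. B (u y x) (w y x)) pt"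
    using Suc.prems unfolding smooth_family_Suc smooth_family_0 differentiable_def
    using bounded_bilinear.FDERIV[OF assms(1)] continuous_map_bounded_bilinear[OF assms(1)] by blast
  show ?case unfolding smooth_family_Suc
  proof (intro conjI allI 0)
    fix v
    have "smooth_family n Y S (\<lambda>y x. B (u y x) (frechet_derivative (w y) (at x) v) + B (frechet_derivative (u y) (at x) v) (w y x)) pt"
      using Suc.prems by (intro smooth_family_add Suc.IH) (auto simp: smooth_family_Suc intro: smooth_family_mono[of "Suc n"])
    then show "smooth_family n Y S (\<lambda>y x. frechet_derivative (\<lambda>x. B (u y x) (w y x)) (at x) v) pt"
    proof (rule smooth_family_cong)
      fix y x assume "y \<in> topspace Y" "x \<in> S y"
      then have "u y differentiable at x" "w y differentiable at x"
        using Suc.prems by (simp_all add: smooth_family_Suc smooth_family_0)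
      then have "(u y has_derivative frechet_derivative (u y) (at x)) (at x)" "(w y has_derivative frechet_derivative (w y) (at x)) (at x)"
        by (simp_all add: frechet_derivative_works)
      from bounded_bilinear.FDERIV[OF assms(1) this, THEN frechet_derivative_at]
      show "B (u y x) (frechet_derivative (w y) (at x) v) + B (frechet_derivative (u y) (at x) v) (w y x)
          = frechet_derivative (\<lambda>x. B (u y x) (w y x)) (at x) v"
        by metis
    qed
  qed
qed

text \<open>\<open>iter_deriv\<close> differentiates along fixed directions, whereas the chain rule
  differentiates \<open>u y\<close> along the derivative of \<open>\<tau> y\<close>, which varies
  with \<open>x\<close>. Expanding this direction in the basis \<open>C\<close> turns the derivative
  of the composite into a sum of products, to which the bilinear rule and the induction hypothesis
  apply.\<close>

lemma smooth_family_compose: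
  fixes \<tau> :: "'y \<Rightarrow> 'a::real_normed_vector \<Rightarrow> 'b::real_normed_vector" and u :: "'y \<Rightarrow> 'b \<Rightarrow> 'c::real_normed_vector"
  assumes C: "linear_coordinates C (c::'b \<Rightarrow> 'b \<Rightarrow> real)"
    and "smooth_family n Y S u (\<lambda>y. \<tau> y (pt y))" "smooth_family n Y T \<tau> pt"
    and "\<And>y x. y \<in> topspace Y \<Longrightarrow> x \<in> T y \<Longrightarrow> \<tau> y x \<in> S y"
  shows "smooth_family n Y T (\<lambda>y x. u y (\<tau> y x)) pt"
  using assms(2-)
proof (induction n arbitrary: u)
  case 0
  then show ?case
    by (auto simp: smooth_family_0 intro!: differentiable_compose[of "u y" "\<tau> y" for y])
next
  case (Suc n)
  have 0: "smooth_family 0 Y T (\<lambda>y x. u y (\<tau> y x)) pt"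
    using Suc.prems by (auto simp: smooth_family_Suc smooth_family_0 intro!: differentiable_compose[of "u y" "\<tau> y" for y])
  show ?case unfolding smooth_family_Suc
  proof (intro conjI allI 0)
    fix v
    have "smooth_family n Y T (\<lambda>y x. \<Sum>b\<in>C. c b (frechet_derivative (\<tau> y) (at x) v) *\<^sub>R
        frechet_derivative (u y) (at (\<tau> y x)) b) pt"
    proof (rule smooth_family_sum)
      show "finite C" using C by (auto simp: linear_coordinates_def)
      show "open (T y) \<and> pt y \<in> T y" if "y \<in> topspace Y" for y
        using Suc.prems(2) that by (simp add: smooth_family_def)
      fix b
      have "smooth_family n Y T (\<lambda>y x. frechet_derivative (\<tau> y) (at x) v) pt"
        using Suc.prems by (simp add: smooth_family_Suc)
      then have 1: "smooth_family n Y T (\<lambda>y x. c b (frechet_derivative (\<tau> y) (at x) v)) pt"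
        using C by (intro smooth_family_bounded_linear[of "c b"]) (auto simp: linear_coordinates_def)
      have u: "smooth_family n Y S (\<lambda>y x. frechet_derivative (u y) (at x) b) (\<lambda>y. \<tau> y (pt y))"
        using Suc.prems(1) by (simp add: smooth_family_Suc)
      have t: "smooth_family n Y T \<tau> pt"
        using Suc.prems(2) by (rule smooth_family_mono) simp
      show "smooth_family n Y T (\<lambda>y x. c b (frechet_derivative (\<tau> y) (at x) v) *\<^sub>R
        frechet_derivative (u y) (at (\<tau> y x)) b) pt"
        using smooth_family_bilinear[OF bounded_bilinear_scaleR 1 Suc.IH[OF u t Suc.prems(3)]] by simp
    qed
    then show "smooth_family n Y T (\<lambda>y x. frechet_derivative (\<lambda>x. u y (\<tau> y x)) (at x) v) pt"
    proof (rule smooth_family_cong)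
      fix y x assume y: "y \<in> topspace Y" "x \<in> T y"
      then have d: "\<tau> y differentiable at x" "u y differentiable at (\<tau> y x)"
        using Suc.prems by (auto simp: smooth_family_Suc smooth_family_0)
      let ?D = "frechet_derivative (u y) (at (\<tau> y x))" and ?w = "frechet_derivative (\<tau> y) (at x) v"
      have lin: "linear ?D" using d(2) linear_frechet_derivative by blast
      have "frechet_derivative (\<lambda>x. u y (\<tau> y x)) (at x) v = ?D ?w"
        using frechet_derivative_compose[OF d] by (simp add: o_def)
      also have "\<dots> = ?D (\<Sum>b\<in>C. c b ?w *\<^sub>R b)"
        using C by (simp add: linear_coordinates_def)
      also have "\<dots> = (\<Sum>b\<in>C. c b ?w *\<^sub>R ?D b)"
        using lin by (simp add: linear_sum linear_scale)
      finally show "(\<Sum>b\<in>C. c b ?w *\<^sub>R ?D b) = frechet_derivative (\<lambda>x. u y (\<tau> y x)) (at x) v" by simp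
    qed
  qed
qed


section \<open>Closure properties of smooth functions, read off from families over a point\<close>

lemma smooth_on_empty [simp]: "smooth_on {} f"
  by (simp add: smooth_on_def)

lemma smooth_on_subset: "smooth_on S f \<Longrightarrow> T \<subseteq> S \<Longrightarrow> smooth_on T f"
  by (auto simp: smooth_on_def)

text \<open>Besides localising, this supplies the point of \<open>S\<close> that
  \<open>smooth_on_family_iff\<close> asks for, so the empty set never has to be treated
  separately.\<close>

lemma smooth_on_openI:
  assumes "\<And>x. x \<in> S \<Longrightarrow> \<exists>T. x \<in> T \<and> smooth_on T f"
  shows "smooth_on S f"
  using assms unfolding smooth_on_def by blast

lemma smooth_on_cong:
  assumes "open S" "smooth_on S f" "\<And>x. x \<in> S \<Longrightarrow> f x = g x"
  shows "smooth_on S g"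
proof (rule smooth_on_openI)
  fix x0 assume x0: "x0 \<in> S"
  have "smooth_on S g"
    unfolding smooth_on_family_iff[OF assms(1) x0]
    using assms x0 by (auto simp: smooth_on_family_iff[OF assms(1) x0] intro: smooth_family_cong)
  then show "\<exists>T. x0 \<in> T \<and> smooth_on T g" using x0 by blast
qed

lemma smooth_on_compose:
  fixes g :: "'b::real_normed_vector \<Rightarrow> 'c::real_normed_vector" and f :: "'a::real_normed_vector \<Rightarrow> 'b"
    and C :: "'b set"
  assumes "linear_coordinates C c" "open S" "open T" "smooth_on S g" "smooth_on T f" "f ` T \<subseteq> S"
  shows "smooth_on T (\<lambda>x. g (f x))"
proof (rule smooth_on_openI)
  fix x0 assume x0: "x0 \<in> T"
  then have "f x0 \<in> S" using assms(6) by blast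
  have "smooth_on T (\<lambda>x. g (f x))"
    unfolding smooth_on_family_iff[OF assms(3) x0]
  proof
    fix n
    show "smooth_family n (discrete_topology {()}) (\<lambda>_. T) (\<lambda>_ x. g (f x)) (\<lambda>_. x0)"
    proof (rule smooth_family_compose[OF assms(1), where S="\<lambda>_. S"])
      show "smooth_family n (discrete_topology {()}) (\<lambda>_. S) (\<lambda>_. g) (\<lambda>_. f x0)"
        using assms(4) smooth_on_family_iff[OF assms(2) \<open>f x0 \<in> S\<close>] by blast
      show "smooth_family n (discrete_topology {()}) (\<lambda>_. T) (\<lambda>_. f) (\<lambda>_. x0)"
        using assms(5) smooth_on_family_iff[OF assms(3) x0] by blast
    qed (use assms(6) in auto)
  qed
  then show "\<exists>T. x0 \<in> T \<and> smooth_on T (\<lambda>x. g (f x))" using x0 by blast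
qed

lemma smooth_on_bounded_linear:
  assumes "bounded_linear L" "open T" "smooth_on T f"
  shows "smooth_on T (\<lambda>x. L (f x))"
proof (rule smooth_on_openI)
  fix x0 assume x0: "x0 \<in> T"
  have "smooth_on T (\<lambda>x. L (f x))"
    using assms(3) smooth_family_bounded_linear[OF assms(1)] unfolding smooth_on_family_iff[OF assms(2) x0] by blast
  then show "\<exists>T. x0 \<in> T \<and> smooth_on T (\<lambda>x. L (f x))" using x0 by blast
qed

lemma smooth_on_add:
  assumes "open T" "smooth_on T f" "smooth_on T g"
  shows "smooth_on T (\<lambda>x. f x + g x)"
proof (rule smooth_on_openI)
  fix x0 assume x0: "x0 \<in> T"
  have "smooth_on T (\<lambda>x. f x + g x)"
    using assms(2,3) smooth_family_add unfolding smooth_on_family_iff[OF assms(1) x0] by blast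
  then show "\<exists>T. x0 \<in> T \<and> smooth_on T (\<lambda>x. f x + g x)" using x0 by blast
qed

lemma smooth_on_const: "open T \<Longrightarrow> smooth_on T (\<lambda>x. k)"
proof (rule smooth_on_openI)
  fix x0 assume "open T" and x0: "x0 \<in> T"
  then have "smooth_on T (\<lambda>x. k)"
    unfolding smooth_on_family_iff[OF \<open>open T\<close> x0] by (auto intro: smooth_family_const)
  then show "\<exists>T. x0 \<in> T \<and> smooth_on T (\<lambda>x. k)" using x0 by blast
qed

lemma smooth_on_ident: "open T \<Longrightarrow> smooth_on T (\<lambda>x. x)"
  by (subst smooth_on_iff_differentiable) (auto intro: smooth_on_const)

lemma smooth_on_Pair:
  assumes "open T" "smooth_on T f" "smooth_on T g"
  shows "smooth_on T (\<lambda>x. (f x, g x))"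
proof -
  have "bounded_linear (\<lambda>x. (x, 0))" "bounded_linear (\<lambda>x. (0, x))"
    by (auto intro!: bounded_linear_Pair bounded_linear_ident bounded_linear_zero)
  then have "smooth_on T (\<lambda>x. (f x, 0) + (0, g x))"
    using assms by (intro smooth_on_add smooth_on_bounded_linear[of "\<lambda>x. (x, 0)"] smooth_on_bounded_linear[of "\<lambda>x. (0, x)"])
  then show ?thesis by simp
qed

lemma smooth_on_fst: "open T \<Longrightarrow> smooth_on T f \<Longrightarrow> smooth_on T (\<lambda>x. fst (f x))"
  by (rule smooth_on_bounded_linear[OF bounded_linear_fst])

lemma smooth_on_snd: "open T \<Longrightarrow> smooth_on T f \<Longrightarrow> smooth_on T (\<lambda>x. snd (f x))"
  by (rule smooth_on_bounded_linear[OF bounded_linear_snd])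

lemma smooth_family_Pair:
  assumes "smooth_family n Y S u pt" "smooth_family n Y S w pt"
  shows "smooth_family n Y S (\<lambda>y x. (u y x, w y x)) pt"
proof -
  have b: "bounded_linear (\<lambda>x. (x, 0))" "bounded_linear (\<lambda>x. (0, x))"
    by (auto intro!: bounded_linear_Pair bounded_linear_ident bounded_linear_zero)
  show ?thesis
    using smooth_family_add[OF smooth_family_bounded_linear[OF b(1) assms(1)] smooth_family_bounded_linear[OF b(2) assms(2)]]
    by simp
qed

lemma smooth_family_ident:
  assumes "\<And>y. y \<in> topspace Y \<Longrightarrow> open (S y) \<and> pt y \<in> S y" "continuous_map Y euclidean pt"
  shows "smooth_family n Y S (\<lambda>y x. x) pt"
proof (cases n)
  case 0 then show ?thesis using assms by (simp add: smooth_family_0)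
next
  case (Suc m) then show ?thesis using assms by (auto simp: smooth_family_Suc smooth_family_0 intro!: smooth_family_const)
qed

section \<open>Taylor polynomials\<close>


lemma directional_DERIV:
  fixes f :: "'a::real_normed_vector \<Rightarrow> real"
  assumes "f differentiable (at (p + s *\<^sub>R v))"
  shows "((\<lambda>s. f (p + s *\<^sub>R v)) has_real_derivative frechet_derivative f (at (p + s *\<^sub>R v)) v) (at s)"
proof -
  let ?D = "frechet_derivative f (at (p + s *\<^sub>R v))"
  have D: "(f has_derivative ?D) (at (p + s *\<^sub>R v))"
    using assms by (simp add: frechet_derivative_works)
  have "((\<lambda>s. p + s *\<^sub>R v) has_derivative (\<lambda>t. t *\<^sub>R v)) (at s)"
    by (auto intro!: derivative_eq_intros)
  from has_derivative_compose[OF this D]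
  have "((\<lambda>s. f (p + s *\<^sub>R v)) has_derivative (\<lambda>t. ?D (t *\<^sub>R v))) (at s)" .
  then show ?thesis
    using linear_frechet_derivative[OF assms]
    by (simp add: has_field_derivative_def linear_scale mult.commute[of _ "?D v"])
qed

text \<open>The mean value theorem twice: first for the increment along \<open>w\<close> as a
  function of the step along \<open>v\<close>, then for the derivative along \<open>v\<close> as a
  function of the step along \<open>w\<close>. The point is that the left-hand side is symmetric in
  \<open>v\<close> and \<open>w\<close>.\<close>

lemma second_difference:
  fixes f :: "'a::real_normed_vector \<Rightarrow> real"
  assumes S: "smooth_on S f" and h: "0 < h"
    and seg: "\<And>s t. 0 \<le> s \<Longrightarrow> s \<le> h \<Longrightarrow> 0 \<le> t \<Longrightarrow> t \<le> h \<Longrightarrow> x + s *\<^sub>R v + t *\<^sub>R w \<in> S"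
  shows "\<exists>s t. 0 \<le> s \<and> s \<le> h \<and> 0 \<le> t \<and> t \<le> h \<and>
    f (x + h *\<^sub>R v + h *\<^sub>R w) - f (x + h *\<^sub>R v) - f (x + h *\<^sub>R w) + f x =
      h * h * iter_deriv [v, w] f (x + s *\<^sub>R v + t *\<^sub>R w)"
proof -
  have d: "f differentiable (at y)" "(\<lambda>y. frechet_derivative f (at y) v) differentiable (at y)" if "y \<in> S" for y
    using that S[unfolded smooth_on_def, THEN spec[of _ "[]"]] S[unfolded smooth_on_def, THEN spec[of _ "[v]"]]
    by auto
  let ?Dv = "\<lambda>y. frechet_derivative f (at y) v"
  define \<phi> where "\<phi> = (\<lambda>s. f ((x + h *\<^sub>R w) + s *\<^sub>R v) - f (x + s *\<^sub>R v))"
  have "(\<phi> has_real_derivative ?Dv ((x + h *\<^sub>R w) + s *\<^sub>R v) - ?Dv (x + s *\<^sub>R v)) (at s)" if "0 \<le> s" "s \<le> h" for s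
    unfolding \<phi>_def
    using seg[of s h] seg[of s 0] h that
    by (intro DERIV_diff directional_DERIV d) (auto simp: algebra_simps)
  from MVT2[OF h this] obtain s where s: "0 < s" "s < h"
    "\<phi> h - \<phi> 0 = h * (?Dv ((x + h *\<^sub>R w) + s *\<^sub>R v) - ?Dv (x + s *\<^sub>R v))" by auto
  have "((\<lambda>t. ?Dv ((x + s *\<^sub>R v) + t *\<^sub>R w)) has_real_derivative
      frechet_derivative ?Dv (at ((x + s *\<^sub>R v) + t *\<^sub>R w)) w) (at t)" if "0 \<le> t" "t \<le> h" for t
    using seg[of s t] s that by (intro directional_DERIV d) auto
  from MVT2[OF h this] obtain t where t: "0 < t" "t < h"
    "?Dv ((x + s *\<^sub>R v) + h *\<^sub>R w) - ?Dv ((x + s *\<^sub>R v) + 0 *\<^sub>R w) =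
      h * frechet_derivative ?Dv (at ((x + s *\<^sub>R v) + t *\<^sub>R w)) w" by auto
  have "\<phi> h - \<phi> 0 = h * (h * frechet_derivative ?Dv (at ((x + s *\<^sub>R v) + t *\<^sub>R w)) w)"
    using s(3) t(3) by (simp add: algebra_simps)
  then show ?thesis
    using s t by (intro exI[of _ s] exI[of _ t]) (simp add: \<phi>_def algebra_simps)
qed

text \<open>The symmetric second difference equates one mixed derivative at a point near
  \<open>x\<close> with the other mixed derivative at another point near \<open>x\<close>. Both are
  continuous, so their values at \<open>x\<close> cannot differ.\<close>

lemma mixed_derivative_symmetric_real:
  fixes f :: "'a::real_normed_vector \<Rightarrow> real"
  assumes S: "open S" "smooth_on S f" "x \<in> S"
  shows "iter_deriv [v, w] f x = iter_deriv [w, v] f x"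
proof (rule ccontr)
  assume ne: "iter_deriv [v, w] f x \<noteq> iter_deriv [w, v] f x"
  define e where "e = dist (iter_deriv [v, w] f x) (iter_deriv [w, v] f x) / 2"
  have e: "e > 0" using ne by (simp add: e_def)
  have c: "isCont (iter_deriv vs f) x" for vs
    using S by (simp add: smooth_on_def differentiable_imp_continuous_within)
  obtain d1 where d1: "d1 > 0" "\<And>y. dist y x < d1 \<Longrightarrow> dist (iter_deriv [v, w] f y) (iter_deriv [v, w] f x) < e"
    using c[of "[v, w]"] e unfolding continuous_at_eps_delta by (metis)
  obtain d2 where d2: "d2 > 0" "\<And>y. dist y x < d2 \<Longrightarrow> dist (iter_deriv [w, v] f y) (iter_deriv [w, v] f x) < e"
    using c[of "[w, v]"] e unfolding continuous_at_eps_delta by (metis)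
  obtain d3 where d3: "d3 > 0" "ball x d3 \<subseteq> S" using S open_contains_ball by blast
  define d where "d = min d1 (min d2 d3)"
  \<comment> \<open>Keeps the parallelogram with steps up to \<open>h\<close> within distance
    \<open>d / 2\<close> of \<open>x\<close>; the summand 1 keeps the denominator positive when both
    directions vanish.\<close>
  define h where "h = d / (2 * (norm v + norm w + 1))"
  have N: "norm v + norm w + 1 > 0" by (smt (verit) norm_ge_zero)
  have d: "d > 0" using d1 d2 d3 by (simp add: d_def)
  have h: "h > 0" using d N by (simp add: h_def)
  have near: "dist (x + s *\<^sub>R v + t *\<^sub>R w) x < d" if "0 \<le> s" "s \<le> h" "0 \<le> t" "t \<le> h" for s t
  proof -
    have "norm (s *\<^sub>R v + t *\<^sub>R w) \<le> s * norm v + t * norm w"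
      using norm_triangle_ineq[of "s *\<^sub>R v" "t *\<^sub>R w"] that by simp
    also have "\<dots> \<le> h * norm v + h * norm w" using that by (intro add_mono mult_right_mono) auto
    also have "\<dots> \<le> h * (norm v + norm w + 1)" using h by (simp add: algebra_simps)
    also have "\<dots> = d / 2" using N unfolding h_def by (simp add: divide_simps)
    also have "\<dots> < d" using d by simp
    finally show ?thesis by (simp add: dist_norm)
  qed
  have seg: "x + s *\<^sub>R v + t *\<^sub>R w \<in> S" if "0 \<le> s" "s \<le> h" "0 \<le> t" "t \<le> h" for s t
    using near[OF that] d3(2) by (auto simp: d_def dist_commute subset_iff)
  obtain s t where st: "0 \<le> s" "s \<le> h" "0 \<le> t" "t \<le> h"
    "f (x + h *\<^sub>R v + h *\<^sub>R w) - f (x + h *\<^sub>R v) - f (x + h *\<^sub>R w) + f x =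
      h * h * iter_deriv [v, w] f (x + s *\<^sub>R v + t *\<^sub>R w)"
    using second_difference[OF S(2) h seg] by auto
  have seg': "x + s *\<^sub>R w + t *\<^sub>R v \<in> S" if "0 \<le> s" "s \<le> h" "0 \<le> t" "t \<le> h" for s t
    using seg[OF that(3,4,1,2)] by (simp add: algebra_simps)
  obtain s' t' where st': "0 \<le> s'" "s' \<le> h" "0 \<le> t'" "t' \<le> h"
    "f (x + h *\<^sub>R w + h *\<^sub>R v) - f (x + h *\<^sub>R w) - f (x + h *\<^sub>R v) + f x =
      h * h * iter_deriv [w, v] f (x + s' *\<^sub>R w + t' *\<^sub>R v)"
    using second_difference[OF S(2) h seg'] by auto
  have "h * h * iter_deriv [v, w] f (x + s *\<^sub>R v + t *\<^sub>R w) = h * h * iter_deriv [w, v] f (x + s' *\<^sub>R w + t' *\<^sub>R v)"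
    using st(5) st'(5) by (simp add: algebra_simps)
  then have eq: "iter_deriv [v, w] f (x + s *\<^sub>R v + t *\<^sub>R w) = iter_deriv [w, v] f (x + s' *\<^sub>R w + t' *\<^sub>R v)"
    using h by simp
  have "dist (iter_deriv [v, w] f (x + s *\<^sub>R v + t *\<^sub>R w)) (iter_deriv [v, w] f x) < e"
    using near[OF st(1-4)] by (intro d1) (auto simp: d_def)
  moreover have swap: "x + s' *\<^sub>R w + t' *\<^sub>R v = x + t' *\<^sub>R v + s' *\<^sub>R w" by simp
  have "dist (iter_deriv [w, v] f (x + s' *\<^sub>R w + t' *\<^sub>R v)) (iter_deriv [w, v] f x) < e"
    unfolding swap using near[OF st'(3,4,1,2)] by (intro d2) (auto simp: d_def)
  ultimately have "dist (iter_deriv [v, w] f x) (iter_deriv [w, v] f x) < e + e"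
    using eq dist_triangle_less_add dist_commute by metis
  then show False by (simp add: e_def)
qed

lemma iter_deriv_append: "iter_deriv (us @ vs) f = iter_deriv vs (iter_deriv us f)"
  by (induction us arbitrary: f) auto

lemma smooth_on_iter_deriv: "smooth_on S f \<Longrightarrow> smooth_on S (iter_deriv us f)"
  unfolding smooth_on_def by (metis iter_deriv_append)

lemma iter_deriv_bounded_linear:
  assumes "bounded_linear L" "open S" "smooth_on S f" "x \<in> S"
  shows "iter_deriv vs (\<lambda>x. L (f x)) x = L (iter_deriv vs f x)"
  using assms(3,4)
proof (induction vs arbitrary: f x)
  case Nil then show ?case by simp
next
  case (Cons v vs)
  have s: "smooth_on S (\<lambda>x. frechet_derivative f (at x) v)"
    using Cons.prems smooth_on_iff_differentiable[OF assms(2)] by blast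
  have "iter_deriv vs (\<lambda>x. frechet_derivative (\<lambda>x. L (f x)) (at x) v) x
      = iter_deriv vs (\<lambda>x. L (frechet_derivative f (at x) v)) x"
  proof (rule iter_deriv_cong[OF assms(2) _ \<open>x \<in> S\<close>])
    fix y assume "y \<in> S"
    then have "f differentiable at y" using Cons.prems smooth_on_iff_differentiable[OF assms(2)] by blast
    then have "(f has_derivative frechet_derivative f (at y)) (at y)" by (simp add: frechet_derivative_works)
    from bounded_linear.has_derivative[OF assms(1) this, THEN frechet_derivative_at]
    show "frechet_derivative (\<lambda>x. L (f x)) (at y) v = L (frechet_derivative f (at y) v)" by metis
  qed
  then show ?case using Cons.IH[OF s \<open>x \<in> S\<close>] by simp
qed

lemma iter_deriv_add:
  assumes "open S" "smooth_on S f" "smooth_on S g" "x \<in> S"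
  shows "iter_deriv vs (\<lambda>x. f x + g x) x = iter_deriv vs f x + iter_deriv vs g x"
proof -
  \<comment> \<open>A sum is a bounded linear map applied to the pair \<open>(f, g)\<close>, so the
    rule for linear maps yields additivity without another induction.\<close>
  have b: "bounded_linear (\<lambda>p. fst p + snd p)"
    by (intro bounded_linear_add bounded_linear_fst bounded_linear_snd)
  have fg: "smooth_on S (\<lambda>x. (f x, g x))" using assms by (intro smooth_on_Pair)
  have "fst (iter_deriv vs (\<lambda>x. (f x, g x)) x) = iter_deriv vs f x"
    "snd (iter_deriv vs (\<lambda>x. (f x, g x)) x) = iter_deriv vs g x"
    using iter_deriv_bounded_linear[OF bounded_linear_fst assms(1) fg assms(4), of vs]
      iter_deriv_bounded_linear[OF bounded_linear_snd assms(1) fg assms(4), of vs] by simp_all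
  then show ?thesis
    using iter_deriv_bounded_linear[OF b assms(1) fg assms(4), of vs] by simp
qed

lemma iter_deriv_zero: "iter_deriv vs (\<lambda>x. 0) x = 0"
  by (induction vs arbitrary: x) auto

lemma iter_deriv_sum:
  assumes "open S" "finite C" "\<And>i. i \<in> C \<Longrightarrow> smooth_on S (f i)" "x \<in> S"
  shows "iter_deriv vs (\<lambda>x. \<Sum>i\<in>C. f i x) x = (\<Sum>i\<in>C. iter_deriv vs (f i) x) \<and> smooth_on S (\<lambda>x. \<Sum>i\<in>C. f i x)"
  using assms(2,3)
proof (induction C)
  case empty then show ?case using assms(1) by (simp add: iter_deriv_zero smooth_on_const)
next
  case (insert i C)
  then show ?case using assms by (simp add: iter_deriv_add[OF assms(1)] smooth_on_add)
qed

lemma linear_coordinates_eqI: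
  assumes "linear_coordinates C c" "\<And>b. c b v = c b w"
  shows "v = w"
proof -
  have "(\<Sum>b\<in>C. c b v *\<^sub>R b) = (\<Sum>b\<in>C. c b w *\<^sub>R b)" using assms(2) by simp
  then show ?thesis using assms(1) by (simp add: linear_coordinates_def)
qed

lemma mixed_derivative_symmetric:
  fixes f :: "'a::real_normed_vector \<Rightarrow> 'c::real_normed_vector"
  assumes C: "linear_coordinates C (c::'c \<Rightarrow> 'c \<Rightarrow> real)" and S: "open S" "smooth_on S f" "x \<in> S"
  shows "iter_deriv [v, w] f x = iter_deriv [w, v] f x"
proof -
  have bl: "bounded_linear (c b)" for b using C by (simp add: linear_coordinates_def)
  have "c b (iter_deriv [v, w] f x) = c b (iter_deriv [w, v] f x)" for b
    using mixed_derivative_symmetric_real[OF S(1) smooth_on_bounded_linear[OF bl S(1,2)] S(3)]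
    unfolding iter_deriv_bounded_linear[OF bl S] .
  then show ?thesis by (rule linear_coordinates_eqI[OF C])
qed

text \<open>If \<open>A\<close> collects the iterated derivatives of a function at a point, then \<open>hom_poly C c m A w\<close> is its
  \<open>m\<close>-th derivative at that point, evaluated at \<open>(w, ..., w)\<close> and expanded in the basis \<open>C\<close>.\<close>

primrec hom_poly :: "'a set \<Rightarrow> ('a \<Rightarrow> 'a \<Rightarrow> real) \<Rightarrow> nat \<Rightarrow> ('a list \<Rightarrow> 'c::real_normed_vector) \<Rightarrow> 'a \<Rightarrow> 'c" where
  "hom_poly C c 0 A w = A []"
| "hom_poly C c (Suc m) A w = (\<Sum>b\<in>C. c b w *\<^sub>R hom_poly C c m (\<lambda>vs. A (b # vs)) w)"

definition taylor_poly :: "'a set \<Rightarrow> ('a \<Rightarrow> 'a \<Rightarrow> real) \<Rightarrow> nat \<Rightarrow> ('a list \<Rightarrow> 'c::real_normed_vector) \<Rightarrow> 'a \<Rightarrow> 'c" where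
  "taylor_poly C c r A w = (\<Sum>m\<le>r. (1 / fact m) *\<^sub>R hom_poly C c m A w)"

text \<open>Formal arrays of derivatives: linear in every slot, which is expressed by expanding the
  entry in \<open>C\<close>, and symmetric under adjacent transpositions. These two rules are what
  differentiating the polynomial of an array requires.\<close>

definition jet_data :: "'a set \<Rightarrow> ('a \<Rightarrow> 'a \<Rightarrow> real) \<Rightarrow> ('a list \<Rightarrow> 'c::real_normed_vector) \<Rightarrow> bool" where
  "jet_data C c A \<longleftrightarrow>
     (\<forall>us v ws. A (us @ v # ws) = (\<Sum>b\<in>C. c b v *\<^sub>R A (us @ b # ws))) \<and>
     (\<forall>us v w ws. A (us @ v # w # ws) = A (us @ w # v # ws))"

lemma jet_data_Cons:
  assumes "jet_data C c A"
  shows "jet_data C c (\<lambda>vs. A (v # vs))"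
  unfolding jet_data_def
proof (intro conjI allI)
  fix us u w ws
  show "A (v # us @ u # ws) = (\<Sum>b\<in>C. c b u *\<^sub>R A (v # us @ b # ws))"
    using assms[unfolded jet_data_def, THEN conjunct1, rule_format, of "v # us" u ws] by simp
  show "A (v # us @ u # w # ws) = A (v # us @ w # u # ws)"
    using assms[unfolded jet_data_def, THEN conjunct2, rule_format, of "v # us" u w ws] by simp
qed

lemma hom_poly_cong: "(\<And>vs. length vs = m \<Longrightarrow> A vs = B vs) \<Longrightarrow> hom_poly C c m A w = hom_poly C c m B w"
proof (induction m arbitrary: A B)
  case 0 then show ?case by simp
next
  case (Suc m)
  have "hom_poly C c m (\<lambda>vs. A (b # vs)) w = hom_poly C c m (\<lambda>vs. B (b # vs)) w" for b
    by (rule Suc.IH) (simp add: Suc.prems)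
  then show ?case by simp
qed

lemma hom_poly_scaleR_sum:
  "finite D \<Longrightarrow> hom_poly C c m (\<lambda>vs. \<Sum>d\<in>D. k d *\<^sub>R A d vs) w = (\<Sum>d\<in>D. k d *\<^sub>R hom_poly C c m (A d) w)"
proof (induction m arbitrary: A)
  case 0 then show ?case by simp
next
  case (Suc m)
  have "hom_poly C c (Suc m) (\<lambda>vs. \<Sum>d\<in>D. k d *\<^sub>R A d vs) w =
    (\<Sum>b\<in>C. \<Sum>d\<in>D. (c b w * k d) *\<^sub>R hom_poly C c m (\<lambda>vs. A d (b # vs)) w)"
    by (simp add: Suc.IH[OF Suc.prems] scaleR_sum_right)
  also have "\<dots> = (\<Sum>d\<in>D. \<Sum>b\<in>C. (c b w * k d) *\<^sub>R hom_poly C c m (\<lambda>vs. A d (b # vs)) w)"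
    by (rule sum.swap)
  also have "\<dots> = (\<Sum>d\<in>D. k d *\<^sub>R hom_poly C c (Suc m) (A d) w)"
    by (simp add: scaleR_sum_right mult.commute)
  finally show ?case .
qed

text \<open>Linearity in a slot comes from expanding that direction in \<open>C\<close> and carrying
  the sum through the remaining derivatives; symmetry is the equality of mixed derivatives for the
  smooth function \<open>iter_deriv us f\<close>.\<close>

lemma jet_data_iter_deriv:
  fixes f :: "'a::real_normed_vector \<Rightarrow> 'b::real_normed_vector"
  assumes C: "linear_coordinates C (c::'a \<Rightarrow> 'a \<Rightarrow> real)" and D: "linear_coordinates D (d::'b \<Rightarrow> 'b \<Rightarrow> real)"
    and S: "open S" "smooth_on S f" "x \<in> S"
  shows "jet_data C c (\<lambda>vs. iter_deriv vs f x)"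
  unfolding jet_data_def
proof (intro conjI allI)
  fix us v ws
  let ?g = "iter_deriv us f"
  have g: "smooth_on S ?g" using S by (intro smooth_on_iter_deriv)
  have dg: "smooth_on S (\<lambda>x. frechet_derivative ?g (at x) b)" for b
    using g smooth_on_iff_differentiable[OF S(1)] by blast
  have cf: "finite C" using C by (simp add: linear_coordinates_def)
  have eq: "frechet_derivative ?g (at y) v = (\<Sum>b\<in>C. c b v *\<^sub>R frechet_derivative ?g (at y) b)" if "y \<in> S" for y
  proof -
    have "linear (frechet_derivative ?g (at y))"
      using g that smooth_on_iff_differentiable[OF S(1)] linear_frechet_derivative by blast
    then have "(\<Sum>b\<in>C. c b v *\<^sub>R frechet_derivative ?g (at y) b) = frechet_derivative ?g (at y) (\<Sum>b\<in>C. c b v *\<^sub>R b)"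
      by (simp add: linear_sum linear_scale)
    then show ?thesis using C by (simp add: linear_coordinates_def)
  qed
  have "iter_deriv ws (\<lambda>x. frechet_derivative ?g (at x) v) x
      = iter_deriv ws (\<lambda>x. \<Sum>b\<in>C. c b v *\<^sub>R frechet_derivative ?g (at x) b) x"
    by (rule iter_deriv_cong[OF S(1) eq S(3)])
  also have "\<dots> = (\<Sum>b\<in>C. iter_deriv ws (\<lambda>x. c b v *\<^sub>R frechet_derivative ?g (at x) b) x)"
    by (rule conjunct1[OF iter_deriv_sum[OF S(1) cf _ S(3)]])
      (rule smooth_on_bounded_linear[OF bounded_linear_scaleR_right S(1) dg])
  also have "\<dots> = (\<Sum>b\<in>C. c b v *\<^sub>R iter_deriv ws (\<lambda>x. frechet_derivative ?g (at x) b) x)"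
    using iter_deriv_bounded_linear[OF bounded_linear_scaleR_right S(1) dg S(3)] by simp
  finally show "iter_deriv (us @ v # ws) f x = (\<Sum>b\<in>C. c b v *\<^sub>R iter_deriv (us @ b # ws) f x)"
    by (simp add: iter_deriv_append)
next
  fix us v w ws
  let ?g = "iter_deriv us f"
  have g: "smooth_on S ?g" using S by (intro smooth_on_iter_deriv)
  have "iter_deriv ws (iter_deriv [v, w] ?g) x = iter_deriv ws (iter_deriv [w, v] ?g) x"
    by (rule iter_deriv_cong[OF S(1) mixed_derivative_symmetric[OF D S(1) g] S(3)])
  then show "iter_deriv (us @ v # w # ws) f x = iter_deriv (us @ w # v # ws) f x"
    by (simp add: iter_deriv_append)
qed

text \<open>The product rule for the first slot, and induction for the others; by symmetry all
  \<open>m\<close> contributions coincide. For \<open>m = 0\<close> the truncated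
  \<open>m - 1\<close> does no harm, because its factor is 0.\<close>

lemma hom_poly_has_derivative:
  fixes C :: "'a::real_normed_vector set"
  assumes C: "linear_coordinates C c" and A: "jet_data C c A"
  shows "(hom_poly C c m A has_derivative (\<lambda>v. of_nat m *\<^sub>R hom_poly C c (m - 1) (\<lambda>vs. A (v # vs)) w)) (at w)"
  using A
proof (induction m arbitrary: A)
  case 0 then show ?case by simp
next
  case (Suc m)
  note D = Suc.IH[OF jet_data_Cons[OF Suc.prems]]
  have bl: "bounded_linear (c b)" for b using C by (simp add: linear_coordinates_def)
  have fin: "finite C" using C by (simp add: linear_coordinates_def)
  have "((\<lambda>w. \<Sum>b\<in>C. c b w *\<^sub>R hom_poly C c m (\<lambda>vs. A (b # vs)) w) has_derivative
     (\<lambda>v. \<Sum>b\<in>C. c b w *\<^sub>R (of_nat m *\<^sub>R hom_poly C c (m - 1) (\<lambda>vs. A (b # v # vs)) w) +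
        c b v *\<^sub>R hom_poly C c m (\<lambda>vs. A (b # vs)) w)) (at w)"
    by (intro has_derivative_sum has_derivative_scaleR bounded_linear_imp_has_derivative bl D)
  moreover have "(\<Sum>b\<in>C. c b w *\<^sub>R (of_nat m *\<^sub>R hom_poly C c (m - 1) (\<lambda>vs. A (b # v # vs)) w) +
        c b v *\<^sub>R hom_poly C c m (\<lambda>vs. A (b # vs)) w) = of_nat (Suc m) *\<^sub>R hom_poly C c m (\<lambda>vs. A (v # vs)) w" for v
  proof -
    have "(\<Sum>b\<in>C. c b v *\<^sub>R hom_poly C c m (\<lambda>vs. A (b # vs)) w) = hom_poly C c m (\<lambda>vs. \<Sum>b\<in>C. c b v *\<^sub>R A (b # vs)) w"
      using fin by (simp add: hom_poly_scaleR_sum)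
    also have "\<dots> = hom_poly C c m (\<lambda>vs. A (v # vs)) w"
      using Suc.prems[unfolded jet_data_def, THEN conjunct1, rule_format, of "[]" v]
      by (intro hom_poly_cong) simp
    finally have 1: "(\<Sum>b\<in>C. c b v *\<^sub>R hom_poly C c m (\<lambda>vs. A (b # vs)) w) = hom_poly C c m (\<lambda>vs. A (v # vs)) w" .
    \<comment> \<open>Symmetry brings \<open>v\<close> in front of \<open>b\<close>, so that the sum
      over \<open>b\<close> rebuilds a form of degree \<open>m\<close> in the array shifted by
      \<open>v\<close>.\<close>
    have sw: "(\<lambda>vs. A (b # v # vs)) = (\<lambda>vs. A (v # b # vs))" for b
      using Suc.prems[unfolded jet_data_def, THEN conjunct2, rule_format, of "[]"] by (intro ext) simp
    have 2: "(\<Sum>b\<in>C. c b w *\<^sub>R (of_nat m *\<^sub>R hom_poly C c (m - 1) (\<lambda>vs. A (b # v # vs)) w))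
        = of_nat m *\<^sub>R hom_poly C c m (\<lambda>vs. A (v # vs)) w"
      unfolding sw by (cases m) (simp_all add: scaleR_sum_right mult.commute)
    show ?thesis unfolding sum.distrib 1 2 by (simp add: scaleR_left_distrib)
  qed
  ultimately show ?case by simp
qed

lemma hom_poly_0: "linear_coordinates C c \<Longrightarrow> hom_poly C c (Suc m) A 0 = 0"
  by (simp add: linear_coordinates_def linear_simps(3))

lemma taylor_poly_0: 
  assumes "linear_coordinates C c"
  shows "taylor_poly C c r A 0 = A []"
proof -
  have "taylor_poly C c r A 0 = (\<Sum>m\<le>r. if m = 0 then A [] else 0)"
    unfolding taylor_poly_def
  proof (rule sum.cong)
    fix m show "(1 / fact m) *\<^sub>R hom_poly C c m A 0 = (if m = 0 then A [] else 0)"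
      using hom_poly_0[OF assms] by (cases m) auto
  qed simp
  then show ?thesis by simp
qed

text \<open>Since \<open>m / fact m = 1 / fact (m - 1)\<close>, differentiation shifts the array and
  lowers the degree by one. Iterating this and evaluating at the centre reads off the entries of the
  array.\<close>

lemma taylor_poly_deriv:
  fixes C :: "'a::real_normed_vector set"
  assumes C: "linear_coordinates C c" and A: "jet_data C c A"
  shows "frechet_derivative (\<lambda>x. taylor_poly C c (Suc r) A (x - a)) (at x) v = taylor_poly C c r (\<lambda>vs. A (v # vs)) (x - a)"
proof -
  have "((\<lambda>x. taylor_poly C c (Suc r) A (x - a)) has_derivative
     (\<lambda>v. \<Sum>m\<le>Suc r. (1 / fact m) *\<^sub>R (of_nat m *\<^sub>R hom_poly C c (m - 1) (\<lambda>vs. A (v # vs)) (x - a)))) (at x)"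
    unfolding taylor_poly_def
  proof (intro has_derivative_sum has_derivative_scaleR_right)
    fix m
    have "((\<lambda>x. x - a) has_derivative (\<lambda>v. v)) (at x)" by (auto intro!: derivative_eq_intros)
    from has_derivative_compose[OF this hom_poly_has_derivative[OF assms]]
    show "((\<lambda>x. hom_poly C c m A (x - a)) has_derivative
      (\<lambda>v. of_nat m *\<^sub>R hom_poly C c (m - 1) (\<lambda>vs. A (v # vs)) (x - a))) (at x)" .
  qed
  from frechet_derivative_at[OF this, symmetric]
  have "frechet_derivative (\<lambda>x. taylor_poly C c (Suc r) A (x - a)) (at x) v =
     (\<Sum>m\<le>Suc r. (1 / fact m) *\<^sub>R (of_nat m *\<^sub>R hom_poly C c (m - 1) (\<lambda>vs. A (v # vs)) (x - a)))" by simp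
  also have "\<dots> = taylor_poly C c r (\<lambda>vs. A (v # vs)) (x - a)"
    unfolding taylor_poly_def sum.atMost_Suc_shift
    by (simp add: divide_simps del: of_nat_Suc)
  finally show ?thesis .
qed

lemma iter_deriv_taylor_poly:
  fixes C :: "'a::real_normed_vector set"
  assumes C: "linear_coordinates C c" and A: "jet_data C c A" and "length vs \<le> r"
  shows "iter_deriv vs (\<lambda>x. taylor_poly C c r A (x - a)) a = A vs"
  using assms(2,3)
proof (induction vs arbitrary: A r)
  case Nil then show ?case using C by (simp add: taylor_poly_0)
next
  case (Cons v vs)
  then obtain r' where r: "r = Suc r'" by (cases r) auto
  show ?case
    using Cons.IH[OF jet_data_Cons[OF Cons.prems(1)], of r' v] Cons.prems(2)
    by (simp add: r taylor_poly_deriv[OF C Cons.prems(1)])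
qed

text \<open>The order \<open>n\<close> is unrelated to the degree \<open>m\<close>: the dependence
  on \<open>x\<close> is polynomial, so continuity of the coefficients in \<open>y\<close> already
  gives continuity of the derivatives of every order. This is why a family of \<open>r\<close>-jets
  can be lifted to a family that satisfies the conditions on jets of all orders.\<close>

lemma smooth_family_hom_poly:
  assumes C: "linear_coordinates C c"
    and S: "\<And>y. y \<in> topspace Y \<Longrightarrow> open (S y) \<and> pt y \<in> S y"
    and "continuous_map Y euclidean pt" "continuous_map Y euclidean a"
    and "\<And>vs. length vs \<le> m \<Longrightarrow> continuous_map Y euclidean (\<lambda>y. A y vs)"
  shows "smooth_family n Y S (\<lambda>y x. hom_poly C c m (A y) (x - a y)) pt"
  using assms(5)
proof (induction m arbitrary: A)
  case 0 then show ?case using S by (simp add: smooth_family_const)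
next
  case (Suc m)
  have bl: "bounded_linear (c b)" for b using C by (simp add: linear_coordinates_def)
  have "smooth_family n Y S (\<lambda>y x. x + - a y) pt"
    using assms by (intro smooth_family_add smooth_family_ident smooth_family_const continuous_map_minus)
  then have 1: "smooth_family n Y S (\<lambda>y x. c b (x - a y)) pt" for b
    using smooth_family_bounded_linear[OF bl] by simp
  have 2: "smooth_family n Y S (\<lambda>y x. hom_poly C c m (\<lambda>vs. A y (b # vs)) (x - a y)) pt" for b
    by (rule Suc.IH) (simp add: Suc.prems)
  show ?case unfolding hom_poly.simps
    using C S smooth_family_bilinear[OF bounded_bilinear_scaleR 1 2]
    by (intro smooth_family_sum) (auto simp: linear_coordinates_def)
qed

lemma smooth_family_taylor_poly:
  assumes C: "linear_coordinates C c"
    and S: "\<And>y. y \<in> topspace Y \<Longrightarrow> open (S y) \<and> pt y \<in> S y"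
    and "continuous_map Y euclidean pt" "continuous_map Y euclidean a"
    and "\<And>vs. length vs \<le> r \<Longrightarrow> continuous_map Y euclidean (\<lambda>y. A y vs)"
  shows "smooth_family n Y S (\<lambda>y x. taylor_poly C c r (A y) (x - a y)) pt"
  unfolding taylor_poly_def
proof (rule smooth_family_sum)
  fix m assume "m \<in> {..r}"
  then have "smooth_family n Y S (\<lambda>y x. hom_poly C c m (A y) (x - a y)) pt"
    using assms by (intro smooth_family_hom_poly) auto
  from smooth_family_bounded_linear[OF bounded_linear_scaleR_right this]
  show "smooth_family n Y S (\<lambda>y x. (1 / fact m) *\<^sub>R hom_poly C c m (A y) (x - a y)) pt" .
qed (use S in auto)

section \<open>Adapted charts\<close>


lemma topspace_chart:
  assumes "topological_chart T (U, \<phi>)"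
  shows "topspace (subtopology T U) = U"
  using assms by (auto simp: topological_chart_def topspace_subtopology dest: openin_subset)

lemma topological_chartD:
  assumes "topological_chart T (U, \<phi>)"
  shows "openin T U" "open (\<phi> ` U)" "inj_on \<phi> U" "U \<subseteq> topspace T"
    "continuous_map (subtopology T U) euclidean \<phi>"
    "continuous_map (top_of_set (\<phi> ` U)) T (inv_into U \<phi>)"
    "\<And>W. openin T W \<Longrightarrow> W \<subseteq> U \<Longrightarrow> open (\<phi> ` W)"
proof -
  have h: "homeomorphic_map (subtopology T U) (top_of_set (\<phi> ` U)) \<phi>"
    and o: "openin T U" "open (\<phi> ` U)"
    using assms by (auto simp: topological_chart_def)
  show "openin T U" "open (\<phi> ` U)" by (rule o)+
  show "U \<subseteq> topspace T" using o(1) by (rule openin_subset)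
  note ts = topspace_chart[OF assms]
  show inj: "inj_on \<phi> U" using homeomorphic_imp_injective_map[OF h] ts by simp
  show "continuous_map (subtopology T U) euclidean \<phi>"
    using homeomorphic_imp_continuous_map[OF h] by (rule continuous_map_into_fulltopology)
  obtain g where g: "homeomorphic_maps (subtopology T U) (top_of_set (\<phi> ` U)) \<phi> g"
    using h homeomorphic_map_maps by blast
  then have "continuous_map (top_of_set (\<phi> ` U)) (subtopology T U) g"
    by (simp add: homeomorphic_maps_def)
  then have "continuous_map (top_of_set (\<phi> ` U)) T g" by (rule continuous_map_into_fulltopology)
  then show "continuous_map (top_of_set (\<phi> ` U)) T (inv_into U \<phi>)"
  proof (rule continuous_map_eq)
    fix x assume "x \<in> topspace (top_of_set (\<phi> ` U))"
    then obtain u where u: "u \<in> U" "x = \<phi> u" by auto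
    have "g (\<phi> u) = u" using g u(1) ts by (simp add: homeomorphic_maps_def)
    then show "g x = inv_into U \<phi> x" using u inj by simp
  qed
  fix W assume W: "openin T W" "W \<subseteq> U"
  then have "openin (subtopology T U) W" using o(1) by (simp add: openin_open_subtopology)
  then have "openin (top_of_set (\<phi> ` U)) (\<phi> ` W)"
    using homeomorphic_imp_open_map[OF h] by (simp add: open_map_def)
  then show "open (\<phi> ` W)" using o(2) by (simp add: openin_open_eq)
qed

lemma topological_chart_restrict:
  assumes "topological_chart T (U, \<phi>)" "openin T W"
  shows "topological_chart T (U \<inter> W, \<phi>)"
proof -
  note c = topological_chartD[OF assms(1)]
  have h: "homeomorphic_map (subtopology T U) (top_of_set (\<phi> ` U)) \<phi>"
    using assms(1) by (auto simp: topological_chart_def)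
  have "homeomorphic_map (subtopology (subtopology T U) (U \<inter> W)) (subtopology (top_of_set (\<phi> ` U)) (\<phi> ` (U \<inter> W))) \<phi>"
    using c(4) by (intro homeomorphic_map_subtopologies[OF h]) auto
  moreover have "\<phi> ` U \<inter> \<phi> ` (U \<inter> W) = \<phi> ` (U \<inter> W)" "U \<inter> (U \<inter> W) = U \<inter> W" by auto
  ultimately have "homeomorphic_map (subtopology T (U \<inter> W)) (top_of_set (\<phi> ` (U \<inter> W))) \<phi>"
    by (simp add: subtopology_subtopology)
  moreover have "openin T (U \<inter> W)" using c(1) assms(2) by blast
  ultimately show ?thesis
    using c(7)[of "U \<inter> W"] by (auto simp: topological_chart_def)
qed

lemma topological_chart_subtopology:
  assumes "topological_chart T (U, \<phi>)" "U \<subseteq> W"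
  shows "topological_chart (subtopology T W) (U, \<phi>)"
proof -
  have "W \<inter> U = U" using assms(2) by auto
  then show ?thesis
    using assms unfolding topological_chart_def
    by (auto simp: subtopology_subtopology openin_subtopology)
qed

lemma inv_into_map_prod:
  assumes "inj_on \<phi> U" "inj_on \<psi> V" "u \<in> U" "v \<in> V"
  shows "inv_into (U \<times> V) (map_prod \<phi> \<psi>) (\<phi> u, \<psi> v) = (u, v)"
proof -
  have "inj_on (map_prod \<phi> \<psi>) (U \<times> V)" using assms(1,2) by (rule map_prod_inj_on)
  from inv_into_f_f[OF this, of "(u, v)"] show ?thesis using assms(3,4) by simp
qed

lemma topological_chart_prod:
  assumes "topological_chart S (U, \<phi>)" "topological_chart T (V, \<psi>)"
  shows "topological_chart (prod_topology S T) (U \<times> V, map_prod \<phi> \<psi>)"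
proof -
  note c = topological_chartD[OF assms(1)] and d = topological_chartD[OF assms(2)]
  have im: "map_prod \<phi> \<psi> ` (U \<times> V) = \<phi> ` U \<times> \<psi> ` V" by auto
  obtain g h where "homeomorphic_maps (subtopology S U) (top_of_set (\<phi> ` U)) \<phi> g"
    "homeomorphic_maps (subtopology T V) (top_of_set (\<psi> ` V)) \<psi> h"
    using assms unfolding topological_chart_def homeomorphic_map_maps by auto
  then have "homeomorphic_maps (prod_topology (subtopology S U) (subtopology T V))
    (prod_topology (top_of_set (\<phi> ` U)) (top_of_set (\<psi> ` V))) (\<lambda>(x,y). (\<phi> x, \<psi> y)) (\<lambda>(x,y). (g x, h y))"
    unfolding homeomorphic_maps_prod by blast
  then have "homeomorphic_map (subtopology (prod_topology S T) (U \<times> V))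
    (top_of_set (\<phi> ` U \<times> \<psi> ` V)) (map_prod \<phi> \<psi>)"
    by (auto simp: homeomorphic_map_maps subtopology_Times map_prod_def simp flip: subtopology_Times)
  then show ?thesis
    using c(1,2) d(1,2) by (auto simp: topological_chart_def im openin_prod_Times_iff open_Times)
qed

lemma smooth_manifoldD:
  assumes "smooth_manifold (N :: ('a, 'b::real_normed_vector) manifold)"
  shows "\<exists>C (c :: 'b \<Rightarrow> 'b \<Rightarrow> real). linear_coordinates C c" "\<And>x R. compact (cball (x::'b) R)"
    "\<And>U \<phi>. (U, \<phi>) \<in> atlas N \<Longrightarrow> topological_chart (mtop N) (U, \<phi>)"
    "\<And>U \<phi> V \<psi>. (U, \<phi>) \<in> atlas N \<Longrightarrow> (V, \<psi>) \<in> atlas N \<Longrightarrow> smooth_on (\<phi> ` (U \<inter> V)) (\<psi> \<circ> inv_into U \<phi>)"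
    "\<And>x. x \<in> topspace (mtop N) \<Longrightarrow> \<exists>U \<phi>. (U, \<phi>) \<in> atlas N \<and> x \<in> U"
    "\<And>c. topological_chart (mtop N) c \<Longrightarrow> (\<And>d. d \<in> atlas N \<Longrightarrow> chart_compatible c d) \<Longrightarrow> c \<in> atlas N"
    "Hausdorff_space (mtop N)" "second_countable (mtop N)"
proof -
  note N = assms[unfolded smooth_manifold_def]
  obtain B :: "'b set" where B: "finite B" "span B = UNIV" using N by auto
  show "\<exists>C (c :: 'b \<Rightarrow> 'b \<Rightarrow> real). linear_coordinates C c" using finite_dim_coordinates[OF B] .
  show "compact (cball (x::'b) R)" for x R using finite_dim_compact_cball[OF B] .
  show "topological_chart (mtop N) (U, \<phi>)" if "(U, \<phi>) \<in> atlas N" for U \<phi> using N that by blast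
  show "smooth_on (\<phi> ` (U \<inter> V)) (\<psi> \<circ> inv_into U \<phi>)" if "(U, \<phi>) \<in> atlas N" "(V, \<psi>) \<in> atlas N" for U \<phi> V \<psi>
  proof -
    have "\<forall>c\<in>atlas N. \<forall>d\<in>atlas N. chart_compatible c d" using N by blast
    then have "chart_compatible (U, \<phi>) (V, \<psi>)" using that by blast
    then show ?thesis by (simp add: chart_compatible_def)
  qed
  show "\<exists>U \<phi>. (U, \<phi>) \<in> atlas N \<and> x \<in> U" if "x \<in> topspace (mtop N)" for x
  proof -
    from N have "topspace (mtop N) = (\<Union>c\<in>atlas N. fst c)" by (elim conjE)
    with that have "x \<in> (\<Union>c\<in>atlas N. fst c)" by simp
    then obtain c where "c \<in> atlas N" "x \<in> fst c" by (rule UN_E)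
    then show ?thesis by (intro exI[of _ "fst c"] exI[of _ "snd c"]) simp
  qed
  show "c \<in> atlas N" if "topological_chart (mtop N) c" "\<And>d. d \<in> atlas N \<Longrightarrow> chart_compatible c d" for c
    using N that by blast
  show "Hausdorff_space (mtop N)" "second_countable (mtop N)" using N by auto
qed

text \<open>Follows from maximality of the atlas. It is needed because the atlas of an open
  submanifold consists of the charts whose domain lies inside it.\<close>

lemma chart_restrict:
  assumes N: "smooth_manifold N" and U: "(U, \<phi>) \<in> atlas N" and W: "openin (mtop N) W"
  shows "(U \<inter> W, \<phi>) \<in> atlas N"
proof (rule smooth_manifoldD(6)[OF N])
  note tc = smooth_manifoldD(3)[OF N U]
  show tcr: "topological_chart (mtop N) (U \<inter> W, \<phi>)" by (rule topological_chart_restrict[OF tc W])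
  fix d assume "d \<in> atlas N"
  then obtain V \<psi> where d: "d = (V, \<psi>)" "(V, \<psi>) \<in> atlas N" by (cases d) auto
  have op: "open (\<phi> ` (U \<inter> W \<inter> V))"
    using topological_chartD(1)[OF smooth_manifoldD(3)[OF N d(2)]] topological_chartD(1)[OF tcr]
    by (intro topological_chartD(7)[OF tcr]) auto
  have "smooth_on (\<phi> ` (U \<inter> W \<inter> V)) (\<psi> \<circ> inv_into U \<phi>)"
    by (rule smooth_on_subset[OF smooth_manifoldD(4)[OF N U d(2)]]) auto
  then have "smooth_on (\<phi> ` (U \<inter> W \<inter> V)) (\<psi> \<circ> inv_into (U \<inter> W) \<phi>)"
  proof (rule smooth_on_cong[OF op])
    fix x assume "x \<in> \<phi> ` (U \<inter> W \<inter> V)"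
    then obtain u where u: "u \<in> U \<inter> W" "x = \<phi> u" by auto
    then show "(\<psi> \<circ> inv_into U \<phi>) x = (\<psi> \<circ> inv_into (U \<inter> W) \<phi>) x"
      using topological_chartD(3)[OF tc] topological_chartD(3)[OF tcr] by simp
  qed
  moreover have "smooth_on (\<psi> ` (U \<inter> W \<inter> V)) (\<phi> \<circ> inv_into V \<psi>)"
    by (rule smooth_on_subset[OF smooth_manifoldD(4)[OF N d(2) U]]) auto
  ultimately show "chart_compatible (U \<inter> W, \<phi>) d"
    by (simp add: chart_compatible_def d)
qed

lemma smooth_on_map_prod:
  fixes f :: "'a::real_normed_vector \<Rightarrow> 'x::real_normed_vector" and g :: "'b::real_normed_vector \<Rightarrow> 'y::real_normed_vector"
  assumes C: "linear_coordinates C (c::'a \<Rightarrow> 'a \<Rightarrow> real)" and D: "linear_coordinates D (d::'b \<Rightarrow> 'b \<Rightarrow> real)"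
    and "open S" "open T" "smooth_on S f" "smooth_on T g"
  shows "smooth_on (S \<times> T) (\<lambda>z. (f (fst z), g (snd z)))"
proof -
  have o: "open (S \<times> T)" using assms by (intro open_Times)
  have "smooth_on (S \<times> T) (\<lambda>z. f (fst z))"
    by (rule smooth_on_compose[OF C assms(3) o assms(5) smooth_on_fst[OF o smooth_on_ident[OF o]]]) auto
  moreover have "smooth_on (S \<times> T) (\<lambda>z. g (snd z))"
    by (rule smooth_on_compose[OF D assms(4) o assms(6) smooth_on_snd[OF o smooth_on_ident[OF o]]]) auto
  ultimately show ?thesis by (rule smooth_on_Pair[OF o])
qed

lemma chart_compatible_prod:
  fixes \<phi> :: "'a \<Rightarrow> 'x::real_normed_vector" and \<psi> :: "'b \<Rightarrow> 'y::real_normed_vector"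
  assumes C: "linear_coordinates C (c::'x \<Rightarrow> 'x \<Rightarrow> real)" and D: "linear_coordinates D (d::'y \<Rightarrow> 'y \<Rightarrow> real)"
    and U: "topological_chart S (U, \<phi>)" "topological_chart S (U', \<phi>')" "chart_compatible (U, \<phi>) (U', \<phi>')"
    and V: "topological_chart T (V, \<psi>)" "topological_chart T (V', \<psi>')" "chart_compatible (V, \<psi>) (V', \<psi>')"
  shows "chart_compatible (U \<times> V, map_prod \<phi> \<psi>) (U' \<times> V', map_prod \<phi>' \<psi>')"
proof -
  \<comment> \<open>One half of compatibility, for arbitrary charts; the other half is the same
    statement with the two pairs of charts exchanged.\<close>
  have main: "smooth_on (map_prod \<phi> \<psi> ` ((U \<times> V) \<inter> (U' \<times> V'))) (map_prod \<phi>' \<psi>' \<circ> inv_into (U \<times> V) (map_prod \<phi> \<psi>))"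
    if U: "topological_chart S (U, \<phi>)" "topological_chart S (U', \<phi>')" "smooth_on (\<phi> ` (U \<inter> U')) (\<phi>' \<circ> inv_into U \<phi>)"
    and V: "topological_chart T (V, \<psi>)" "topological_chart T (V', \<psi>')" "smooth_on (\<psi> ` (V \<inter> V')) (\<psi>' \<circ> inv_into V \<psi>)"
    for U U' V V' and \<phi> \<phi>' :: "'a \<Rightarrow> 'x" and \<psi> \<psi>' :: "'b \<Rightarrow> 'y"
  proof -
    have oU: "open (\<phi> ` (U \<inter> U'))"
      using topological_chartD(1)[OF U(1)] topological_chartD(1)[OF U(2)] by (intro topological_chartD(7)[OF U(1)]) auto
    have oV: "open (\<psi> ` (V \<inter> V'))"
      using topological_chartD(1)[OF V(1)] topological_chartD(1)[OF V(2)] by (intro topological_chartD(7)[OF V(1)]) auto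
    have im: "map_prod \<phi> \<psi> ` ((U \<times> V) \<inter> (U' \<times> V')) = \<phi> ` (U \<inter> U') \<times> \<psi> ` (V \<inter> V')" by force
    show ?thesis unfolding im
    proof (rule smooth_on_cong[OF open_Times[OF oU oV] smooth_on_map_prod[OF C D oU oV U(3) V(3)]])
      fix z assume "z \<in> \<phi> ` (U \<inter> U') \<times> \<psi> ` (V \<inter> V')"
      then obtain u v where "u \<in> U \<inter> U'" "v \<in> V \<inter> V'" "z = (\<phi> u, \<psi> v)" by auto
      then show "((\<phi>' \<circ> inv_into U \<phi>) (fst z), (\<psi>' \<circ> inv_into V \<psi>) (snd z)) =
         (map_prod \<phi>' \<psi>' \<circ> inv_into (U \<times> V) (map_prod \<phi> \<psi>)) z"
        using topological_chartD(3)[OF U(1)] topological_chartD(3)[OF V(1)] by (simp add: inv_into_map_prod)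
    qed
  qed
  have "(U' \<times> V') \<inter> (U \<times> V) = (U \<times> V) \<inter> (U' \<times> V')" "U' \<inter> U = U \<inter> U'" "V' \<inter> V = V \<inter> V'" by auto
  then show ?thesis
    using main[OF U(1,2) _ V(1,2)] main[OF U(2,1) _ V(2,1)] U(3) V(3)
    by (simp add: chart_compatible_def)
qed

lemma prod_chart:
  fixes M :: "('m, 'b::real_normed_vector) manifold" and F :: "('f, 'c::real_normed_vector) manifold"
  assumes M: "smooth_manifold M" and F: "smooth_manifold F"
    and U: "(U, \<phi>) \<in> atlas M" "U \<subseteq> W" and V: "(V, \<psi>) \<in> atlas F"
  shows "(U \<times> V, map_prod \<phi> \<psi>) \<in> atlas (prod_manifold (open_submanifold M W) F)"
proof -
  obtain C D and c :: "'b \<Rightarrow> 'b \<Rightarrow> real" and d :: "'c \<Rightarrow> 'c \<Rightarrow> real"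
    where CD: "linear_coordinates C c" "linear_coordinates D d"
    using smooth_manifoldD(1)[OF M] smooth_manifoldD(1)[OF F] by blast
  have tU: "topological_chart (mtop M) (U, \<phi>)" by (rule smooth_manifoldD(3)[OF M U(1)])
  have tV: "topological_chart (mtop F) (V, \<psi>)" by (rule smooth_manifoldD(3)[OF F V])
  have "topological_chart (prod_topology (subtopology (mtop M) W) (mtop F)) (U \<times> V, map_prod \<phi> \<psi>)"
    by (intro topological_chart_prod topological_chart_subtopology tU tV U)
  moreover have "chart_compatible (U \<times> V, map_prod \<phi> \<psi>) (U' \<times> V', map_prod \<phi>' \<psi>')"
    if "(U', \<phi>') \<in> atlas M" "(V', \<psi>') \<in> atlas F" for U' \<phi>' V' \<psi>'
  proof (rule chart_compatible_prod[OF CD tU smooth_manifoldD(3)[OF M that(1)] _ tV smooth_manifoldD(3)[OF F that(2)]])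
    have "U' \<inter> U = U \<inter> U'" "V' \<inter> V = V \<inter> V'" by auto
    then show "chart_compatible (U, \<phi>) (U', \<phi>')" "chart_compatible (V, \<psi>) (V', \<psi>')"
      using smooth_manifoldD(4)[OF M U(1) that(1)] smooth_manifoldD(4)[OF M that(1) U(1)]
        smooth_manifoldD(4)[OF F V that(2)] smooth_manifoldD(4)[OF F that(2) V]
      by (simp_all add: chart_compatible_def)
  qed
  ultimately show ?thesis
    by (auto simp: prod_manifold_def open_submanifold_def)
qed

lemma smooth_mapD:
  assumes "smooth_map M N f"
  shows "continuous_map (mtop M) (mtop N) f"
    "\<And>U \<phi> V \<psi>. (U, \<phi>) \<in> atlas M \<Longrightarrow> (V, \<psi>) \<in> atlas N \<Longrightarrow> smooth_on (\<phi> ` {x\<in>U. f x \<in> V}) (\<psi> \<circ> f \<circ> inv_into U \<phi>)"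
  using assms unfolding smooth_map_def by auto

text \<open>A local trivialization \<open>\<tau>\<close> followed by a product chart is a chart of
  \<open>E\<close> by maximality of the atlas, and its first coordinate is the base chart because
  \<open>\<tau>\<close> covers the identity of the base.\<close>

lemma adapted_chart_exists:
  fixes M :: "('m, 'b::real_normed_vector) manifold" and E :: "('e, 'b \<times> 'c::real_normed_vector) manifold"
  assumes fb: "smooth_fiber_bundle M E F p" and e: "e \<in> topspace (mtop E)"
  shows "\<exists>c d. (c, d) \<in> adapted_charts M E p \<and> e \<in> fst d"
proof -
  have M: "smooth_manifold M" and E: "smooth_manifold E" and F: "smooth_manifold F" and p: "smooth_map E M p"
    using fb by (auto simp: smooth_fiber_bundle_def)
  have "p e \<in> topspace (mtop M)"
    using continuous_map_image_subset_topspace[OF smooth_mapD(1)[OF p]] e by blast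
  then obtain U \<tau> where U: "openin (mtop M) U" "p e \<in> U"
    and dif: "diffeomorphism (open_submanifold E {x\<in>topspace (mtop E). p x \<in> U}) (prod_manifold (open_submanifold M U) F) \<tau>"
    and fst\<tau>: "\<And>x. x \<in> topspace (mtop E) \<Longrightarrow> p x \<in> U \<Longrightarrow> fst (\<tau> x) = p x"
    using fb unfolding smooth_fiber_bundle_def by blast
  define P where "P = {x\<in>topspace (mtop E). p x \<in> U}"
  have oP: "openin (mtop E) P"
    unfolding P_def by (rule openin_continuous_map_preimage[OF smooth_mapD(1)[OF p] U(1)])
  let ?EP = "open_submanifold E P" and ?Q = "prod_manifold (open_submanifold M U) F"
  let ?TQ = "prod_topology (subtopology (mtop M) U) (mtop F)"
  have tEP: "mtop ?EP = subtopology (mtop E) P" and tQ: "mtop ?Q = ?TQ"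
    by (simp_all add: open_submanifold_def prod_manifold_def)
  have tsP: "topspace (subtopology (mtop E) P) = P" using oP openin_subset by (auto simp: topspace_subtopology)
  obtain g where \<tau>: "smooth_map ?EP ?Q \<tau>" and g: "smooth_map ?Q ?EP g"
    and g\<tau>: "\<And>x. x \<in> P \<Longrightarrow> g (\<tau> x) = x" and \<tau>g: "\<And>y. y \<in> topspace ?TQ \<Longrightarrow> \<tau> (g y) = y"
    using dif unfolding diffeomorphism_def P_def[symmetric] tEP tQ tsP by blast
  have c\<tau>: "continuous_map (subtopology (mtop E) P) ?TQ \<tau>" and cg: "continuous_map ?TQ (subtopology (mtop E) P) g"
    using smooth_mapD(1)[OF \<tau>] smooth_mapD(1)[OF g] by (simp_all only: tEP tQ)
  have h\<tau>: "homeomorphic_map (subtopology (mtop E) P) ?TQ \<tau>"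
    unfolding homeomorphic_map_maps homeomorphic_maps_def using c\<tau> cg g\<tau> \<tau>g tsP by blast
  have eP: "e \<in> P" using e U by (simp add: P_def)
  then have "\<tau> e \<in> topspace ?TQ"
    using continuous_map_image_subset_topspace[OF c\<tau>] tsP by blast
  then have "snd (\<tau> e) \<in> topspace (mtop F)" by auto
  then obtain V \<psi> where V: "(V, \<psi>) \<in> atlas F" "snd (\<tau> e) \<in> V"
    using smooth_manifoldD(5)[OF F] by blast
  obtain U0 \<phi> where U0: "(U0, \<phi>) \<in> atlas M" "p e \<in> U0"
    using smooth_manifoldD(5)[OF M] \<open>p e \<in> topspace (mtop M)\<close> by blast
  \<comment> \<open>The product charts available on the target of \<open>\<tau>\<close> live over
    base charts contained in the trivializing set \<open>U\<close>.\<close>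
  define U1 where "U1 = U0 \<inter> U"
  have U1: "(U1, \<phi>) \<in> atlas M" "U1 \<subseteq> U" "p e \<in> U1"
    using chart_restrict[OF M U0(1) U(1)] U0(2) U(2) by (auto simp: U1_def)
  define \<pi> where "\<pi> = map_prod \<phi> \<psi>"
  have \<pi>: "(U1 \<times> V, \<pi>) \<in> atlas ?Q" unfolding \<pi>_def by (rule prod_chart[OF M F U1(1,2) V(1)])
  then have t\<pi>: "topological_chart ?TQ (U1 \<times> V, \<pi>)"
    by (simp add: prod_manifold_def open_submanifold_def)
  define N where "N = {x\<in>P. \<tau> x \<in> U1 \<times> V}"
  define \<eta> where "\<eta> = \<pi> \<circ> \<tau>"
  have "openin (subtopology (mtop E) P) {x\<in>topspace (subtopology (mtop E) P). \<tau> x \<in> U1 \<times> V}"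
    by (rule openin_continuous_map_preimage[OF c\<tau> topological_chartD(1)[OF t\<pi>]])
  then have "openin (subtopology (mtop E) P) N" by (simp only: tsP N_def)
  then have oN: "openin (mtop E) N" using openin_open_subtopology[OF oP] by simp
  have NP: "N \<subseteq> P" by (auto simp: N_def)
  have gim: "g z \<in> P" if "z \<in> U1 \<times> V" for z
  proof -
    have "z \<in> topspace ?TQ" using topological_chartD(4)[OF t\<pi>] that by blast
    then show ?thesis using continuous_map_image_subset_topspace[OF cg] tsP by blast
  qed
  have \<tau>gz: "\<tau> (g z) = z" if "z \<in> U1 \<times> V" for z
    using topological_chartD(4)[OF t\<pi>] that by (intro \<tau>g) blast
  have gN: "g z \<in> N" if "z \<in> U1 \<times> V" for z
    using gim[OF that] \<tau>gz[OF that] that unfolding N_def by simp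
  have \<tau>N: "\<tau> ` N = U1 \<times> V"
  proof
    show "\<tau> ` N \<subseteq> U1 \<times> V" by (auto simp: N_def)
    show "U1 \<times> V \<subseteq> \<tau> ` N" using gN \<tau>gz by (metis image_eqI subsetI)
  qed
  have inj\<tau>: "inj_on \<tau> P" using g\<tau> by (metis inj_onI)
  have \<eta>N: "\<eta> ` N = \<pi> ` (U1 \<times> V)" unfolding \<eta>_def image_comp[symmetric] \<tau>N ..
  have inj\<eta>: "inj_on \<eta> N"
    unfolding \<eta>_def using topological_chartD(3)[OF t\<pi>] inj_on_subset[OF inj\<tau> NP] \<tau>N by (simp add: comp_inj_on)
  have t\<eta>: "topological_chart (mtop E) (N, \<eta>)"
  proof -
    have "homeomorphic_map (subtopology (subtopology (mtop E) P) N) (subtopology ?TQ (U1 \<times> V)) \<tau>"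
    proof (rule homeomorphic_map_subtopologies[OF h\<tau>])
      have "topspace ?TQ \<inter> U1 \<times> V = U1 \<times> V" using topological_chartD(4)[OF t\<pi>] by auto
      moreover have "P \<inter> N = N" using NP by auto
      ultimately show "\<tau> ` (topspace (subtopology (mtop E) P) \<inter> N) = topspace ?TQ \<inter> U1 \<times> V"
        using \<tau>N by (simp only: tsP)
    qed
    moreover have "P \<inter> N = N" using NP by auto
    ultimately have "homeomorphic_map (subtopology (mtop E) N) (subtopology ?TQ (U1 \<times> V)) \<tau>"
      by (simp add: subtopology_subtopology)
    moreover have "homeomorphic_map (subtopology ?TQ (U1 \<times> V)) (top_of_set (\<pi> ` (U1 \<times> V))) \<pi>"
      using t\<pi> by (simp add: topological_chart_def)
    ultimately have "homeomorphic_map (subtopology (mtop E) N) (top_of_set (\<eta> ` N)) \<eta>"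
      unfolding \<eta>N unfolding \<eta>_def by (rule homeomorphic_map_compose)
    then show ?thesis using oN topological_chartD(2)[OF t\<pi>] by (simp add: topological_chart_def \<eta>N)
  qed
  have inv\<eta>: "inv_into N \<eta> (\<pi> z) = g z" if "z \<in> U1 \<times> V" for z
    using inv_into_f_f[OF inj\<eta> gN[OF that]] \<tau>gz[OF that] by (simp add: \<eta>_def)
  \<comment> \<open>The transition maps are coordinate forms of the diffeomorphism: of its inverse
    \<open>g\<close> out of the new chart, and of \<open>\<tau>\<close> into it.\<close>
  have "(N, \<eta>) \<in> atlas E"
  proof (rule smooth_manifoldD(6)[OF E t\<eta>])
    fix d assume "d \<in> atlas E"
    then obtain D \<delta> where d: "d = (D, \<delta>)" "(D, \<delta>) \<in> atlas E" by (cases d) auto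
    have D': "(D \<inter> P, \<delta>) \<in> atlas E" by (rule chart_restrict[OF E d(2) oP])
    then have D'': "(D \<inter> P, \<delta>) \<in> atlas ?EP" by (simp add: open_submanifold_def)
    note tD = smooth_manifoldD(3)[OF E d(2)] and tD' = smooth_manifoldD(3)[OF E D']
    have oND: "openin (mtop E) (N \<inter> D)" using oN topological_chartD(1)[OF tD] by blast
    have 1: "smooth_on (\<eta> ` (N \<inter> D)) (\<delta> \<circ> inv_into N \<eta>)"
    proof -
      have im: "\<eta> ` (N \<inter> D) = \<pi> ` {z\<in>U1 \<times> V. g z \<in> D \<inter> P}"
      proof (intro equalityI subsetI)
        fix y assume "y \<in> \<eta> ` (N \<inter> D)"
        then obtain x where x: "x \<in> N" "x \<in> D" "y = \<pi> (\<tau> x)" by (auto simp: \<eta>_def)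
        have "\<tau> x \<in> U1 \<times> V" "g (\<tau> x) = x" "x \<in> P" using x(1) g\<tau> by (auto simp: N_def)
        then show "y \<in> \<pi> ` {z\<in>U1 \<times> V. g z \<in> D \<inter> P}" using x by (intro image_eqI[of y \<pi> "\<tau> x"]) simp_all
      next
        fix y assume "y \<in> \<pi> ` {z\<in>U1 \<times> V. g z \<in> D \<inter> P}"
        then obtain z where z: "z \<in> U1 \<times> V" "g z \<in> D" "y = \<pi> z" by blast
        then show "y \<in> \<eta> ` (N \<inter> D)" using gN[OF z(1)] \<tau>gz[OF z(1)] by (intro image_eqI[of _ _ "g z"]) (simp_all add: \<eta>_def)
      qed
      have s: "smooth_on (\<eta> ` (N \<inter> D)) (\<delta> \<circ> g \<circ> inv_into (U1 \<times> V) \<pi>)"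
        unfolding im by (rule smooth_mapD(2)[OF g \<pi> D''])
      have o: "open (\<eta> ` (N \<inter> D))" by (rule topological_chartD(7)[OF t\<eta> oND]) auto
      show ?thesis
      proof (rule smooth_on_cong[OF o s])
        fix y assume "y \<in> \<eta> ` (N \<inter> D)"
        then obtain z where z: "z \<in> U1 \<times> V" "y = \<pi> z" unfolding im by blast
        show "(\<delta> \<circ> g \<circ> inv_into (U1 \<times> V) \<pi>) y = (\<delta> \<circ> inv_into N \<eta>) y"
          unfolding z(2) o_def inv\<eta>[OF z(1)] inv_into_f_f[OF topological_chartD(3)[OF t\<pi>] z(1)] ..
      qed
    qed
    have 2: "smooth_on (\<delta> ` (N \<inter> D)) (\<eta> \<circ> inv_into D \<delta>)"
    proof -
      have im: "N \<inter> D = {x\<in>D \<inter> P. \<tau> x \<in> U1 \<times> V}" by (auto simp: N_def)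
      have s: "smooth_on (\<delta> ` (N \<inter> D)) (\<pi> \<circ> \<tau> \<circ> inv_into (D \<inter> P) \<delta>)"
        unfolding im by (rule smooth_mapD(2)[OF \<tau> D'' \<pi>])
      have o: "open (\<delta> ` (N \<inter> D))" by (rule topological_chartD(7)[OF tD oND]) auto
      show ?thesis
      proof (rule smooth_on_cong[OF o s])
        fix y assume "y \<in> \<delta> ` (N \<inter> D)"
        then obtain x where x: "x \<in> D" "x \<in> D \<inter> P" "y = \<delta> x" using NP by auto
        show "(\<pi> \<circ> \<tau> \<circ> inv_into (D \<inter> P) \<delta>) y = (\<eta> \<circ> inv_into D \<delta>) y"
          unfolding x(3) o_def \<eta>_def inv_into_f_f[OF topological_chartD(3)[OF tD] x(1)]
            inv_into_f_f[OF topological_chartD(3)[OF tD'] x(2)] ..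
      qed
    qed
    show "chart_compatible (N, \<eta>) d" using 1 2 by (simp add: chart_compatible_def d)
  qed
  moreover have "p x \<in> U1 \<and> fst (\<eta> x) = \<phi> (p x)" if "x \<in> N" for x
  proof -
    have "x \<in> topspace (mtop E)" "p x \<in> U" "\<tau> x \<in> U1 \<times> V" using that by (auto simp: N_def P_def)
    then show ?thesis using fst\<tau>[of x] by (auto simp: \<eta>_def \<pi>_def)
  qed
  ultimately have "((U1, \<phi>), (N, \<eta>)) \<in> adapted_charts M E p"
    using U1(1) by (simp add: adapted_charts_def)
  moreover have "e \<in> N"
    using eP V(2) U1(3) fst\<tau>[OF e] U(2) by (simp add: N_def mem_Times_iff)
  ultimately show ?thesis by (intro exI[of _ "(U1, \<phi>)"] exI[of _ "(N, \<eta>)"]) simp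
qed

section \<open>Sections and jets in adapted charts\<close>


locale smooth_bundle =
  fixes M :: "('m, 'b::real_normed_vector) manifold"
    and E :: "('e, 'b \<times> 'c::real_normed_vector) manifold"
    and F :: "('f, 'c) manifold"
    and p :: "'e \<Rightarrow> 'm"
  assumes fiber_bundle: "smooth_fiber_bundle M E F p"
begin

abbreviation "TM \<equiv> mtop M"
abbreviation "TE \<equiv> mtop E"

lemma manifolds: "smooth_manifold M" "smooth_manifold E" "smooth_manifold F"
  using fiber_bundle by (auto simp: smooth_fiber_bundle_def)

lemma coordinates:
  "\<exists>C (c :: 'b \<Rightarrow> 'b \<Rightarrow> real). linear_coordinates C c"
  "\<exists>C (c :: 'c \<Rightarrow> 'c \<Rightarrow> real). linear_coordinates C c"
  "\<exists>C (c :: 'b \<times> 'c \<Rightarrow> 'b \<times> 'c \<Rightarrow> real). linear_coordinates C c"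
  using smooth_manifoldD(1) manifolds by blast+

lemma adapted_chartD:
  assumes "(c, d) \<in> adapted_charts M E p"
  shows "topological_chart TM c" "topological_chart TE d" "c \<in> atlas M" "d \<in> atlas E"
    "\<And>x. x \<in> fst d \<Longrightarrow> p x \<in> fst c" "\<And>x. x \<in> fst d \<Longrightarrow> fst (snd d x) = snd c (p x)"
proof -
  obtain U \<phi> N \<eta> where *: "c = (U, \<phi>)" "d = (N, \<eta>)" by (cases c, cases d) auto
  show "c \<in> atlas M" "d \<in> atlas E" "\<And>x. x \<in> fst d \<Longrightarrow> p x \<in> fst c" "\<And>x. x \<in> fst d \<Longrightarrow> fst (snd d x) = snd c (p x)"
    using assms by (auto simp: adapted_charts_def *)
  then show "topological_chart TM c" "topological_chart TE d"
    using smooth_manifoldD(3)[OF manifolds(1)] smooth_manifoldD(3)[OF manifolds(2)] by (auto simp: *)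
qed

lemma chartD:
  assumes "topological_chart T c"
  shows "openin T (fst c)" "open (snd c ` fst c)" "inj_on (snd c) (fst c)" "fst c \<subseteq> topspace T"
    "continuous_map (subtopology T (fst c)) euclidean (snd c)"
    "continuous_map (top_of_set (snd c ` fst c)) T (inv_into (fst c) (snd c))"
    "\<And>W. openin T W \<Longrightarrow> W \<subseteq> fst c \<Longrightarrow> open (snd c ` W)"
  using topological_chartD[of T "fst c" "snd c"] assms by simp_all

lemma local_rep_eq: "local_rep c d s x = snd (snd d (s (inv_into (fst c) (snd c) x)))"
  by (simp add: local_rep_def case_prod_unfold)

text \<open>The first coordinate of an adapted chart is the base chart, so in it a section is the
  graph of its local representative, and either one can be recovered from the other.\<close>

lemma local_rep_graph:
  assumes cd: "(c, d) \<in> adapted_charts M E p" and "s q \<in> fst d" "p (s q) = q"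
  shows "q \<in> fst c" "snd d (s q) = (snd c q, local_rep c d s (snd c q))"
    "s q = inv_into (fst d) (snd d) (snd c q, local_rep c d s (snd c q))"
proof -
  note c = adapted_chartD[OF cd]
  show q: "q \<in> fst c" using c(5)[of "s q"] assms by simp
  show eq: "snd d (s q) = (snd c q, local_rep c d s (snd c q))"
    using c(6)[OF assms(2)] assms(3) inv_into_f_f[OF chartD(3)[OF c(1)] q]
    by (simp add: local_rep_eq prod_eq_iff)
  show "s q = inv_into (fst d) (snd d) (snd c q, local_rep c d s (snd c q))"
    unfolding eq[symmetric] using inv_into_f_f[OF chartD(3)[OF c(2)] assms(2)] by simp
qed

lemma smooth_sectionsD:
  assumes "s \<in> smooth_sections M E p V"
  shows "s \<in> extensional V" "continuous_map (subtopology TM V) TE s" "\<And>q. q \<in> V \<Longrightarrow> p (s q) = q"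
    "smooth_map (open_submanifold M V) E s"
proof -
  show *: "smooth_map (open_submanifold M V) E s" using assms by (simp add: smooth_sections_def)
  show "s \<in> extensional V" "\<And>q. q \<in> V \<Longrightarrow> p (s q) = q"
    using assms by (auto simp: smooth_sections_def)
  show "continuous_map (subtopology TM V) TE s"
    using smooth_mapD(1)[OF *] by (simp add: open_submanifold_def)
qed

lemma local_rep_smooth:
  assumes s: "s \<in> smooth_sections M E p V" and V: "openin TM V"
    and cd: "(c, d) \<in> adapted_charts M E p" and W: "openin TM W" "W \<subseteq> V" "s ` W \<subseteq> fst d"
  shows "smooth_on (snd c ` W) (local_rep c d s)"
proof -
  note c = adapted_chartD[OF cd] and s' = smooth_sectionsD[OF s]
  have WU: "W \<subseteq> fst c" using c(5) s'(3) W by force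
  have oW: "open (snd c ` W)" by (rule chartD(7)[OF c(1) W(1) WU])
  \<comment> \<open>Smoothness of \<open>s\<close> over \<open>V\<close> is tested in charts
    contained in \<open>V\<close>, so the base chart is cut down first.\<close>
  have "(fst c \<inter> V, snd c) \<in> atlas M"
    using c(3) by (intro chart_restrict[OF manifolds(1) _ V]) simp
  then have "(fst c \<inter> V, snd c) \<in> atlas (open_submanifold M V)" by (simp add: open_submanifold_def)
  from smooth_mapD(2)[OF s'(4) this, of "fst d" "snd d"] c(4)
  have "smooth_on (snd c ` {x \<in> fst c \<inter> V. s x \<in> fst d}) (snd d \<circ> s \<circ> inv_into (fst c \<inter> V) (snd c))" by simp
  then have "smooth_on (snd c ` W) (snd d \<circ> s \<circ> inv_into (fst c \<inter> V) (snd c))"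
    by (rule smooth_on_subset) (use W WU in auto)
  from smooth_on_snd[OF oW this] show ?thesis
  proof (rule smooth_on_cong[OF oW])
    fix x assume "x \<in> snd c ` W"
    then obtain w where w: "w \<in> W" "x = snd c w" by auto
    have "inj_on (snd c) (fst c \<inter> V)" using chartD(3)[OF c(1)] by (rule inj_on_subset) auto
    then have "inv_into (fst c \<inter> V) (snd c) x = w"
      using w W WU by (auto simp: w(2) intro: inv_into_f_f)
    moreover have "inv_into (fst c) (snd c) x = w"
      using inv_into_f_f[OF chartD(3)[OF c(1)]] w WU by auto
    ultimately show "snd ((snd d \<circ> s \<circ> inv_into (fst c \<inter> V) (snd c)) x) = local_rep c d s x"
      by (simp add: local_rep_eq)
  qed
qed

lemma local_sections_atE:
  assumes "s \<in> local_sections_at M E p q"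
  obtains V where "openin TM V" "q \<in> V" "s \<in> smooth_sections M E p V"
  using assms by (auto simp: local_sections_at_def)

lemma local_sections_atD:
  assumes "s \<in> local_sections_at M E p q"
  shows "q \<in> topspace TM" "p (s q) = q"
proof -
  obtain V where V: "openin TM V" "q \<in> V" "s \<in> smooth_sections M E p V"
    using assms by (rule local_sections_atE)
  show "q \<in> topspace TM" using openin_subset[OF V(1)] V(2) by blast
  show "p (s q) = q" using smooth_sectionsD(3)[OF V(3,2)] .
qed

lemma section_chart_nbhd:
  assumes s: "s \<in> local_sections_at M E p q" and cd: "(c, d) \<in> adapted_charts M E p" and q: "s q \<in> fst d"
  shows "\<exists>V. openin TM V \<and> q \<in> V \<and> s ` V \<subseteq> fst d \<and> (\<forall>x\<in>V. p (s x) = x) \<and>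
     continuous_map (subtopology TM V) TE s \<and> smooth_on (snd c ` V) (local_rep c d s)"
proof -
  obtain V where V: "openin TM V" "q \<in> V" "s \<in> smooth_sections M E p V"
    using s by (rule local_sections_atE)
  note s' = smooth_sectionsD[OF V(3)]
  define W where "W = {x \<in> topspace (subtopology TM V). s x \<in> fst d}"
  have tV: "topspace (subtopology TM V) = V" using openin_subset[OF V(1)] by auto
  have "openin (subtopology TM V) W"
    unfolding W_def by (rule openin_continuous_map_preimage[OF s'(2) chartD(1)[OF adapted_chartD(2)[OF cd]]])
  then have W: "openin TM W" "W \<subseteq> V" using openin_open_subtopology[OF V(1)] by auto
  have WN: "s ` W \<subseteq> fst d" "q \<in> W" using V(2) q tV by (auto simp: W_def)
  have "continuous_map (subtopology TM W) TE s"
    by (rule continuous_map_from_subtopology_mono[OF s'(2) W(2)])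
  then show ?thesis
    using W WN s'(3) local_rep_smooth[OF V(3,1) cd W WN(1)] by (intro exI[of _ W]) auto
qed

text \<open>Let \<open>f\<close> be a local representative in the first chart, \<open>\<tau>\<close>
  the change of base coordinates and \<open>T\<close> the change of coordinates of the total space.
  In the second chart the representative is the last component of
  \<open>T (\<tau> x, f (\<tau> x))\<close>, and composition of families carries continuity of its
  derivatives over. The parameter space is arbitrary, which later allows two single jets to be
  compared as well.\<close>

lemma jet_transition:
  assumes cd: "(c, d) \<in> adapted_charts M E p" and cd': "(c', d') \<in> adapted_charts M E p"
    and q: "continuous_map Y TM q"
    and s: "\<And>y. y \<in> topspace Y \<Longrightarrow> s y \<in> local_sections_at M E p (q y)"
    and sd: "\<And>y. y \<in> topspace Y \<Longrightarrow> s y (q y) \<in> fst d \<inter> fst d'"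
    and jets: "\<And>vs. length vs \<le> k \<Longrightarrow> continuous_map Y euclidean (\<lambda>y. iter_deriv vs (local_rep c d (s y)) (snd c (q y)))"
    and len: "length vs \<le> k"
  shows "continuous_map Y euclidean (\<lambda>y. iter_deriv vs (local_rep c' d' (s y)) (snd c' (q y)))"
proof -
  note c = adapted_chartD[OF cd] and c' = adapted_chartD[OF cd']
  define U \<phi> N \<eta> U' \<phi>' N' \<eta>' where defs: "U = fst c" "\<phi> = snd c" "N = fst d" "\<eta> = snd d"
    "U' = fst c'" "\<phi>' = snd c'" "N' = fst d'" "\<eta>' = snd d'"
  note C = chartD[OF c(1), folded defs] and D = chartD[OF c(2), folded defs]
   and C' = chartD[OF c'(1), folded defs] and D' = chartD[OF c'(2), folded defs]
  have "\<exists>V. \<forall>y\<in>topspace Y. openin TM (V y) \<and> q y \<in> V y \<and> s y ` V y \<subseteq> N \<and> (\<forall>x\<in>V y. p (s y x) = x) \<and>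
     continuous_map (subtopology TM (V y)) TE (s y) \<and> smooth_on (\<phi> ` V y) (local_rep c d (s y))"
    unfolding defs using section_chart_nbhd[OF s cd] sd by (intro bchoice) auto
  then obtain V where V: "\<And>y. y \<in> topspace Y \<Longrightarrow> openin TM (V y)" "\<And>y. y \<in> topspace Y \<Longrightarrow> q y \<in> V y"
     "\<And>y x. y \<in> topspace Y \<Longrightarrow> x \<in> V y \<Longrightarrow> s y x \<in> N" "\<And>y x. y \<in> topspace Y \<Longrightarrow> x \<in> V y \<Longrightarrow> p (s y x) = x"
     "\<And>y. y \<in> topspace Y \<Longrightarrow> continuous_map (subtopology TM (V y)) TE (s y)"
     "\<And>y. y \<in> topspace Y \<Longrightarrow> smooth_on (\<phi> ` V y) (local_rep c d (s y))"
    by blast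
  define W where "W y = {x \<in> topspace (subtopology TM (V y)). s y x \<in> N'}" for y
  have tV: "topspace (subtopology TM (V y)) = V y" if "y \<in> topspace Y" for y
    using openin_subset[OF V(1)[OF that]] by auto
  have W: "openin TM (W y)" "W y \<subseteq> V y" if y: "y \<in> topspace Y" for y
  proof -
    have "openin (subtopology TM (V y)) (W y)"
      unfolding W_def by (rule openin_continuous_map_preimage[OF V(5)[OF y] D'(1)])
    then show "openin TM (W y)" "W y \<subseteq> V y" using openin_open_subtopology[OF V(1)[OF y]] by auto
  qed
  have Wmem: "x \<in> V y" "s y x \<in> N" "s y x \<in> N'" "x \<in> U" "x \<in> U'" "p (s y x) = x" if y: "y \<in> topspace Y" and x: "x \<in> W y" for x y
  proof -
    show xV: "x \<in> V y" using W(2)[OF y] x by auto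
    show N: "s y x \<in> N" and N': "s y x \<in> N'" and px: "p (s y x) = x" using V(3,4)[OF y xV] x by (auto simp: W_def)
    show "x \<in> U" "x \<in> U'" using c(5)[of "s y x"] c'(5)[of "s y x"] N N' px by (simp_all add: defs)
  qed
  have qW: "q y \<in> W y" if "y \<in> topspace Y" for y
    using V(2)[OF that] sd[OF that] tV[OF that] by (auto simp: W_def defs)
  have VU: "V y \<subseteq> U" if "y \<in> topspace Y" for y
    using c(5) V(3,4)[OF that] by (force simp: defs)
  define \<tau> where "\<tau> = \<phi> \<circ> inv_into U' \<phi>'"
  have \<tau>: "\<tau> (\<phi>' x) = \<phi> x" if "x \<in> U'" for x
    using inv_into_f_f[OF C'(3) that] by (simp add: \<tau>_def)
  have sm\<tau>: "smooth_on (\<phi>' ` (U' \<inter> U)) \<tau>"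
    unfolding \<tau>_def defs using c(3) c'(3) by (intro smooth_manifoldD(4)[OF manifolds(1)]) simp_all
  have o\<tau>: "open (\<phi>' ` (U' \<inter> U))"
    using C'(1) C(1) by (intro C'(7)) auto
  define T where "T = \<eta>' \<circ> inv_into N \<eta>"
  have smT: "smooth_on (\<eta> ` (N \<inter> N')) T"
    unfolding T_def defs using c(4) c'(4) by (intro smooth_manifoldD(4)[OF manifolds(2)]) simp_all
  have oT: "open (\<eta> ` (N \<inter> N'))" using D(1) D'(1) by (intro D(7)) auto
  have cq': "continuous_map Y euclidean (\<lambda>y. \<phi>' (q y))"
  proof -
    have "continuous_map Y (subtopology TM U') q"
      using q Wmem(5) qW by (auto simp: continuous_map_in_subtopology)
    from continuous_map_compose[OF this C'(5)] show ?thesis by (simp add: o_def)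
  qed
  obtain B1 B3 and b1 :: "'b \<Rightarrow> 'b \<Rightarrow> real" and b3 :: "'b \<times> 'c \<Rightarrow> 'b \<times> 'c \<Rightarrow> real"
    where B: "linear_coordinates B1 b1" "linear_coordinates B3 b3"
    using coordinates by blast
  have oS: "open (\<phi> ` V y)" "open (\<phi>' ` W y)" if "y \<in> topspace Y" for y
    using C(7)[OF V(1)[OF that] VU[OF that]] C'(7)[OF W(1)[OF that]] Wmem(5)[OF that] by auto
  have f1: "smooth_family k Y (\<lambda>y. \<phi> ` V y) (\<lambda>y. local_rep c d (s y)) (\<lambda>y. \<phi> (q y))"
    unfolding smooth_family_def
    using oS(1) V(2,6) jets by (auto simp: smooth_on_def defs)
  have f2: "smooth_family k Y (\<lambda>y. \<phi>' ` W y) (\<lambda>_. \<tau>) (\<lambda>y. \<phi>' (q y))"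
  proof (rule smooth_family_subset[OF smooth_familyI_smooth_on[OF o\<tau> sm\<tau> cq']])
    show "\<phi>' (q y) \<in> \<phi>' ` (U' \<inter> U)" if "y \<in> topspace Y" for y
      using Wmem[OF that qW[OF that]] by auto
    show "open (\<phi>' ` W y) \<and> \<phi>' (q y) \<in> \<phi>' ` W y \<and> \<phi>' ` W y \<subseteq> \<phi>' ` (U' \<inter> U)" if "y \<in> topspace Y" for y
      using oS(2)[OF that] qW[OF that] Wmem[OF that] by auto
  qed
  \<comment> \<open>The same family with its base points written as images under
    \<open>\<tau>\<close>, as the composition rule expects them.\<close>
  have f1': "smooth_family k Y (\<lambda>y. \<phi> ` V y) (\<lambda>y. local_rep c d (s y)) (\<lambda>y. \<tau> (\<phi>' (q y)))"
  proof -
    have eq: "\<tau> (\<phi>' (q y)) = \<phi> (q y)" if "y \<in> topspace Y" for y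
      using \<tau> Wmem(5)[OF that qW[OF that]] .
    show ?thesis unfolding smooth_family_def
    proof (intro conjI allI impI ballI)
      fix vs :: "'b list" assume len: "length vs \<le> k"
      show "iter_deriv vs (local_rep c d (s y)) differentiable at x" if "y \<in> topspace Y" "x \<in> \<phi> ` V y" for y x
        using f1 len that unfolding smooth_family_def by blast
      have "continuous_map Y euclidean (\<lambda>y. iter_deriv vs (local_rep c d (s y)) (\<phi> (q y)))"
        using f1 len unfolding smooth_family_def by blast
      then show "continuous_map Y euclidean (\<lambda>y. iter_deriv vs (local_rep c d (s y)) (\<tau> (\<phi>' (q y))))"
        by (rule continuous_map_eq) (simp add: eq)
    qed (use f1 eq in \<open>auto simp: smooth_family_def\<close>)
  qed
  have f3: "smooth_family k Y (\<lambda>y. \<phi>' ` W y) (\<lambda>y x. local_rep c d (s y) (\<tau> x)) (\<lambda>y. \<phi>' (q y))"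
  proof (rule smooth_family_compose[OF B(1) f1' f2])
    fix y x assume y: "y \<in> topspace Y" and "x \<in> \<phi>' ` W y"
    then obtain w where "w \<in> W y" "x = \<phi>' w" by auto
    then show "\<tau> x \<in> \<phi> ` V y" using \<tau> Wmem[OF y] by auto
  qed
  have f4: "smooth_family k Y (\<lambda>y. \<phi>' ` W y) (\<lambda>y x. (\<tau> x, local_rep c d (s y) (\<tau> x))) (\<lambda>y. \<phi>' (q y))"
    by (rule smooth_family_Pair[OF f2 f3])
  have graph: "(\<tau> (\<phi>' x), local_rep c d (s y) (\<tau> (\<phi>' x))) = \<eta> (s y x)" if "y \<in> topspace Y" "x \<in> W y" for y x
    using local_rep_graph(2)[OF cd, of "s y" x] Wmem[OF that] \<tau> by (simp add: defs)
  have f5: "smooth_family k Y (\<lambda>_. \<eta> ` (N \<inter> N')) (\<lambda>_. T) (\<lambda>y. (\<tau> (\<phi>' (q y)), local_rep c d (s y) (\<tau> (\<phi>' (q y)))))"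
  proof (rule smooth_familyI_smooth_on[OF oT smT])
    show "continuous_map Y euclidean (\<lambda>y. (\<tau> (\<phi>' (q y)), local_rep c d (s y) (\<tau> (\<phi>' (q y)))))"
      using f4[unfolded smooth_family_def, THEN conjunct2, THEN spec[of _ "[]"]] by simp
    show "(\<tau> (\<phi>' (q y)), local_rep c d (s y) (\<tau> (\<phi>' (q y)))) \<in> \<eta> ` (N \<inter> N')" if "y \<in> topspace Y" for y
      using graph[OF that qW[OF that]] Wmem[OF that qW[OF that]] by auto
  qed
  have f6: "smooth_family k Y (\<lambda>y. \<phi>' ` W y) (\<lambda>y x. T (\<tau> x, local_rep c d (s y) (\<tau> x))) (\<lambda>y. \<phi>' (q y))"
  proof (rule smooth_family_compose[OF B(2) f5 f4])
    fix y x assume y: "y \<in> topspace Y" and "x \<in> \<phi>' ` W y"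
    then obtain w where "w \<in> W y" "x = \<phi>' w" by auto
    then show "(\<tau> x, local_rep c d (s y) (\<tau> x)) \<in> \<eta> ` (N \<inter> N')" using graph[OF y] Wmem[OF y] by auto
  qed
  have "smooth_family k Y (\<lambda>y. \<phi>' ` W y) (\<lambda>y x. snd (T (\<tau> x, local_rep c d (s y) (\<tau> x)))) (\<lambda>y. \<phi>' (q y))"
    by (rule smooth_family_bounded_linear[OF bounded_linear_snd f6])
  then have "smooth_family k Y (\<lambda>y. \<phi>' ` W y) (\<lambda>y. local_rep c' d' (s y)) (\<lambda>y. \<phi>' (q y))"
  proof (rule smooth_family_cong)
    fix y x assume y: "y \<in> topspace Y" and "x \<in> \<phi>' ` W y"
    then obtain w where w: "w \<in> W y" "x = \<phi>' w" by auto
    have "T (\<eta> (s y w)) = \<eta>' (s y w)"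
      using inv_into_f_f[OF D(3) Wmem(2)[OF y w(1)]] by (simp add: T_def)
    then show "snd (T (\<tau> x, local_rep c d (s y) (\<tau> x))) = local_rep c' d' (s y) x"
      using graph[OF y w(1)] local_rep_graph(2)[OF cd', of "s y" w] Wmem[OF y w(1)]
      by (simp add: w(2) defs)
  qed
  then show ?thesis using len by (simp add: smooth_family_def defs)
qed

lemma value_continuous:
  assumes cd: "(c, d) \<in> adapted_charts M E p" and q: "continuous_map Y TM q"
    and "\<And>y. y \<in> topspace Y \<Longrightarrow> s y (q y) \<in> fst d" "\<And>y. y \<in> topspace Y \<Longrightarrow> p (s y (q y)) = q y"
    and r: "continuous_map Y euclidean (\<lambda>y. local_rep c d (s y) (snd c (q y)))"
  shows "continuous_map Y TE (\<lambda>y. s y (q y))"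
proof -
  note c = adapted_chartD[OF cd]
  have g: "q y \<in> fst c" "snd d (s y (q y)) = (snd c (q y), local_rep c d (s y) (snd c (q y)))"
    "s y (q y) = inv_into (fst d) (snd d) (snd c (q y), local_rep c d (s y) (snd c (q y)))" if "y \<in> topspace Y" for y
    using local_rep_graph[OF cd, of "s y" "q y"] assms(3,4) that by simp_all
  have "continuous_map Y (subtopology TM (fst c)) q"
    using q g(1) by (auto simp: continuous_map_in_subtopology)
  from continuous_map_compose[OF this chartD(5)[OF c(1)]]
  have 1: "continuous_map Y euclidean (\<lambda>y. snd c (q y))" by (simp add: o_def)
  have "continuous_map Y (prod_topology euclidean euclidean) (\<lambda>y. (snd c (q y), local_rep c d (s y) (snd c (q y))))"
    by (intro continuous_map_pairedI 1 r)
  then have "continuous_map Y euclidean (\<lambda>y. (snd c (q y), local_rep c d (s y) (snd c (q y))))" by simp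
  then have "continuous_map Y (top_of_set (snd d ` fst d)) (\<lambda>y. (snd c (q y), local_rep c d (s y) (snd c (q y))))"
    using g(2) assms(3) by (force simp: continuous_map_in_subtopology)
  from continuous_map_compose[OF this chartD(6)[OF c(2)]] show ?thesis
    by (rule continuous_map_eq) (use g(3) in \<open>simp add: o_def\<close>)
qed

lemma same_jet_refl: "same_jet M E p r q s s"
  by (auto simp: same_jet_def)

lemma same_jet_sym: "same_jet M E p r q s t \<Longrightarrow> same_jet M E p r q t s"
  unfolding same_jet_def by auto



lemma same_jetD:
  assumes "same_jet M E p r q s t"
  shows "s q = t q"
    "\<And>c d vs. (c, d) \<in> adapted_charts M E p \<Longrightarrow> s q \<in> fst d \<Longrightarrow> length vs \<le> r \<Longrightarrow>
       iter_deriv vs (local_rep c d s) (snd c q) = iter_deriv vs (local_rep c d t) (snd c q)"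
  using assms unfolding same_jet_def by blast+

lemma same_jetI:
  assumes "s q = t q"
    "\<And>c d vs. (c, d) \<in> adapted_charts M E p \<Longrightarrow> s q \<in> fst d \<Longrightarrow> length vs \<le> r \<Longrightarrow>
       iter_deriv vs (local_rep c d s) (snd c q) = iter_deriv vs (local_rep c d t) (snd c q)"
  shows "same_jet M E p r q s t"
  using assms unfolding same_jet_def by blast

lemma same_jet_trans:
  assumes "same_jet M E p r q s t" "same_jet M E p r q t u"
  shows "same_jet M E p r q s u"
proof (rule same_jetI)
  show "s q = u q" using same_jetD(1)[OF assms(1)] same_jetD(1)[OF assms(2)] by simp
  show "iter_deriv vs (local_rep c d s) (snd c q) = iter_deriv vs (local_rep c d u) (snd c q)"
    if "(c, d) \<in> adapted_charts M E p" "s q \<in> fst d" "length vs \<le> r" for c d vs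
    using same_jetD(2)[OF assms(1) that] same_jetD(2)[OF assms(2), of c d vs] same_jetD(1)[OF assms(1)] that by simp
qed

lemma same_jet_imp_jet_eq: "same_jet M E p r q s t \<Longrightarrow> jet M E p r q s = jet M E p r q t"
  unfolding jet_def using same_jet_sym same_jet_trans by blast

text \<open>The class of \<open>t\<close> contains \<open>t\<close> itself because \<open>t\<close>
  is a local section; equality of the classes therefore relates it to \<open>s\<close>.\<close>

lemma jet_eqD:
  assumes "jet M E p r q s = jet M E p r q' t" "t \<in> local_sections_at M E p q'"
  shows "q' = q" "same_jet M E p r q s t"
proof -
  show q: "q' = q" using assms(1) by (simp add: jet_def)
  have "t \<in> snd (jet M E p r q' t)" using assms(2) same_jet_refl by (simp add: jet_def)
  then have "t \<in> snd (jet M E p r q s)" using assms(1) by simp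
  then show "same_jet M E p r q s t" by (simp add: jet_def)
qed

lemma fst_jet [simp]: "fst (jet M E p r q s) = q"
  by (simp add: jet_def)

text \<open>Jets depend on germs alone. The functions are arbitrary off \<open>W\<close>, so the
  rule also applies to representatives of germs picked by a choice operator.\<close>

lemma jet_cong:
  assumes W: "openin TM W" "q \<in> W" "\<And>x. x \<in> W \<Longrightarrow> s x = t x" and pq: "p (s q) = q"
  shows "jet M E p r q s = jet M E p r q t"
proof (rule same_jet_imp_jet_eq)
  show "same_jet M E p r q s t"
  proof (rule same_jetI)
    show "s q = t q" using W by simp
    fix c d vs assume cd: "(c, d) \<in> adapted_charts M E p" "s q \<in> fst d"
    note C = adapted_chartD[OF cd(1)]
    have q: "q \<in> fst c" using C(5)[OF cd(2)] pq by simp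
    show "iter_deriv vs (local_rep c d s) (snd c q) = iter_deriv vs (local_rep c d t) (snd c q)"
    proof (rule iter_deriv_cong)
      show "open (snd c ` (fst c \<inter> W))" using chartD(1)[OF C(1)] W(1) by (intro chartD(7)[OF C(1)]) auto
      show "snd c q \<in> snd c ` (fst c \<inter> W)" using q W(2) by auto
      fix x assume "x \<in> snd c ` (fst c \<inter> W)"
      then obtain w where "w \<in> fst c" "w \<in> W" "x = snd c w" by auto
      then show "local_rep c d s x = local_rep c d t x"
        using inv_into_f_f[OF chartD(3)[OF C(1)]] W(3) by (simp add: local_rep_eq)
    qed
  qed
qed


end

lemma continuous_map_localI:
  assumes "\<And>y. y \<in> topspace Y \<Longrightarrow> \<exists>W. openin Y W \<and> y \<in> W \<and> continuous_map (subtopology Y W) Z f"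
  shows "continuous_map Y Z f"
  by (rule pasting_lemma[where I="{W. openin Y W \<and> continuous_map (subtopology Y W) Z f}" and T="\<lambda>W. W" and f="\<lambda>_. f"])
    (use assms in auto)

lemma continuous_map_empty_topspace: "topspace Y = {} \<Longrightarrow> continuous_map Y Z f"
  by (simp add: continuous_map_def)

section \<open>Continuity of maps into the jet space\<close>

context smooth_bundle
begin

abbreviation "JS \<equiv> jet_space M E p"

definition "jet_source_set k U = {jet M E p k q s |q s. q \<in> U \<and> s \<in> local_sections_at M E p q}"

definition "jet_chart_set k c d vs G = {jet M E p k q s | q s. q \<in> topspace TM \<and> s \<in> local_sections_at M E p q \<and>
  s q \<in> fst d \<and> iter_deriv vs (local_rep c d s) (snd c q) \<in> G}"

definition "jet_subbasis k = {jet_source_set k U | U. openin TM U} \<union>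
  {jet_chart_set k c d vs G | c d vs G. (c, d) \<in> adapted_charts M E p \<and> length vs \<le> k \<and> open G}"

lemma jet_space_eq: "JS k = topology_generated_by (jet_subbasis k)"
  unfolding jet_space_def jet_subbasis_def jet_source_set_def jet_chart_set_def ..

lemma jet_in_source_set: "s \<in> local_sections_at M E p q \<Longrightarrow> jet M E p k q s \<in> jet_source_set k U \<longleftrightarrow> q \<in> U"
  unfolding jet_source_set_def by (auto dest: arg_cong[where f=fst])

text \<open>A subbasic set asks for one representative with suitable value and derivative; equality
  of jets passes the condition on to every representative.\<close>

lemma jet_in_chart_set:
  assumes "(c, d) \<in> adapted_charts M E p" "length vs \<le> k" "s \<in> local_sections_at M E p q"
  shows "jet M E p k q s \<in> jet_chart_set k c d vs G \<longleftrightarrow>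
    s q \<in> fst d \<and> iter_deriv vs (local_rep c d s) (snd c q) \<in> G" (is "?L \<longleftrightarrow> ?R")
proof
  assume ?L
  then obtain q' t where t: "jet M E p k q s = jet M E p k q' t" "t \<in> local_sections_at M E p q'"
    "t q' \<in> fst d" "iter_deriv vs (local_rep c d t) (snd c q') \<in> G"
    unfolding jet_chart_set_def by blast
  have q: "q' = q" "same_jet M E p k q s t" using jet_eqD[OF t(1,2)] by auto
  show ?R
    using same_jetD(1)[OF q(2)] same_jetD(2)[OF q(2) assms(1) _ assms(2)] t(3,4) by (simp add: q(1))
next
  assume ?R
  then show ?L using assms(3) local_sections_atD(1)[OF assms(3)] unfolding jet_chart_set_def by blast
qed

lemma topspace_jet_space:
  assumes "j \<in> topspace (JS k)"
  shows "\<exists>q s. j = jet M E p k q s \<and> s \<in> local_sections_at M E p q"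
proof -
  obtain S where "S \<in> jet_subbasis k" "j \<in> S"
    using assms unfolding jet_space_eq topology_generated_by_topspace by blast
  then show ?thesis
    unfolding jet_subbasis_def jet_source_set_def jet_chart_set_def by blast
qed

text \<open>The subbasis involves all adapted charts, but one chart near each parameter decides:
  preimages of the sets belonging to another chart are open by
  \<open>jet_transition\<close>.\<close>

lemma jet_space_continuousI:
  assumes q: "continuous_map Y TM q"
    and s: "\<And>y. y \<in> topspace Y \<Longrightarrow> s y \<in> local_sections_at M E p (q y)"
    and loc: "\<And>y0. y0 \<in> topspace Y \<Longrightarrow> \<exists>Y0 c d. openin Y Y0 \<and> y0 \<in> Y0 \<and> (c, d) \<in> adapted_charts M E p \<and>
       (\<forall>y\<in>Y0. s y (q y) \<in> fst d) \<and> (\<forall>vs. length vs \<le> k \<longrightarrow>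
         continuous_map (subtopology Y Y0) euclidean (\<lambda>y. iter_deriv vs (local_rep c d (s y)) (snd c (q y))))"
  shows "continuous_map Y (JS k) (\<lambda>y. jet M E p k (q y) (s y))"
proof (rule continuous_map_localI)
  fix y0 assume "y0 \<in> topspace Y"
  from loc[OF this] obtain Y0 c d where Y0: "openin Y Y0" "y0 \<in> Y0" and cd: "(c, d) \<in> adapted_charts M E p"
    and val: "\<And>y. y \<in> Y0 \<Longrightarrow> s y (q y) \<in> fst d" and
    jets: "\<And>vs. length vs \<le> k \<Longrightarrow>
         continuous_map (subtopology Y Y0) euclidean (\<lambda>y. iter_deriv vs (local_rep c d (s y)) (snd c (q y)))"
    by blast
  let ?Y = "subtopology Y Y0" and ?f = "\<lambda>y. jet M E p k (q y) (s y)"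
  have tY: "topspace ?Y = Y0" using openin_subset[OF Y0(1)] by auto
  have q0: "continuous_map ?Y TM q" using q by (rule continuous_map_from_subtopology)
  have s0: "s y \<in> local_sections_at M E p (q y)" if "y \<in> Y0" for y
    using that s openin_subset[OF Y0(1)] by blast
  have cv: "continuous_map ?Y TE (\<lambda>y. s y (q y))"
    by (rule value_continuous[OF cd q0]) (use jets[of "[]"] val s0 tY local_sections_atD(2) in auto)
  have "continuous_map ?Y (JS k) ?f"
    unfolding jet_space_eq
  proof (rule continuous_on_generated_topo)
    have "?f y \<in> jet_source_set k (topspace TM)" if "y \<in> Y0" for y
      using s0[OF that] local_sections_atD(1)[OF s0[OF that]] by (auto simp: jet_source_set_def)
    moreover have "jet_source_set k (topspace TM) \<in> jet_subbasis k" by (auto simp: jet_subbasis_def)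
    ultimately show "?f ` topspace ?Y \<subseteq> \<Union> (jet_subbasis k)"
      unfolding tY by blast
    fix S assume "S \<in> jet_subbasis k"
    then consider
       (a) U where "openin TM U" "S = jet_source_set k U"
     | (b) c' d' vs G where "(c', d') \<in> adapted_charts M E p" "length vs \<le> k" "open G"
        "S = jet_chart_set k c' d' vs G" unfolding jet_subbasis_def by blast
    then show "openin ?Y (?f -` S \<inter> topspace ?Y)"
    proof cases
      case a
      have "?f -` S \<inter> topspace ?Y = {y \<in> topspace ?Y. q y \<in> U}"
        unfolding a(2) tY by (intro set_eqI) (simp add: jet_in_source_set[OF s0] conj_commute cong: conj_cong)
      then show ?thesis using openin_continuous_map_preimage[OF q0 a(1)] by simp
    next
      case b
      \<comment> \<open>The coordinates of the other chart are available only where the values lie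
        in its domain; this set is open because the values vary continuously.\<close>
      define Y1 where "Y1 = {y \<in> topspace ?Y. s y (q y) \<in> fst d'}"
      have oY1: "openin ?Y Y1"
        unfolding Y1_def by (rule openin_continuous_map_preimage[OF cv chartD(1)[OF adapted_chartD(2)[OF b(1)]]])
      have tY1: "topspace (subtopology ?Y Y1) = Y1" using openin_subset[OF oY1] by auto
      have Y1: "y \<in> Y0" "s y (q y) \<in> fst d'" if "y \<in> Y1" for y using that tY by (auto simp: Y1_def)
      have "continuous_map (subtopology ?Y Y1) euclidean (\<lambda>y. iter_deriv vs (local_rep c' d' (s y)) (snd c' (q y)))"
        by (rule jet_transition[OF cd b(1) _ _ _ _ b(2)])
          (use tY1 Y1 s0 val jets q0 in \<open>auto intro: continuous_map_from_subtopology\<close>)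
      from openin_continuous_map_preimage[OF this, of G] b(3)
      have "openin (subtopology ?Y Y1) {y \<in> Y1. iter_deriv vs (local_rep c' d' (s y)) (snd c' (q y)) \<in> G}"
        by (simp only: tY1 open_openin)
      then have "openin ?Y {y \<in> Y1. iter_deriv vs (local_rep c' d' (s y)) (snd c' (q y)) \<in> G}"
        using openin_open_subtopology[OF oY1] by blast
      moreover have "?f -` S \<inter> topspace ?Y = {y \<in> Y1. iter_deriv vs (local_rep c' d' (s y)) (snd c' (q y)) \<in> G}"
        unfolding b(4) tY Y1_def by (intro set_eqI) (simp add: jet_in_chart_set[OF b(1,2) s0] conj_commute cong: conj_cong)
      ultimately show ?thesis by simp
    qed
  qed
  then show "\<exists>W. openin Y W \<and> y0 \<in> W \<and> continuous_map (subtopology Y W) (JS k) ?f" using Y0 by blast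
qed

text \<open>The representatives \<open>s y\<close> may jump with \<open>y\<close>; continuity of the
  jets still controls their derivatives at the moving point, on the open set where the chart
  applies.\<close>

lemma jet_space_continuousD:
  assumes f: "continuous_map Y (JS k) f"
    and fy: "\<And>y. y \<in> topspace Y \<Longrightarrow> f y = jet M E p k (q y) (s y)"
    and s: "\<And>y. y \<in> topspace Y \<Longrightarrow> s y \<in> local_sections_at M E p (q y)"
  shows "continuous_map Y TM q"
    "\<And>c d. (c, d) \<in> adapted_charts M E p \<Longrightarrow> openin Y {y \<in> topspace Y. s y (q y) \<in> fst d}"
    "\<And>c d vs. (c, d) \<in> adapted_charts M E p \<Longrightarrow> length vs \<le> k \<Longrightarrow>
       continuous_map (subtopology Y {y \<in> topspace Y. s y (q y) \<in> fst d}) euclidean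
         (\<lambda>y. iter_deriv vs (local_rep c d (s y)) (snd c (q y)))"
    "continuous_map Y TE (\<lambda>y. s y (q y))"
proof -
  have pre: "openin Y (f -` S \<inter> topspace Y)" if "S \<in> jet_subbasis k" for S
    using f that unfolding jet_space_eq continuous_on_generated_topo_iff by blast
  have chart_pre: "openin Y {y \<in> topspace Y. s y (q y) \<in> fst d \<and> iter_deriv vs (local_rep c d (s y)) (snd c (q y)) \<in> G}"
    if "(c, d) \<in> adapted_charts M E p" "length vs \<le> k" "open G" for c d vs G
  proof -
    let ?S = "jet_chart_set k c d vs G"
    have "?S \<in> jet_subbasis k" unfolding jet_subbasis_def using that by blast
    then have "openin Y (f -` ?S \<inter> topspace Y)" by (rule pre)
    moreover have "f -` ?S \<inter> topspace Y =
      {y \<in> topspace Y. s y (q y) \<in> fst d \<and> iter_deriv vs (local_rep c d (s y)) (snd c (q y)) \<in> G}"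
      by (intro set_eqI) (simp add: fy jet_in_chart_set[OF that(1,2) s] conj_commute cong: conj_cong)
    ultimately show ?thesis by simp
  qed
  show "continuous_map Y TM q"
    unfolding continuous_map
  proof (intro conjI allI impI)
    show "q ` topspace Y \<subseteq> topspace TM" using local_sections_atD(1)[OF s] by blast
    fix U assume U: "openin TM U"
    let ?S = "jet_source_set k U"
    have "openin Y (f -` ?S \<inter> topspace Y)" by (rule pre) (use U in \<open>auto simp: jet_subbasis_def\<close>)
    moreover have "f -` ?S \<inter> topspace Y = {y \<in> topspace Y. q y \<in> U}"
      by (intro set_eqI) (simp add: fy jet_in_source_set[OF s] conj_commute cong: conj_cong)
    ultimately show "openin Y {y \<in> topspace Y. q y \<in> U}" by simp
  qed
  note cq = this
  show op: "openin Y {y \<in> topspace Y. s y (q y) \<in> fst d}" if "(c, d) \<in> adapted_charts M E p" for c d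
    \<comment> \<open>With the empty list of directions and no restriction on the value, the
      subbasic condition says just that the value lies in the chart.\<close>
    using chart_pre[OF that, of "[]" UNIV] by simp
  show cd: "continuous_map (subtopology Y {y \<in> topspace Y. s y (q y) \<in> fst d}) euclidean
         (\<lambda>y. iter_deriv vs (local_rep c d (s y)) (snd c (q y)))"
    if "(c, d) \<in> adapted_charts M E p" "length vs \<le> k" for c d vs
    unfolding continuous_map
  proof (intro conjI allI impI)
    let ?Y0 = "{y \<in> topspace Y. s y (q y) \<in> fst d}"
    fix G :: "'c set" assume "openin euclidean G"
    then have "open G" by (simp flip: open_openin)
    from chart_pre[OF that this]
    have "openin (subtopology Y ?Y0) {y \<in> topspace Y. s y (q y) \<in> fst d \<and> iter_deriv vs (local_rep c d (s y)) (snd c (q y)) \<in> G}"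
      by (subst openin_open_subtopology[OF op[OF that(1)]]) auto
    moreover have "{y \<in> topspace (subtopology Y ?Y0). iter_deriv vs (local_rep c d (s y)) (snd c (q y)) \<in> G} =
      {y \<in> topspace Y. s y (q y) \<in> fst d \<and> iter_deriv vs (local_rep c d (s y)) (snd c (q y)) \<in> G}" by auto
    ultimately show "openin (subtopology Y ?Y0) {y \<in> topspace (subtopology Y ?Y0). iter_deriv vs (local_rep c d (s y)) (snd c (q y)) \<in> G}"
      by simp
  qed auto
  show "continuous_map Y TE (\<lambda>y. s y (q y))"
  proof (rule continuous_map_localI)
    fix y0 assume y0: "y0 \<in> topspace Y"
    obtain V where V: "openin TM V" "q y0 \<in> V" "s y0 \<in> smooth_sections M E p V"
      using s[OF y0] by (rule local_sections_atE)
    have "q y0 \<in> topspace (subtopology TM V)" using V(1,2) openin_subset by auto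
    then have "s y0 (q y0) \<in> topspace TE"
      using continuous_map_image_subset_topspace[OF smooth_sectionsD(2)[OF V(3)]] by blast
    then obtain c d where *: "(c, d) \<in> adapted_charts M E p" "s y0 (q y0) \<in> fst d"
      using adapted_chart_exists[OF fiber_bundle] by blast
    let ?Y0 = "{y \<in> topspace Y. s y (q y) \<in> fst d}"
    have "continuous_map (subtopology Y ?Y0) TE (\<lambda>y. s y (q y))"
      by (rule value_continuous[OF *(1) continuous_map_from_subtopology[OF cq]])
        (use local_sections_atD(2)[OF s] cd[OF *(1), of "[]"] in auto)
    then show "\<exists>W. openin Y W \<and> y0 \<in> W \<and> continuous_map (subtopology Y W) TE (\<lambda>y. s y (q y))"
      using op[OF *(1)] y0 *(2) by blast
  qed
qed

lemma same_jetI_chart: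
  assumes cd: "(c, d) \<in> adapted_charts M E p"
    and s: "s \<in> local_sections_at M E p q" and t: "t \<in> local_sections_at M E p q"
    and val: "s q = t q" "s q \<in> fst d"
    and eq: "\<And>vs. length vs \<le> r \<Longrightarrow> iter_deriv vs (local_rep c d s) (snd c q) = iter_deriv vs (local_rep c d t) (snd c q)"
  shows "same_jet M E p r q s t"
proof (rule same_jetI)
  show "s q = t q" by (rule val(1))
  fix c' d' and vs :: "'b list"
  assume cd': "(c', d') \<in> adapted_charts M E p" "s q \<in> fst d'" and len: "length vs \<le> r"
  text \<open>Families over the indiscrete two-point space are constant, so that the transition rule
    for jets of continuous families also yields the chart independence of equality of jets.\<close>
  define Y :: "bool topology" where "Y = topology (\<lambda>S. S = {} \<or> S = UNIV)"
  have "istopology (\<lambda>S::bool set. S = {} \<or> S = UNIV)" unfolding istopology_def by blast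
  then have oY: "openin Y S \<longleftrightarrow> S = {} \<or> S = UNIV" for S by (simp add: Y_def topology_inverse')
  then have tY: "topspace Y = UNIV" using openin_topspace oY openin_subset by (metis UNIV_I empty_iff subset_empty top.extremum_unique)
  let ?s = "\<lambda>b. if b then s else t"
  have "continuous_map Y euclidean (\<lambda>b. iter_deriv vs (local_rep c' d' (?s b)) (snd c' q))"
  proof (rule jet_transition[OF cd cd'(1) _ _ _ _ len, where q="\<lambda>_. q" and s="?s"])
    show "continuous_map Y TM (\<lambda>_. q)" using local_sections_atD(1)[OF s] by simp
    show "?s y \<in> local_sections_at M E p q" for y using s t by simp
    show "?s y q \<in> fst d \<inter> fst d'" for y using val cd' by simp
    show "continuous_map Y euclidean (\<lambda>b. iter_deriv vs (local_rep c d (?s b)) (snd c q))" if "length vs \<le> r" for vs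
      by (rule continuous_map_eq[where f="\<lambda>_. iter_deriv vs (local_rep c d s) (snd c q)"]) (use eq[OF that] in auto)
  qed
  then have *: "openin Y {b. iter_deriv vs (local_rep c' d' (?s b)) (snd c' q) \<in> G}" if "open G" for G
    using openin_continuous_map_preimage[of Y euclidean _ G] that by (simp add: tY)
  show "iter_deriv vs (local_rep c' d' s) (snd c' q) = iter_deriv vs (local_rep c' d' t) (snd c' q)" (is "?x = ?y")
  proof (rule ccontr)
    assume ne: "?x \<noteq> ?y"
    \<comment> \<open>Points are closed, so two different derivatives would be separated by an open
      set whose preimage contains exactly one of the two parameters, which the indiscrete topology
      forbids.\<close>
    have "open (- {?y})" by (simp add: open_Compl)
    from *[OF this] have "{b. iter_deriv vs (local_rep c' d' (?s b)) (snd c' q) \<in> - {?y}} \<in> {{}, UNIV}"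
      unfolding oY by simp
    moreover have "True \<in> {b. iter_deriv vs (local_rep c' d' (?s b)) (snd c' q) \<in> - {?y}}" using ne by simp
    moreover have "False \<notin> {b. iter_deriv vs (local_rep c' d' (?s b)) (snd c' q) \<in> - {?y}}" by simp
    ultimately show False by blast
  qed
qed

end

section \<open>Families of sections over boxes, in adapted charts\<close>

context smooth_bundle
begin

lemma topspace_sub: "openin TM V \<Longrightarrow> topspace (subtopology TM V) = V"
  using openin_subset by fastforce

lemma chart_continuous_on:
  assumes "topological_chart T c" "continuous_map Y T q" "\<And>y. y \<in> topspace Y \<Longrightarrow> q y \<in> fst c"
  shows "continuous_map Y euclidean (\<lambda>y. snd c (q y))"
proof -
  have "continuous_map Y (subtopology T (fst c)) q"
    using assms(2,3) by (auto simp: continuous_map_in_subtopology)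
  from continuous_map_compose[OF this chartD(5)[OF assms(1)]] show ?thesis by (simp add: o_def)
qed

text \<open>One adapted chart decides smoothness, since in any other pair of charts the section
  takes the form \<open>T (\<tau> x, f (\<tau> x))\<close> known from the transition of jets.
  Sections are constructed from coordinate functions in this way.\<close>

lemma smooth_sectionsI:
  assumes V: "openin TM V" and s: "s \<in> extensional V" and cd: "(c, d) \<in> adapted_charts M E p"
    and sd: "\<And>q. q \<in> V \<Longrightarrow> s q \<in> fst d" and ps: "\<And>q. q \<in> V \<Longrightarrow> p (s q) = q"
    and sm: "smooth_on (snd c ` V) (local_rep c d s)"
  shows "s \<in> smooth_sections M E p V"
proof -
  note c = adapted_chartD[OF cd]
  define U \<phi> N \<eta> where defs: "U = fst c" "\<phi> = snd c" "N = fst d" "\<eta> = snd d"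
  note C = chartD[OF c(1), folded defs] and D = chartD[OF c(2), folded defs]
  have graph: "\<eta> (s q) = (\<phi> q, local_rep c d s (\<phi> q))" "q \<in> U" if "q \<in> V" for q
    using local_rep_graph(1,2)[OF cd, of s q] sd[OF that] ps[OF that] by (simp_all add: defs)
  have VU: "V \<subseteq> U" using graph(2) by blast
  have tV: "topspace (subtopology TM V) = V" by (rule topspace_sub[OF V])
  have id: "continuous_map (subtopology TM V) TM (\<lambda>q. q)" by (simp add: continuous_map_from_subtopology)
  have c\<phi>: "continuous_map (subtopology TM V) euclidean \<phi>"
    using chart_continuous_on[OF c(1) id] graph(2) tV by (auto simp: defs)
  have "continuous_on (\<phi> ` V) (local_rep c d s)"
    using sm C(7)[OF V VU] unfolding smooth_on_def defs
    by (metis continuous_at_imp_continuous_on differentiable_imp_continuous_within iter_deriv.simps(1))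
  moreover have "continuous_map (subtopology TM V) (top_of_set (\<phi> ` V)) \<phi>"
    using c\<phi> tV by (auto simp: continuous_map_in_subtopology)
  ultimately have "continuous_map (subtopology TM V) euclidean (local_rep c d s \<circ> \<phi>)"
    by (intro continuous_map_compose[of _ "top_of_set (\<phi> ` V)"]) auto
  then have cs: "continuous_map (subtopology TM V) TE s"
    using value_continuous[OF cd id, of "\<lambda>_. s"] sd ps tV by (simp add: o_def defs)
  have main: "smooth_on (\<phi>' ` {x\<in>U'. s x \<in> N'}) (\<eta>' \<circ> s \<circ> inv_into U' \<phi>')"
    if c': "(U', \<phi>') \<in> atlas M" "U' \<subseteq> V" and d': "(N', \<eta>') \<in> atlas E" for U' \<phi>' N' \<eta>'
  proof -
    note C' = topological_chartD[OF smooth_manifoldD(3)[OF manifolds(1) c'(1)]]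
     and D' = topological_chartD[OF smooth_manifoldD(3)[OF manifolds(2) d']]
    define W where "W = {x \<in> U'. s x \<in> N'}"
    have cs': "continuous_map (subtopology TM U') TE s"
      by (rule continuous_map_from_subtopology_mono[OF cs c'(2)])
    have "openin (subtopology TM U') {x \<in> topspace (subtopology TM U'). s x \<in> N'}"
      by (rule openin_continuous_map_preimage[OF cs' D'(1)])
    then have "openin (subtopology TM U') W" by (simp only: topspace_sub[OF C'(1)] W_def)
    then have oW: "openin TM W" using openin_open_subtopology[OF C'(1)] by blast
    have WU: "W \<subseteq> U'" "W \<subseteq> V" "W \<subseteq> U" using c'(2) VU by (auto simp: W_def)
    have o\<phi>: "open (\<phi>' ` W)" by (rule C'(7)[OF oW WU(1)])
    define \<tau> where "\<tau> = \<phi> \<circ> inv_into U' \<phi>'"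
    have \<tau>: "\<tau> (\<phi>' x) = \<phi> x" if "x \<in> U'" for x
      using inv_into_f_f[OF C'(3) that] by (simp add: \<tau>_def)
    have sm\<tau>: "smooth_on (\<phi>' ` W) \<tau>"
      unfolding \<tau>_def using c(3) c' WU
      by (intro smooth_on_subset[OF smooth_manifoldD(4)[OF manifolds(1)], of U' \<phi>' U \<phi>]) (auto simp: defs)
    define T where "T = \<eta>' \<circ> inv_into N \<eta>"
    have smT: "smooth_on (\<eta> ` (N \<inter> N')) T"
      unfolding T_def defs using c(4) d' by (intro smooth_manifoldD(4)[OF manifolds(2)]) simp_all
    have oT: "open (\<eta> ` (N \<inter> N'))" using D(1) D'(1) by (intro D(7)) auto
    obtain B1 B3 and b1 :: "'b \<Rightarrow> 'b \<Rightarrow> real" and b3 :: "'b \<times> 'c \<Rightarrow> 'b \<times> 'c \<Rightarrow> real"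
      where B: "linear_coordinates B1 b1" "linear_coordinates B3 b3"
      using coordinates by blast
    have "smooth_on (\<phi>' ` W) (\<lambda>x. local_rep c d s (\<tau> x))"
    proof (rule smooth_on_compose[OF B(1) C(7)[OF V VU] o\<phi> _ sm\<tau>])
      show "smooth_on (\<phi> ` V) (local_rep c d s)" using sm by (simp add: defs)
      show "\<tau> ` \<phi>' ` W \<subseteq> \<phi> ` V" using \<tau> WU by force
    qed
    from smooth_on_Pair[OF o\<phi> sm\<tau> this]
    have "smooth_on (\<phi>' ` W) (\<lambda>x. T (\<tau> x, local_rep c d s (\<tau> x)))"
    proof (rule smooth_on_compose[OF B(2) oT o\<phi> smT])
      show "(\<lambda>x. (\<tau> x, local_rep c d s (\<tau> x))) ` \<phi>' ` W \<subseteq> \<eta> ` (N \<inter> N')"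
      proof (clarify)
        fix w assume w: "w \<in> W"
        then have "w \<in> U'" "w \<in> V" using WU by auto
        then have "(\<tau> (\<phi>' w), local_rep c d s (\<tau> (\<phi>' w))) = \<eta> (s w)" by (simp only: \<tau> graph)
        moreover have "s w \<in> N \<inter> N'" using w sd WU by (auto simp: W_def defs)
        ultimately show "(\<tau> (\<phi>' w), local_rep c d s (\<tau> (\<phi>' w))) \<in> \<eta> ` (N \<inter> N')" by simp
      qed
    qed
    then show ?thesis unfolding W_def[symmetric]
    proof (rule smooth_on_cong[OF o\<phi>])
      fix x assume "x \<in> \<phi>' ` W"
      then obtain w where w: "w \<in> W" "x = \<phi>' w" by auto
      have "T (\<eta> (s w)) = \<eta>' (s w)"
        using inv_into_f_f[OF D(3), of "s w"] sd w WU by (auto simp: T_def defs)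
      moreover have "inv_into U' \<phi>' x = w" using inv_into_f_f[OF C'(3), of w] w WU by auto
      ultimately show "T (\<tau> x, local_rep c d s (\<tau> x)) = (\<eta>' \<circ> s \<circ> inv_into U' \<phi>') x"
        using \<tau>[of w] graph(1)[of w] w(1) WU by (auto simp: w(2) subset_iff)
    qed
  qed
  have "smooth_map (open_submanifold M V) E s"
    unfolding smooth_map_def using cs main by (auto simp: open_submanifold_def)
  then show ?thesis using s ps by (simp add: smooth_sections_def)
qed

text \<open>The order of the factors results from unfolding two nested \<open>Maps\<close>, each of
  which puts its own source first: the point \<open>q\<close> at which a section is evaluated, then
  the base point \<open>a\<close>, then the parameter. Hence \<open>V\<close> precedes
  \<open>U\<close>.\<close>

abbreviation box :: "'m set \<Rightarrow> 'm set \<Rightarrow> 'z topology \<Rightarrow> ('m \<times> 'm \<times> 'z) topology" where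
  "box U V Z \<equiv> prod_topology (subtopology TM V) (prod_topology (subtopology TM U) Z)"

text \<open>Unfolds the nested \<open>Maps\<close> into joint continuity in \<open>(q, a, z)\<close>
  of the values and of all jets in the variable \<open>q\<close>.\<close>

lemma P_quasitopologyD:
  assumes h: "h \<in> P_quasitopology M E p W Z" and UV: "openin TM U" "openin TM V" "U \<times> V \<subseteq> W"
  shows "\<And>z a. z \<in> topspace Z \<Longrightarrow> a \<in> U \<Longrightarrow> (\<lambda>q\<in>V. h z (a, q)) \<in> smooth_sections M E p V"
    "continuous_map (box U V Z) TE (\<lambda>(q, a, z). h z (a, q))"
    "\<And>k. continuous_map (box U V Z) (JS k) (\<lambda>(q, a, z). jet M E p k q (\<lambda>q\<in>V. h z (a, q)))"
proof -
  note tU = topspace_sub[OF UV(1)] and tV = topspace_sub[OF UV(2)]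
  let ?Z = "prod_topology (subtopology TM U) Z"
  let ?f = "\<lambda>(a, z). (\<lambda>a\<in>U. \<lambda>q\<in>V. h z (a, q)) a"
  have "(\<lambda>z. \<lambda>a\<in>U. \<lambda>q\<in>V. h z (a, q)) \<in> Maps (subtopology TM U) (section_quasitopology M E p V) Z"
    using h UV by (simp add: P_quasitopology_def)
  then have f: "?f \<in> section_quasitopology M E p V ?Z"
    by (simp add: Maps_def)
  show "(\<lambda>q\<in>V. h z (a, q)) \<in> smooth_sections M E p V" if "z \<in> topspace Z" "a \<in> U" for z a
  proof -
    have "(a, z) \<in> topspace ?Z" using that tU by simp
    then have "?f (a, z) \<in> smooth_sections M E p V" using f unfolding section_quasitopology_def by blast
    then show ?thesis using that by simp
  qed
  have "continuous_map (box U V Z) TE (\<lambda>(q, az). ?f az q)"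
    using f unfolding section_quasitopology_def Maps_def top_quasitopology_def by blast
  then show "continuous_map (box U V Z) TE (\<lambda>(q, a, z). h z (a, q))"
    by (rule continuous_map_eq) (use tU tV in auto)
  show "continuous_map (box U V Z) (JS k) (\<lambda>(q, a, z). jet M E p k q (\<lambda>q\<in>V. h z (a, q)))" for k
  proof -
    have "continuous_map (box U V Z) (JS k) (\<lambda>(q, az). (\<lambda>q\<in>V. jet M E p k q (?f az)) q)"
      using f unfolding section_quasitopology_def Maps_def top_quasitopology_def by blast
    then show ?thesis
      by (rule continuous_map_eq) (use tU tV in auto)
  qed
qed

lemma P_quasitopologyI:
  assumes ext: "\<And>z. z \<in> topspace Z \<Longrightarrow> h z \<in> extensional W"
    and 1: "\<And>U V z a. openin TM U \<Longrightarrow> openin TM V \<Longrightarrow> U \<times> V \<subseteq> W \<Longrightarrow> z \<in> topspace Z \<Longrightarrow> a \<in> U \<Longrightarrow> (\<lambda>q\<in>V. h z (a, q)) \<in> smooth_sections M E p V"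
    and 2: "\<And>U V. openin TM U \<Longrightarrow> openin TM V \<Longrightarrow> U \<times> V \<subseteq> W \<Longrightarrow> continuous_map (box U V Z) TE (\<lambda>(q, a, z). h z (a, q))"
    and 3: "\<And>U V k. openin TM U \<Longrightarrow> openin TM V \<Longrightarrow> U \<times> V \<subseteq> W \<Longrightarrow>
       continuous_map (box U V Z) (JS k) (\<lambda>(q, a, z). jet M E p k q (\<lambda>q\<in>V. h z (a, q)))"
  shows "h \<in> P_quasitopology M E p W Z"
  unfolding P_quasitopology_def
proof (rule CollectI, intro conjI ballI allI impI; (elim conjE)?)
  show "h z \<in> extensional W" if "z \<in> topspace Z" for z by (rule ext[OF that])
  fix U V assume UV: "openin TM U" "openin TM V" "U \<times> V \<subseteq> W"
  note tU = topspace_sub[OF UV(1)] and tV = topspace_sub[OF UV(2)]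
  let ?Z = "prod_topology (subtopology TM U) Z"
  let ?f = "\<lambda>(a, z). (\<lambda>a\<in>U. \<lambda>q\<in>V. h z (a, q)) a"
  have "?f \<in> section_quasitopology M E p V ?Z"
    unfolding section_quasitopology_def Maps_def top_quasitopology_def
  proof (rule CollectI, intro conjI ballI allI CollectI)
    fix az assume "az \<in> topspace ?Z"
    then obtain a z where az: "az = (a, z)" "a \<in> U" "z \<in> topspace Z" using tU by auto
    show "?f az \<in> extensional (topspace (subtopology TM V))" unfolding tV using az by simp
    show "?f az \<in> smooth_sections M E p V" using 1[OF UV az(3,2)] az by simp
    show "(\<lambda>q\<in>V. jet M E p k q (?f az)) \<in> extensional (topspace (subtopology TM V))" for k
      unfolding tV by simp
  next
    show "continuous_map (box U V Z) TE (\<lambda>(w, z). ?f z w)"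
      by (rule continuous_map_eq[OF 2[OF UV]]) (use tU tV in auto)
    show "continuous_map (box U V Z) (JS k) (\<lambda>(w, z). (\<lambda>q\<in>V. jet M E p k q (?f z)) w)" for k
      by (rule continuous_map_eq[OF 3[OF UV]]) (use tU tV in auto)
  qed
  then show "(\<lambda>z. \<lambda>a\<in>U. \<lambda>q\<in>V. h z (a, q)) \<in> Maps (subtopology TM U) (section_quasitopology M E p V) Z"
    using tU by (simp add: Maps_def)
qed

lemma P_quasitopology_restrict:
  assumes "h \<in> P_quasitopology M E p W Z" "W' \<subseteq> W"
  shows "(\<lambda>z. restrict (h z) W') \<in> P_quasitopology M E p W' Z"
proof -
  have eq: "(\<lambda>q\<in>V. restrict (h z) W' (a, q)) = (\<lambda>q\<in>V. h z (a, q))" if "U \<times> V \<subseteq> W'" "a \<in> U" for U V z a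
    using that by (intro restrict_ext) auto
  show ?thesis
  proof (rule P_quasitopologyI)
    fix U V assume UV: "openin TM U" "openin TM V" "U \<times> V \<subseteq> W'"
    then have UV': "U \<times> V \<subseteq> W" using assms(2) by blast
    note tU = topspace_sub[OF UV(1)] and tV = topspace_sub[OF UV(2)]
    note D = P_quasitopologyD[OF assms(1) UV(1,2) UV']
    show "(\<lambda>q\<in>V. restrict (h z) W' (a, q)) \<in> smooth_sections M E p V" if "z \<in> topspace Z" "a \<in> U" for z a
      unfolding eq[OF UV(3) that(2)] by (rule D(1)[OF that])
    show "continuous_map (box U V Z) TE (\<lambda>(q, a, z). restrict (h z) W' (a, q))"
      by (rule continuous_map_eq[OF D(2)]) (use tU tV UV(3) in auto)
    show "continuous_map (box U V Z) (JS k) (\<lambda>(q, a, z). jet M E p k q (\<lambda>q\<in>V. restrict (h z) W' (a, q)))" for k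
      by (rule continuous_map_eq[OF D(3)]) (use tU eq[OF UV(3)] in auto)
  qed simp
qed

text \<open>The coordinate form of a family over \<open>V \<times> V\<close> with values in the
  domain of \<open>d\<close>; \<open>P_chartI\<close> and \<open>P_chartD\<close> translate between
  the two. Lists \<open>vs\<close> of every length occur because admissibility concerns jets of all
  orders.\<close>

definition chart_family ::
  "('m, 'b) chart \<Rightarrow> ('e, 'b \<times> 'c) chart \<Rightarrow> 'm set \<Rightarrow> 'z topology \<Rightarrow> ('z \<Rightarrow> 'm \<Rightarrow> 'b \<Rightarrow> 'c) \<Rightarrow> bool" where
  "chart_family c d V Z w \<longleftrightarrow>
     (\<forall>z\<in>topspace Z. \<forall>a\<in>V. smooth_on (snd c ` V) (w z a) \<and> (\<forall>q\<in>V. (snd c q, w z a (snd c q)) \<in> snd d ` fst d)) \<and>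
     (\<forall>vs. continuous_map (box V V Z) euclidean (\<lambda>(q, a, z). iter_deriv vs (w z a) (snd c q)))"

definition chart_section ::
  "('m, 'b) chart \<Rightarrow> ('e, 'b \<times> 'c) chart \<Rightarrow> ('m \<Rightarrow> 'b \<Rightarrow> 'c) \<Rightarrow> 'm \<times> 'm \<Rightarrow> 'e" where
  "chart_section c d w = (\<lambda>(a, q). inv_into (fst d) (snd d) (snd c q, w a (snd c q)))"

lemma chart_section_props:
  assumes cd: "(c, d) \<in> adapted_charts M E p" and V: "V \<subseteq> fst c" and q: "q \<in> V"
    and im: "(snd c q, w a (snd c q)) \<in> snd d ` fst d"
  shows "chart_section c d w (a, q) \<in> fst d" "snd d (chart_section c d w (a, q)) = (snd c q, w a (snd c q))"
    "p (chart_section c d w (a, q)) = q"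
proof -
  note c = adapted_chartD[OF cd]
  let ?e = "chart_section c d w (a, q)"
  show e: "?e \<in> fst d" using im by (simp add: chart_section_def inv_into_into)
  show *: "snd d ?e = (snd c q, w a (snd c q))" using im by (simp add: chart_section_def f_inv_into_f)
  have "snd c (p ?e) = snd c q" using c(6)[OF e] * by simp
  then show "p ?e = q" using chartD(3)[OF c(1)] c(5)[OF e] V q by (auto dest: inj_onD)
qed

lemma local_rep_chart_section:
  assumes cd: "(c, d) \<in> adapted_charts M E p" and V: "V \<subseteq> fst c"
    and im: "\<And>q. q \<in> V \<Longrightarrow> (snd c q, w a (snd c q)) \<in> snd d ` fst d"
    and s: "\<And>q. q \<in> V \<Longrightarrow> s q = chart_section c d w (a, q)" and x: "x \<in> snd c ` V"
  shows "local_rep c d s x = w a x"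
proof -
  note c = adapted_chartD[OF cd]
  obtain q where q: "q \<in> V" "x = snd c q" using x by auto
  have "inv_into (fst c) (snd c) x = q" using inv_into_f_f[OF chartD(3)[OF c(1)], of q] V q by auto
  then show ?thesis using chart_section_props(2)[OF cd V q(1), of w a] im[OF q(1)] s[OF q(1)] q(2)
    by (simp add: local_rep_eq)
qed

lemma P_chartI:
  assumes cd: "(c, d) \<in> adapted_charts M E p" and V: "openin TM V" "V \<subseteq> fst c"
    and w: "chart_family c d V Z w"
  shows "(\<lambda>z. restrict (chart_section c d (w z)) (V \<times> V)) \<in> P_quasitopology M E p (V \<times> V) Z"
proof -
  note c = adapted_chartD[OF cd]
  let ?h = "\<lambda>z. restrict (chart_section c d (w z)) (V \<times> V)"
  have im: "(snd c q, w z a (snd c q)) \<in> snd d ` fst d" if "z \<in> topspace Z" "a \<in> V" "q \<in> V" for z a q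
    using w that by (simp add: chart_family_def)
  have props: "?h z (a, q) \<in> fst d" "p (?h z (a, q)) = q" if "z \<in> topspace Z" "a \<in> V" "q \<in> V" for z a q
    using chart_section_props(1,3)[OF cd V(2) that(3), of "w z" a] im[OF that] that by simp_all
  have rep: "local_rep c d (\<lambda>q\<in>V'. ?h z (a, q)) x = w z a x"
    if "z \<in> topspace Z" "a \<in> V" "V' \<subseteq> V" "x \<in> snd c ` V'" for z a V' x
    by (rule local_rep_chart_section[OF cd order_trans[OF that(3) V(2)] _ _ that(4)]) (use that im in auto)
  have sec: "(\<lambda>q\<in>V'. ?h z (a, q)) \<in> smooth_sections M E p V'"
    if "z \<in> topspace Z" "a \<in> V" "V' \<subseteq> V" "openin TM V'" for z a V'
  proof (rule smooth_sectionsI[OF that(4) _ cd])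
    have o: "open (snd c ` V')" using V(2) that(3) by (intro chartD(7)[OF c(1) that(4)]) auto
    have "smooth_on (snd c ` V') (w z a)"
      using w that by (auto simp: chart_family_def intro: smooth_on_subset)
    then show "smooth_on (snd c ` V') (local_rep c d (\<lambda>q\<in>V'. ?h z (a, q)))"
      by (rule smooth_on_cong[OF o]) (use rep[OF that(1-3)] in simp)
  qed (use props that in auto)
  have "continuous_map (box U V' Z) TE (\<lambda>(q, a, z). ?h z (a, q)) \<and>
    (\<forall>k. continuous_map (box U V' Z) (JS k) (\<lambda>(q, a, z). jet M E p k q (\<lambda>q\<in>V'. ?h z (a, q))))"
    if UV: "openin TM U" "openin TM V'" "U \<times> V' \<subseteq> V \<times> V" for U V'
  \<comment> \<open>If \<open>U\<close> is empty, the inclusion of the box into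
    \<open>V \<times> V\<close> says nothing about \<open>V'\<close>.\<close>
  proof (cases "U = {}")
    case True
    then have "topspace (box U V' Z) = {}" by simp
    then show ?thesis by (simp add: continuous_map_empty_topspace del: topspace_prod_topology)
  next
    case False
    then have sub: "V' \<subseteq> V" using UV(3) by auto
    note tU = topspace_sub[OF UV(1)] and tV = topspace_sub[OF UV(2)]
    have mem: "q \<in> V' \<and> a \<in> V \<and> z \<in> topspace Z" if "(q, a, z) \<in> topspace (box U V' Z)" for q a z
      using that tU tV UV(3) by auto
    let ?s = "\<lambda>(q, a, z). (\<lambda>q\<in>V'. ?h z (a, q))"
    have fst: "continuous_map (box U V' Z) TM fst"
      by (rule continuous_map_into_fulltopology[OF continuous_map_fst])
    have loc: "?s y \<in> local_sections_at M E p (fst y)" if "y \<in> topspace (box U V' Z)" for y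
    proof -
      obtain q a z where y: "y = (q, a, z)" by (cases y) auto
      then show ?thesis using mem[of q a z] that sec[of z a V'] UV sub
        unfolding local_sections_at_def by auto
    qed
    have val: "?s y (fst y) \<in> fst d" if "y \<in> topspace (box U V' Z)" for y
    proof -
      obtain q a z where y: "y = (q, a, z)" by (cases y) auto
      then show ?thesis using mem[of q a z] that props[of z a q] sub by auto
    qed
    have jets: "continuous_map (box U V' Z) euclidean (\<lambda>y. iter_deriv vs (local_rep c d (?s y)) (snd c (fst y)))" for vs
    proof -
      have "continuous_map (box V V Z) euclidean (\<lambda>(q, a, z). iter_deriv vs (w z a) (snd c q))"
        using w by (simp add: chart_family_def)
      then have "continuous_map (subtopology (box V V Z) (V' \<times> U \<times> topspace Z)) euclidean (\<lambda>(q, a, z). iter_deriv vs (w z a) (snd c q))"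
        by (rule continuous_map_from_subtopology)
      moreover have "subtopology (box V V Z) (V' \<times> U \<times> topspace Z) = box U V' Z"
      proof (cases "V' = {}")
        case True
        then show ?thesis by (simp add: subtopology_Times)
      next
        case False
        have "V \<inter> V' = V'" "V \<inter> U = U" using sub UV(3) False by auto
        then show ?thesis by (simp add: subtopology_Times subtopology_subtopology)
      qed
      ultimately have "continuous_map (box U V' Z) euclidean (\<lambda>(q, a, z). iter_deriv vs (w z a) (snd c q))" by simp
      then show ?thesis
      proof (rule continuous_map_eq)
        fix y assume yt: "y \<in> topspace (box U V' Z)"
        obtain q a z where y: "y = (q, a, z)" by (cases y) auto
        have m: "q \<in> V'" "a \<in> V" "z \<in> topspace Z" using mem[of q a z] yt y by auto
        have o: "open (snd c ` V')" using V(2) sub by (intro chartD(7)[OF c(1) UV(2)]) auto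
        have "iter_deriv vs (w z a) (snd c q) = iter_deriv vs (local_rep c d (\<lambda>q\<in>V'. ?h z (a, q))) (snd c q)"
          by (rule iter_deriv_cong[OF o rep[OF m(3,2) sub, symmetric]]) (use m in auto)
        then show "(case y of (q, a, z) \<Rightarrow> iter_deriv vs (w z a) (snd c q)) = iter_deriv vs (local_rep c d (?s y)) (snd c (fst y))"
          by (simp add: y)
      qed
    qed
    have ps: "p (?s y (fst y)) = fst y" if "y \<in> topspace (box U V' Z)" for y
      using local_sections_atD(2)[OF loc[OF that]] .
    have "continuous_map (box U V' Z) TE (\<lambda>y. ?s y (fst y))"
      by (rule value_continuous[OF cd fst, where s="?s"]) (use val ps jets[of "[]"] in auto)
    then have "continuous_map (box U V' Z) TE (\<lambda>(q, a, z). ?h z (a, q))"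
      by (rule continuous_map_eq) (use mem in auto)
    moreover have "continuous_map (box U V' Z) (JS k) (\<lambda>(q, a, z). jet M E p k q (\<lambda>q\<in>V'. ?h z (a, q)))" for k
    proof -
      have "continuous_map (box U V' Z) (JS k) (\<lambda>y. jet M E p k (fst y) (?s y))"
      proof (rule jet_space_continuousI[OF fst, where s="?s"])
        show "?s y \<in> local_sections_at M E p (fst y)" if "y \<in> topspace (box U V' Z)" for y by (rule loc[OF that])
        fix y0 assume "y0 \<in> topspace (box U V' Z)"
        then show "\<exists>Y0 c d. openin (box U V' Z) Y0 \<and> y0 \<in> Y0 \<and> (c, d) \<in> adapted_charts M E p \<and>
           (\<forall>y\<in>Y0. ?s y (fst y) \<in> fst d) \<and> (\<forall>vs. length vs \<le> k \<longrightarrow>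
           continuous_map (subtopology (box U V' Z) Y0) euclidean (\<lambda>y. iter_deriv vs (local_rep c d (?s y)) (snd c (fst y))))"
          using val jets cd
          by (intro exI[of _ "topspace (box U V' Z)"] exI[of _ c] exI[of _ d]) (simp del: topspace_prod_topology topspace_subtopology)
      qed
      then show ?thesis by (simp add: case_prod_unfold)
    qed
    ultimately show ?thesis by blast
  qed
  note cont = this
  show ?thesis
  proof (rule P_quasitopologyI)
    show "(\<lambda>q\<in>V'. ?h z (a, q)) \<in> smooth_sections M E p V'"
      if "openin TM U" "openin TM V'" "U \<times> V' \<subseteq> V \<times> V" "z \<in> topspace Z" "a \<in> U" for U V' z a
    \<comment> \<open>Here an empty \<open>V'\<close> would leave \<open>a \<in> V\<close> unknown;
      the section over the empty set is smooth for trivial reasons.\<close>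
    proof (cases "V' = {}")
      case False then show ?thesis using that by (intro sec) auto
    next
      case True
      then show ?thesis using that by (intro smooth_sectionsI[OF _ _ cd]) auto
    qed
  qed (use cont in auto)
qed

end

section \<open>Interpolation and local lifts in a chart\<close>


context smooth_bundle
begin

lemma P_quasitopology_cong_eq:
  assumes "h \<in> P_quasitopology M E p W Z" "\<And>z. z \<in> topspace Z \<Longrightarrow> h z = g z"
  shows "g \<in> P_quasitopology M E p W Z"
proof (rule P_quasitopologyI)
  show "g z \<in> extensional W" if "z \<in> topspace Z" for z
    using assms that by (auto simp: P_quasitopology_def)
  fix U V assume UV: "openin TM U" "openin TM V" "U \<times> V \<subseteq> W"
  note D = P_quasitopologyD[OF assms(1) UV]
  show "(\<lambda>q\<in>V. g z (a, q)) \<in> smooth_sections M E p V" if "z \<in> topspace Z" "a \<in> U" for z a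
    using D(1)[OF that] assms(2)[OF that(1)] by simp
  show "continuous_map (box U V Z) TE (\<lambda>(q, a, z). g z (a, q))"
    by (rule continuous_map_eq[OF D(2)]) (use assms(2) in auto)
  show "continuous_map (box U V Z) (JS k) (\<lambda>(q, a, z). jet M E p k q (\<lambda>q\<in>V. g z (a, q)))" for k
    by (rule continuous_map_eq[OF D(3)]) (use assms(2) in auto)
qed

lemma P_value_section:
  assumes "h \<in> P_quasitopology M E p W Z" "openin TM U" "openin TM V" "U \<times> V \<subseteq> W"
    "z \<in> topspace Z" "a \<in> U" "q \<in> V"
  shows "p (h z (a, q)) = q"
  using smooth_sectionsD(3)[OF P_quasitopologyD(1)[OF assms(1-4,5,6)] assms(7)] assms(7) by simp

lemma P_chartD:
  assumes cd: "(c, d) \<in> adapted_charts M E p" and V: "openin TM V"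
    and h: "h \<in> P_quasitopology M E p W Z" and W: "V \<times> V \<subseteq> W"
    and hd: "\<And>z a q. z \<in> topspace Z \<Longrightarrow> a \<in> V \<Longrightarrow> q \<in> V \<Longrightarrow> h z (a, q) \<in> fst d"
  shows "chart_family c d V Z (\<lambda>z a. local_rep c d (\<lambda>q\<in>V. h z (a, q)))"
    "\<And>z a q. z \<in> topspace Z \<Longrightarrow> a \<in> V \<Longrightarrow> q \<in> V \<Longrightarrow>
       snd d (h z (a, q)) = (snd c q, local_rep c d (\<lambda>q\<in>V. h z (a, q)) (snd c q))"
proof -
  note D = P_quasitopologyD[OF h V V W] and tV = topspace_sub[OF V]
  let ?s = "\<lambda>(q, a, z). \<lambda>q\<in>V. h z (a, q)"
  have mem: "q \<in> V \<and> a \<in> V \<and> z \<in> topspace Z" if "(q, a, z) \<in> topspace (box V V Z)" for q a z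
    using that tV by auto
  have sec: "(\<lambda>q\<in>V. h z (a, q)) \<in> local_sections_at M E p q" if "z \<in> topspace Z" "a \<in> V" "q \<in> V" for z a q
    using D(1)[OF that(1,2)] V that(3) by (auto simp: local_sections_at_def)
  show graph: "snd d (h z (a, q)) = (snd c q, local_rep c d (\<lambda>q\<in>V. h z (a, q)) (snd c q))"
    if "z \<in> topspace Z" "a \<in> V" "q \<in> V" for z a q
    using local_rep_graph(2)[OF cd, of "\<lambda>q\<in>V. h z (a, q)" q] hd[OF that] P_value_section[OF h V V W that] that(3) by simp
  have sm: "smooth_on (snd c ` V) (local_rep c d (\<lambda>q\<in>V. h z (a, q)))" if "z \<in> topspace Z" "a \<in> V" for z a
    by (rule local_rep_smooth[OF D(1)[OF that] V cd V order_refl]) (use hd that in auto)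
  have jets: "continuous_map (box V V Z) euclidean (\<lambda>(q, a, z). iter_deriv vs (local_rep c d (\<lambda>q\<in>V. h z (a, q))) (snd c q))" for vs
  proof -
    let ?Y0 = "{y \<in> topspace (box V V Z). ?s y (fst y) \<in> fst d}"
    have "continuous_map (subtopology (box V V Z) ?Y0) euclidean (\<lambda>y. iter_deriv vs (local_rep c d (?s y)) (snd c (fst y)))"
    proof (rule jet_space_continuousD(3)[OF D(3) _ _ cd order_refl])
      fix y assume y: "y \<in> topspace (box V V Z)"
      obtain q a z where yq: "y = (q, a, z)" by (cases y) auto
      show "(case y of (q, a, z) \<Rightarrow> jet M E p (length vs) q (\<lambda>q\<in>V. h z (a, q))) = jet M E p (length vs) (fst y) (?s y)"
        by (simp add: yq)
      show "?s y \<in> local_sections_at M E p (fst y)" using sec mem[of q a z] y by (simp add: yq)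
    qed
    moreover have "?Y0 = topspace (box V V Z)"
    proof -
      have "?s y (fst y) \<in> fst d" if "y \<in> topspace (box V V Z)" for y
      proof -
        obtain q a z where yq: "y = (q, a, z)" by (cases y) auto
        then show ?thesis using hd mem[of q a z] that by simp
      qed
      then show ?thesis by blast
    qed
    ultimately have "continuous_map (box V V Z) euclidean (\<lambda>y. iter_deriv vs (local_rep c d (?s y)) (snd c (fst y)))"
      by (simp only: subtopology_topspace)
    then show ?thesis by (simp add: case_prod_unfold)
  qed
  have "(snd c q, local_rep c d (\<lambda>q\<in>V. h z (a, q)) (snd c q)) \<in> snd d ` fst d" if "z \<in> topspace Z" "a \<in> V" "q \<in> V" for z a q
    using graph[OF that] hd[OF that] by (metis image_eqI)
  then show "chart_family c d V Z (\<lambda>z a. local_rep c d (\<lambda>q\<in>V. h z (a, q)))"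
    using sm jets by (simp add: chart_family_def)
qed

text \<open>At a diagonal point the neighbourhoods of \<open>a\<close> and of \<open>q\<close> can
  be intersected, so one set serves both for base points and as a domain of sections.\<close>

lemma openin_box_nbhd:
  assumes S: "openin (box V V Z) S" and V: "openin TM V" and mem: "(a, a, z) \<in> S"
  shows "\<exists>N V'. openin Z N \<and> z \<in> N \<and> openin TM V' \<and> a \<in> V' \<and> V' \<subseteq> V \<and> (\<forall>z\<in>N. \<forall>a\<in>V'. \<forall>q\<in>V'. (q, a, z) \<in> S)"
proof -
  obtain A B where A: "openin (subtopology TM V) A" "openin (prod_topology (subtopology TM V) Z) B" "a \<in> A" "(a, z) \<in> B" "A \<times> B \<subseteq> S"
    using S mem by (force simp: openin_prod_topology_alt)
  obtain A' N where B: "openin (subtopology TM V) A'" "openin Z N" "a \<in> A'" "z \<in> N" "A' \<times> N \<subseteq> B"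
    using A(2,4) by (force simp: openin_prod_topology_alt)
  have "openin TM A \<and> A \<subseteq> V" "openin TM A' \<and> A' \<subseteq> V"
    using A(1) B(1) by (simp_all add: openin_open_subtopology[OF V])
  then show ?thesis using A B by (intro exI[of _ N] exI[of _ "A \<inter> A'"]) auto
qed

lemma P_value_nbhd:
  assumes h: "h \<in> P_quasitopology M E p W Z" and V: "openin TM V" "V \<times> V \<subseteq> W" and z: "z \<in> topspace Z" "a \<in> V"
    and G: "openin TE G" "h z (a, a) \<in> G"
  shows "\<exists>N V'. openin Z N \<and> z \<in> N \<and> openin TM V' \<and> a \<in> V' \<and> V' \<subseteq> V \<and> (\<forall>z\<in>N. \<forall>a\<in>V'. \<forall>q\<in>V'. h z (a, q) \<in> G)"
proof -
  have "openin (box V V Z) {y \<in> topspace (box V V Z). (\<lambda>(q, a, z). h z (a, q)) y \<in> G}"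
    by (rule openin_continuous_map_preimage[OF P_quasitopologyD(2)[OF h V(1) V(1) V(2)] G(1)])
  moreover have "(a, a, z) \<in> {y \<in> topspace (box V V Z). (\<lambda>(q, a, z). h z (a, q)) y \<in> G}"
    using z G(2) topspace_sub[OF V(1)] by simp
  ultimately obtain N V' where "openin Z N" "z \<in> N" "openin TM V'" "a \<in> V'" "V' \<subseteq> V"
    "\<forall>z\<in>N. \<forall>a\<in>V'. \<forall>q\<in>V'. (q, a, z) \<in> {y \<in> topspace (box V V Z). (\<lambda>(q, a, z). h z (a, q)) y \<in> G}"
    using openin_box_nbhd[OF _ V(1)] by meson
  then show ?thesis by (intro exI[of _ N] exI[of _ V']) auto
qed

text \<open>The weight \<open>t\<close> is constant in \<open>x\<close>, so it contributes no
  derivatives; where \<open>f\<close> and \<open>g\<close> have equal derivatives, the mixture has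
  the same ones.\<close>

lemma iter_deriv_mix:
  assumes "open S" "smooth_on S f" "smooth_on S g" "x \<in> S"
  shows "iter_deriv vs (\<lambda>x. t *\<^sub>R f x + (1 - t) *\<^sub>R g x) x = t *\<^sub>R iter_deriv vs f x + (1 - t) *\<^sub>R iter_deriv vs g x"
    "smooth_on S (\<lambda>x. t *\<^sub>R f x + (1 - t) *\<^sub>R g x)"
proof -
  have s: "smooth_on S (\<lambda>x. k *\<^sub>R f x)" "smooth_on S (\<lambda>x. k *\<^sub>R g x)" for k
    using assms by (auto intro: smooth_on_bounded_linear[OF bounded_linear_scaleR_right])
  show "smooth_on S (\<lambda>x. t *\<^sub>R f x + (1 - t) *\<^sub>R g x)"
    by (rule smooth_on_add[OF assms(1) s])
  show "iter_deriv vs (\<lambda>x. t *\<^sub>R f x + (1 - t) *\<^sub>R g x) x = t *\<^sub>R iter_deriv vs f x + (1 - t) *\<^sub>R iter_deriv vs g x"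
    using iter_deriv_add[OF assms(1) s assms(4)]
      iter_deriv_bounded_linear[OF bounded_linear_scaleR_right assms(1,2,4)]
      iter_deriv_bounded_linear[OF bounded_linear_scaleR_right assms(1,3,4)] by simp
qed

lemma chart_family_mix:
  assumes cd: "(c, d) \<in> adapted_charts M E p" and V: "openin TM V" "V \<subseteq> fst c"
    and w: "chart_family c d V Z w1" "chart_family c d V Z w2"
    and \<theta>: "continuous_map (prod_topology (subtopology TM V) Z) euclideanreal \<theta>"
    and im: "\<And>z a q. z \<in> topspace Z \<Longrightarrow> a \<in> V \<Longrightarrow> q \<in> V \<Longrightarrow>
      (snd c q, \<theta> (a, z) *\<^sub>R w1 z a (snd c q) + (1 - \<theta> (a, z)) *\<^sub>R w2 z a (snd c q)) \<in> snd d ` fst d"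
  shows "chart_family c d V Z (\<lambda>z a x. \<theta> (a, z) *\<^sub>R w1 z a x + (1 - \<theta> (a, z)) *\<^sub>R w2 z a x)"
  unfolding chart_family_def
proof (intro conjI ballI allI)
  have o: "open (snd c ` V)" by (rule chartD(7)[OF adapted_chartD(1)[OF cd] V])
  have s: "smooth_on (snd c ` V) (w1 z a)" "smooth_on (snd c ` V) (w2 z a)" if "z \<in> topspace Z" "a \<in> V" for z a
    using w that by (auto simp: chart_family_def)
  show "smooth_on (snd c ` V) (\<lambda>x. \<theta> (a, z) *\<^sub>R w1 z a x + (1 - \<theta> (a, z)) *\<^sub>R w2 z a x)"
    if "z \<in> topspace Z" "a \<in> V" for z a
    using s[OF that] that iter_deriv_mix(2)[OF o s[OF that]] by blast
  fix vs :: "'b list"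
  have \<theta>': "continuous_map (box V V Z) euclideanreal (\<lambda>(q, a, z). \<theta> (a, z))"
    using continuous_map_compose[OF continuous_map_snd \<theta>] by (simp add: o_def case_prod_unfold)
  then have \<theta>'': "continuous_map (box V V Z) euclideanreal (\<lambda>y. 1 - (case y of (q, a, z) \<Rightarrow> \<theta> (a, z)))"
    by (intro continuous_map_diff) auto
  have c1: "continuous_map (box V V Z) euclidean (\<lambda>(q, a, z). iter_deriv vs (w1 z a) (snd c q))"
    "continuous_map (box V V Z) euclidean (\<lambda>(q, a, z). iter_deriv vs (w2 z a) (snd c q))"
    using w by (auto simp: chart_family_def)
  have "continuous_map (box V V Z) euclidean (\<lambda>y. (case y of (q, a, z) \<Rightarrow> \<theta> (a, z)) *\<^sub>R (case y of (q, a, z) \<Rightarrow> iter_deriv vs (w1 z a) (snd c q))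
     + (1 - (case y of (q, a, z) \<Rightarrow> \<theta> (a, z))) *\<^sub>R (case y of (q, a, z) \<Rightarrow> iter_deriv vs (w2 z a) (snd c q)))"
    by (intro continuous_map_add continuous_map_bounded_bilinear[OF bounded_bilinear_scaleR] \<theta>' \<theta>'' c1)
  then show "continuous_map (box V V Z) euclidean (\<lambda>(q, a, z). iter_deriv vs (\<lambda>x. \<theta> (a, z) *\<^sub>R w1 z a x + (1 - \<theta> (a, z)) *\<^sub>R w2 z a x) (snd c q))"
  proof (rule continuous_map_eq)
    fix y assume "y \<in> topspace (box V V Z)"
    moreover obtain q a z where y: "y = (q, a, z)" by (cases y) auto
    ultimately have m: "q \<in> V" "a \<in> V" "z \<in> topspace Z" using topspace_sub[OF V(1)] by auto
    have "snd c q \<in> snd c ` V" using m by simp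
    from iter_deriv_mix(1)[OF o s[OF m(3,2)] this]
    show "(case y of (q, a, z) \<Rightarrow> \<theta> (a, z)) *\<^sub>R (case y of (q, a, z) \<Rightarrow> iter_deriv vs (w1 z a) (snd c q))
     + (1 - (case y of (q, a, z) \<Rightarrow> \<theta> (a, z))) *\<^sub>R (case y of (q, a, z) \<Rightarrow> iter_deriv vs (w2 z a) (snd c q)) =
     (case y of (q, a, z) \<Rightarrow> iter_deriv vs (\<lambda>x. \<theta> (a, z) *\<^sub>R w1 z a x + (1 - \<theta> (a, z)) *\<^sub>R w2 z a x) (snd c q))"
      by (simp add: y)
  qed
qed (rule im)

text \<open>The convex combination of two points of one fiber, in the coordinates of
  \<open>d\<close>. It is a total function, meaningful when both points lie over one base point and
  the combined coordinates stay in the image of the chart.\<close>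

definition chart_mix :: "('e, 'b \<times> 'c) chart \<Rightarrow> real \<Rightarrow> 'e \<Rightarrow> 'e \<Rightarrow> 'e" where
  "chart_mix d t e e' = inv_into (fst d) (snd d)
     (fst (snd d e), t *\<^sub>R snd (snd d e) + (1 - t) *\<^sub>R snd (snd d e'))"

lemma chart_mix_0_1:
  assumes d: "topological_chart TE d" and "e \<in> fst d" "e' \<in> fst d" "fst (snd d e) = fst (snd d e')"
  shows "chart_mix d 1 e e' = e" "chart_mix d 0 e e' = e'"
proof -
  show "chart_mix d 1 e e' = e" using inv_into_f_f[OF chartD(3)[OF d] assms(2)] by (simp add: chart_mix_def)
  show "chart_mix d 0 e e' = e'" using inv_into_f_f[OF chartD(3)[OF d] assms(3)] assms(4) by (simp add: chart_mix_def)
qed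

text \<open>Inside the open image of the chart there is a product of an open set with a ball; over
  it the fiber coordinates range in the ball, which is convex.\<close>

lemma convex_chart_nbhd:
  assumes cd: "(c, d) \<in> adapted_charts M E p" and e: "e \<in> fst d"
  shows "\<exists>G. openin TE G \<and> e \<in> G \<and> G \<subseteq> fst d \<and>
    (\<forall>x\<in>G. \<forall>y\<in>G. \<forall>t. p x = p y \<longrightarrow> 0 \<le> t \<longrightarrow> t \<le> 1 \<longrightarrow>
       (fst (snd d x), t *\<^sub>R snd (snd d x) + (1 - t) *\<^sub>R snd (snd d y)) \<in> snd d ` fst d)"
proof -
  note c = adapted_chartD[OF cd] and D = chartD[OF adapted_chartD(2)[OF cd]]
  obtain x0 y0 where xy: "snd d e = (x0, y0)" by (cases "snd d e") auto
  have "(x0, y0) \<in> snd d ` fst d" using e xy by (metis image_eqI)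
  then obtain A B where AB: "open A" "open B" "(x0, y0) \<in> A \<times> B" "A \<times> B \<subseteq> snd d ` fst d"
    using open_prod_elim[OF D(2)] by metis
  then obtain r where r: "r > 0" "ball y0 r \<subseteq> B" using open_contains_ball by blast
  define G where "G = {x \<in> topspace (subtopology TE (fst d)). snd d x \<in> A \<times> ball y0 r}"
  have "openin (subtopology TE (fst d)) G"
    unfolding G_def using AB(1) by (intro openin_continuous_map_preimage[OF D(5)]) (simp add: open_Times)
  then have G: "openin TE G" "G \<subseteq> fst d" using openin_open_subtopology[OF D(1)] by auto
  have "e \<in> G" using e D(4) xy AB(3) r(1) by (auto simp: G_def)
  moreover have "(fst (snd d x), t *\<^sub>R snd (snd d x) + (1 - t) *\<^sub>R snd (snd d y)) \<in> snd d ` fst d"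
    if "x \<in> G" "y \<in> G" "0 \<le> t" "t \<le> 1" for x y t
  proof -
    have "snd d x \<in> A \<times> ball y0 r" "snd d y \<in> A \<times> ball y0 r" using that by (auto simp: G_def)
    then have "fst (snd d x) \<in> A" "snd (snd d x) \<in> ball y0 r" "snd (snd d y) \<in> ball y0 r" by (auto simp: mem_Times_iff)
    moreover from this have "t *\<^sub>R snd (snd d x) + (1 - t) *\<^sub>R snd (snd d y) \<in> ball y0 r"
      using that by (intro convexD[OF convex_ball]) auto
    ultimately show ?thesis using r(2) AB(4) by blast
  qed
  ultimately show ?thesis using G by (intro exI[of _ G]) blast
qed

text \<open>The two families agree at \<open>(a0, a0)\<close> for the parameter \<open>z0\<close>,
  so nearby both stay in one set with convex fiber coordinates, where their local representatives
  can be combined. That the combination lies in the image of the chart is part of the conclusion,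
  because the coordinates of the mixture can then be read back.\<close>

lemma P_mix_local:
  assumes cd: "(c, d) \<in> adapted_charts M E p"
    and h: "h \<in> P_quasitopology M E p W Z" and l: "l \<in> P_quasitopology M E p W Z"
    and V: "openin TM V" "V \<times> V \<subseteq> W" "V \<subseteq> fst c" and za: "z0 \<in> topspace Z" "a0 \<in> V"
    and \<theta>: "continuous_map (prod_topology (subtopology TM V) Z) euclideanreal \<theta>"
    and \<theta>01: "\<And>y. \<theta> y \<in> {0..1}"
    and val: "h z0 (a0, a0) = l z0 (a0, a0)" "h z0 (a0, a0) \<in> fst d"
  shows "\<exists>N V'. openin Z N \<and> z0 \<in> N \<and> openin TM V' \<and> a0 \<in> V' \<and> V' \<subseteq> V \<and>
    (\<forall>z\<in>N. \<forall>a\<in>V'. \<forall>q\<in>V'. h z (a, q) \<in> fst d \<and> l z (a, q) \<in> fst d \<and>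
      (fst (snd d (h z (a, q))), \<theta> (a, z) *\<^sub>R snd (snd d (h z (a, q))) + (1 - \<theta> (a, z)) *\<^sub>R snd (snd d (l z (a, q)))) \<in> snd d ` fst d) \<and>
    (\<lambda>z. restrict (\<lambda>(a, q). chart_mix d (\<theta> (a, z)) (h z (a, q)) (l z (a, q))) (V' \<times> V'))
      \<in> P_quasitopology M E p (V' \<times> V') (subtopology Z N)"
proof -
  note c = adapted_chartD[OF cd]
  obtain G where G': "openin TE G \<and> h z0 (a0, a0) \<in> G \<and> G \<subseteq> fst d \<and>
    (\<forall>x\<in>G. \<forall>y\<in>G. \<forall>t. p x = p y \<longrightarrow> 0 \<le> t \<longrightarrow> t \<le> 1 \<longrightarrow>
       (fst (snd d x), t *\<^sub>R snd (snd d x) + (1 - t) *\<^sub>R snd (snd d y)) \<in> snd d ` fst d)"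
    using convex_chart_nbhd[OF cd val(2)] by (rule exE)
  then have G: "openin TE G" "h z0 (a0, a0) \<in> G" "G \<subseteq> fst d" by simp_all
  have G4: "(fst (snd d x), t *\<^sub>R snd (snd d x) + (1 - t) *\<^sub>R snd (snd d y)) \<in> snd d ` fst d"
    if "x \<in> G" "y \<in> G" "p x = p y" "0 \<le> t" "t \<le> 1" for x y t
    using G'[THEN conjunct2, THEN conjunct2, THEN conjunct2, rule_format, OF that] .
  obtain N1 V1 where 1: "openin Z N1" "z0 \<in> N1" "openin TM V1" "a0 \<in> V1" "V1 \<subseteq> V" "\<And>z a q. z \<in> N1 \<Longrightarrow> a \<in> V1 \<Longrightarrow> q \<in> V1 \<Longrightarrow> h z (a, q) \<in> G"
    using P_value_nbhd[OF h V(1,2) za G(1,2)] by blast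
  have Gl: "l z0 (a0, a0) \<in> G" using G(2) val(1) by simp
  obtain N2 V2 where 2: "openin Z N2" "z0 \<in> N2" "openin TM V2" "a0 \<in> V2" "V2 \<subseteq> V" "\<And>z a q. z \<in> N2 \<Longrightarrow> a \<in> V2 \<Longrightarrow> q \<in> V2 \<Longrightarrow> l z (a, q) \<in> G"
    using P_value_nbhd[OF l V(1,2) za G(1) Gl] by blast
  define N V' where NV: "N = N1 \<inter> N2" "V' = V1 \<inter> V2"
  have V': "openin TM V'" "V' \<subseteq> V" "V' \<subseteq> fst c" "V' \<times> V' \<subseteq> W" "V' \<times> V' \<subseteq> V' \<times> V'" using 1 2 V by (auto simp: NV)
  have tN: "topspace (subtopology Z N) \<subseteq> N" by simp
  have sub: "continuous_map (subtopology Z N) Z (\<lambda>z. z)" by (simp add: continuous_map_from_subtopology)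
  have h': "h \<in> P_quasitopology M E p W (subtopology Z N)" and l': "l \<in> P_quasitopology M E p W (subtopology Z N)"
    using P_quasitopology_compose[OF h sub] P_quasitopology_compose[OF l sub] by (simp_all add: o_def)
  have hG: "h z (a, q) \<in> G" "l z (a, q) \<in> G" if "z \<in> topspace (subtopology Z N)" "a \<in> V'" "q \<in> V'" for z a q
    using 1(6)[of z a q] 2(6)[of z a q] that by (auto simp: NV)
  have hd: "h z (a, q) \<in> fst d" "l z (a, q) \<in> fst d" if "z \<in> topspace (subtopology Z N)" "a \<in> V'" "q \<in> V'" for z a q
    using hG[OF that] G(3) by auto
  have ps: "p (h z (a, q)) = q" "p (l z (a, q)) = q" if "z \<in> topspace (subtopology Z N)" "a \<in> V'" "q \<in> V'" for z a q
    using P_value_section[OF h' V'(1) V'(1) V'(4) that] P_value_section[OF l' V'(1) V'(1) V'(4) that] .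
  define w1 where "w1 z a = local_rep c d (\<lambda>q\<in>V'. h z (a, q))" for z a
  define w2 where "w2 z a = local_rep c d (\<lambda>q\<in>V'. l z (a, q))" for z a
  have H1: "chart_family c d V' (subtopology Z N) w1" and L1: "chart_family c d V' (subtopology Z N) w2"
    unfolding w1_def w2_def
    by (rule P_chartD(1)[OF cd V'(1) h' V'(4) hd(1)], assumption+, rule P_chartD(1)[OF cd V'(1) l' V'(4) hd(2)], assumption+)
  have H2: "snd d (h z (a, q)) = (snd c q, w1 z a (snd c q))" "snd d (l z (a, q)) = (snd c q, w2 z a (snd c q))"
    if "z \<in> topspace (subtopology Z N)" "a \<in> V'" "q \<in> V'" for z a q
    unfolding w1_def w2_def
    by (rule P_chartD(2)[OF cd V'(1) h' V'(4) hd(1) that], assumption+, rule P_chartD(2)[OF cd V'(1) l' V'(4) hd(2) that], assumption+)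
  let ?w = "\<lambda>z a x. \<theta> (a, z) *\<^sub>R w1 z a x + (1 - \<theta> (a, z)) *\<^sub>R w2 z a x"
  have sub2: "continuous_map (prod_topology (subtopology TM V') (subtopology Z N)) euclideanreal \<theta>"
  proof -
    have "V \<inter> V' = V'" using V'(2) by auto
    then have "prod_topology (subtopology TM V') (subtopology Z N) = subtopology (prod_topology (subtopology TM V) Z) (V' \<times> N)"
      by (simp add: subtopology_Times subtopology_subtopology)
    then show ?thesis using \<theta> by (simp add: continuous_map_from_subtopology)
  qed
  have img: "(fst (snd d (h z (a, q))), \<theta> (a, z) *\<^sub>R snd (snd d (h z (a, q))) + (1 - \<theta> (a, z)) *\<^sub>R snd (snd d (l z (a, q)))) \<in> snd d ` fst d"
    if m: "z \<in> topspace (subtopology Z N)" "a \<in> V'" "q \<in> V'" for z a q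
    using G4[OF hG[OF m], of "\<theta> (a, z)"] \<theta>01[of "(a, z)"] ps[OF m] by simp
  have "chart_family c d V' (subtopology Z N) ?w"
  proof (rule chart_family_mix[OF cd V'(1,3) H1 L1 sub2])
    fix z a q assume m: "z \<in> topspace (subtopology Z N)" "a \<in> V'" "q \<in> V'"
    show "(snd c q, \<theta> (a, z) *\<^sub>R w1 z a (snd c q) + (1 - \<theta> (a, z)) *\<^sub>R w2 z a (snd c q)) \<in> snd d ` fst d"
      using img[OF m] H2[OF m] by simp
  qed
  from P_chartI[OF cd V'(1,3) this]
  have "(\<lambda>z. restrict (chart_section c d (?w z)) (V' \<times> V')) \<in> P_quasitopology M E p (V' \<times> V') (subtopology Z N)" .
  moreover have "restrict (chart_section c d (?w z)) (V' \<times> V') =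
    restrict (\<lambda>(a, q). chart_mix d (\<theta> (a, z)) (h z (a, q)) (l z (a, q))) (V' \<times> V')" if z: "z \<in> topspace (subtopology Z N)" for z
  proof (rule restrict_ext, clarify)
    fix a q assume "a \<in> V'" "q \<in> V'"
    then show "chart_section c d (?w z) (a, q) = chart_mix d (\<theta> (a, z)) (h z (a, q)) (l z (a, q))"
      using H2[OF z] by (simp add: chart_section_def chart_mix_def)
  qed
  ultimately have "(\<lambda>z. restrict (\<lambda>(a, q). chart_mix d (\<theta> (a, z)) (h z (a, q)) (l z (a, q))) (V' \<times> V'))
      \<in> P_quasitopology M E p (V' \<times> V') (subtopology Z N)"
    by (rule P_quasitopology_cong_eq)
  moreover have "openin Z N" using 1(1) 2(1) by (auto simp: NV)
  moreover from this have "topspace (subtopology Z N) = N" using openin_subset by fastforce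
  ultimately show ?thesis using 1(2,4) 2(2,4) V' hd img by (intro exI[of _ N] exI[of _ V']) (simp add: NV)
qed

end

section \<open>Local lifts by Taylor polynomials\<close>

context smooth_bundle
begin

lemma continuous_map_prod_subtopology:
  assumes "continuous_map (prod_topology (subtopology TM V) Z) Y \<theta>" "V' \<subseteq> V"
  shows "continuous_map (prod_topology (subtopology TM V') (subtopology Z N)) Y \<theta>"
proof -
  have "V \<inter> V' = V'" using assms(2) by auto
  then have "prod_topology (subtopology TM V') (subtopology Z N) = subtopology (prod_topology (subtopology TM V) Z) (V' \<times> N)"
    by (simp add: subtopology_Times subtopology_subtopology)
  then show ?thesis using assms(1) by (simp add: continuous_map_from_subtopology)
qed

lemma P_quasitopology_subtopology:
  assumes "h \<in> P_quasitopology M E p W Z"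
  shows "h \<in> P_quasitopology M E p W (subtopology Z N)"
proof -
  have "continuous_map (subtopology Z N) Z (\<lambda>z. z)" by (simp add: continuous_map_from_subtopology)
  from P_quasitopology_compose[OF assms this] show ?thesis by (simp add: o_def)
qed

lemma diag_family_subtopology:
  assumes "diag_family M E p U Z f"
  shows "diag_family M E p U (subtopology Z N) f"
proof -
  have "continuous_map (subtopology Z N) Z (\<lambda>z. z)" by (simp add: continuous_map_from_subtopology)
  from diag_family_compose[OF assms this] show ?thesis by (simp add: o_def)
qed

text \<open>The topology of the jet space provides exactly the continuity of the derivatives up to
  order \<open>r\<close> at the base point. These are the coefficients of a Taylor polynomial, whose
  derivatives of all orders are then continuous in base point and parameter.\<close>

lemma local_lift:
  assumes U: "openin TM U" and \<sigma>: "continuous_map (prod_topology (subtopology TM U) Z) (JS r) \<sigma>"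
    and src: "\<And>a z. a \<in> U \<Longrightarrow> z \<in> topspace Z \<Longrightarrow> fst (\<sigma> (a, z)) = a"
    and z0: "z0 \<in> topspace Z" and a0: "a0 \<in> U"
  shows "\<exists>c d N V l. (c, d) \<in> adapted_charts M E p \<and> openin Z N \<and> z0 \<in> N \<and> openin TM V \<and> a0 \<in> V \<and> V \<subseteq> U \<and> V \<subseteq> fst c \<and>
    l \<in> P_quasitopology M E p (V \<times> V) (subtopology Z N) \<and>
    (\<forall>z\<in>N. \<forall>a\<in>V. l z (a, a) \<in> fst d \<and> jet M E p r a (\<lambda>q. l z (a, q)) = \<sigma> (a, z))"
proof -
  let ?Y = "prod_topology (subtopology TM U) Z"
  have tY: "topspace ?Y = U \<times> topspace Z" using topspace_sub[OF U] by simp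
  \<comment> \<open>Representing sections are chosen separately for each \<open>y\<close>, without
    any continuity; only their derivatives at the base point enter the lift.\<close>
  have "\<exists>s. \<sigma> y = jet M E p r (fst y) s \<and> s \<in> local_sections_at M E p (fst y)" if "y \<in> topspace ?Y" for y
  proof -
    have "\<sigma> y \<in> topspace (JS r)" using continuous_map_image_subset_topspace[OF \<sigma>] that by blast
    then obtain q s where *: "\<sigma> y = jet M E p r q s" "s \<in> local_sections_at M E p q" using topspace_jet_space by blast
    have "q = fst y" using src[of "fst y" "snd y"] that *(1) unfolding tY by auto
    then show ?thesis using * by blast
  qed
  then obtain s where s: "\<And>y. y \<in> topspace ?Y \<Longrightarrow> \<sigma> y = jet M E p r (fst y) (s y)"
    "\<And>y. y \<in> topspace ?Y \<Longrightarrow> s y \<in> local_sections_at M E p (fst y)"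
    using bchoice[of "topspace ?Y" "\<lambda>y s. \<sigma> y = jet M E p r (fst y) s \<and> s \<in> local_sections_at M E p (fst y)"] by blast
  note D = jet_space_continuousD[where q=fst and s=s, OF \<sigma> s]
  have y0: "(a0, z0) \<in> topspace ?Y" using z0 a0 tY by simp
  have "continuous_map ?Y TE (\<lambda>y. s y (fst y))" by (rule D(4))
  then have "s (a0, z0) (fst (a0, z0)) \<in> topspace TE"
    using continuous_map_image_subset_topspace y0 by blast
  then have "s (a0, z0) a0 \<in> topspace TE" by simp
  then obtain c d where cd: "(c, d) \<in> adapted_charts M E p" "s (a0, z0) a0 \<in> fst d"
    using adapted_chart_exists[OF fiber_bundle] by blast
  note ch = adapted_chartD[OF cd(1)]
  let ?Dom = "{y \<in> topspace ?Y. s y (fst y) \<in> fst d}"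
  have oY0: "openin ?Y ?Dom" by (rule D(2)[OF _ _ cd(1)])
  have "(a0, z0) \<in> ?Dom" using y0 cd(2) by simp
  from openin_prod_topology_alt[THEN iffD1, OF oY0, THEN spec, THEN spec, THEN mp, OF this]
  obtain V1 N1 where "openin (subtopology TM U) V1" "openin Z N1" "a0 \<in> V1" "z0 \<in> N1" "V1 \<times> N1 \<subseteq> ?Dom"
    by (elim exE conjE)
  then have V1: "openin TM V1" "V1 \<subseteq> U" "a0 \<in> V1" and N1: "openin Z N1" "z0 \<in> N1" and VN: "V1 \<times> N1 \<subseteq> ?Dom"
    using openin_open_subtopology[OF U] by auto
  have sd: "s (a, z) a \<in> fst d" "s (a, z) \<in> local_sections_at M E p a" "\<sigma> (a, z) = jet M E p r a (s (a, z))" "(a, z) \<in> topspace ?Y"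
    if "a \<in> V1" "z \<in> N1" for a z
  proof -
    have "(a, z) \<in> ?Dom" using VN that by blast
    then show "s (a, z) a \<in> fst d" "s (a, z) \<in> local_sections_at M E p a" "\<sigma> (a, z) = jet M E p r a (s (a, z))" "(a, z) \<in> topspace ?Y"
      using s[of "(a, z)"] by auto
  qed
  have V1c: "V1 \<subseteq> fst c"
    using ch(5) sd(1)[OF _ N1(2)] local_sections_atD(2)[OF sd(2)[OF _ N1(2)]] by force
  let ?ZN = "subtopology Z N1"
  have tZ1: "topspace ?ZN = N1" using openin_subset[OF N1(1)] by auto
  note tV1 = topspace_sub[OF V1(1)]
  obtain C D' and cc :: "'b \<Rightarrow> 'b \<Rightarrow> real" and dd :: "'c \<Rightarrow> 'c \<Rightarrow> real"
    where C: "linear_coordinates C cc" and D': "linear_coordinates D' dd"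
    using coordinates by blast
  define A where "A z a vs = iter_deriv vs (local_rep c d (s (a, z))) (snd c a)" for z a vs
  \<comment> \<open>The polynomial is centred at the coordinate of the base point \<open>a\<close>,
    so that its derivatives there up to order \<open>r\<close> are the entries of
    \<open>A z a\<close>.\<close>
  define w where "w z a x = taylor_poly C cc r (A z a) (x - snd c a)" for z a x
  have jd: "jet_data C cc (A z a)" if az: "a \<in> V1" "z \<in> N1" for z a
  proof -
    obtain V where V: "openin TM V" "a \<in> V" "s (a, z) ` V \<subseteq> fst d" "\<forall>x\<in>V. p (s (a, z) x) = x"
      "smooth_on (snd c ` V) (local_rep c d (s (a, z)))"
      using section_chart_nbhd[OF sd(2)[OF az] cd(1) sd(1)[OF az]] by blast
    have "V \<subseteq> fst c" using ch(5) V(3,4) by force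
    then have "open (snd c ` V)" by (rule chartD(7)[OF ch(1) V(1)])
    from jet_data_iter_deriv[OF C D' this V(5)] V(2) show ?thesis unfolding A_def by blast
  qed
  let ?B = "box V1 V1 ?ZN"
  have cA: "continuous_map ?B euclidean (\<lambda>y. A (snd (snd y)) (fst (snd y)) vs)" if "length vs \<le> r" for vs
  proof -
    have "continuous_map (subtopology ?Y ?Dom) euclidean (\<lambda>y. iter_deriv vs (local_rep c d (s y)) (snd c (fst y)))"
      by (rule D(3)[OF _ _ cd(1) that])
    then have "continuous_map (subtopology ?Y (V1 \<times> N1)) euclidean (\<lambda>y. iter_deriv vs (local_rep c d (s y)) (snd c (fst y)))"
      by (rule continuous_map_from_subtopology_mono[OF _ VN])
    moreover have "subtopology ?Y (V1 \<times> N1) = prod_topology (subtopology TM V1) ?ZN"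
      using V1(2) by (simp add: subtopology_Times subtopology_subtopology Int_absorb1)
    ultimately have "continuous_map (prod_topology (subtopology TM V1) ?ZN) euclidean (\<lambda>y. A (snd y) (fst y) vs)"
      by (simp add: A_def)
    from continuous_map_compose[OF continuous_map_snd this] show ?thesis by (simp add: o_def)
  qed
  have pr1: "continuous_map ?B TM fst" by (rule continuous_map_into_fulltopology[OF continuous_map_fst])
  have pr2: "continuous_map ?B TM (\<lambda>y. fst (snd y))"
    by (rule continuous_map_into_fulltopology)
      (rule continuous_map_compose[OF continuous_map_snd continuous_map_fst, unfolded o_def])
  have c1: "continuous_map ?B euclidean (\<lambda>y. snd c (fst y))"
    by (rule chart_continuous_on[OF ch(1) pr1]) (use tV1 V1c in auto)
  have c2: "continuous_map ?B euclidean (\<lambda>y. snd c (fst (snd y)))"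
    by (rule chart_continuous_on[OF ch(1) pr2]) (use tV1 V1c in auto)
  have o1: "open (snd c ` V1)" by (rule chartD(7)[OF ch(1) V1(1) V1c])
  have fam: "smooth_family n ?B (\<lambda>_. snd c ` V1) (\<lambda>y. w (snd (snd y)) (fst (snd y))) (\<lambda>y. snd c (fst y))" for n
    unfolding w_def
    by (rule smooth_family_taylor_poly[OF C _ c1 c2 cA]) (use o1 tV1 in auto)
  have cw: "continuous_map ?B euclidean (\<lambda>y. iter_deriv vs (w (snd (snd y)) (fst (snd y))) (snd c (fst y)))" for vs
    using fam[of "length vs"] unfolding smooth_family_def by blast
  have sw: "smooth_on (snd c ` V1) (w z a)" if "a \<in> V1" "z \<in> N1" for z a
    unfolding smooth_on_def
  proof (intro allI ballI)
    fix vs x assume "x \<in> snd c ` V1"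
    moreover have "(a, a, z) \<in> topspace ?B" using that tV1 tZ1 by simp
    ultimately show "iter_deriv vs (w z a) differentiable at x"
      using fam[of "length vs"] unfolding smooth_family_def by fastforce
  qed
  \<comment> \<open>Away from its centre the polynomial may leave the chart of \<open>E\<close>. The
    set \<open>S\<close> where it does not is open, and it contains the diagonal point because the
    value at the centre is that of the chosen section.\<close>
  define S where "S = {y \<in> topspace ?B. (snd c (fst y), w (snd (snd y)) (fst (snd y)) (snd c (fst y))) \<in> snd d ` fst d}"
  have "openin ?B S"
    unfolding S_def
  proof (rule openin_continuous_map_preimage)
    show "continuous_map ?B euclidean (\<lambda>y. (snd c (fst y), w (snd (snd y)) (fst (snd y)) (snd c (fst y))))"
      using continuous_map_pairedI[OF c1 cw[of "[]"]] by simp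
    show "openin euclidean (snd d ` fst d)" using chartD(2)[OF ch(2)] by simp
  qed
  moreover have wa: "w z a (snd c a) = local_rep c d (s (a, z)) (snd c a)" for z a
    by (simp add: w_def A_def taylor_poly_0[OF C])
  have "(a0, a0, z0) \<in> S"
  proof -
    have "snd d (s (a0, z0) a0) = (snd c a0, w z0 a0 (snd c a0))"
      unfolding wa using V1(3) N1(2) sd local_sections_atD(2)[OF sd(2)] by (intro local_rep_graph(2)[OF cd(1)]) auto
    then have "(snd c a0, w z0 a0 (snd c a0)) \<in> snd d ` fst d" using cd(2) by (metis image_eqI)
    then show ?thesis using V1(3) N1(2) tV1 tZ1 by (simp add: S_def)
  qed
  ultimately obtain N V where NV: "openin ?ZN N" "z0 \<in> N" "openin TM V" "a0 \<in> V" "V \<subseteq> V1" "\<forall>z\<in>N. \<forall>a\<in>V. \<forall>q\<in>V. (q, a, z) \<in> S"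
    using openin_box_nbhd[OF _ V1(1)] by meson
  have N: "openin Z N" "N \<subseteq> N1" using NV(1) openin_open_subtopology[OF N1(1)] by auto
  have Vc: "V \<subseteq> fst c" using NV(5) V1c by auto
  have tN: "topspace (subtopology Z N) = N" using openin_subset[OF N(1)] by auto
  have im: "(snd c q, w z a (snd c q)) \<in> snd d ` fst d" if "z \<in> N" "a \<in> V" "q \<in> V" for z a q
    using NV(6) that by (auto simp: S_def)
  have cf: "chart_family c d V (subtopology Z N) w"
    unfolding chart_family_def
  proof (intro conjI ballI allI)
    fix z a assume za: "z \<in> topspace (subtopology Z N)" "a \<in> V"
    then show "smooth_on (snd c ` V) (w z a)"
      using N(2) NV(5) tN by (intro smooth_on_subset[OF sw]) auto
    show "(snd c q, w z a (snd c q)) \<in> snd d ` fst d" if "q \<in> V" for q using im za that tN by auto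
  next
    fix vs :: "'b list"
    have "continuous_map (subtopology ?B (V \<times> V \<times> N)) euclidean (\<lambda>y. iter_deriv vs (w (snd (snd y)) (fst (snd y))) (snd c (fst y)))"
      by (rule continuous_map_from_subtopology[OF cw])
    moreover have "subtopology ?B (V \<times> V \<times> N) = box V V (subtopology Z N)"
      using NV(5) N(2) by (simp add: subtopology_Times subtopology_subtopology Int_absorb1)
    ultimately show "continuous_map (box V V (subtopology Z N)) euclidean (\<lambda>(q, a, z). iter_deriv vs (w z a) (snd c q))"
      by (simp add: case_prod_unfold)
  qed
  define l where "l z = restrict (chart_section c d (w z)) (V \<times> V)" for z
  have l: "l \<in> P_quasitopology M E p (V \<times> V) (subtopology Z N)"
    unfolding l_def by (rule P_chartI[OF cd(1) NV(3) Vc cf])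
  have "l z (a, a) \<in> fst d \<and> jet M E p r a (\<lambda>q. l z (a, q)) = \<sigma> (a, z)" if za: "z \<in> N" "a \<in> V" for z a
  proof (rule conjI)
    show ld: "l z (a, a) \<in> fst d"
      using chart_section_props(1)[OF cd(1) Vc za(2), of "w z" a] im[OF za za(2)] za by (simp add: l_def)
    let ?t = "\<lambda>q\<in>V. l z (a, q)"
    have za1: "a \<in> V1" "z \<in> N1" using za NV(5) N(2) by auto
    have "?t \<in> smooth_sections M E p V"
      by (rule P_quasitopologyD(1)[OF l NV(3) NV(3) order_refl]) (use za tN in auto)
    then have t: "?t \<in> local_sections_at M E p a" using NV(3) za by (auto simp: local_sections_at_def)
    have rep: "local_rep c d ?t x = w z a x" if "x \<in> snd c ` V" for x
      by (rule local_rep_chart_section[OF cd(1) Vc _ _ that]) (use im za in \<open>auto simp: l_def\<close>)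
    have oV: "open (snd c ` V)" by (rule chartD(7)[OF ch(1) NV(3) Vc])
    have sv: "s (a, z) a = ?t a"
      using local_rep_graph(3)[OF cd(1), of "s (a, z)" a] sd(1)[OF za1] local_sections_atD(2)[OF sd(2)[OF za1]] wa[of z a] za
      by (simp add: l_def chart_section_def)
    have "same_jet M E p r a (s (a, z)) ?t"
    proof (rule same_jetI_chart[OF cd(1) sd(2)[OF za1] t sv sd(1)[OF za1]])
      fix vs :: "'b list" assume len: "length vs \<le> r"
      have "iter_deriv vs (local_rep c d ?t) (snd c a) = iter_deriv vs (w z a) (snd c a)"
        by (rule iter_deriv_cong[OF oV rep]) (use za in auto)
      also have "\<dots> = A z a vs"
        unfolding w_def by (rule iter_deriv_taylor_poly[OF C jd[OF za1] len])
      finally show "iter_deriv vs (local_rep c d (s (a, z))) (snd c a) = iter_deriv vs (local_rep c d ?t) (snd c a)"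
        by (simp add: A_def)
    qed
    then have "\<sigma> (a, z) = jet M E p r a ?t" using same_jet_imp_jet_eq sd(3)[OF za1] by simp
    also have "\<dots> = jet M E p r a (\<lambda>q. l z (a, q))"
      by (rule jet_cong[OF NV(3) za(2)]) (use local_sections_atD(2)[OF t] in auto)
    finally show "jet M E p r a (\<lambda>q. l z (a, q)) = \<sigma> (a, z)" by simp
  qed
  moreover have "V \<subseteq> U" using NV(5) V1(2) by auto
  ultimately show ?thesis using cd(1) N(1) NV Vc l by blast
qed

end

section \<open>Families of germs along the diagonal\<close>


lemma germ_at_cong:
  assumes "openin T W" "x \<in> W" "\<And>y. y \<in> W \<Longrightarrow> h y = h' y"
  shows "germ_at T x h = germ_at T x h'"
proof -
  have "germ_at T x h \<subseteq> germ_at T x h'" if eq: "\<And>y. y \<in> W \<Longrightarrow> h y = h' y" for h h'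
  proof
    fix k assume "k \<in> germ_at T x h"
    then obtain W' where "openin T W'" "x \<in> W'" "\<forall>y\<in>W'. k y = h y" by (auto simp: germ_at_def)
    then show "k \<in> germ_at T x h'"
      using assms(1,2) eq unfolding germ_at_def by (intro CollectI exI[of _ "W \<inter> W'"]) auto
  qed
  then show ?thesis using assms(3) by (metis subset_antisym)
qed

lemma germ_at_self: "x \<in> topspace T \<Longrightarrow> h \<in> germ_at T x h"
  unfolding germ_at_def by (intro CollectI exI[of _ "topspace T"]) auto

text \<open>\<open>Psi\<close> evaluates a chosen representative of a germ. Such a representative
  agrees with a given one just on some neighbourhood of the point, which is enough for jets by
  \<open>jet_cong\<close>.\<close>

lemma germ_at_some:
  assumes "x \<in> topspace T"
  shows "\<exists>W. openin T W \<and> x \<in> W \<and> (\<forall>y\<in>W. (SOME k. k \<in> germ_at T x h) y = h y)"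
proof -
  have "(SOME k. k \<in> germ_at T x h) \<in> germ_at T x h" using someI[of "\<lambda>k. k \<in> germ_at T x h" h] germ_at_self[OF assms] by blast
  then show ?thesis by (simp add: germ_at_def)
qed

lemma germ_at_eqD:
  assumes "germ_at T x h = germ_at T x h'" "x \<in> topspace T"
  shows "h x = h' x"
proof -
  have "h \<in> germ_at T x h'" using germ_at_self[OF assms(2)] assms(1) by metis
  then show ?thesis by (auto simp: germ_at_def)
qed

context smooth_bundle
begin

abbreviation "TMM \<equiv> prod_topology TM TM"
abbreviation "dgerm a h \<equiv> germ_at TMM (a, a) h"

lemma openin_box: "openin TM V \<Longrightarrow> openin TMM (V \<times> V)"
  by (simp add: openin_prod_Times_iff)

lemma box_nbhd:
  assumes "openin TMM W" "(a, a) \<in> W"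
  shows "\<exists>V. openin TM V \<and> a \<in> V \<and> V \<times> V \<subseteq> W"
proof -
  obtain A B where "openin TM A" "openin TM B" "a \<in> A" "a \<in> B" "A \<times> B \<subseteq> W"
    using openin_prod_topology_alt[THEN iffD1, OF assms(1), THEN spec, THEN spec, THEN mp, OF assms(2)]
    by (elim exE conjE)
  then show ?thesis by (intro exI[of _ "A \<inter> B"]) auto
qed

definition "germ_jet r a g = jet M E p r a (\<lambda>q. (SOME h. h \<in> g) (a, q))"

lemma Psi_eq: "Psi M E p r U \<gamma> = (\<lambda>a\<in>U. germ_jet r a (\<gamma> a))"
  by (simp add: Psi_def germ_jet_def)

lemma germ_jet_rep:
  assumes a: "a \<in> topspace TM" and "p (h (a, a)) = a"
  shows "germ_jet r a (dgerm a h) = jet M E p r a (\<lambda>q. h (a, q))"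
proof -
  have "(a, a) \<in> topspace TMM" using a by simp
  from germ_at_some[OF this] obtain W where W: "openin TMM W" "(a, a) \<in> W"
    "\<forall>y\<in>W. (SOME k. k \<in> dgerm a h) y = h y" by blast
  obtain V where V: "openin TM V" "a \<in> V" "V \<times> V \<subseteq> W" using box_nbhd[OF W(1,2)] by blast
  have eq: "(SOME k. k \<in> dgerm a h) (a, q) = h (a, q)" if "q \<in> V" for q
    using W(3) V(2,3) that by blast
  show ?thesis unfolding germ_jet_def
    by (rule jet_cong[OF V(1,2)]) (use eq V(2) assms(2) in simp_all)
qed

lemma P_jet:
  assumes h: "h \<in> P_quasitopology M E p W Z" and V: "openin TM V" "V \<times> V \<subseteq> W" and za: "z \<in> topspace Z" "a \<in> V"
  shows "(\<lambda>q\<in>V. h z (a, q)) \<in> local_sections_at M E p a" "p (h z (a, a)) = a"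
    "jet M E p r a (\<lambda>q. h z (a, q)) = jet M E p r a (\<lambda>q\<in>V. h z (a, q))"
    "germ_jet r a (dgerm a (h z)) = jet M E p r a (\<lambda>q\<in>V. h z (a, q))"
proof -
  show l: "(\<lambda>q\<in>V. h z (a, q)) \<in> local_sections_at M E p a"
    using P_quasitopologyD(1)[OF h V(1) V za] V(1) za(2) by (auto simp: local_sections_at_def)
  show ph: "p (h z (a, a)) = a" by (rule P_value_section[OF h V(1) V za za(2)])
  show j: "jet M E p r a (\<lambda>q. h z (a, q)) = jet M E p r a (\<lambda>q\<in>V. h z (a, q))"
    by (rule jet_cong[OF V(1) za(2)]) (use ph in auto)
  have "a \<in> topspace TM" using V(1) za(2) openin_subset by blast
  from germ_jet_rep[of a "h z", OF this ph] j
  show "germ_jet r a (dgerm a (h z)) = jet M E p r a (\<lambda>q\<in>V. h z (a, q))" by simp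
qed

lemma diag_family_openin: "diag_family M E p U Z f \<Longrightarrow> openin TM U"
  by (induction rule: diag_family.induct) auto

lemma subtopology_box_left:
  assumes "openin TM U" "V \<subseteq> U"
  shows "subtopology (prod_topology (subtopology TM U) Z) (V \<times> topspace Z) = prod_topology (subtopology TM V) Z"
  using assms by (simp add: subtopology_Times subtopology_subtopology Int_absorb1)

lemma subtopology_box_right:
  assumes "openin TM U"
  shows "subtopology (prod_topology (subtopology TM U) Z) (U \<times> C) = prod_topology (subtopology TM U) (subtopology Z C)"
  using assms by (simp add: subtopology_Times subtopology_subtopology)

text \<open>Induction over the generation of the admissible families. A represented family is pulled
  back along \<open>(a, z) \<mapsto> (a, a, z)\<close>, and each of the three covering rules is
  matched by a gluing lemma for continuous maps.\<close>

lemma germ_jet_continuous: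
  assumes "diag_family M E p U Z f"
  shows "continuous_map (prod_topology (subtopology TM U) Z) (JS r) (\<lambda>(a, z). germ_jet r a (f z a))"
  using assms
proof (induction rule: diag_family.induct)
  case (germs U W h Z f)
  note tU = topspace_sub[OF germs.hyps(1)]
  let ?Y = "prod_topology (subtopology TM U) Z"
  show ?case
  proof (rule continuous_map_localI)
    fix y assume "y \<in> topspace ?Y"
    then obtain a z where y: "y = (a, z)" "a \<in> U" "z \<in> topspace Z" using tU by auto
    then have "(a, a) \<in> W" using germs.hyps(3) by blast
    then obtain V0 where "openin TM V0" "a \<in> V0" "V0 \<times> V0 \<subseteq> W" using box_nbhd[OF germs.hyps(2)] by blast
    then obtain V where V: "openin TM V" "a \<in> V" "V \<times> V \<subseteq> W" "V \<subseteq> U"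
      using germs.hyps(1) y(2) by (intro that[of "U \<inter> V0"]) auto
    note tV = topspace_sub[OF V(1)]
    have "continuous_map (prod_topology (subtopology TM V) Z) (box V V Z) (\<lambda>y. (fst y, y))"
      by (intro continuous_map_pairedI continuous_map_fst) simp
    from continuous_map_compose[OF this P_quasitopologyD(3)[OF germs.hyps(4) V(1) V(1) V(3)], of r]
    have "continuous_map (prod_topology (subtopology TM V) Z) (JS r) (\<lambda>(a, z). jet M E p r a (\<lambda>q\<in>V. h z (a, q)))"
      by (simp add: o_def case_prod_unfold)
    then have "continuous_map (prod_topology (subtopology TM V) Z) (JS r) (\<lambda>(a, z). germ_jet r a (f z a))"
    proof (rule continuous_map_eq)
      fix y assume "y \<in> topspace (prod_topology (subtopology TM V) Z)"
      then obtain a z where y: "y = (a, z)" "a \<in> V" "z \<in> topspace Z" using tV by auto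
      then have "f z a = dgerm a (h z)" using germs.hyps(5) V(4) by auto
      then show "(case y of (a, z) \<Rightarrow> jet M E p r a (\<lambda>q\<in>V. h z (a, q))) = (case y of (a, z) \<Rightarrow> germ_jet r a (f z a))"
        using P_jet(4)[OF germs.hyps(4) V(1,3) y(3,2)] y(1) by simp
    qed
    then have "continuous_map (subtopology ?Y (V \<times> topspace Z)) (JS r) (\<lambda>(a, z). germ_jet r a (f z a))"
      unfolding subtopology_box_left[OF germs.hyps(1) V(4)] .
    moreover have "openin ?Y (V \<times> topspace Z)"
      using V(1,4) germs.hyps(1) by (auto simp: openin_prod_Times_iff openin_open_subtopology)
    ultimately show "\<exists>W. openin ?Y W \<and> y \<in> W \<and> continuous_map (subtopology ?Y W) (JS r) (\<lambda>(a, z). germ_jet r a (f z a))"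
      using y V(2) by blast
  qed
next
  case (open_cover U \<C> Z f)
  note tU = topspace_sub[OF open_cover.hyps(1)]
  let ?Y = "prod_topology (subtopology TM U) Z"
  show ?case
  proof (rule continuous_map_localI)
    fix y assume "y \<in> topspace ?Y"
    then obtain a z where y: "y = (a, z)" "a \<in> U" "z \<in> topspace Z" using tU by auto
    then obtain C where C: "C \<in> \<C>" "z \<in> C" using open_cover.hyps(2) by blast
    have "openin ?Y (U \<times> C)"
      using C open_cover.IH open_cover.hyps(1) by (auto simp: openin_prod_Times_iff openin_open_subtopology)
    moreover have "continuous_map (subtopology ?Y (U \<times> C)) (JS r) (\<lambda>(a, z). germ_jet r a (f z a))"
      unfolding subtopology_box_right[OF open_cover.hyps(1)] using C open_cover.IH by blast
    ultimately show "\<exists>W. openin ?Y W \<and> y \<in> W \<and> continuous_map (subtopology ?Y W) (JS r) (\<lambda>(a, z). germ_jet r a (f z a))"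
      using y C by blast
  qed
next
  case (closed_cover Z C D U f)
  have U: "openin TM U" using diag_family_openin closed_cover.hyps by blast
  note tU = topspace_sub[OF U]
  let ?Y = "prod_topology (subtopology TM U) Z"
  show ?case
  proof (rule pasting_lemma_closed[where I="{C, D}" and T="\<lambda>X. U \<times> X" and f="\<lambda>_ (a, z). germ_jet r a (f z a)"])
    have "closedin (subtopology TM U) U" using tU closedin_topspace[of "subtopology TM U"] by simp
    then show "closedin ?Y (U \<times> X)" if "X \<in> {C, D}" for X
      using that closed_cover.hyps by (auto simp: closedin_prod_Times_iff)
    show "continuous_map (subtopology ?Y (U \<times> X)) (JS r) (\<lambda>(a, z). germ_jet r a (f z a))" if "X \<in> {C, D}" for X
      unfolding subtopology_box_right[OF U] using that closed_cover.IH by blast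
    show "\<exists>j. j \<in> {C, D} \<and> x \<in> U \<times> j \<and> (case x of (a, z) \<Rightarrow> germ_jet r a (f z a)) = (case x of (a, z) \<Rightarrow> germ_jet r a (f z a))"
      if "x \<in> topspace ?Y" for x
      using that closed_cover.hyps(3) tU by auto
  qed auto
next
  case (base_cover U \<U> Z f)
  note tU = topspace_sub[OF base_cover.hyps(1)]
  let ?Y = "prod_topology (subtopology TM U) Z"
  show ?case
  proof (rule continuous_map_localI)
    fix y assume "y \<in> topspace ?Y"
    then obtain a z where y: "y = (a, z)" "a \<in> U" "z \<in> topspace Z" using tU by auto
    then obtain V where V: "V \<in> \<U>" "a \<in> V" using base_cover.hyps(2) by blast
    have VU: "V \<subseteq> U" using V(1) base_cover.hyps(2) by blast
    have oV: "openin TM V" using V(1) base_cover.IH by blast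
    have "openin ?Y (V \<times> topspace Z)"
      using oV VU base_cover.hyps(1) by (auto simp: openin_prod_Times_iff openin_open_subtopology)
    moreover have "continuous_map (prod_topology (subtopology TM V) Z) (JS r) (\<lambda>(a, z). germ_jet r a (restrict (f z) V a))"
      using V base_cover.IH by blast
    then have "continuous_map (prod_topology (subtopology TM V) Z) (JS r) (\<lambda>(a, z). germ_jet r a (f z a))"
      by (rule continuous_map_eq) (use topspace_sub[OF oV] in auto)
    then have "continuous_map (subtopology ?Y (V \<times> topspace Z)) (JS r) (\<lambda>(a, z). germ_jet r a (f z a))"
      unfolding subtopology_box_left[OF base_cover.hyps(1) VU] .
    ultimately show "\<exists>W. openin ?Y W \<and> y \<in> W \<and> continuous_map (subtopology ?Y W) (JS r) (\<lambda>(a, z). germ_jet r a (f z a))"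
      using y V by blast
  qed
qed

lemma fst_germ_jet [simp]: "fst (germ_jet r a g) = a"
  by (simp add: germ_jet_def)

lemma jet_quasitopologyI:
  assumes U: "openin TM U"
    and f: "continuous_map (prod_topology (subtopology TM U) Z) (JS r) (\<lambda>(a, z). f z a)"
    and src: "\<And>a z. a \<in> U \<Longrightarrow> z \<in> topspace Z \<Longrightarrow> fst (f z a) = a"
    and ext: "\<And>z. z \<in> topspace Z \<Longrightarrow> f z \<in> extensional U"
  shows "f \<in> jet_quasitopology M E p r U Z"
proof -
  note tU = topspace_sub[OF U]
  have "f z \<in> jet_sections M E p r U" if z: "z \<in> topspace Z" for z
  proof -
    have "continuous_map (subtopology TM U) (prod_topology (subtopology TM U) Z) (\<lambda>a. (a, z))"
      using z by (simp add: continuous_map_pairedI)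
    from continuous_map_compose[OF this f] have "continuous_map (subtopology TM U) (JS r) (f z)" by (simp add: o_def)
    then show ?thesis using src z ext by (simp add: jet_sections_def)
  qed
  then show ?thesis using f ext tU by (simp add: jet_quasitopology_def Maps_def top_quasitopology_def)
qed

lemma jet_quasitopologyD:
  assumes f: "f \<in> jet_quasitopology M E p r U Z"
  shows "continuous_map (prod_topology (subtopology TM U) Z) (JS r) (\<lambda>(a, z). f z a)"
    "\<And>z. z \<in> topspace Z \<Longrightarrow> f z \<in> jet_sections M E p r U"
    "\<And>z. z \<in> topspace Z \<Longrightarrow> f z \<in> extensional U"
    "\<And>a z. a \<in> U \<Longrightarrow> z \<in> topspace Z \<Longrightarrow> fst (f z a) = a"
proof -
  show "continuous_map (prod_topology (subtopology TM U) Z) (JS r) (\<lambda>(a, z). f z a)"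
    using f by (simp add: jet_quasitopology_def Maps_def top_quasitopology_def)
  show *: "f z \<in> jet_sections M E p r U" if "z \<in> topspace Z" for z
    using f that by (simp add: jet_quasitopology_def)
  show "f z \<in> extensional U" if "z \<in> topspace Z" for z using *[OF that] by (simp add: jet_sections_def)
  show "fst (f z a) = a" if "a \<in> U" "z \<in> topspace Z" for a z
    using *[OF that(2)] that(1) by (simp add: jet_sections_def)
qed

lemma Psi_family:
  assumes "diag_family M E p U Z f"
  shows "Psi M E p r U \<circ> f \<in> jet_quasitopology M E p r U Z"
proof (rule jet_quasitopologyI)
  show U: "openin TM U" by (rule diag_family_openin[OF assms])
  show "continuous_map (prod_topology (subtopology TM U) Z) (JS r) (\<lambda>(a, z). (Psi M E p r U \<circ> f) z a)"
    by (rule continuous_map_eq[OF germ_jet_continuous[OF assms, of r]]) (use topspace_sub[OF U] in \<open>auto simp: Psi_eq\<close>)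
qed (simp_all add: Psi_eq)

lemma P_sections_const:
  assumes "h \<in> P_sections M E p W"
  shows "(\<lambda>_. h) \<in> P_quasitopology M E p W Z"
  unfolding P_quasitopology_def
proof (rule CollectI, intro conjI ballI allI impI; (elim conjE)?)
  show "h \<in> extensional W" using assms by (simp add: P_sections_def)
  fix U V assume UV: "openin TM U" "openin TM V" "U \<times> V \<subseteq> W"
  let ?Z = "prod_topology (subtopology TM U) Z"
  have "(\<lambda>a. \<lambda>q\<in>V. h (a, q)) \<in> section_quasitopology M E p V (subtopology TM U)"
    using assms UV by (simp add: P_sections_def)
  from section_quasitopology_compose[OF this continuous_map_fst, of Z]
  have "(\<lambda>az. \<lambda>q\<in>V. h (fst az, q)) \<in> section_quasitopology M E p V ?Z" by (simp add: o_def)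
  then have "(\<lambda>(a, z). (\<lambda>a\<in>U. \<lambda>q\<in>V. h (a, q)) a) \<in> section_quasitopology M E p V ?Z"
    by (rule section_quasitopology_cong) (use topspace_sub[OF UV(1)] in auto)
  then show "(\<lambda>z. \<lambda>a\<in>U. \<lambda>q\<in>V. h (a, q)) \<in> Maps (subtopology TM U) (section_quasitopology M E p V) Z"
    using topspace_sub[OF UV(1)] by (simp add: Maps_def)
qed

lemma dgerm_restrict: "openin TM V \<Longrightarrow> b \<in> V \<Longrightarrow> dgerm b (restrict h (V \<times> V)) = dgerm b h"
  by (rule germ_at_cong[OF openin_box]) auto

lemma diag_sections_rep:
  assumes \<gamma>: "\<gamma> \<in> diag_sections M E p U" and a: "a \<in> U"
  shows "\<exists>V h. openin TM V \<and> a \<in> V \<and> V \<subseteq> U \<and> (\<forall>b\<in>V. \<gamma> b = dgerm b h) \<and>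
    h \<in> P_sections M E p (V \<times> V)"
proof -
  obtain V0 W h where *: "h \<in> P_sections M E p W" "openin TM V0" "a \<in> V0" "V0 \<subseteq> U" "openin TMM W"
    "\<forall>b\<in>V0. (b, b) \<in> W" "\<forall>b\<in>V0. \<gamma> b = dgerm b h"
    using \<gamma> a unfolding diag_sections_def by blast
  obtain V1 where V1: "openin TM V1" "a \<in> V1" "V1 \<times> V1 \<subseteq> W" using box_nbhd[OF *(5)] *(3,6) by blast
  define V where "V = V0 \<inter> V1"
  have V: "openin TM V" "a \<in> V" "V \<subseteq> U" "V \<times> V \<subseteq> W" "V \<subseteq> V0" using * V1 by (auto simp: V_def)
  \<comment> \<open>Over a one-point parameter space the restriction lemma for families applies to a
    single section.\<close>
  let ?Z = "discrete_topology {()}"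
  have "(\<lambda>_. restrict h (V \<times> V)) \<in> P_quasitopology M E p (V \<times> V) ?Z"
    by (rule P_quasitopology_restrict[OF P_sections_const[OF *(1)] V(4)])
  from P_quasitopology_point[OF this, of "()"]
  have "restrict h (V \<times> V) \<in> P_sections M E p (V \<times> V)" by simp
  moreover have "\<gamma> b = dgerm b (restrict h (V \<times> V))" if "b \<in> V" for b
    using *(7) V(5) that by (simp add: dgerm_restrict[OF V(1) that] subset_iff)
  ultimately show ?thesis using V by blast
qed

text \<open>A section of the pullback is represented by sections of the sheaf on the product only
  locally on the base, hence the rule \<open>base_cover\<close>.\<close>

lemma diag_family_const:
  assumes U: "openin TM U" and \<gamma>: "\<gamma> \<in> diag_sections M E p U"
  shows "diag_family M E p U Z (\<lambda>_. \<gamma>)"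
proof (rule diag_family.base_cover[OF U])
  let ?\<U> = "{V. openin TM V \<and> V \<subseteq> U \<and> diag_family M E p V Z (\<lambda>_. restrict \<gamma> V)}"
  have "\<exists>V\<in>?\<U>. a \<in> V" if aU: "a \<in> U" for a
  proof -
    obtain V h where V: "openin TM V" "a \<in> V" "V \<subseteq> U" "\<forall>b\<in>V. \<gamma> b = dgerm b h" "h \<in> P_sections M E p (V \<times> V)"
      using diag_sections_rep[OF \<gamma> aU] by blast
    have "diag_family M E p V Z (\<lambda>_. restrict \<gamma> V)"
      by (rule diag_family.germs[OF V(1) openin_box[OF V(1)] _ P_sections_const[OF V(5)]])
        (use V(4) in \<open>auto intro!: restrict_ext\<close>)
    then show ?thesis using V by blast
  qed
  then show "\<Union>?\<U> = U" by blast
  show "\<forall>z\<in>topspace Z. \<gamma> \<in> extensional U" using \<gamma> by (simp add: diag_sections_def)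
  show "\<forall>V\<in>?\<U>. openin TM V \<and> diag_family M E p V Z (\<lambda>z. restrict \<gamma> V)" by blast
qed

lemma diag_family_restrict:
  assumes "diag_family M E p U Z f" "openin TM V" "V \<subseteq> U"
  shows "diag_family M E p V Z (\<lambda>z. restrict (f z) V)"
  using assms
proof (induction arbitrary: V rule: diag_family.induct)
  case (germs U W h Z f)
  have "restrict (f z) V = (\<lambda>a\<in>V. dgerm a (h z))" if "z \<in> topspace Z" for z
    using germs.hyps(5) that germs.prems(2) by (intro restrict_ext) auto
  then show ?case
    using germs.hyps(3) germs.prems(2)
    by (intro diag_family.germs[OF germs.prems(1) germs.hyps(2) _ germs.hyps(4)]) auto
next
  case (open_cover U \<C> Z f)
  show ?case
    by (rule diag_family.open_cover[OF open_cover.prems(1) open_cover.hyps(2)]) (use open_cover in blast)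
next
  case (closed_cover Z C D U f)
  show ?case
    by (rule diag_family.closed_cover[OF closed_cover.hyps(1-3)]) (use closed_cover in blast)+
next
  case (base_cover U \<U> Z f)
  show ?case
  proof (rule diag_family.base_cover[OF base_cover.prems(1)])
    show "\<Union>((\<lambda>U'. U' \<inter> V) ` \<U>) = V" using base_cover.hyps(2) base_cover.prems(2) by blast
    show "\<forall>z\<in>topspace Z. restrict (f z) V \<in> extensional V" by simp
    show "\<forall>V'\<in>(\<lambda>U'. U' \<inter> V) ` \<U>. openin TM V' \<and> diag_family M E p V' Z (\<lambda>z. restrict (restrict (f z) V) V')"
    proof
      fix V' assume "V' \<in> (\<lambda>U'. U' \<inter> V) ` \<U>"
      then obtain U' where U': "U' \<in> \<U>" "V' = U' \<inter> V" by blast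
      then have o: "openin TM V'" using base_cover.IH base_cover.prems(1) by auto
      have "diag_family M E p V' Z (\<lambda>z. restrict (restrict (f z) U') V')"
        using base_cover.IH U' o by blast
      moreover have "restrict (restrict (f z) U') V' = restrict (restrict (f z) V) V'" for z
        using U'(2) by (auto simp: restrict_def fun_eq_iff)
      ultimately show "openin TM V' \<and> diag_family M E p V' Z (\<lambda>z. restrict (restrict (f z) V) V')"
        using o by simp
    qed
  qed
qed

end

section \<open>Interpolation of germs along the diagonal\<close>

context smooth_bundle
begin

text \<open>The weight is a function and not a number, because a germ at \<open>(a, a)\<close> also
  involves nearby base points \<open>b\<close>. The chosen representative of \<open>g\<close> does
  not affect the result when \<open>g\<close> is a germ at \<open>(a, a)\<close>, by
  \<open>mix_germ_rep\<close>.\<close>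

definition mix_germ :: "('e, 'b \<times> 'c) chart \<Rightarrow> 'm \<Rightarrow> ('m \<Rightarrow> real) \<Rightarrow> ('m \<times> 'm \<Rightarrow> 'e) set \<Rightarrow> ('m \<times> 'm \<Rightarrow> 'e) \<Rightarrow> ('m \<times> 'm \<Rightarrow> 'e) set" where
  "mix_germ d a t g l = dgerm a (\<lambda>(b, q). chart_mix d (t b) ((SOME h. h \<in> g) (b, q)) (l (b, q)))"

lemma mix_germ_rep:
  assumes "a \<in> topspace TM"
  shows "mix_germ d a t (dgerm a h) l = dgerm a (\<lambda>(b, q). chart_mix d (t b) (h (b, q)) (l (b, q)))"
proof -
  have "(a, a) \<in> topspace TMM" using assms by simp
  from germ_at_some[OF this, of h] obtain W where W: "openin TMM W" "(a, a) \<in> W"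
    "\<forall>y\<in>W. (SOME k. k \<in> dgerm a h) y = h y" by (elim exE conjE)
  show ?thesis unfolding mix_germ_def
  proof (rule germ_at_cong[OF W(1,2)])
    fix y assume "y \<in> W"
    then show "(case y of (b, q) \<Rightarrow> chart_mix d (t b) ((SOME k. k \<in> dgerm a h) (b, q)) (l (b, q))) =
      (case y of (b, q) \<Rightarrow> chart_mix d (t b) (h (b, q)) (l (b, q)))"
      using W(3) by (cases y) simp
  qed
qed

text \<open>The order-0 part of a jet is the value of the section, so this holds already for
  \<open>r = 0\<close>. It covers every representative \<open>h\<close> of the germ, since
  interpolation starts from an arbitrary one.\<close>

lemma jets_imp_value:
  assumes \<gamma>: "\<gamma> \<in> diag_sections M E p U" "a \<in> U"
    and l: "l \<in> P_quasitopology M E p W Z" and V: "openin TM V" "V \<times> V \<subseteq> W" and za: "z \<in> topspace Z" "a \<in> V"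
    and jets: "germ_jet r a (\<gamma> a) = jet M E p r a (\<lambda>q. l z (a, q))"
    and h: "\<gamma> a = dgerm a h"
  shows "h (a, a) = l z (a, a)"
proof -
  obtain V1 h1 where V1: "openin TM V1" "a \<in> V1" "V1 \<subseteq> U" "\<forall>b\<in>V1. \<gamma> b = dgerm b h1" "h1 \<in> P_sections M E p (V1 \<times> V1)"
    using diag_sections_rep[OF \<gamma>] by blast
  note c = P_sections_const[OF V1(5), of Z]
  note j1 = P_jet[OF c V1(1) order_refl za(1) V1(2)] and j2 = P_jet[OF l V za]
  have eq: "jet M E p r a (\<lambda>q\<in>V1. h1 (a, q)) = jet M E p r a (\<lambda>q\<in>V. l z (a, q))"
    using jets j1(4)[of r] j2(3)[of r] V1(2,4) by auto
  have "h1 (a, a) = l z (a, a)" using same_jetD(1)[OF jet_eqD(2)[OF eq j2(1)]] V1(2) za(2) by simp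
  moreover have "a \<in> topspace TM" using openin_subset[OF V(1)] za(2) by blast
  then have "(a, a) \<in> topspace TMM" by simp
  moreover have "dgerm a h = dgerm a h1" using h V1(2,4) by simp
  ultimately have "h (a, a) = h1 (a, a)" by (intro germ_at_eqD[of TMM "(a, a)" h h1])
  then show ?thesis using \<open>h1 (a, a) = l z (a, a)\<close> by simp
qed

lemma diag_family_empty:
  assumes "openin TM U" "topspace Z = {}"
  shows "diag_family M E p U Z f"
  by (rule diag_family.open_cover[where \<C>="{}", OF assms(1)]) (use assms(2) in auto)

lemma diag_family_shrink:
  assumes f: "diag_family M E p V (subtopology Z N) (\<lambda>z. \<lambda>a\<in>V. g z a)" and "openin TM V'" "V' \<subseteq> V" "N' \<subseteq> N"
  shows "diag_family M E p V' (subtopology Z N') (\<lambda>z. \<lambda>a\<in>V'. g z a)"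
proof -
  have "diag_family M E p V' (subtopology (subtopology Z N) N') (\<lambda>z. restrict (\<lambda>a\<in>V. g z a) V')"
    by (intro diag_family_restrict[OF _ assms(2,3)] diag_family_subtopology f)
  moreover have "N \<inter> N' = N'" "V \<inter> V' = V'" using assms by auto
  ultimately show ?thesis by (simp add: subtopology_subtopology)
qed

text \<open>Families glued along a cover by two closed sets have representatives that agree only on germs, with
  no neighbourhood of the diagonal common to nearby parameters.  Interpolation is therefore defined
  on germs, and its continuity follows the inductive generation of the admissible families.\<close>

lemma mix_family_local:
  assumes f: "diag_family M E p U Z f"
    and cd: "(c, d) \<in> adapted_charts M E p"
    and l: "l \<in> P_quasitopology M E p W Z"
    and V: "openin TM V" "V \<subseteq> U" "V \<times> V \<subseteq> W" "V \<subseteq> fst c"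
    and \<theta>: "continuous_map (prod_topology (subtopology TM V) Z) euclideanreal \<theta>"
    and \<theta>01: "\<And>y. \<theta> y \<in> {0..1}"
    and za: "z0 \<in> topspace Z" "a0 \<in> V"
    and val: "\<And>z a h. z \<in> topspace Z \<Longrightarrow> a \<in> V \<Longrightarrow> f z a = dgerm a h \<Longrightarrow> h (a, a) = l z (a, a)"
    and lval: "\<And>z a. z \<in> topspace Z \<Longrightarrow> a \<in> V \<Longrightarrow> l z (a, a) \<in> fst d"
  shows "\<exists>N V'. openin Z N \<and> z0 \<in> N \<and> openin TM V' \<and> a0 \<in> V' \<and> V' \<subseteq> V \<and>
    diag_family M E p V' (subtopology Z N) (\<lambda>z. \<lambda>a\<in>V'. mix_germ d a (\<lambda>b. \<theta> (b, z)) (f z a) (l z))"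
  using f l V \<theta> za val lval
proof (induction arbitrary: V rule: diag_family.induct)
  case (germs U W1 h Z f)
  note P = germs.prems
  have "a0 \<in> U" using P by auto
  then have "(a0, a0) \<in> W1" using germs.hyps(3) by blast
  then obtain V0 where V0: "openin TM V0" "a0 \<in> V0" "V0 \<times> V0 \<subseteq> W1" using box_nbhd[OF germs.hyps(2)] by blast
  define V1 where "V1 = V \<inter> V0"
  have V1: "openin TM V1" "a0 \<in> V1" "V1 \<subseteq> V" "V1 \<times> V1 \<subseteq> W1" "V1 \<times> V1 \<subseteq> W" "V1 \<subseteq> fst c"
    using V0 P by (auto simp: V1_def)
  have h1: "(\<lambda>z. restrict (h z) (V1 \<times> V1)) \<in> P_quasitopology M E p (V1 \<times> V1) Z"
    by (rule P_quasitopology_restrict[OF germs.hyps(4) V1(4)])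
  have l1: "(\<lambda>z. restrict (l z) (V1 \<times> V1)) \<in> P_quasitopology M E p (V1 \<times> V1) Z"
    by (rule P_quasitopology_restrict[OF P(1) V1(5)])
  have \<theta>1: "continuous_map (prod_topology (subtopology TM V1) Z) euclideanreal \<theta>"
    using continuous_map_prod_subtopology[OF P(6) V1(3), of "topspace Z"] by simp
  have "f z0 a0 = dgerm a0 (h z0)" using germs.hyps(5) P(7) \<open>a0 \<in> U\<close> by auto
  then have v: "h z0 (a0, a0) = l z0 (a0, a0)" "l z0 (a0, a0) \<in> fst d"
    using P(9)[OF P(7,8)] P(10)[OF P(7,8)] by auto
  obtain N V' where N: "openin Z N" "z0 \<in> N" "openin TM V'" "a0 \<in> V'" "V' \<subseteq> V1"
    and m: "(\<lambda>z. restrict (\<lambda>(a, q). chart_mix d (\<theta> (a, z)) (restrict (h z) (V1 \<times> V1) (a, q)) (restrict (l z) (V1 \<times> V1) (a, q))) (V' \<times> V'))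
      \<in> P_quasitopology M E p (V' \<times> V') (subtopology Z N)"
    using P_mix_local[OF cd h1 l1 V1(1) order_refl V1(6) P(7) V1(2) \<theta>1 \<theta>01] v V1(2) by auto
  have "diag_family M E p V' (subtopology Z N) (\<lambda>z. \<lambda>a\<in>V'. mix_germ d a (\<lambda>b. \<theta> (b, z)) (f z a) (l z))"
  proof (rule diag_family.germs[OF N(3) openin_box[OF N(3)] _ m])
    show "\<forall>z\<in>topspace (subtopology Z N). (\<lambda>a\<in>V'. mix_germ d a (\<lambda>b. \<theta> (b, z)) (f z a) (l z)) =
       (\<lambda>a\<in>V'. dgerm a (restrict (\<lambda>(a, q). chart_mix d (\<theta> (a, z)) (restrict (h z) (V1 \<times> V1) (a, q)) (restrict (l z) (V1 \<times> V1) (a, q))) (V' \<times> V')))"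
    proof (intro ballI restrict_ext)
      fix z a assume z: "z \<in> topspace (subtopology Z N)" and a: "a \<in> V'"
      have "a \<in> U" "a \<in> topspace TM" using a N(5) V1(3) P(3) openin_subset[OF N(3)] by auto
      then have "f z a = dgerm a (h z)" using germs.hyps(5) z by auto
      then have "mix_germ d a (\<lambda>b. \<theta> (b, z)) (f z a) (l z) = dgerm a (\<lambda>(b, q). chart_mix d (\<theta> (b, z)) (h z (b, q)) (l z (b, q)))"
        using mix_germ_rep[OF \<open>a \<in> topspace TM\<close>] by simp
      also have "\<dots> = dgerm a (restrict (\<lambda>(a, q). chart_mix d (\<theta> (a, z)) (restrict (h z) (V1 \<times> V1) (a, q)) (restrict (l z) (V1 \<times> V1) (a, q))) (V' \<times> V'))"
        by (rule germ_at_cong[OF openin_box[OF N(3)]]) (use a N(5) in auto)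
      finally show "mix_germ d a (\<lambda>b. \<theta> (b, z)) (f z a) (l z) =
        dgerm a (restrict (\<lambda>(a, q). chart_mix d (\<theta> (a, z)) (restrict (h z) (V1 \<times> V1) (a, q)) (restrict (l z) (V1 \<times> V1) (a, q))) (V' \<times> V'))" .
    qed
  qed simp
  moreover have "V' \<subseteq> V" using N(5) V1(3) by blast
  ultimately show ?case using N(1-4) by blast
next
  case (open_cover U \<C> Z f)
  note P = open_cover.prems
  obtain C where C: "C \<in> \<C>" "z0 \<in> C" using open_cover.hyps(2) P(7) by blast
  have oC: "openin Z C" using C open_cover.IH by blast
  have "z0 \<in> topspace (subtopology Z C)" using C P(7) by simp
  moreover have "continuous_map (prod_topology (subtopology TM V) (subtopology Z C)) euclideanreal \<theta>"
    by (rule continuous_map_prod_subtopology[OF P(6) order_refl])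
  ultimately have "\<exists>N V'. openin (subtopology Z C) N \<and> z0 \<in> N \<and> openin TM V' \<and> a0 \<in> V' \<and> V' \<subseteq> V \<and>
    diag_family M E p V' (subtopology (subtopology Z C) N) (\<lambda>z. \<lambda>a\<in>V'. mix_germ d a (\<lambda>b. \<theta> (b, z)) (f z a) (l z))"
    using open_cover.IH C(1) P by (intro open_cover.IH[rule_format, OF C(1), THEN conjunct2, THEN conjunct2, rule_format])
      (auto intro: P_quasitopology_subtopology)
  then obtain N V' where N: "openin (subtopology Z C) N" "z0 \<in> N" "openin TM V'" "a0 \<in> V'" "V' \<subseteq> V"
    "diag_family M E p V' (subtopology (subtopology Z C) N) (\<lambda>z. \<lambda>a\<in>V'. mix_germ d a (\<lambda>b. \<theta> (b, z)) (f z a) (l z))"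
    by (elim exE conjE)
  have "openin Z N" "C \<inter> N = N" using N(1) openin_open_subtopology[OF oC] by auto
  moreover from this have "diag_family M E p V' (subtopology Z N) (\<lambda>z. \<lambda>a\<in>V'. mix_germ d a (\<lambda>b. \<theta> (b, z)) (f z a) (l z))"
    using N(6) by (simp add: subtopology_subtopology)
  ultimately show ?case using N(2-5) by blast
next
  case (closed_cover Z C D U f)
  note P = closed_cover.prems
  let ?m = "\<lambda>z a. mix_germ d a (\<lambda>b. \<theta> (b, z)) (f z a) (l z)"
  have "\<exists>O' V'. openin Z O' \<and> z0 \<in> O' \<and> openin TM V' \<and> a0 \<in> V' \<and> V' \<subseteq> V \<and>
     diag_family M E p V' (subtopology Z (O' \<inter> X)) (\<lambda>z. \<lambda>a\<in>V'. ?m z a)"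
    if X: "X = C \<or> X = D" for X
  proof (cases "z0 \<in> X")
    \<comment> \<open>The complement of the closed set \<open>X\<close> is then a neighbourhood of
      \<open>z0\<close>; its part in \<open>X\<close> is empty, and over an empty parameter space
      every family is admissible.\<close>
    case False
    have "closedin Z X" using X closed_cover.hyps by blast
    then have "openin Z (topspace Z - X)" by blast
    moreover have "diag_family M E p V (subtopology Z ((topspace Z - X) \<inter> X)) (\<lambda>z. \<lambda>a\<in>V. ?m z a)"
      by (rule diag_family_empty[OF P(2)]) auto
    ultimately show ?thesis using False P by blast
  next
    case True
    have z: "z0 \<in> topspace (subtopology Z X)" using True P(7) by simp
    have \<theta>X: "continuous_map (prod_topology (subtopology TM V) (subtopology Z X)) euclideanreal \<theta>"
      by (rule continuous_map_prod_subtopology[OF P(6) order_refl])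
    have lX: "l \<in> P_quasitopology M E p W (subtopology Z X)" by (rule P_quasitopology_subtopology[OF P(1)])
    have valX: "\<And>z a h. z \<in> topspace (subtopology Z X) \<Longrightarrow> a \<in> V \<Longrightarrow> f z a = dgerm a h \<Longrightarrow> h (a, a) = l z (a, a)"
      "\<And>z a. z \<in> topspace (subtopology Z X) \<Longrightarrow> a \<in> V \<Longrightarrow> l z (a, a) \<in> fst d"
      using P(9,10) by auto
    have "\<exists>N V'. openin (subtopology Z X) N \<and> z0 \<in> N \<and> openin TM V' \<and> a0 \<in> V' \<and> V' \<subseteq> V \<and>
      diag_family M E p V' (subtopology (subtopology Z X) N) (\<lambda>z. \<lambda>a\<in>V'. ?m z a)"
      using X
    proof
      assume "X = C"
      show ?thesis unfolding \<open>X = C\<close>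
        by (rule closed_cover.IH(1)[OF lX[unfolded \<open>X = C\<close>] P(2-5) \<theta>X[unfolded \<open>X = C\<close>] z[unfolded \<open>X = C\<close>] P(8)])
          (use valX \<open>X = C\<close> in blast)+
    next
      assume "X = D"
      show ?thesis unfolding \<open>X = D\<close>
        by (rule closed_cover.IH(2)[OF lX[unfolded \<open>X = D\<close>] P(2-5) \<theta>X[unfolded \<open>X = D\<close>] z[unfolded \<open>X = D\<close>] P(8)])
          (use valX \<open>X = D\<close> in blast)+
    qed
    then obtain N V' where N: "openin (subtopology Z X) N" "z0 \<in> N" "openin TM V'" "a0 \<in> V'" "V' \<subseteq> V"
      "diag_family M E p V' (subtopology (subtopology Z X) N) (\<lambda>z. \<lambda>a\<in>V'. ?m z a)"
      by (elim exE conjE)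
    \<comment> \<open>The neighbourhood is open only in the closed part \<open>X\<close>. Extending
      it to an open set of \<open>Z\<close> allows the neighbourhoods from the two parts to be
      intersected.\<close>
    obtain O' where "openin Z O'" "N = O' \<inter> X" using N(1) by (auto simp: openin_subtopology)
    moreover have "X \<inter> (O' \<inter> X) = O' \<inter> X" by auto
    ultimately have "openin Z O'" "z0 \<in> O'" "diag_family M E p V' (subtopology Z (O' \<inter> X)) (\<lambda>z. \<lambda>a\<in>V'. ?m z a)"
      using N(2,6) by (simp_all add: subtopology_subtopology)
    then show ?thesis using N(3-5) by blast
  qed
  note * = this
  obtain OC VC where OC: "openin Z OC" "z0 \<in> OC" "openin TM VC" "a0 \<in> VC" "VC \<subseteq> V"
    "diag_family M E p VC (subtopology Z (OC \<inter> C)) (\<lambda>z. \<lambda>a\<in>VC. ?m z a)"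
    using *[OF disjI1[OF refl]] by (elim exE conjE)
  obtain OD VD where OD: "openin Z OD" "z0 \<in> OD" "openin TM VD" "a0 \<in> VD" "VD \<subseteq> V"
    "diag_family M E p VD (subtopology Z (OD \<inter> D)) (\<lambda>z. \<lambda>a\<in>VD. ?m z a)"
    using *[OF disjI2[OF refl]] by (elim exE conjE)
  define N V' where NV: "N = OC \<inter> OD" "V' = VC \<inter> VD"
  have V': "openin TM V'" "V' \<subseteq> VC" "V' \<subseteq> VD" using OC OD by (auto simp: NV)
  have "openin Z N" using OC OD by (auto simp: NV)
  have "diag_family M E p V' (subtopology Z N) (\<lambda>z. \<lambda>a\<in>V'. ?m z a)"
  proof (rule diag_family.closed_cover)
    show "closedin (subtopology Z N) (N \<inter> C)" "closedin (subtopology Z N) (N \<inter> D)"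
      using closed_cover.hyps(1,2) by (auto simp: closedin_subtopology)
    show "N \<inter> C \<union> N \<inter> D = topspace (subtopology Z N)"
      using closed_cover.hyps(3) openin_subset[OF \<open>openin Z N\<close>] by auto
    have "N \<inter> (N \<inter> C) = N \<inter> C" "N \<inter> (N \<inter> D) = N \<inter> D" by auto
    then show "diag_family M E p V' (subtopology (subtopology Z N) (N \<inter> C)) (\<lambda>z. \<lambda>a\<in>V'. ?m z a)"
      "diag_family M E p V' (subtopology (subtopology Z N) (N \<inter> D)) (\<lambda>z. \<lambda>a\<in>V'. ?m z a)"
      using diag_family_shrink[OF OC(6) V'(1,2), of "N \<inter> C"] diag_family_shrink[OF OD(6) V'(1,3), of "N \<inter> D"]
      by (auto simp: subtopology_subtopology NV)
  qed
  moreover have "z0 \<in> N" "a0 \<in> V'" "V' \<subseteq> V" using OC OD by (auto simp: NV)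
  ultimately show ?case using \<open>openin Z N\<close> V'(1) by blast
next
  case (base_cover U \<U> Z f)
  note P = base_cover.prems
  have "a0 \<in> U" using P by auto
  then obtain U0 where U0: "U0 \<in> \<U>" "a0 \<in> U0" using base_cover.hyps(2) by blast
  have oU0: "openin TM U0" using U0 base_cover.IH by blast
  let ?V = "V \<inter> U0"
  have V1: "openin TM ?V" "?V \<subseteq> U0" "?V \<times> ?V \<subseteq> W" "?V \<subseteq> fst c" "a0 \<in> ?V" using P oU0 U0 by auto
  have \<theta>1: "continuous_map (prod_topology (subtopology TM ?V) Z) euclideanreal \<theta>"
    using continuous_map_prod_subtopology[OF P(6), of ?V "topspace Z"] by simp
  note IH = base_cover.IH[rule_format, OF U0(1), THEN conjunct2, THEN conjunct2, rule_format]
  have "\<exists>N V'. openin Z N \<and> z0 \<in> N \<and> openin TM V' \<and> a0 \<in> V' \<and> V' \<subseteq> ?V \<and>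
    diag_family M E p V' (subtopology Z N) (\<lambda>z. \<lambda>a\<in>V'. mix_germ d a (\<lambda>b. \<theta> (b, z)) (restrict (f z) U0 a) (l z))"
    using P V1 \<theta>1 by (intro IH) auto
  then obtain N V' where N: "openin Z N" "z0 \<in> N" "openin TM V'" "a0 \<in> V'" "V' \<subseteq> ?V"
    "diag_family M E p V' (subtopology Z N) (\<lambda>z. \<lambda>a\<in>V'. mix_germ d a (\<lambda>b. \<theta> (b, z)) (restrict (f z) U0 a) (l z))"
    by (elim exE conjE)
  have "(\<lambda>a\<in>V'. mix_germ d a (\<lambda>b. \<theta> (b, z)) (restrict (f z) U0 a) (l z)) = (\<lambda>a\<in>V'. mix_germ d a (\<lambda>b. \<theta> (b, z)) (f z a) (l z))" for z
    using N(5) by (intro restrict_ext) auto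
  then have "diag_family M E p V' (subtopology Z N) (\<lambda>z. \<lambda>a\<in>V'. mix_germ d a (\<lambda>b. \<theta> (b, z)) (f z a) (l z))"
    using N(6) by simp
  moreover have "V' \<subseteq> V" using N(5) by blast
  ultimately show ?case using N(1-4) by blast
qed

end

context smooth_bundle
begin

text \<open>To recover the old germ or the germ of \<open>l z\<close>, the weight has to be constant
  near \<open>a\<close>, not just at \<open>a\<close>, since germs see nearby base points. The jet
  at \<open>a\<close> looks at the base point \<open>a\<close> alone and is therefore kept for every
  weight.\<close>

lemma mix_germ_props:
  assumes cd: "(c, d) \<in> adapted_charts M E p"
    and \<gamma>: "\<gamma> \<in> diag_sections M E p U" "a \<in> U"
    and l: "l \<in> P_quasitopology M E p W Z"
    and V: "openin TM V" "V \<times> V \<subseteq> W" "V \<subseteq> fst c"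
    and \<theta>: "continuous_map (prod_topology (subtopology TM V) Z) euclideanreal \<theta>"
    and \<theta>01: "\<And>y. \<theta> y \<in> {0..1}"
    and za: "z \<in> topspace Z" "a \<in> V"
    and lval: "l z (a, a) \<in> fst d"
    and jets: "germ_jet r a (\<gamma> a) = jet M E p r a (\<lambda>q. l z (a, q))"
  shows "\<And>V2. openin TM V2 \<Longrightarrow> a \<in> V2 \<Longrightarrow> (\<And>b. b \<in> V2 \<Longrightarrow> \<theta> (b, z) = 1) \<Longrightarrow> mix_germ d a (\<lambda>b. \<theta> (b, z)) (\<gamma> a) (l z) = \<gamma> a"
    "\<And>V2. openin TM V2 \<Longrightarrow> a \<in> V2 \<Longrightarrow> (\<And>b. b \<in> V2 \<Longrightarrow> \<theta> (b, z) = 0) \<Longrightarrow> mix_germ d a (\<lambda>b. \<theta> (b, z)) (\<gamma> a) (l z) = dgerm a (l z)"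
    "germ_jet r a (mix_germ d a (\<lambda>b. \<theta> (b, z)) (\<gamma> a) (l z)) = germ_jet r a (\<gamma> a)"
proof -
  note ch = adapted_chartD[OF cd]
  obtain V1 h where V1: "openin TM V1" "a \<in> V1" "V1 \<subseteq> U" "\<forall>b\<in>V1. \<gamma> b = dgerm b h" "h \<in> P_sections M E p (V1 \<times> V1)"
    using diag_sections_rep[OF \<gamma>] by blast
  have \<gamma>a: "\<gamma> a = dgerm a h" using V1 by blast
  define V' where "V' = V \<inter> V1"
  have V': "openin TM V'" "a \<in> V'" "V' \<times> V' \<subseteq> V1 \<times> V1" "V' \<times> V' \<subseteq> W" "V' \<subseteq> fst c" "V' \<subseteq> V"
    using V V1 za by (auto simp: V'_def)
  have h1: "(\<lambda>_. restrict h (V' \<times> V')) \<in> P_quasitopology M E p (V' \<times> V') Z"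
    by (rule P_quasitopology_restrict[OF P_sections_const[OF V1(5)] V'(3)])
  have l1: "(\<lambda>z. restrict (l z) (V' \<times> V')) \<in> P_quasitopology M E p (V' \<times> V') Z"
    by (rule P_quasitopology_restrict[OF l V'(4)])
  have \<theta>1: "continuous_map (prod_topology (subtopology TM V') Z) euclideanreal \<theta>"
    using continuous_map_prod_subtopology[OF \<theta> V'(6), of "topspace Z"] by simp
  have hl: "h (a, a) = l z (a, a)"
    by (rule jets_imp_value[OF \<gamma> l V(1,2) za jets \<gamma>a])
  have v: "restrict h (V' \<times> V') (a, a) = restrict (l z) (V' \<times> V') (a, a)" "restrict h (V' \<times> V') (a, a) \<in> fst d"
    using hl lval V'(2) by auto
  let ?m = "\<lambda>z. restrict (\<lambda>(a, q). chart_mix d (\<theta> (a, z)) (restrict h (V' \<times> V') (a, q)) (restrict (l z) (V' \<times> V') (a, q)))"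
  obtain N V2 where N: "openin Z N" "z \<in> N" and V2: "openin TM V2" "a \<in> V2" "V2 \<subseteq> V'"
    and in0: "\<forall>z\<in>N. \<forall>a\<in>V2. \<forall>q\<in>V2. restrict h (V' \<times> V') (a, q) \<in> fst d \<and> restrict (l z) (V' \<times> V') (a, q) \<in> fst d \<and>
      (fst (snd d (restrict h (V' \<times> V') (a, q))), \<theta> (a, z) *\<^sub>R snd (snd d (restrict h (V' \<times> V') (a, q))) +
        (1 - \<theta> (a, z)) *\<^sub>R snd (snd d (restrict (l z) (V' \<times> V') (a, q)))) \<in> snd d ` fst d"
    and m: "(\<lambda>z. ?m z (V2 \<times> V2)) \<in> P_quasitopology M E p (V2 \<times> V2) (subtopology Z N)"
    using P_mix_local[OF cd h1 l1 V'(1) order_refl V'(5) za(1) V'(2) \<theta>1 \<theta>01 v] by (elim exE conjE)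
  have in1: "h (b, q) \<in> fst d" "l z (b, q) \<in> fst d"
     "(fst (snd d (h (b, q))), \<theta> (b, z) *\<^sub>R snd (snd d (h (b, q))) + (1 - \<theta> (b, z)) *\<^sub>R snd (snd d (l z (b, q)))) \<in> snd d ` fst d"
    if "b \<in> V2" "q \<in> V2" for b q
    using in0[rule_format, OF N(2) that] that V2(3) by (simp_all add: subset_iff)
  have sub2: "V2 \<times> V2 \<subseteq> V1 \<times> V1" "V2 \<times> V2 \<subseteq> W" using V2(3) V'(3,4) by auto
  have ph: "p (h (b, q)) = q" "p (l z (b, q)) = q" if "b \<in> V2" "q \<in> V2" for b q
    using P_value_section[OF P_sections_const[OF V1(5), of Z] V2(1) V2(1) sub2(1) za(1) that]
      P_value_section[OF l V2(1) V2(1) sub2(2) za(1) that] by simp_all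
  have fe: "fst (snd d (h (b, q))) = fst (snd d (l z (b, q)))" if "b \<in> V2" "q \<in> V2" for b q
    using ch(6)[OF in1(1)[OF that]] ch(6)[OF in1(2)[OF that]] ph[OF that] by simp
  have aT: "a \<in> topspace TM" using openin_subset[OF V2(1)] V2(2) by blast
  have mix: "mix_germ d a (\<lambda>b. \<theta> (b, z)) (\<gamma> a) (l z) = dgerm a (\<lambda>(b, q). chart_mix d (\<theta> (b, z)) (h (b, q)) (l z (b, q)))"
    unfolding \<gamma>a by (rule mix_germ_rep[OF aT])
  show "mix_germ d a (\<lambda>b. \<theta> (b, z)) (\<gamma> a) (l z) = \<gamma> a" if V3: "openin TM V3" "a \<in> V3" "\<And>b. b \<in> V3 \<Longrightarrow> \<theta> (b, z) = 1" for V3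
    unfolding mix unfolding \<gamma>a
  proof (rule germ_at_cong)
    show "openin TMM ((V2 \<inter> V3) \<times> (V2 \<inter> V3))" using V2(1) V3(1) by (intro openin_box) auto
    show "(a, a) \<in> (V2 \<inter> V3) \<times> (V2 \<inter> V3)" using V2 V3 by auto
    fix y assume "y \<in> (V2 \<inter> V3) \<times> (V2 \<inter> V3)"
    then obtain b q where y: "y = (b, q)" "b \<in> V2" "q \<in> V2" "b \<in> V3" by auto
    then show "(case y of (b, q) \<Rightarrow> chart_mix d (\<theta> (b, z)) (h (b, q)) (l z (b, q))) = h y"
      using chart_mix_0_1(1)[OF ch(2) in1(1,2)[OF y(2,3)] fe[OF y(2,3)]] V3(3) by simp
  qed
  show "mix_germ d a (\<lambda>b. \<theta> (b, z)) (\<gamma> a) (l z) = dgerm a (l z)" if V3: "openin TM V3" "a \<in> V3" "\<And>b. b \<in> V3 \<Longrightarrow> \<theta> (b, z) = 0" for V3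
    unfolding mix
  proof (rule germ_at_cong)
    show "openin TMM ((V2 \<inter> V3) \<times> (V2 \<inter> V3))" using V2(1) V3(1) by (intro openin_box) auto
    show "(a, a) \<in> (V2 \<inter> V3) \<times> (V2 \<inter> V3)" using V2 V3 by auto
    fix y assume "y \<in> (V2 \<inter> V3) \<times> (V2 \<inter> V3)"
    then obtain b q where y: "y = (b, q)" "b \<in> V2" "q \<in> V2" "b \<in> V3" by auto
    then show "(case y of (b, q) \<Rightarrow> chart_mix d (\<theta> (b, z)) (h (b, q)) (l z (b, q))) = l z y"
      using chart_mix_0_1(2)[OF ch(2) in1(1,2)[OF y(2,3)] fe[OF y(2,3)]] V3(3) by simp
  qed
  let ?s1 = "\<lambda>q\<in>V2. h (a, q)" and ?s2 = "\<lambda>q\<in>V2. l z (a, q)" and ?s3 = "\<lambda>q\<in>V2. ?m z (V2 \<times> V2) (a, q)"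
  note j1 = P_jet[OF P_sections_const[OF V1(5), of Z] V2(1) sub2(1) za(1) V2(2)]
    and j2 = P_jet[OF l V2(1) sub2(2) za(1) V2(2)]
  have zN: "z \<in> topspace (subtopology Z N)" using N za(1) by simp
  note j3 = P_jet[OF m V2(1) order_refl zN V2(2)]
  have s3: "?s3 q = chart_mix d (\<theta> (a, z)) (h (a, q)) (l z (a, q))" if "q \<in> V2" for q
    using that V2(2,3) by (auto simp: subset_iff)
  have sec: "?s1 \<in> smooth_sections M E p V2" "?s2 \<in> smooth_sections M E p V2"
    using P_quasitopologyD(1)[OF P_sections_const[OF V1(5), of Z] V2(1) V2(1) sub2(1) za(1) V2(2)]
      P_quasitopologyD(1)[OF l V2(1) V2(1) sub2(2) za(1) V2(2)] by simp_all
  have sm: "smooth_on (snd c ` V2) (local_rep c d ?s1)" "smooth_on (snd c ` V2) (local_rep c d ?s2)"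
    by (rule local_rep_smooth[OF sec(1) V2(1) cd V2(1) order_refl], use in1 V2(2) in force)
      (rule local_rep_smooth[OF sec(2) V2(1) cd V2(1) order_refl], use in1 V2(2) in force)
  have Vc: "V2 \<subseteq> fst c" using V2(3) V'(5) by blast
  have oV: "open (snd c ` V2)" by (rule chartD(7)[OF ch(1) V2(1) Vc])
  have j12: "jet M E p r a ?s1 = jet M E p r a ?s2"
    using jets j1(4)[of r] j2(3)[of r] \<gamma>a by simp
  note sj = jet_eqD(2)[OF j12 j2(1)]
  have ha: "h (a, a) \<in> fst d" using in1(1) V2(2) by blast
  \<comment> \<open>Along the slice at \<open>a\<close> the weight is the single number
    \<open>\<theta> (a, z)\<close>, so the representative of the mixture is a convex combination of
    two functions whose derivatives at \<open>a\<close> agree up to order \<open>r\<close>.\<close>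
  have "same_jet M E p r a ?s1 ?s3"
  proof (rule same_jetI_chart[OF cd j1(1) j3(1)])
    show "?s1 a = ?s3 a"
      unfolding s3[OF V2(2)] hl[symmetric] using V2(2) inv_into_f_f[OF chartD(3)[OF ch(2)] ha]
      by (simp add: chart_mix_def flip: scaleR_left_distrib)
    show "?s1 a \<in> fst d" using ha V2(2) by simp
    fix vs :: "'b list" assume len: "length vs \<le> r"
    have "iter_deriv vs (local_rep c d ?s3) (snd c a) =
      iter_deriv vs (\<lambda>x. \<theta> (a, z) *\<^sub>R local_rep c d ?s1 x + (1 - \<theta> (a, z)) *\<^sub>R local_rep c d ?s2 x) (snd c a)"
    proof (rule iter_deriv_cong[OF oV])
      show "snd c a \<in> snd c ` V2" using V2(2) by simp
      fix x assume "x \<in> snd c ` V2"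
      then obtain q where q: "q \<in> V2" "x = snd c q" by auto
      have "inv_into (fst c) (snd c) x = q" using inv_into_f_f[OF chartD(3)[OF ch(1)], of q] q Vc by auto
      then show "local_rep c d ?s3 x = \<theta> (a, z) *\<^sub>R local_rep c d ?s1 x + (1 - \<theta> (a, z)) *\<^sub>R local_rep c d ?s2 x"
        using q s3[OF q(1)] f_inv_into_f[OF in1(3)[OF V2(2) q(1)]]
        by (simp add: local_rep_eq chart_mix_def del: restrict_apply) simp
    qed
    also have "\<dots> = \<theta> (a, z) *\<^sub>R iter_deriv vs (local_rep c d ?s1) (snd c a) + (1 - \<theta> (a, z)) *\<^sub>R iter_deriv vs (local_rep c d ?s2) (snd c a)"
      by (rule iter_deriv_mix(1)[OF oV sm]) (use V2(2) in simp)
    also have "iter_deriv vs (local_rep c d ?s2) (snd c a) = iter_deriv vs (local_rep c d ?s1) (snd c a)"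
      by (rule same_jetD(2)[OF sj cd _ len, symmetric]) (use ha V2(2) in simp)
    finally have eq: "iter_deriv vs (local_rep c d ?s3) (snd c a) =
      \<theta> (a, z) *\<^sub>R iter_deriv vs (local_rep c d ?s1) (snd c a) + (1 - \<theta> (a, z)) *\<^sub>R iter_deriv vs (local_rep c d ?s1) (snd c a)" .
    have conv: "t *\<^sub>R x + (1 - t) *\<^sub>R x = x" for t and x :: 'c by (simp flip: scaleR_left_distrib)
    show "iter_deriv vs (local_rep c d ?s1) (snd c a) = iter_deriv vs (local_rep c d ?s3) (snd c a)"
      unfolding eq conv ..
  qed
  from same_jet_imp_jet_eq[OF this] have "jet M E p r a ?s1 = jet M E p r a ?s3" .
  moreover have "mix_germ d a (\<lambda>b. \<theta> (b, z)) (\<gamma> a) (l z) = dgerm a (?m z (V2 \<times> V2))"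
    unfolding mix
  proof (rule germ_at_cong[OF openin_box[OF V2(1)]])
    show "(a, a) \<in> V2 \<times> V2" using V2(2) by simp
    fix y assume "y \<in> V2 \<times> V2"
    then obtain b q where y: "y = (b, q)" "b \<in> V2" "q \<in> V2" "b \<in> V'" "q \<in> V'" using V2(3) by auto
    then show "(case y of (b, q) \<Rightarrow> chart_mix d (\<theta> (b, z)) (h (b, q)) (l z (b, q))) = ?m z (V2 \<times> V2) y"
      by simp
  qed
  ultimately show "germ_jet r a (mix_germ d a (\<lambda>b. \<theta> (b, z)) (\<gamma> a) (l z)) = germ_jet r a (\<gamma> a)"
    using j1(4)[of r] j3(4)[of r] \<gamma>a by simp
qed

text \<open>The gluing rules treat covers of the parameters and covers of the base separately, while
  the hypothesis provides boxes. For a fixed \<open>a\<close>, finitely many parameter sets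
  \<open>N\<close> cover the compact \<open>Z\<close>; the intersection \<open>V\<close> of the
  corresponding neighbourhoods of \<open>a\<close> is open, and gluing over the sets
  \<open>N\<close> gives a family over \<open>V\<close> for all parameters at once.\<close>

lemma diag_family_localI:
  assumes Z: "compact_space Z" and U: "openin TM U"
    and loc: "\<And>a z. a \<in> U \<Longrightarrow> z \<in> topspace Z \<Longrightarrow> \<exists>N V. openin Z N \<and> z \<in> N \<and> openin TM V \<and> a \<in> V \<and> V \<subseteq> U \<and>
       diag_family M E p V (subtopology Z N) (\<lambda>z. \<lambda>a\<in>V. \<gamma> z a)"
  shows "diag_family M E p U Z (\<lambda>z. \<lambda>a\<in>U. \<gamma> z a)"
proof (rule diag_family.base_cover[OF U])
  let ?\<U> = "{V. openin TM V \<and> V \<subseteq> U \<and> diag_family M E p V Z (\<lambda>z. \<lambda>a\<in>V. \<gamma> z a)}"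
  have "\<exists>V\<in>?\<U>. a \<in> V" if a: "a \<in> U" for a
  proof -
    define \<N> where "\<N> = {N. openin Z N \<and> (\<exists>V. openin TM V \<and> a \<in> V \<and> V \<subseteq> U \<and> diag_family M E p V (subtopology Z N) (\<lambda>z. \<lambda>a\<in>V. \<gamma> z a))}"
    have "topspace Z \<subseteq> \<Union>\<N>" using loc[OF a] unfolding \<N>_def by blast
    then have "\<exists>\<F>. finite \<F> \<and> \<F> \<subseteq> \<N> \<and> topspace Z \<subseteq> \<Union>\<F>"
      using Z unfolding compact_space_alt by (auto simp: \<N>_def)
    then obtain \<F> where F: "finite \<F>" "\<F> \<subseteq> \<N>" "topspace Z \<subseteq> \<Union>\<F>" by blast
    have "\<exists>W. \<forall>N\<in>\<F>. openin TM (W N) \<and> a \<in> W N \<and> W N \<subseteq> U \<and> diag_family M E p (W N) (subtopology Z N) (\<lambda>z. \<lambda>a\<in>W N. \<gamma> z a)"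
      using F(2) unfolding \<N>_def by (intro bchoice) blast
    then obtain W where W: "\<And>N. N \<in> \<F> \<Longrightarrow> openin TM (W N)" "\<And>N. N \<in> \<F> \<Longrightarrow> a \<in> W N"
      "\<And>N. N \<in> \<F> \<Longrightarrow> diag_family M E p (W N) (subtopology Z N) (\<lambda>z. \<lambda>a\<in>W N. \<gamma> z a)" by blast
    define V where "V = U \<inter> \<Inter>(W ` \<F>)"
    have V: "openin TM V" "a \<in> V" "V \<subseteq> U"
    proof -
      show "openin TM V"
      proof (cases "\<F> = {}")
        case False
        then have "openin TM (\<Inter>(W ` \<F>))" using W(1) F(1) by (intro openin_INT2) auto
        then show ?thesis using U by (auto simp: V_def)
      qed (use U in \<open>simp add: V_def\<close>)
    qed (use a W(2) in \<open>auto simp: V_def\<close>)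
    have "diag_family M E p V Z (\<lambda>z. \<lambda>a\<in>V. \<gamma> z a)"
    proof (rule diag_family.open_cover[OF V(1)])
      show "\<Union>\<F> = topspace Z"
        using F(2,3) openin_subset unfolding \<N>_def by blast
      show "\<forall>N\<in>\<F>. openin Z N \<and> diag_family M E p V (subtopology Z N) (\<lambda>z. \<lambda>a\<in>V. \<gamma> z a)"
      proof
        fix N assume N: "N \<in> \<F>"
        then have "V \<subseteq> W N" by (auto simp: V_def)
        from diag_family_shrink[OF W(3)[OF N] V(1) this order_refl] N F(2)
        show "openin Z N \<and> diag_family M E p V (subtopology Z N) (\<lambda>z. \<lambda>a\<in>V. \<gamma> z a)"
          unfolding \<N>_def by blast
      qed
    qed
    then show ?thesis using V by blast
  qed
  then show "\<Union>?\<U> = U" by blast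
  show "\<forall>z\<in>topspace Z. (\<lambda>a\<in>U. \<gamma> z a) \<in> extensional U" by simp
  show "\<forall>V\<in>?\<U>. openin TM V \<and> diag_family M E p V Z (\<lambda>z. restrict (\<lambda>a\<in>U. \<gamma> z a) V)"
  proof
    fix V assume V: "V \<in> ?\<U>"
    then have "U \<inter> V = V" by auto
    then show "openin TM V \<and> diag_family M E p V Z (\<lambda>z. restrict (\<lambda>a\<in>U. \<gamma> z a) V)" using V by simp
  qed
qed

end

section \<open>Lifting families of jets\<close>


context smooth_bundle
begin

abbreviation (input) "param_topology U Z \<equiv> prod_topology (subtopology TM U) Z"

lemma param_nbhd:
  assumes U: "openin TM U" and S: "openin (param_topology U Z) S" "(a, z) \<in> S"
  shows "\<exists>N V. openin Z N \<and> z \<in> N \<and> openin TM V \<and> a \<in> V \<and> V \<subseteq> U \<and> V \<times> N \<subseteq> S"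
proof -
  obtain V N where *: "openin (subtopology TM U) V" "openin Z N" "a \<in> V" "z \<in> N" "V \<times> N \<subseteq> S"
    using openin_prod_topology_alt[THEN iffD1, OF S(1), THEN spec, THEN spec, THEN mp, OF S(2)]
    by (elim exE conjE)
  have "openin TM V \<and> V \<subseteq> U" using *(1) openin_open_subtopology[OF U] by simp
  then show ?thesis using * by blast
qed

text \<open>A lift of the jets over a subset \<open>D\<close> of the product of base and parameters.
  Such a set is rarely a product, so admissibility is demanded on small boxes; the values of
  \<open>\<gamma>\<close> off \<open>D\<close> are arbitrary.\<close>

definition partial_lift :: "nat \<Rightarrow> 'z topology \<Rightarrow> ('m \<times> 'z \<Rightarrow> 'm \<times> ('m \<Rightarrow> 'e) set) \<Rightarrow> ('m \<times> 'z) set \<Rightarrow>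
    ('z \<Rightarrow> 'm \<Rightarrow> ('m \<times> 'm \<Rightarrow> 'e) set) \<Rightarrow> bool" where
  "partial_lift r Z \<sigma> D \<gamma> \<longleftrightarrow>
     (\<forall>a z. (a, z) \<in> D \<longrightarrow> (\<exists>N V. openin Z N \<and> z \<in> N \<and> openin TM V \<and> a \<in> V \<and> V \<times> N \<subseteq> D \<and>
        diag_family M E p V (subtopology Z N) (\<lambda>z. \<lambda>a\<in>V. \<gamma> z a))) \<and>
     (\<forall>a z. (a, z) \<in> D \<longrightarrow> germ_jet r a (\<gamma> z a) = \<sigma> (a, z))"

lemma diag_family_eq_on:
  assumes "diag_family M E p V (subtopology Z N) (\<lambda>z. \<lambda>a\<in>V. \<gamma> z a)"
    and "\<And>z a. z \<in> N \<Longrightarrow> a \<in> V \<Longrightarrow> \<gamma>' z a = \<gamma> z a"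
  shows "diag_family M E p V (subtopology Z N) (\<lambda>z. \<lambda>a\<in>V. \<gamma>' z a)"
  by (rule diag_family_cong[OF assms(1)]) (use assms(2) in \<open>auto intro!: restrict_ext\<close>)

text \<open>The given partial lift is interpolated with the lift \<open>l\<close> over a box, using a cut-off function \<open>\<theta>\<close> that
  is 1 near \<open>A\<close> and 0 near the complement of \<open>D\<close>.\<close>

lemma partial_lift_step:
  fixes Z :: "'z topology"
  assumes U: "openin TM U" and Y: "normal_space (param_topology U Z)"
    and D: "openin (param_topology U Z) D" and A: "closedin (param_topology U Z) A" "A \<subseteq> D"
    and \<gamma>: "partial_lift r Z \<sigma> D \<gamma>"
    and cd: "(c, d) \<in> adapted_charts M E p"
    and N0: "openin Z N0" and V0: "openin TM V0" "V0 \<subseteq> U" "V0 \<subseteq> fst c"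
    and l: "l \<in> P_quasitopology M E p (V0 \<times> V0) (subtopology Z N0)"
    and l\<sigma>: "\<forall>z\<in>N0. \<forall>a\<in>V0. l z (a, a) \<in> fst d \<and> jet M E p r a (\<lambda>q. l z (a, q)) = \<sigma> (a, z)"
  shows "\<exists>D' \<gamma>'. openin (param_topology U Z) D' \<and> A \<subseteq> D' \<and> V0 \<times> N0 \<subseteq> D' \<and> partial_lift r Z \<sigma> D' \<gamma>' \<and>
    (\<forall>(a, z)\<in>A. \<gamma>' z a = \<gamma> z a)"
proof -
  let ?Y = "param_topology U Z"
  let ?B = "V0 \<times> N0"
  note tU = topspace_sub[OF U]
  have tN0: "topspace (subtopology Z N0) = N0" using openin_subset[OF N0] by auto
  have "openin (subtopology TM U) V0" using V0 by (simp add: openin_open_subtopology[OF U])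
  then have oB: "openin ?Y ?B" using N0 by (simp add: openin_prod_Times_iff)
  have "closedin ?Y (topspace ?Y - D)" using D by blast
  moreover have "disjnt (topspace ?Y - D) A" using A(2) by (auto simp: disjnt_def)
  ultimately obtain f where f: "continuous_map ?Y euclideanreal f" "f ` (topspace ?Y - D) \<subseteq> {0}" "f ` A \<subseteq> {1}"
    using Urysohn_lemma_alt[OF Y _ A(1), of "topspace ?Y - D" 0 1] by blast
  \<comment> \<open>Rescaling makes the cut-off 1 on the open set \<open>f > 2/3\<close> around
    \<open>A\<close> and 0 on the open set \<open>f < 1/3\<close> around the complement of
    \<open>D\<close>, as required for germs.\<close>
  define \<theta> where "\<theta> y = max 0 (min 1 (3 * f y - 1))" for y
  have \<theta>01: "\<theta> y \<in> {0..1}" for y by (simp add: \<theta>_def)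
  have \<theta>c: "continuous_map ?Y euclideanreal \<theta>"
    unfolding \<theta>_def by (intro continuous_intros f(1) continuous_map_real_max continuous_map_real_min) simp_all
  define P Q where "P = {y \<in> topspace ?Y. f y \<in> {2/3<..}}" and "Q = {y \<in> topspace ?Y. f y \<in> {..<1/3}}"
  have oP: "openin ?Y P" unfolding P_def by (rule openin_continuous_map_preimage[OF f(1)]) simp
  have oQ: "openin ?Y Q" unfolding Q_def by (rule openin_continuous_map_preimage[OF f(1)]) simp
  have P1: "\<theta> y = 1" if "y \<in> P" for y using that by (simp add: P_def \<theta>_def)
  have Q0: "\<theta> y = 0" if "y \<in> Q" for y using that by (simp add: Q_def \<theta>_def)
  have PD: "P \<subseteq> D" using f(2) by (force simp: P_def)
  have AP: "A \<subseteq> P"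
  proof
    fix y assume y: "y \<in> A"
    then have "y \<in> topspace ?Y" using closedin_subset[OF A(1)] by blast
    moreover have "f y = 1" using f(3) y by blast
    ultimately show "y \<in> P" by (simp add: P_def)
  qed
  \<comment> \<open>In the box but off \<open>D\<close> there is no old lift and \<open>l\<close> is
    taken. This fits with the mixture, because such points lie in \<open>Q\<close>, where the
    mixture is the germ of \<open>l\<close> as well.\<close>
  define \<gamma>' where "\<gamma>' z a = (if (a, z) \<in> ?B then if (a, z) \<in> D then mix_germ d a (\<lambda>b. \<theta> (b, z)) (\<gamma> z a) (l z) else dgerm a (l z) else \<gamma> z a)" for z a
  have restr: "prod_topology (subtopology TM V) (subtopology Z N) = subtopology ?Y (V \<times> N)" if "V \<subseteq> U" for V N
    using that by (simp add: subtopology_Times subtopology_subtopology Int_absorb1)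
  have \<theta>res: "continuous_map (prod_topology (subtopology TM V) (subtopology Z N)) euclideanreal \<theta>" if "V \<subseteq> U" for V N
    unfolding restr[OF that] by (rule continuous_map_from_subtopology[OF \<theta>c])
  have \<gamma>loc: "\<exists>N V. openin Z N \<and> z \<in> N \<and> openin TM V \<and> a \<in> V \<and> V \<times> N \<subseteq> D \<and> diag_family M E p V (subtopology Z N) (\<lambda>z. \<lambda>a\<in>V. \<gamma> z a)"
    and \<gamma>jet: "germ_jet r a (\<gamma> z a) = \<sigma> (a, z)" if "(a, z) \<in> D" for a z
    using \<gamma> that unfolding partial_lift_def by blast+
  have props: "\<And>V2. openin TM V2 \<Longrightarrow> a \<in> V2 \<Longrightarrow> (\<And>b. b \<in> V2 \<Longrightarrow> \<theta> (b, z) = 1) \<Longrightarrow> mix_germ d a (\<lambda>b. \<theta> (b, z)) (\<gamma> z a) (l z) = \<gamma> z a"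
    "\<And>V2. openin TM V2 \<Longrightarrow> a \<in> V2 \<Longrightarrow> (\<And>b. b \<in> V2 \<Longrightarrow> \<theta> (b, z) = 0) \<Longrightarrow> mix_germ d a (\<lambda>b. \<theta> (b, z)) (\<gamma> z a) (l z) = dgerm a (l z)"
    "germ_jet r a (mix_germ d a (\<lambda>b. \<theta> (b, z)) (\<gamma> z a) (l z)) = germ_jet r a (\<gamma> z a)"
    if az: "(a, z) \<in> ?B" "(a, z) \<in> D" for a z
  proof -
    obtain N V where NV: "openin Z N" "z \<in> N" "openin TM V" "a \<in> V" "V \<times> N \<subseteq> D" "diag_family M E p V (subtopology Z N) (\<lambda>z. \<lambda>a\<in>V. \<gamma> z a)"
      using \<gamma>loc[OF az(2)] by blast
    have "z \<in> topspace (subtopology Z N)" using NV(1,2) openin_subset by fastforce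
    from diag_family_point[OF NV(6) this] have s: "(\<lambda>a\<in>V. \<gamma> z a) \<in> diag_sections M E p V" .
    have zN0: "z \<in> topspace (subtopology Z N0)" using az(1) tN0 by simp
    have aV0: "a \<in> V0" and lz: "l z (a, a) \<in> fst d" and j: "germ_jet r a ((\<lambda>a\<in>V. \<gamma> z a) a) = jet M E p r a (\<lambda>q. l z (a, q))"
      using az l\<sigma> NV(4) \<gamma>jet[OF az(2)] by auto
    note mp = mix_germ_props[OF cd s NV(4) l V0(1) order_refl V0(3) \<theta>res[OF V0(2)] \<theta>01 zN0 aV0 lz j]
    have e: "(\<lambda>a\<in>V. \<gamma> z a) a = \<gamma> z a" using NV(4) by simp
    show "mix_germ d a (\<lambda>b. \<theta> (b, z)) (\<gamma> z a) (l z) = \<gamma> z a" if "openin TM V2" "a \<in> V2" "\<And>b. b \<in> V2 \<Longrightarrow> \<theta> (b, z) = 1" for V2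
      using mp(1)[OF that] unfolding e .
    show "mix_germ d a (\<lambda>b. \<theta> (b, z)) (\<gamma> z a) (l z) = dgerm a (l z)" if "openin TM V2" "a \<in> V2" "\<And>b. b \<in> V2 \<Longrightarrow> \<theta> (b, z) = 0" for V2
      using mp(2)[OF that] unfolding e .
    show "germ_jet r a (mix_germ d a (\<lambda>b. \<theta> (b, z)) (\<gamma> z a) (l z)) = germ_jet r a (\<gamma> z a)"
      using mp(3) unfolding e .
  qed
  have \<gamma>'P: "\<gamma>' z a = \<gamma> z a" if az: "(a, z) \<in> P" for a z
  proof (cases "(a, z) \<in> ?B")
    case True
    obtain N V where NV: "z \<in> N" "openin TM V" "a \<in> V" "V \<times> N \<subseteq> P" using param_nbhd[OF U oP az] by blast
    have "\<theta> (b, z) = 1" if "b \<in> V" for b using P1 NV(1,4) that by blast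
    then show ?thesis using props(1)[OF True _ NV(2,3)] True PD az by (auto simp: \<gamma>'_def)
  qed (auto simp: \<gamma>'_def)
  have \<gamma>'Q: "\<gamma>' z a = dgerm a (l z)" if az: "(a, z) \<in> Q" "(a, z) \<in> ?B" for a z
  proof (cases "(a, z) \<in> D")
    case True
    obtain N V where NV: "z \<in> N" "openin TM V" "a \<in> V" "V \<times> N \<subseteq> Q" using param_nbhd[OF U oQ az(1)] by blast
    have "\<theta> (b, z) = 0" if "b \<in> V" for b using Q0 NV(1,4) that by blast
    then show ?thesis using props(2)[OF az(2) True NV(2,3)] az True by (auto simp: \<gamma>'_def)
  qed (use az in \<open>auto simp: \<gamma>'_def\<close>)
  \<comment> \<open>Off the box the old lift is retained only on \<open>P\<close>: at the edge of
    the box the mixture matches it where the weight is locally 1. Thus parts of \<open>D\<close> may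
    be lost, but \<open>A\<close> is kept.\<close>
  define D' where "D' = ?B \<union> P"
  have "partial_lift r Z \<sigma> D' \<gamma>'"
    unfolding partial_lift_def
  proof (intro conjI allI impI)
    fix a z assume az: "(a, z) \<in> D'"
    show "germ_jet r a (\<gamma>' z a) = \<sigma> (a, z)"
    proof (cases "(a, z) \<in> ?B")
      case True
      show ?thesis
      proof (cases "(a, z) \<in> D")
        case D: True
        then show ?thesis using props(3)[OF True D] \<gamma>jet[OF D] True by (simp add: \<gamma>'_def)
      next
        case False
        have zN0: "z \<in> topspace (subtopology Z N0)" and aV0: "a \<in> V0" using True tN0 by simp_all
        have "germ_jet r a (dgerm a (l z)) = jet M E p r a (\<lambda>q. l z (a, q))"
          using P_jet(3,4)[OF l V0(1) order_refl zN0 aV0, of r] by simp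
        then show ?thesis using l\<sigma> True False by (auto simp: \<gamma>'_def)
      qed
    next
      case False
      then have "(a, z) \<in> P" using az by (auto simp: D'_def)
      then show ?thesis using \<gamma>'P \<gamma>jet PD by auto
    qed
    \<comment> \<open>Three open regions cover \<open>D'\<close>; on them \<open>\<gamma>'\<close>
      is the old lift, the germ of \<open>l\<close> and the mixture, in this order. A point of the
      box off \<open>D\<close> belongs to \<open>Q\<close> because \<open>f\<close> vanishes
      there.\<close>
    have triple: "(a, z) \<in> P \<or> (a, z) \<in> ?B \<inter> Q \<or> (a, z) \<in> ?B \<inter> D"
    proof (cases "(a, z) \<in> D")
      case False
      then have B: "(a, z) \<in> ?B" using az PD by (auto simp: D'_def)
      then have t: "(a, z) \<in> topspace ?Y" using openin_subset[OF oB] by blast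
      then have "f (a, z) = 0" using f(2) False by blast
      then show ?thesis using B t by (simp add: Q_def)
    qed (use az in \<open>auto simp: D'_def\<close>)
    then consider "(a, z) \<in> P" | "(a, z) \<in> ?B \<inter> Q" | "(a, z) \<in> ?B \<inter> D" by blast
    then show "\<exists>N V. openin Z N \<and> z \<in> N \<and> openin TM V \<and> a \<in> V \<and> V \<times> N \<subseteq> D' \<and> diag_family M E p V (subtopology Z N) (\<lambda>z. \<lambda>a\<in>V. \<gamma>' z a)"
    proof cases
      case 1
      obtain N V where NV: "openin Z N" "z \<in> N" "openin TM V" "a \<in> V" "V \<times> N \<subseteq> P" using param_nbhd[OF U oP 1] by blast
      have "(a, z) \<in> D" using 1 PD by blast
      from \<gamma>loc[OF this] obtain N1 V1 where NV1: "openin Z N1" "z \<in> N1" "openin TM V1" "a \<in> V1"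
        "diag_family M E p V1 (subtopology Z N1) (\<lambda>z. \<lambda>a\<in>V1. \<gamma> z a)" by blast
      have "openin TM (V \<inter> V1)" "openin Z (N \<inter> N1)" using NV NV1 by auto
      moreover have "diag_family M E p (V \<inter> V1) (subtopology Z (N \<inter> N1)) (\<lambda>z. \<lambda>a\<in>(V \<inter> V1). \<gamma> z a)"
        by (rule diag_family_shrink[OF NV1(5) calculation(1)]) auto
      then have "diag_family M E p (V \<inter> V1) (subtopology Z (N \<inter> N1)) (\<lambda>z. \<lambda>a\<in>(V \<inter> V1). \<gamma>' z a)"
        by (rule diag_family_eq_on) (use \<gamma>'P NV(5) in blast)
      moreover have "(V \<inter> V1) \<times> (N \<inter> N1) \<subseteq> D'" using NV(5) by (auto simp: D'_def)
      moreover have "z \<in> N \<inter> N1" "a \<in> V \<inter> V1" using NV NV1 by auto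
      ultimately show ?thesis by blast
    next
      case 2
      have "openin ?Y (?B \<inter> Q)" using oB oQ by blast
      from param_nbhd[OF U this 2]
      obtain N V where NV: "openin Z N" "z \<in> N" "openin TM V" "a \<in> V" "V \<times> N \<subseteq> ?B \<inter> Q" by blast
      have sub: "V \<times> V \<subseteq> V0 \<times> V0" "N \<subseteq> N0" "V \<subseteq> V0" using NV(2,4,5) by auto
      have "(\<lambda>z. restrict (l z) (V \<times> V)) \<in> P_quasitopology M E p (V \<times> V) (subtopology (subtopology Z N0) N)"
        by (rule P_quasitopology_restrict[OF P_quasitopology_subtopology[OF l] sub(1)])
      then have lN: "(\<lambda>z. restrict (l z) (V \<times> V)) \<in> P_quasitopology M E p (V \<times> V) (subtopology Z N)"
        using sub(2) by (simp add: subtopology_subtopology Int_absorb1)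
      have "diag_family M E p V (subtopology Z N) (\<lambda>z. \<lambda>a\<in>V. dgerm a (l z))"
      proof (rule diag_family.germs[OF NV(3) openin_box[OF NV(3)] _ lN])
        show "\<forall>z\<in>topspace (subtopology Z N). (\<lambda>a\<in>V. dgerm a (l z)) = (\<lambda>a\<in>V. dgerm a (restrict (l z) (V \<times> V)))"
          by (intro ballI restrict_ext) (simp add: dgerm_restrict[OF NV(3)])
      qed simp
      then have "diag_family M E p V (subtopology Z N) (\<lambda>z. \<lambda>a\<in>V. \<gamma>' z a)"
        by (rule diag_family_eq_on) (use \<gamma>'Q NV(5) in blast)
      moreover have "V \<times> N \<subseteq> D'" using NV(5) by (auto simp: D'_def)
      ultimately show ?thesis using NV by blast
    next
      case 3
      then have azD: "(a, z) \<in> D" and azB: "a \<in> V0" "z \<in> N0" by auto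
      from \<gamma>loc[OF azD] obtain N V where NV: "openin Z N" "z \<in> N" "openin TM V" "a \<in> V" "V \<times> N \<subseteq> D"
        "diag_family M E p V (subtopology Z N) (\<lambda>z. \<lambda>a\<in>V. \<gamma> z a)" by blast
      define V1 N1 where "V1 = V \<inter> V0" and "N1 = N \<inter> N0"
      have V1: "openin TM V1" "V1 \<subseteq> V" "V1 \<subseteq> V0" "a \<in> V1" "V1 \<subseteq> U" and N1: "openin Z N1" "N1 \<subseteq> N" "N1 \<subseteq> N0" "z \<in> N1"
        using NV V0 N0 azB by (auto simp: V1_def N1_def)
      have tN1: "topspace (subtopology Z N1) = N1" using openin_subset[OF N1(1)] by auto
      have f1: "diag_family M E p V1 (subtopology Z N1) (\<lambda>z. \<lambda>a\<in>V1. \<gamma> z a)"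
        by (rule diag_family_shrink[OF NV(6) V1(1,2) N1(2)])
      have l1: "l \<in> P_quasitopology M E p (V0 \<times> V0) (subtopology Z N1)"
        using P_quasitopology_subtopology[OF l, of N1] N1(3) by (simp add: subtopology_subtopology Int_absorb1)
      have sub: "V1 \<times> V1 \<subseteq> V0 \<times> V0" "V1 \<subseteq> fst c" using V1 V0 by auto
      have zN1: "z \<in> topspace (subtopology Z N1)" using N1(4) tN1 by simp
      have val: "h (a', a') = l z' (a', a')"
        if z': "z' \<in> topspace (subtopology Z N1)" and a': "a' \<in> V1" and g: "(\<lambda>a\<in>V1. \<gamma> z' a) a' = dgerm a' h" for z' a' h
      proof (rule jets_imp_value[OF diag_family_point[OF f1 z'] a' l1 V1(1) sub(1) z' a' _ g])
        have "(a', z') \<in> D" "a' \<in> V0" "z' \<in> N0" using z' a' tN1 V1 N1 NV(5) by auto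
        then show "germ_jet r a' ((\<lambda>a\<in>V1. \<gamma> z' a) a') = jet M E p r a' (\<lambda>q. l z' (a', q))"
          using \<gamma>jet l\<sigma> a' by simp
      qed
      have lval: "l z' (a', a') \<in> fst d" if "z' \<in> topspace (subtopology Z N1)" "a' \<in> V1" for z' a'
        using l\<sigma> that tN1 V1(3) N1(3) by auto
      have "\<exists>N V'. openin (subtopology Z N1) N \<and> z \<in> N \<and> openin TM V' \<and> a \<in> V' \<and> V' \<subseteq> V1 \<and>
        diag_family M E p V' (subtopology (subtopology Z N1) N)
          (\<lambda>z. \<lambda>a\<in>V'. mix_germ d a (\<lambda>b. \<theta> (b, z)) ((\<lambda>a\<in>V1. \<gamma> z a) a) (l z))"
        by (rule mix_family_local[OF f1 cd l1 V1(1) order_refl sub \<theta>res[OF V1(5)] \<theta>01 zN1 V1(4)])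
          (rule val lval, assumption+)+
      then obtain N2 V2 where N2: "openin (subtopology Z N1) N2" "z \<in> N2" and V2: "openin TM V2" "a \<in> V2" "V2 \<subseteq> V1"
        and m: "diag_family M E p V2 (subtopology (subtopology Z N1) N2)
          (\<lambda>z. \<lambda>a\<in>V2. mix_germ d a (\<lambda>b. \<theta> (b, z)) ((\<lambda>a\<in>V1. \<gamma> z a) a) (l z))"
        by (elim exE conjE)
      have N2': "openin Z N2" "N2 \<subseteq> N1" using N2(1) openin_open_subtopology[OF N1(1)] by auto
      have "diag_family M E p V2 (subtopology Z N2) (\<lambda>z. \<lambda>a\<in>V2. mix_germ d a (\<lambda>b. \<theta> (b, z)) ((\<lambda>a\<in>V1. \<gamma> z a) a) (l z))"
        using m N2'(2) by (simp only: subtopology_subtopology Int_absorb1)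
      then have "diag_family M E p V2 (subtopology Z N2) (\<lambda>z. \<lambda>a\<in>V2. \<gamma>' z a)"
      proof (rule diag_family_eq_on)
        fix z' a' assume "z' \<in> N2" "a' \<in> V2"
        then have "a' \<in> V1" "a' \<in> V" "a' \<in> V0" "z' \<in> N" "z' \<in> N0" using N2'(2) V2(3) V1 N1 by auto
        then have "(a', z') \<in> ?B" "(a', z') \<in> D" "a' \<in> V1" using NV(5) by blast+
        then show "\<gamma>' z' a' = mix_germ d a' (\<lambda>b. \<theta> (b, z')) ((\<lambda>a\<in>V1. \<gamma> z' a) a') (l z')" by (simp add: \<gamma>'_def)
      qed
      moreover have "V2 \<times> N2 \<subseteq> D'" using N2'(2) V2(3) V1 N1 by (auto simp: D'_def)
      ultimately show ?thesis using N2'(1) N2(2) V2 by blast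
    qed
  qed
  moreover have "openin ?Y D'" using oB oP by (auto simp: D'_def)
  moreover have "\<forall>(a, z)\<in>A. \<gamma>' z a = \<gamma> z a" using \<gamma>'P AP by auto
  ultimately show ?thesis using AP by (intro exI[of _ D'] exI[of _ \<gamma>']) (auto simp: D'_def)
qed

end

section \<open>Separation and countability of the parameter spaces, and the global lift\<close>

lemma second_countable_prod_topology:
  assumes "second_countable X" "second_countable Y"
  shows "second_countable (prod_topology X Y)"
proof -
  obtain A where A: "countable A" "\<And>V. V \<in> A \<Longrightarrow> openin X V" "\<And>U x. openin X U \<and> x \<in> U \<longrightarrow> (\<exists>V \<in> A. x \<in> V \<and> V \<subseteq> U)"
    using assms(1) by (auto simp: second_countable_def)
  obtain B where B: "countable B" "\<And>V. V \<in> B \<Longrightarrow> openin Y V" "\<And>U x. openin Y U \<and> x \<in> U \<longrightarrow> (\<exists>V \<in> B. x \<in> V \<and> V \<subseteq> U)"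
    using assms(2) by (auto simp: second_countable_def)
  show ?thesis unfolding second_countable_def
  proof (intro exI conjI ballI allI impI)
    let ?C = "(\<lambda>(S, T). S \<times> T) ` (A \<times> B)"
    show "countable ?C" using A(1) B(1) by (intro countable_image countable_SIGMA)
    show "openin (prod_topology X Y) V" if "V \<in> ?C" for V
      using that A(2) B(2) by (auto simp: openin_prod_Times_iff)
    fix W x assume W: "openin (prod_topology X Y) W \<and> x \<in> W"
    obtain a b where x: "x = (a, b)" by (cases x)
    have "(a, b) \<in> W" and oW: "openin (prod_topology X Y) W" using W x by auto
    from openin_prod_topology_alt[THEN iffD1, OF oW, THEN spec, THEN spec, THEN mp, OF this(1)]
    obtain S T where "openin X S" "openin Y T" "a \<in> S" "b \<in> T" and ST: "S \<times> T \<subseteq> W" by (elim exE conjE)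
    then obtain S' T' where "S' \<in> A" "a \<in> S'" "S' \<subseteq> S" "T' \<in> B" "b \<in> T'" "T' \<subseteq> T"
      using A(3)[of S a] B(3)[of T b] by blast
    then show "\<exists>V\<in>?C. x \<in> V \<and> V \<subseteq> W"
      using ST x by (intro bexI[of _ "S' \<times> T'"]) auto
  qed
qed

lemma second_countable_euclidean: "second_countable (euclidean :: 'a::second_countable_topology topology)"
proof -
  obtain B :: "'a set set" where B: "countable B" "\<And>C. C \<in> B \<Longrightarrow> open C" "\<And>S. open S \<Longrightarrow> \<exists>U. U \<subseteq> B \<and> S = \<Union>U"
    using univ_second_countable by blast
  show ?thesis unfolding second_countable_def
  proof (intro exI[of _ B] conjI ballI allI impI)
    show "countable B" by fact
    show "openin euclidean V" if "V \<in> B" for V using B(2)[OF that] by simp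
    fix U :: "'a set" and x assume U: "openin euclidean U \<and> x \<in> U"
    then obtain \<U> where "\<U> \<subseteq> B" "U = \<Union>\<U>" using B(3)[of U] by auto
    then show "\<exists>V\<in>B. x \<in> V \<and> V \<subseteq> U" using U by blast
  qed
qed

context smooth_bundle
begin

text \<open>Closed coordinate balls are compact, so the manifold is locally compact, and a locally
  compact Hausdorff space is regular. Normality of the product with the parameters is derived from
  this.\<close>

lemma regular_TM: "regular_space TM"
proof (rule locally_compact_Hausdorff_imp_regular_space)
  show "Hausdorff_space TM" by (rule smooth_manifoldD(7)[OF manifolds(1)])
  show "locally_compact_space TM"
    unfolding locally_compact_space_def
  proof
    fix x assume "x \<in> topspace TM"
    then obtain U \<phi> where U: "(U, \<phi>) \<in> atlas M" "x \<in> U" using smooth_manifoldD(5)[OF manifolds(1)] by blast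
    note C = topological_chartD[OF smooth_manifoldD(3)[OF manifolds(1) U(1)]]
    obtain r where r: "r > 0" "cball (\<phi> x) r \<subseteq> \<phi> ` U"
      using C(2) U(2) open_contains_cball by blast
    let ?K = "inv_into U \<phi> ` cball (\<phi> x) r" and ?V = "{u \<in> topspace (subtopology TM U). \<phi> u \<in> ball (\<phi> x) r}"
    have "compactin (top_of_set (\<phi> ` U)) (cball (\<phi> x) r)"
      using smooth_manifoldD(2)[OF manifolds(1)] r(2) by (simp add: compactin_subtopology)
    then have K: "compactin TM ?K" by (rule image_compactin[OF _ C(6)])
    have "openin (subtopology TM U) ?V" by (rule openin_continuous_map_preimage[OF C(5)]) simp
    then have V: "openin TM ?V" "?V \<subseteq> U" using openin_open_subtopology[OF C(1)] by auto
    have "?V \<subseteq> ?K"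
    proof
      fix u assume "u \<in> ?V"
      then have "u \<in> U" "\<phi> u \<in> cball (\<phi> x) r" by auto
      then show "u \<in> ?K" using inv_into_f_f[OF C(3)] by (metis image_eqI)
    qed
    moreover have "x \<in> ?V" using U(2) C(4) r(1) by auto
    ultimately show "\<exists>U K. openin TM U \<and> compactin TM K \<and> x \<in> U \<and> U \<subseteq> K" using K V(1) by blast
  qed
qed

lemma partial_lift_total:
  assumes Z: "compact_space Z" and U: "openin TM U" and \<gamma>: "partial_lift r Z \<sigma> (U \<times> topspace Z) \<gamma>"
  shows "diag_family M E p U Z (\<lambda>z. \<lambda>a\<in>U. \<gamma> z a)"
proof (rule diag_family_localI[OF Z U])
  fix a z assume "a \<in> U" "z \<in> topspace Z"
  then obtain N V where *: "openin Z N" "z \<in> N" "openin TM V" "a \<in> V" "V \<times> N \<subseteq> U \<times> topspace Z"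
        "diag_family M E p V (subtopology Z N) (\<lambda>z. \<lambda>a\<in>V. \<gamma> z a)"
    using \<gamma> unfolding partial_lift_def by blast
  then have "V \<subseteq> U" by blast
  then show "\<exists>N V. openin Z N \<and> z \<in> N \<and> openin TM V \<and> a \<in> V \<and> V \<subseteq> U \<and> diag_family M E p V (subtopology Z N) (\<lambda>z. \<lambda>a\<in>V. \<gamma> z a)"
    using * by blast
qed

text \<open>The partial lift compared with may change from point to point. This serves for the limit
  of a sequence of lifts that becomes constant on a neighbourhood of each point.\<close>

lemma partial_lift_union:
  assumes D: "\<And>a z. (a, z) \<in> T \<Longrightarrow> \<exists>S D \<gamma>'. (a, z) \<in> S \<and> openin (param_topology U Z) S \<and> S \<subseteq> D \<and> S \<subseteq> T \<and> partial_lift r Z \<sigma> D \<gamma>' \<and>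
      (\<forall>(a, z)\<in>S. \<gamma> z a = \<gamma>' z a)" and U: "openin TM U"
  shows "partial_lift r Z \<sigma> T \<gamma>"
  unfolding partial_lift_def
proof (intro conjI allI impI)
  fix a z assume "(a, z) \<in> T"
  from D[OF this] obtain S D \<gamma>' where S: "(a, z) \<in> S" "openin (param_topology U Z) S" "S \<subseteq> D" "S \<subseteq> T" "partial_lift r Z \<sigma> D \<gamma>'"
    "\<forall>(a, z)\<in>S. \<gamma> z a = \<gamma>' z a" by blast
  have azD: "(a, z) \<in> D" using S by blast
  have "germ_jet r a (\<gamma>' z a) = \<sigma> (a, z)" using S(5) azD unfolding partial_lift_def by blast
  then show "germ_jet r a (\<gamma> z a) = \<sigma> (a, z)" using bspec[OF S(6,1)] by simp
  obtain N V where NV: "openin Z N" "z \<in> N" "openin TM V" "a \<in> V" "V \<times> N \<subseteq> S"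
    using param_nbhd[OF U S(2,1)] by blast
  from azD obtain N1 V1 where N1: "openin Z N1" "z \<in> N1" "openin TM V1" "a \<in> V1" "diag_family M E p V1 (subtopology Z N1) (\<lambda>z. \<lambda>a\<in>V1. \<gamma>' z a)"
    using S(5) unfolding partial_lift_def by blast
  have "openin TM (V \<inter> V1)" using NV N1 by auto
  then have "diag_family M E p (V \<inter> V1) (subtopology Z (N \<inter> N1)) (\<lambda>z. \<lambda>a\<in>(V \<inter> V1). \<gamma>' z a)"
    by (rule diag_family_shrink[OF N1(5)]) auto
  then have "diag_family M E p (V \<inter> V1) (subtopology Z (N \<inter> N1)) (\<lambda>z. \<lambda>a\<in>(V \<inter> V1). \<gamma> z a)"
    by (rule diag_family_eq_on) (use S(6) NV(5) in blast)
  moreover have "(V \<inter> V1) \<times> (N \<inter> N1) \<subseteq> T" using NV(5) S(4) by blast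
  moreover have "openin Z (N \<inter> N1)" "z \<in> N \<inter> N1" "a \<in> V \<inter> V1" using NV N1 by auto
  ultimately show "\<exists>N V. openin Z N \<and> z \<in> N \<and> openin TM V \<and> a \<in> V \<and> V \<times> N \<subseteq> T \<and> diag_family M E p V (subtopology Z N) (\<lambda>z. \<lambda>a\<in>V. \<gamma> z a)"
    using \<open>openin TM (V \<inter> V1)\<close> by blast
qed

lemma lifting:
  fixes Z :: "'z topology" and \<gamma>0 :: "'z \<Rightarrow> 'm \<Rightarrow> ('m \<times> 'm \<Rightarrow> 'e) set"
  assumes Z: "compact_space Z" "regular_space Z" "second_countable Z" and U: "openin TM U"
    and \<sigma>: "\<sigma> \<in> jet_quasitopology M E p r U Z"
    and D0: "openin (param_topology U Z) D0" and A0: "closedin (param_topology U Z) A0" "A0 \<subseteq> D0"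
    and \<gamma>0: "partial_lift r Z (\<lambda>(a, z). \<sigma> z a) D0 \<gamma>0"
  shows "\<exists>\<gamma>. diag_family M E p U Z \<gamma> \<and> (\<forall>z\<in>topspace Z. \<forall>a\<in>U. germ_jet r a (\<gamma> z a) = \<sigma> z a) \<and> 
    (\<forall>(a, z)\<in>A0. \<gamma> z a = \<gamma>0 z a) \<and> (\<forall>z. \<gamma> z \<in> extensional U)"
proof -
  let ?Y = "param_topology U Z"
  let ?\<sigma> = "\<lambda>(a, z). \<sigma> z a"
  note tU = topspace_sub[OF U]
  have tY: "topspace ?Y = U \<times> topspace Z" using tU by simp
  have regY: "regular_space ?Y"
    unfolding regular_space_prod_topology using regular_space_subtopology[OF regular_TM] Z(2) by blast
  have scY: "second_countable ?Y"
    by (intro second_countable_prod_topology second_countable_subtopology smooth_manifoldD(8)[OF manifolds(1)] Z(3))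
  have LY: "Lindelof_space ?Y" using scY by (rule second_countable_imp_Lindelof_space)
  \<comment> \<open>Normality is what the Urysohn function of each extension step requires; the
    Lindelof property is used once more to extract a countable cover.\<close>
  have nY: "normal_space ?Y" by (rule regular_Lindelof_imp_normal_space[OF regY LY])
  \<comment> \<open>Any partial lift can be extended over \<open>C\<close> while keeping its values
    on a closed part \<open>A\<close> of its domain. The open sets \<open>S\<close> serve to cover,
    the closed sets \<open>C\<close> around them to be frozen in later steps.\<close>
  define good where "good S C \<longleftrightarrow> openin ?Y S \<and> closedin ?Y C \<and> S \<subseteq> C \<and>
    (\<forall>D \<gamma> A. openin ?Y D \<longrightarrow> closedin ?Y A \<longrightarrow> A \<subseteq> D \<longrightarrow> partial_lift r Z ?\<sigma> D \<gamma> \<longrightarrow>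
      (\<exists>D' \<gamma>'. openin ?Y D' \<and> A \<union> C \<subseteq> D' \<and> partial_lift r Z ?\<sigma> D' \<gamma>' \<and> (\<forall>(a, z)\<in>A. \<gamma>' z a = \<gamma> z a)))" for S C
  have goodD: "openin ?Y S" "closedin ?Y C" "S \<subseteq> C" if "good S C" for S C
    using that[unfolded good_def] by (simp_all only: simp_thms)
  have ex_good: "\<exists>S C. good S C \<and> y \<in> S" if y: "y \<in> topspace ?Y" for y
  proof -
    obtain a z where az: "y = (a, z)" "a \<in> U" "z \<in> topspace Z" using y tY by auto
    obtain c d N V l where loc: "(c, d) \<in> adapted_charts M E p" "openin Z N" "z \<in> N" "openin TM V" "a \<in> V" "V \<subseteq> U" "V \<subseteq> fst c"
      "l \<in> P_quasitopology M E p (V \<times> V) (subtopology Z N)"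
      "\<forall>z\<in>N. \<forall>a\<in>V. l z (a, a) \<in> fst d \<and> jet M E p r a (\<lambda>q. l z (a, q)) = ?\<sigma> (a, z)"
      using local_lift[OF U jet_quasitopologyD(1)[OF \<sigma>] _ az(3,2)] jet_quasitopologyD(4)[OF \<sigma>] by (auto 0 3)
    have "openin (subtopology TM U) V" using loc by (simp add: openin_open_subtopology[OF U])
    then have "openin ?Y (V \<times> N)" using loc by (simp add: openin_prod_Times_iff)
    moreover have "(a, z) \<in> V \<times> N" using loc by simp
    \<comment> \<open>Only closed sets can be frozen, so regularity is used to shrink the box of the
      local lift to a closed neighbourhood.\<close>
    ultimately obtain S C where SC: "openin ?Y S" "closedin ?Y C" "(a, z) \<in> S" "S \<subseteq> C" "C \<subseteq> V \<times> N"
      using regY unfolding neighbourhood_base_of_closedin[symmetric] neighbourhood_base_of by metis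
    have "good S C" unfolding good_def
    proof (intro conjI allI impI SC)
      fix D \<gamma> A assume D: "openin ?Y D" "closedin ?Y A" "A \<subseteq> D" "partial_lift r Z ?\<sigma> D \<gamma>"
      from partial_lift_step[OF U nY D loc(1,2,4,6,7,8,9)]
      obtain D' \<gamma>' where D': "openin ?Y D'" "A \<subseteq> D'" "V \<times> N \<subseteq> D'" "partial_lift r Z ?\<sigma> D' \<gamma>'" "\<forall>(a, z)\<in>A. \<gamma>' z a = \<gamma> z a"
        by (elim exE conjE)
      moreover have "A \<union> C \<subseteq> D'" using D'(2,3) SC(5) by (meson Un_least order_trans)
      ultimately show "\<exists>D' \<gamma>'. openin ?Y D' \<and> A \<union> C \<subseteq> D' \<and> partial_lift r Z ?\<sigma> D' \<gamma>' \<and> (\<forall>(a, z)\<in>A. \<gamma>' z a = \<gamma> z a)"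
        by (intro exI[of _ D'] exI[of _ \<gamma>'] conjI)
    qed
    then show ?thesis using SC(3) az(1) by blast
  qed
  have "\<exists>\<V>. countable \<V> \<and> \<V> \<subseteq> {S. \<exists>C. good S C} \<and> \<Union>\<V> = topspace ?Y"
  proof (rule Lindelof_spaceD[OF LY])
    show "openin ?Y S" if "S \<in> {S. \<exists>C. good S C}" for S using that goodD(1) by blast
    show "\<Union>{S. \<exists>C. good S C} = topspace ?Y"
    proof
      show "\<Union>{S. \<exists>C. good S C} \<subseteq> topspace ?Y" using goodD(1) openin_subset by (intro Union_least) blast
      show "topspace ?Y \<subseteq> \<Union>{S. \<exists>C. good S C}" using ex_good by blast
    qed
  qed
  then obtain \<V> where V: "countable \<V>" "\<V> \<subseteq> {S. \<exists>C. good S C}" "\<Union>\<V> = topspace ?Y" by (elim exE conjE)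
  have "\<exists>\<gamma>. partial_lift r Z ?\<sigma> (topspace ?Y) \<gamma> \<and> (\<forall>(a, z)\<in>A0. \<gamma> z a = \<gamma>0 z a)"
  proof (cases "\<V> = {}")
    case True
    have e: "topspace ?Y = {}" unfolding V(3)[symmetric] True by (rule Union_empty)
    have "partial_lift r Z ?\<sigma> (topspace ?Y) \<gamma>0" unfolding e partial_lift_def by blast
    then show ?thesis by (intro exI[of _ \<gamma>0]) auto
  next
    case False
    define S where "S i = from_nat_into \<V> i" for i
    have S\<V>: "S i \<in> \<V>" for i unfolding S_def by (rule from_nat_into[OF False])
    have "\<forall>i. \<exists>C. good (S i) C" using subsetD[OF V(2) S\<V>] by simp
    then have "\<exists>C. \<forall>i. good (S i) (C i)" by (rule choice)
    then obtain C where C': "\<forall>i. good (S i) (C i)" by (elim exE)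
    note C = C'[THEN spec]
    have cover: "\<exists>i. y \<in> S i" if "y \<in> topspace ?Y" for y
    proof -
      have "y \<in> \<Union>\<V>" using that unfolding V(3) .
      then obtain T where T: "T \<in> \<V>" "y \<in> T" by (rule UnionE)
      obtain i where "S i = T" unfolding S_def using from_nat_into_surj[OF V(1) T(1)] by (elim exE)
      then show ?thesis using T(2) by (intro exI[of _ i]) simp
    qed
    define A where "A i = A0 \<union> (\<Union>j<i. C j)" for i :: nat
    have clA: "closedin ?Y (A i)" for i
      unfolding A_def using A0(1) C by (intro closedin_Un closedin_Union) (auto intro: goodD(2))
    define P where "P i x \<longleftrightarrow> openin ?Y (fst x) \<and> A i \<subseteq> fst x \<and> partial_lift r Z ?\<sigma> (fst x) (snd x)" for i and x :: "('m \<times> 'z) set \<times> ('z \<Rightarrow> 'm \<Rightarrow> ('m \<times> 'm \<Rightarrow> 'e) set)"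
    \<comment> \<open>Dependent choice only asserts that some initial element exists; the clause for
      \<open>i = 0\<close> pins it to the given lift.\<close>
    define P' where "P' i x \<longleftrightarrow> P i x \<and> (i = 0 \<longrightarrow> x = (D0, \<gamma>0))" for i x
    have "\<exists>F. \<forall>i. P' i (F i) \<and> (\<forall>(a, z)\<in>A i. snd (F (Suc i)) z a = snd (F i) z a)"
    proof (rule dependent_nat_choice)
      show "\<exists>x. P' 0 x" using D0 A0(2) \<gamma>0 by (intro exI[of _ "(D0, \<gamma>0)"]) (simp add: P'_def P_def A_def)
      fix x i assume "P' i x"
      then have x: "openin ?Y (fst x)" "A i \<subseteq> fst x" "partial_lift r Z ?\<sigma> (fst x) (snd x)" by (auto simp: P'_def P_def)
      have "\<exists>D' \<gamma>'. openin ?Y D' \<and> A i \<union> C i \<subseteq> D' \<and> partial_lift r Z ?\<sigma> D' \<gamma>' \<and> (\<forall>(a, z)\<in>A i. \<gamma>' z a = snd x z a)"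
        using C[of i, unfolded good_def, THEN conjunct2, THEN conjunct2, THEN conjunct2, rule_format, OF x(1) clA x(2,3)] .
      then obtain D' \<gamma>' where D': "openin ?Y D'" "A i \<union> C i \<subseteq> D'" "partial_lift r Z ?\<sigma> D' \<gamma>'" "\<forall>(a, z)\<in>A i. \<gamma>' z a = snd x z a"
        by blast
      have "A (Suc i) = A i \<union> C i" by (auto simp: A_def lessThan_Suc)
      then show "\<exists>y. P' (Suc i) y \<and> (\<forall>(a, z)\<in>A i. snd y z a = snd x z a)"
        using D' by (intro exI[of _ "(D', \<gamma>')"]) (simp add: P'_def P_def)
    qed
    then obtain F where F: "\<And>i. P' i (F i)" "\<And>i. \<forall>(a, z)\<in>A i. snd (F (Suc i)) z a = snd (F i) z a" by blast
    have monoA: "A i \<subseteq> A j" if "i \<le> j" for i j using that by (fastforce simp: A_def)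
    have stable: "snd (F j) z a = snd (F i) z a" if "i \<le> j" "(a, z) \<in> A i" for i j a z
      using that(1)
    proof (induction j rule: dec_induct)
      case base then show ?case by simp
    next
      case (step n)
      have "(a, z) \<in> A n" using monoA[OF step.hyps(1)] that(2) by blast
      then show ?case using F(2)[of n] step.IH by auto
    qed
    \<comment> \<open>From step \<open>Suc i\<close> on the values over \<open>S i\<close> are
      frozen, so every index whose set contains the point gives the same germ; the least one is just
      a definite choice.\<close>
    define \<gamma> where "\<gamma> z a = snd (F (Suc (LEAST i. (a, z) \<in> S i))) z a" for z a
    have SA: "S i \<subseteq> A (Suc i)" for i using goodD(3)[OF C[of i]] by (auto simp: A_def lessThan_Suc)
    have \<gamma>S: "\<gamma> z a = snd (F (Suc i)) z a" if "(a, z) \<in> S i" for a z i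
    proof -
      let ?k = "LEAST i. (a, z) \<in> S i"
      have "(a, z) \<in> S ?k" "?k \<le> i" using that by (auto intro: LeastI Least_le)
      then show ?thesis unfolding \<gamma>_def using stable[of "Suc ?k" "Suc i" a z] SA by auto
    qed
    have "partial_lift r Z ?\<sigma> (topspace ?Y) \<gamma>"
    proof (rule partial_lift_union[OF _ U])
      fix a z assume "(a, z) \<in> topspace ?Y"
      then obtain i where i: "(a, z) \<in> S i" using cover by blast
      have o: "openin ?Y (S i)" by (rule goodD(1)[OF C])
      have "S i \<subseteq> fst (F (Suc i))" "partial_lift r Z ?\<sigma> (fst (F (Suc i))) (snd (F (Suc i)))"
        using F(1)[of "Suc i"] SA[of i] by (auto simp: P'_def P_def)
      then show "\<exists>S D \<gamma>'. (a, z) \<in> S \<and> openin ?Y S \<and> S \<subseteq> D \<and> S \<subseteq> topspace ?Y \<and> partial_lift r Z ?\<sigma> D \<gamma>' \<and> (\<forall>(a, z)\<in>S. \<gamma> z a = \<gamma>' z a)"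
        using i o openin_subset[OF o] \<gamma>S by (intro exI[of _ "S i"] exI[of _ "fst (F (Suc i))"] exI[of _ "snd (F (Suc i))"]) auto
    qed
    moreover have "\<gamma> z a = \<gamma>0 z a" if "(a, z) \<in> A0" for a z
    proof -
      have "(a, z) \<in> topspace ?Y" using that closedin_subset[OF A0(1)] by blast
      then obtain i where i: "(a, z) \<in> S i" using cover by blast
      have "\<gamma> z a = snd (F (Suc i)) z a" by (rule \<gamma>S[OF i])
      also have "\<dots> = snd (F 0) z a" using that by (intro stable) (auto simp: A_def)
      also have "F 0 = (D0, \<gamma>0)" using F(1)[of 0] by (simp add: P'_def)
      finally show ?thesis by simp
    qed
    ultimately show ?thesis by (intro exI[of _ \<gamma>]) auto
  qed
  then obtain \<gamma> where \<gamma>: "partial_lift r Z ?\<sigma> (U \<times> topspace Z) \<gamma>" "\<forall>(a, z)\<in>A0. \<gamma> z a = \<gamma>0 z a" unfolding tY by blast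
  show ?thesis
  proof (intro exI[of _ "\<lambda>z. \<lambda>a\<in>U. \<gamma> z a"] conjI)
    show "diag_family M E p U Z (\<lambda>z. \<lambda>a\<in>U. \<gamma> z a)" by (rule partial_lift_total[OF Z(1) U \<gamma>(1)])
    show "\<forall>z\<in>topspace Z. \<forall>a\<in>U. germ_jet r a ((\<lambda>a\<in>U. \<gamma> z a) a) = \<sigma> z a"
      using \<gamma>(1) unfolding partial_lift_def by auto
    show "\<forall>(a, z)\<in>A0. (\<lambda>a\<in>U. \<gamma> z a) a = \<gamma>0 z a"
      using \<gamma>(2) closedin_subset[OF A0(1)] unfolding tY by auto
  qed simp
qed

end

section \<open>Weak equivalences from relative lifting\<close>


lemma quasitopologyD:
  assumes "quasitopology_on X (A :: ('z, 'a) quasitopology)"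
  shows "\<And>Z f z. f \<in> A Z \<Longrightarrow> z \<in> topspace Z \<Longrightarrow> f z \<in> X"
    "\<And>Z f g. g \<in> A Z \<Longrightarrow> (\<And>z. z \<in> topspace Z \<Longrightarrow> f z = g z) \<Longrightarrow> f \<in> A Z"
    "\<And>Z Z' \<phi> f. f \<in> A Z \<Longrightarrow> continuous_map Z' Z \<phi> \<Longrightarrow> f \<circ> \<phi> \<in> A Z'"
    "\<And>Z \<C> f. (\<And>C. C \<in> \<C> \<Longrightarrow> openin Z C) \<Longrightarrow> (\<And>C. C \<in> \<C> \<Longrightarrow> f \<in> A (subtopology Z C)) \<Longrightarrow> \<Union>\<C> = topspace Z \<Longrightarrow> f \<in> A Z"
    "\<And>Z C D f. closedin Z C \<Longrightarrow> closedin Z D \<Longrightarrow> C \<union> D = topspace Z \<Longrightarrow> f \<in> A (subtopology Z C) \<Longrightarrow>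
       f \<in> A (subtopology Z D) \<Longrightarrow> f \<in> A Z"
proof -
  note q = assms[unfolded quasitopology_on_def]
  note q1 = q[THEN conjunct1] and q2 = q[THEN conjunct2, THEN conjunct1]
    and q3 = q[THEN conjunct2, THEN conjunct2, THEN conjunct1]
    and q4 = q[THEN conjunct2, THEN conjunct2, THEN conjunct2, THEN conjunct1, THEN spec, THEN spec, THEN spec, THEN mp]
    and q5 = q[THEN conjunct2, THEN conjunct2, THEN conjunct2, THEN conjunct2, THEN spec, THEN spec, THEN spec, THEN spec, THEN mp]
  show "f z \<in> X" if "f \<in> A Z" "z \<in> topspace Z" for Z f z
    by (rule subsetD[OF q1[rule_format, OF that(1)] imageI[OF that(2)]])
  show "f \<in> A Z" if "g \<in> A Z" "\<And>z. z \<in> topspace Z \<Longrightarrow> f z = g z" for Z f g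
    by (rule q2[rule_format, OF that])
  show "f \<circ> \<phi> \<in> A Z'" if "f \<in> A Z" "continuous_map Z' Z \<phi>" for Z Z' \<phi> f
    by (rule q3[rule_format, OF that])
  show "f \<in> A Z" if "\<And>C. C \<in> \<C> \<Longrightarrow> openin Z C" "\<And>C. C \<in> \<C> \<Longrightarrow> f \<in> A (subtopology Z C)" "\<Union>\<C> = topspace Z" for Z \<C> f
    by (rule q4[of \<C> Z f]) (intro conjI ballI that)
  show "f \<in> A Z" if "closedin Z C" "closedin Z D" "C \<union> D = topspace Z" "f \<in> A (subtopology Z C)" "f \<in> A (subtopology Z D)" for Z C D f
    by (rule q5[of Z C D f]) (intro conjI that)
qed

section \<open>Cubes, collars and homotopies of spheroids\<close>

lemma topspace_cube [simp]: "topspace (cube n) = cube_set n"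
  by (simp add: cube_def)

lemma cube_coordinate: "continuous_on S (\<lambda>x::nat \<Rightarrow> real. x i)"
  by (rule continuous_on_subset[OF continuous_on_product_coordinates]) simp

lemma cube_mapI:
  assumes "\<And>i. continuous_on S (\<lambda>x. \<phi> x i)" "\<And>x. x \<in> S \<Longrightarrow> \<phi> x \<in> cube_set n"
  shows "continuous_map (top_of_set S) (cube n) \<phi>"
proof -
  have "continuous_on S \<phi>" by (rule continuous_on_coordinatewise_then_product) (rule assms(1))
  then show ?thesis using assms(2) by (auto simp: cube_def continuous_map_in_subtopology)
qed

lemma cube_update:
  assumes "x \<in> cube_set n" "0 \<le> t" "t \<le> 1"
  shows "x(n := t) \<in> cube_set (Suc n)"
  using assms by (auto simp: cube_set_def less_Suc_eq)

text \<open>Points of \<open>cube_set n\<close> vanish from coordinate \<open>n\<close> on, so the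
  smaller cube literally is the bottom face of the larger one, and a homotopy at time 0 is its value
  at the point itself.\<close>

lemma cube_set_Suc: "cube_set n \<subseteq> cube_set (Suc n)"
  by (auto simp: cube_set_def less_Suc_eq)

lemma cube_set_project: "y \<in> cube_set (Suc n) \<Longrightarrow> y(n := 0) \<in> cube_set n"
  by (auto simp: cube_set_def)

lemma cube_set_last: "x \<in> cube_set n \<Longrightarrow> x(n := 0) = x"
  by (auto simp: cube_set_def)

lemma continuous_on_update:
  fixes t :: "(nat \<Rightarrow> real) \<Rightarrow> real"
  assumes "continuous_on S t"
  shows "continuous_on S (\<lambda>y. (y(n := t y)) i)"
  by (cases "i = n") (use assms cube_coordinate in auto)

definition clamp01 :: "real \<Rightarrow> real" where "clamp01 t = max 0 (min 1 t)"

lemma clamp01: "0 \<le> clamp01 t" "clamp01 t \<le> 1"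
  by (auto simp: clamp01_def)

lemma continuous_on_clamp01 [continuous_intros]: "continuous_on S t \<Longrightarrow> continuous_on S (\<lambda>x. clamp01 (t x))"
  unfolding clamp01_def by (intro continuous_intros)

text \<open>The case \<open>t = 1\<close> stretches the middle half of each coordinate over the unit interval and collapses the
  rest to the boundary; \<open>t\<close> is the parameter of a homotopy from the identity.\<close>

definition collar :: "nat \<Rightarrow> real \<Rightarrow> (nat \<Rightarrow> real) \<Rightarrow> nat \<Rightarrow> real" where
  "collar n t x = (\<lambda>i. if i < n then clamp01 ((1 + t) * x i - t / 2) else 0)"

lemma collar_cube: "collar n t x \<in> cube_set n"
  by (auto simp: collar_def cube_set_def clamp01)

lemma collar_0: "x \<in> cube_set n \<Longrightarrow> collar n 0 x = x"
  by (auto simp: collar_def cube_set_def clamp01_def fun_eq_iff)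

text \<open>The affine map under the clamp sends 0 to \<open>- t / 2\<close> and 1 to
  \<open>1 + t / 2\<close>, so both ends stay where they are.\<close>

lemma collar_boundary:
  assumes "0 \<le> t" "x \<in> cube_boundary n"
  shows "collar n t x \<in> cube_boundary n"
proof -
  obtain i where i: "i < n" "x i = 0 \<or> x i = 1" using assms(2) by (auto simp: cube_boundary_def)
  then have "collar n t x i = 0 \<or> collar n t x i = 1"
    using assms(1) by (auto simp: collar_def clamp01_def max_def min_def)
  then show ?thesis using i(1) collar_cube[of n t x] by (auto simp: cube_boundary_def)
qed

text \<open>For \<open>t = 1\<close> the affine map is \<open>2 * x i - 1 / 2\<close>, which is
  negative below 1/4 and exceeds 1 above 3/4; the clamp then gives 0 or 1.\<close>

lemma collar_near_boundary:
  assumes "i < n" "x i < 1/4 \<or> x i > 3/4"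
  shows "collar n 1 x \<in> cube_boundary n"
proof -
  have "collar n 1 x i = 0 \<or> collar n 1 x i = 1"
    using assms by (auto simp: collar_def clamp01_def max_def min_def)
  then show ?thesis using assms(1) collar_cube[of n 1 x] by (auto simp: cube_boundary_def)
qed

lemma collar_Suc: "collar (Suc n) t y = (collar n t y)(n := clamp01 ((1 + t) * y n - t / 2))"
  by (auto simp: collar_def fun_eq_iff less_Suc_eq)

lemma collar_update [simp]: "collar n t (y(n := s)) = collar n t y"
  by (auto simp: collar_def fun_eq_iff)

lemma continuous_on_collar:
  assumes "continuous_on S t"
  shows "continuous_on S (\<lambda>y. collar n (t y) y i)"
  unfolding collar_def by (cases "i < n") (auto intro!: continuous_intros assms cube_coordinate)

lemma collar_continuous_map: "continuous_map (top_of_set S) (cube n) (collar n 1)"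
  by (rule cube_mapI[OF continuous_on_collar collar_cube]) simp

lemma spheroid_homotopyI:
  assumes "f \<in> spheroids A n a" "g \<in> spheroids A n a" "H \<in> A (cube (Suc n))"
    "\<And>x. x \<in> cube_set n \<Longrightarrow> H x = f x" "\<And>x. x \<in> cube_set n \<Longrightarrow> H (x(n := 1)) = g x"
    "\<And>x t. x \<in> cube_boundary n \<Longrightarrow> 0 \<le> t \<Longrightarrow> t \<le> 1 \<Longrightarrow> H (x(n := t)) = a"
  shows "(f, g) \<in> spheroid_homotopy A n a"
  using assms unfolding spheroid_homotopy_def by (auto intro!: bexI[of _ H])

lemma spheroid_homotopyE:
  assumes "(f, g) \<in> spheroid_homotopy A n a"
  obtains H where "f \<in> spheroids A n a" "g \<in> spheroids A n a" "H \<in> A (cube (Suc n))"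
    "\<And>x. x \<in> cube_set n \<Longrightarrow> H x = f x" "\<And>x. x \<in> cube_set n \<Longrightarrow> H (x(n := 1)) = g x"
    "\<And>x t. x \<in> cube_boundary n \<Longrightarrow> 0 \<le> t \<Longrightarrow> t \<le> 1 \<Longrightarrow> H (x(n := t)) = a"
  using assms unfolding spheroid_homotopy_def by auto

lemma cube_boundary_subset: "cube_boundary n \<subseteq> cube_set n"
  by (auto simp: cube_boundary_def)

context
  fixes X :: "'a set" and A :: "(nat \<Rightarrow> real, 'a) quasitopology"
  assumes q: "quasitopology_on X A"
begin

text \<open>The time coordinate of the homotopy is used as the parameter of the collar; the boundary
  of the cube stays in the boundary throughout, where the spheroid is constant.\<close>

lemma spheroid_homotopy_collar:
  assumes "f \<in> spheroids A n a"
  shows "(f, f \<circ> collar n 1) \<in> spheroid_homotopy A n a"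
proof (rule spheroid_homotopyI)
  let ?H = "f \<circ> (\<lambda>y. collar n (y n) y)"
  have fA: "f \<in> A (cube n)" and fb: "\<And>x. x \<in> cube_boundary n \<Longrightarrow> f x = a"
    using assms by (auto simp: spheroids_def)
  show "f \<in> spheroids A n a" by fact
  have "f \<circ> collar n 1 \<in> A (cube n)"
    using quasitopologyD(3)[OF q fA, of "cube n" "collar n 1"] collar_continuous_map[of "cube_set n" n] by (simp add: cube_def)
  then show "f \<circ> collar n 1 \<in> spheroids A n a"
    using fb collar_boundary[of 1] by (simp add: spheroids_def)
  have "continuous_map (cube (Suc n)) (cube n) (\<lambda>y. collar n (y n) y)"
    unfolding cube_def[of "Suc n"] by (rule cube_mapI[OF continuous_on_collar[OF cube_coordinate] collar_cube])
  then show "?H \<in> A (cube (Suc n))" by (rule quasitopologyD(3)[OF q fA])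
  show "?H x = f x" if "x \<in> cube_set n" for x
  proof -
    have "x n = 0" using that by (auto simp: cube_set_def)
    then show ?thesis using collar_0[OF that] by simp
  qed
  show "?H (x(n := 1)) = (f \<circ> collar n 1) x" for x by simp
  show "?H (x(n := t)) = a" if "x \<in> cube_boundary n" "0 \<le> t" "t \<le> 1" for x t
    using fb[OF collar_boundary[OF that(2,1)]] by simp
qed

text \<open>Spheroids are HOL functions and may differ off the cube while agreeing on it. The
  constant homotopy identifies them; with \<open>g = f\<close> this is reflexivity.\<close>

lemma spheroid_homotopy_cong:
  assumes f: "f \<in> spheroids A n a" and g: "\<And>x. x \<in> cube_set n \<Longrightarrow> g x = f x"
  shows "(f, g) \<in> spheroid_homotopy A n a"
proof (rule spheroid_homotopyI)
  let ?H = "f \<circ> (\<lambda>y. y(n := 0))"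
  have fA: "f \<in> A (cube n)" and fb: "\<And>x. x \<in> cube_boundary n \<Longrightarrow> f x = a"
    using f by (auto simp: spheroids_def)
  show "f \<in> spheroids A n a" by fact
  show "g \<in> spheroids A n a"
    using quasitopologyD(2)[OF q fA, of g] g fb cube_boundary_subset by (auto simp: spheroids_def)
  have "continuous_map (cube (Suc n)) (cube n) (\<lambda>y. y(n := 0))"
    unfolding cube_def[of "Suc n"] by (rule cube_mapI[OF continuous_on_update cube_set_project]) auto
  then show "?H \<in> A (cube (Suc n))" by (rule quasitopologyD(3)[OF q fA])
  show "?H x = f x" "?H (x(n := 1)) = g x" if "x \<in> cube_set n" for x
    using cube_set_last[OF that] g[OF that] by simp_all
  show "?H (x(n := t)) = a" if "x \<in> cube_boundary n" "0 \<le> t" "t \<le> 1" for x t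
    using fb[OF that(1)] cube_set_last[of x n] that(1) cube_boundary_subset by (auto simp: subset_iff)
qed

lemma spheroid_homotopy_sym:
  assumes "(f, g) \<in> spheroid_homotopy A n a"
  shows "(g, f) \<in> spheroid_homotopy A n a"
  using assms
proof (rule spheroid_homotopyE)
  fix H assume H: "f \<in> spheroids A n a" "g \<in> spheroids A n a" "H \<in> A (cube (Suc n))"
    "\<And>x. x \<in> cube_set n \<Longrightarrow> H x = f x" "\<And>x. x \<in> cube_set n \<Longrightarrow> H (x(n := 1)) = g x"
    "\<And>x t. x \<in> cube_boundary n \<Longrightarrow> 0 \<le> t \<Longrightarrow> t \<le> 1 \<Longrightarrow> H (x(n := t)) = a"
  let ?H = "H \<circ> (\<lambda>y. y(n := 1 - y n))"
  show ?thesis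
  proof (rule spheroid_homotopyI[OF H(2,1)])
    have "continuous_map (cube (Suc n)) (cube (Suc n)) (\<lambda>y. y(n := 1 - y n))"
      unfolding cube_def[of "Suc n"]
    proof (rule cube_mapI[OF continuous_on_update, unfolded cube_def])
      show "continuous_on (cube_set (Suc n)) (\<lambda>y. 1 - y n)" by (intro continuous_intros cube_coordinate)
      show "x(n := 1 - x n) \<in> cube_set (Suc n)" if "x \<in> cube_set (Suc n)" for x
        using that by (auto simp: cube_set_def)
    qed
    then show "?H \<in> A (cube (Suc n))" by (rule quasitopologyD(3)[OF q H(3)])
    show "?H x = g x" "?H (x(n := 1)) = f x" if x: "x \<in> cube_set n" for x
    proof -
      have "x n = 0" using x by (auto simp: cube_set_def)
      then show "?H x = g x" "?H (x(n := 1)) = f x"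
        using H(4,5)[OF x] cube_set_last[OF x] by simp_all
    qed
    show "?H (x(n := t)) = a" if "x \<in> cube_boundary n" "0 \<le> t" "t \<le> 1" for x t
      using H(6)[OF that(1), of "1 - t"] that by simp
  qed
qed

lemma spheroid_homotopy_trans:
  assumes "(f, g) \<in> spheroid_homotopy A n a" "(g, h) \<in> spheroid_homotopy A n a"
  shows "(f, h) \<in> spheroid_homotopy A n a"
  using assms(1)
proof (rule spheroid_homotopyE)
  fix H assume H: "f \<in> spheroids A n a" "g \<in> spheroids A n a" "H \<in> A (cube (Suc n))"
    "\<And>x. x \<in> cube_set n \<Longrightarrow> H x = f x" "\<And>x. x \<in> cube_set n \<Longrightarrow> H (x(n := 1)) = g x"
    "\<And>x t. x \<in> cube_boundary n \<Longrightarrow> 0 \<le> t \<Longrightarrow> t \<le> 1 \<Longrightarrow> H (x(n := t)) = a"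
  show ?thesis
    using assms(2)
  proof (rule spheroid_homotopyE)
    fix K assume K: "g \<in> spheroids A n a" "h \<in> spheroids A n a" "K \<in> A (cube (Suc n))"
      "\<And>x. x \<in> cube_set n \<Longrightarrow> K x = g x" "\<And>x. x \<in> cube_set n \<Longrightarrow> K (x(n := 1)) = h x"
      "\<And>x t. x \<in> cube_boundary n \<Longrightarrow> 0 \<le> t \<Longrightarrow> t \<le> 1 \<Longrightarrow> K (x(n := t)) = a"
    define L where "L y = (if y n \<le> 1/2 then H (y(n := 2 * y n)) else K (y(n := 2 * y n - 1)))" for y
    let ?C = "{y \<in> cube_set (Suc n). y n \<le> 1/2}" and ?D = "{y \<in> cube_set (Suc n). y n \<ge> 1/2}"
    show ?thesis
    proof (rule spheroid_homotopyI[OF H(1) K(2)])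
      \<comment> \<open>Gluing over two closed sets, here the halves of the time interval, is the
        axiom that makes concatenation admissible.\<close>
      show "L \<in> A (cube (Suc n))"
      proof (rule quasitopologyD(5)[OF q])
        have c: "continuous_map (cube (Suc n)) euclideanreal (\<lambda>y. y n)"
          by (simp add: cube_def cube_coordinate)
        have "closedin (cube (Suc n)) {y \<in> topspace (cube (Suc n)). y n \<in> {..1/2}}"
          "closedin (cube (Suc n)) {y \<in> topspace (cube (Suc n)). y n \<in> {1/2..}}"
          by (rule closedin_continuous_map_preimage[OF c]; simp)+
        then show "closedin (cube (Suc n)) ?C" "closedin (cube (Suc n)) ?D" by simp_all
        show "?C \<union> ?D = topspace (cube (Suc n))" by auto
        have sub: "subtopology (cube (Suc n)) ?C = top_of_set ?C" "subtopology (cube (Suc n)) ?D = top_of_set ?D"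
          by (auto simp: cube_def subtopology_subtopology intro!: arg_cong[where f="subtopology euclidean"])
        have 1: "continuous_map (top_of_set ?C) (cube (Suc n)) (\<lambda>y. y(n := 2 * y n))"
        proof (rule cube_mapI[OF continuous_on_update])
          show "continuous_on ?C (\<lambda>y. 2 * y n)" by (intro continuous_intros cube_coordinate)
          show "x(n := 2 * x n) \<in> cube_set (Suc n)" if "x \<in> ?C" for x using that by (auto simp: cube_set_def)
        qed
        have 2: "continuous_map (top_of_set ?D) (cube (Suc n)) (\<lambda>y. y(n := 2 * y n - 1))"
        proof (rule cube_mapI[OF continuous_on_update])
          show "continuous_on ?D (\<lambda>y. 2 * y n - 1)" by (intro continuous_intros cube_coordinate)
          show "x(n := 2 * x n - 1) \<in> cube_set (Suc n)" if "x \<in> ?D" for x using that by (auto simp: cube_set_def)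
        qed
        show "L \<in> A (subtopology (cube (Suc n)) ?C)"
          unfolding sub by (rule quasitopologyD(2)[OF q quasitopologyD(3)[OF q H(3) 1]]) (simp add: L_def)
        show "L \<in> A (subtopology (cube (Suc n)) ?D)"
          unfolding sub
        proof (rule quasitopologyD(2)[OF q quasitopologyD(3)[OF q K(3) 2]])
          fix y assume "y \<in> topspace (top_of_set ?D)"
          then have y: "y \<in> cube_set (Suc n)" "y n \<ge> 1/2" by auto
          show "L y = (K \<circ> (\<lambda>y. y(n := 2 * y n - 1))) y"
          proof (cases "y n = 1/2")
            case True
            note p = cube_set_project[OF y(1)]
            have "H (y(n := 1)) = g (y(n := 0))" using H(5)[OF p] by simp
            moreover have "K (y(n := 0)) = g (y(n := 0))" by (rule K(4)[OF p])
            ultimately show ?thesis by (simp add: L_def True)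
          qed (use y in \<open>simp add: L_def\<close>)
        qed
      qed
      fix x
      show "L x = f x" "L (x(n := 1)) = h x" if x: "x \<in> cube_set n"
      proof -
        have "x n = 0" using x by (auto simp: cube_set_def)
        then show "L x = f x" "L (x(n := 1)) = h x"
          using H(4)[OF x] K(5)[OF x] cube_set_last[OF x] by (simp_all add: L_def)
      qed
      show "L (x(n := t)) = a" if "x \<in> cube_boundary n" "0 \<le> t" "t \<le> 1" for t
        using H(6)[OF that(1), of "2 * t"] K(6)[OF that(1), of "2 * t - 1"] that by (simp add: L_def)
    qed
  qed
qed

lemma equiv_spheroid_homotopy: "equiv (spheroids A n a) (spheroid_homotopy A n a)"
proof (rule equivI)
  show "spheroid_homotopy A n a \<subseteq> spheroids A n a \<times> spheroids A n a"
    by (auto simp: spheroid_homotopy_def)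
  show "refl_on (spheroids A n a) (spheroid_homotopy A n a)"
    by (rule refl_onI) (rule spheroid_homotopy_cong, auto)
  show "sym (spheroid_homotopy A n a)" by (rule symI) (rule spheroid_homotopy_sym)
  show "trans (spheroid_homotopy A n a)" by (rule transI) (rule spheroid_homotopy_trans)
qed

lemma cube_0: "cube_set 0 = {\<lambda>_. 0}"
  by (auto simp: cube_set_def)

lemma cube_boundary_0: "cube_boundary 0 = {}"
  by (auto simp: cube_boundary_def)

text \<open>Path components are the case \<open>n = 0\<close> of spheroids up to homotopy: the
  0-cube is a point with empty boundary, so the base point \<open>a\<close> imposes no
  condition.\<close>

lemma path_rel_iff:
  assumes c: "\<And>x. x \<in> X \<Longrightarrow> (\<lambda>_. x) \<in> A (cube 0)"
  shows "(x, y) \<in> path_rel X A \<longleftrightarrow> x \<in> X \<and> y \<in> X \<and> ((\<lambda>_. x), (\<lambda>_. y)) \<in> spheroid_homotopy A 0 a"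
  using c unfolding path_rel_def spheroid_homotopy_def spheroids_def
  by (auto simp: cube_0 cube_boundary_0 fun_upd_def)

lemma equiv_path_rel:
  assumes c: "\<And>x. x \<in> X \<Longrightarrow> (\<lambda>_. x) \<in> A (cube 0)"
  shows "equiv X (path_rel X A)"
proof (rule equivI)
  note iff = path_rel_iff[OF c]
  show "path_rel X A \<subseteq> X \<times> X" by (auto simp: path_rel_def)
  show "refl_on X (path_rel X A)"
  proof (rule refl_onI)
    fix x assume x: "x \<in> X"
    then have "(\<lambda>_. x) \<in> spheroids A 0 x" using c by (simp add: spheroids_def cube_boundary_0)
    then have "(\<lambda>_. x, \<lambda>_. x) \<in> spheroid_homotopy A 0 x" by (rule spheroid_homotopy_cong) simp
    then show "(x, x) \<in> path_rel X A" using iff[of x x x] x by blast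
  qed
  show "sym (path_rel X A)" by (rule symI) (use iff spheroid_homotopy_sym in blast)
  show "trans (path_rel X A)" by (rule transI) (use iff spheroid_homotopy_trans in blast)
qed

end

text \<open>The map on classes is written as the saturation of the image of a class. For compatible
  \<open>h\<close> it equals the class of the image of any representative, which is the usual
  induced map.\<close>

lemma bij_betw_quotient:
  assumes R: "equiv S R" and Q: "equiv T Q"
    and h: "\<And>x y. (x, y) \<in> R \<Longrightarrow> (h x, h y) \<in> Q"
    and inj: "\<And>x y. x \<in> S \<Longrightarrow> y \<in> S \<Longrightarrow> (h x, h y) \<in> Q \<Longrightarrow> (x, y) \<in> R"
    and surj: "\<And>t. t \<in> T \<Longrightarrow> \<exists>x\<in>S. (t, h x) \<in> Q"
  shows "bij_betw (\<lambda>C. Q `` (h ` C)) (S // R) (T // Q)"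
proof -
  have val: "Q `` (h ` (R `` {x})) = Q `` {h x}" if x: "x \<in> S" for x
  proof
    have "(x, x) \<in> R" using R x by (meson equiv_def refl_onD)
    then show "Q `` {h x} \<subseteq> Q `` (h ` (R `` {x}))" by blast
    show "Q `` (h ` (R `` {x})) \<subseteq> Q `` {h x}"
    proof
      fix t assume "t \<in> Q `` (h ` (R `` {x}))"
      then obtain y where "(x, y) \<in> R" "(h y, t) \<in> Q" by blast
      then have "(h x, t) \<in> Q" using h Q by (meson equiv_def transD)
      then show "t \<in> Q `` {h x}" by blast
    qed
  qed
  have hT: "h x \<in> T" if "x \<in> S" for x
  proof -
    have "(x, x) \<in> R" using R that by (meson equiv_def refl_onD)
    then show ?thesis using h Q by (metis equiv_class_eq_iff)
  qed
  show ?thesis unfolding bij_betw_def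
  proof
    show "inj_on (\<lambda>C. Q `` (h ` C)) (S // R)"
    proof (rule inj_onI)
      fix C D assume "C \<in> S // R" "D \<in> S // R" and eq: "Q `` (h ` C) = Q `` (h ` D)"
      then obtain x y where xy: "x \<in> S" "C = R `` {x}" "y \<in> S" "D = R `` {y}" by (auto elim!: quotientE)
      have "Q `` {h x} = Q `` {h y}" using eq val xy by simp
      then have "(h x, h y) \<in> Q" using eq_equiv_class[OF _ Q hT[OF xy(3)]] by blast
      then show "C = D" using inj xy equiv_class_eq[OF R] by blast
    qed
    show "(\<lambda>C. Q `` (h ` C)) ` (S // R) = T // Q"
    proof
      show "(\<lambda>C. Q `` (h ` C)) ` (S // R) \<subseteq> T // Q"
        using val hT by (auto elim!: quotientE intro!: quotientI)
      show "T // Q \<subseteq> (\<lambda>C. Q `` (h ` C)) ` (S // R)"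
      proof
        fix D assume "D \<in> T // Q"
        then obtain t where t: "t \<in> T" "D = Q `` {t}" by (auto elim!: quotientE)
        obtain x where x: "x \<in> S" "(t, h x) \<in> Q" using surj t(1) by blast
        have "D = Q `` (h ` (R `` {x}))" using t(2) val[OF x(1)] equiv_class_eq[OF Q x(2)] by simp
        then show "D \<in> (\<lambda>C. Q `` (h ` C)) ` (S // R)" using x(1) by (auto intro!: quotientI)
      qed
    qed
  qed
qed

text \<open>Gluing over the empty open cover.\<close>

lemma quasitopology_empty:
  assumes "quasitopology_on X A" "topspace Z = {}"
  shows "f \<in> A Z"
  by (rule quasitopologyD(4)[OF assms(1), of "{}"]) (use assms(2) in simp_all)

lemma openin_cube_coordinate:
  assumes "open S"
  shows "openin (cube n) {x \<in> cube_set n. x i \<in> S}"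
proof -
  have "continuous_map (cube n) euclidean (\<lambda>x. x i)" by (simp add: cube_def cube_coordinate)
  from openin_continuous_map_preimage[OF this, of S] assms show ?thesis by simp
qed

lemma openin_cube_coordinates:
  assumes "open S"
  shows "openin (cube k) (\<Union>i\<in>{..<n}. {x \<in> cube_set k. x i \<in> S})"
proof (rule openin_Union)
  fix T assume "T \<in> (\<lambda>i. {x \<in> cube_set k. x i \<in> S}) ` {..<n}"
  then obtain i where "T = {x \<in> cube_set k. x i \<in> S}" by blast
  then show "openin (cube k) T" using openin_cube_coordinate[OF assms] by simp
qed

lemma closedin_cube_boundary: "closedin (cube n) (cube_boundary n)"
proof -
  have "closedin (cube n) {x \<in> cube_set n. x i \<in> {0, 1}}" for i
  proof -
    have "continuous_map (cube n) euclidean (\<lambda>x. x i)" by (simp add: cube_def cube_coordinate)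
    from closedin_continuous_map_preimage[OF this, of "{0, 1}"] show ?thesis by simp
  qed
  then have "closedin (cube n) (\<Union>i\<in>{..<n}. {x \<in> cube_set n. x i \<in> {0, 1}})" by (intro closedin_Union) auto
  moreover have "(\<Union>i\<in>{..<n}. {x \<in> cube_set n. x i \<in> {0, 1}}) = cube_boundary n" by (auto simp: cube_boundary_def)
  ultimately show ?thesis by simp
qed

text \<open>The bounds 1/4 and 3/4 are those of the collar: \<open>collar n 1\<close> maps this open
  neighbourhood of the boundary into the boundary.\<close>

definition near_boundary :: "nat \<Rightarrow> (nat \<Rightarrow> real) set" where
  "near_boundary n = {x \<in> cube_set n. \<exists>i<n. x i < 1/4 \<or> x i > 3/4}"

lemma near_boundary: "openin (cube n) (near_boundary n)" "cube_boundary n \<subseteq> near_boundary n"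
proof -
  have "openin (cube n) (\<Union>i\<in>{..<n}. {x \<in> cube_set n. x i \<in> {..<1/4} \<union> {3/4<..}})"
    by (rule openin_cube_coordinates) (intro open_Un open_lessThan open_greaterThan)
  moreover have "(\<Union>i\<in>{..<n}. {x \<in> cube_set n. x i \<in> {..<1/4} \<union> {3/4<..}}) = near_boundary n"
    by (auto simp: near_boundary_def)
  ultimately show "openin (cube n) (near_boundary n)" by simp
  show "cube_boundary n \<subseteq> near_boundary n" by (force simp: near_boundary_def cube_boundary_def)
qed

context
  fixes X :: "'a set" and A :: "(nat \<Rightarrow> real, 'a) quasitopology"
    and Y :: "'b set" and B :: "(nat \<Rightarrow> real, 'b) quasitopology" and \<Psi> :: "'a \<Rightarrow> 'b"
  assumes qA: "quasitopology_on X A" and qB: "quasitopology_on Y B" and qc: "quasi_continuous X A Y B \<Psi>"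
    and cA: "\<And>x Z. x \<in> X \<Longrightarrow> (\<lambda>_. x) \<in> A Z" and cB: "\<And>y Z. y \<in> Y \<Longrightarrow> (\<lambda>_. y) \<in> B Z"
    and LP: "\<And>n f W K g0. f \<in> B (cube n) \<Longrightarrow> openin (cube n) W \<Longrightarrow> closedin (cube n) K \<Longrightarrow> K \<subseteq> W \<Longrightarrow>
      g0 \<in> A (subtopology (cube n) W) \<Longrightarrow> (\<And>x. x \<in> W \<Longrightarrow> \<Psi> (g0 x) = f x) \<Longrightarrow>
      \<exists>g\<in>A (cube n). (\<forall>x\<in>cube_set n. \<Psi> (g x) = f x) \<and> (\<forall>x\<in>K. g x = g0 x)"
begin

lemma Psi_spheroid: "f \<in> spheroids A n a \<Longrightarrow> \<Psi> \<circ> f \<in> spheroids B n (\<Psi> a)"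
  using qc by (auto simp: quasi_continuous_def spheroids_def)

lemma collar_spheroid:
  assumes "quasitopology_on X' A'" "f \<in> spheroids A' n a"
  shows "f \<circ> collar n 1 \<in> spheroids A' n a" "(f, f \<circ> collar n 1) \<in> spheroid_homotopy A' n a"
proof -
  show *: "(f, f \<circ> collar n 1) \<in> spheroid_homotopy A' n a" by (rule spheroid_homotopy_collar[OF assms])
  show "f \<circ> collar n 1 \<in> spheroids A' n a" using * by (simp add: spheroid_homotopy_def)
qed

text \<open>After composition with the collar, the spheroid is constant on an open neighbourhood of
  the boundary, where the constant \<open>a\<close> is a lift; relative lifting keeps it on the
  boundary itself.\<close>

lemma spheroid_lift_surj:
  assumes f: "f \<in> spheroids B n (\<Psi> a)" and a: "a \<in> X"
  shows "\<exists>g\<in>spheroids A n a. (f, \<Psi> \<circ> g) \<in> spheroid_homotopy B n (\<Psi> a)"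
proof -
  let ?f = "f \<circ> collar n 1"
  note c = collar_spheroid[OF qB f]
  have fB: "?f \<in> B (cube n)" using c(1) by (simp add: spheroids_def)
  have "\<Psi> a = ?f x" if "x \<in> near_boundary n" for x
    using f collar_near_boundary[of _ n x] that by (auto simp: near_boundary_def spheroids_def)
  from LP[OF fB near_boundary(1) closedin_cube_boundary near_boundary(2) cA[OF a] this]
  obtain g where g: "g \<in> A (cube n)" "\<And>x. x \<in> cube_set n \<Longrightarrow> \<Psi> (g x) = ?f x" "\<And>x. x \<in> cube_boundary n \<Longrightarrow> g x = a"
    by auto
  have "(?f, \<Psi> \<circ> g) \<in> spheroid_homotopy B n (\<Psi> a)"
    by (rule spheroid_homotopy_cong[OF qB c(1)]) (use g(2) in simp)
  from spheroid_homotopy_trans[OF qB c(2) this] show ?thesis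
    using g by (intro bexI[of _ g]) (auto simp: spheroids_def)
qed

text \<open>The homotopy downstairs is collared in all \<open>n + 1\<close> directions. Near the
  boundary of its cube it then has an evident lift: the collared \<open>f\<close> near time 0, the
  collared \<open>g\<close> near time 1, and \<open>a\<close> near the sides. Relative lifting
  extends this to a homotopy upstairs.\<close>

lemma spheroid_lift_inj:
  assumes f: "f \<in> spheroids A n a" and g: "g \<in> spheroids A n a" and a: "a \<in> X"
    and h: "(\<Psi> \<circ> f, \<Psi> \<circ> g) \<in> spheroid_homotopy B n (\<Psi> a)"
  shows "(f, g) \<in> spheroid_homotopy A n a"
proof -
  obtain H where H: "H \<in> B (cube (Suc n))"
    "\<And>x. x \<in> cube_set n \<Longrightarrow> H x = \<Psi> (f x)" "\<And>x. x \<in> cube_set n \<Longrightarrow> H (x(n := 1)) = \<Psi> (g x)"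
    "\<And>x t. x \<in> cube_boundary n \<Longrightarrow> 0 \<le> t \<Longrightarrow> t \<le> 1 \<Longrightarrow> H (x(n := t)) = \<Psi> a"
    using h by (rule spheroid_homotopyE) auto
  let ?n = "Suc n"
  let ?H = "H \<circ> collar ?n 1"
  have cc: "continuous_map (cube k) (cube l) (collar l 1)" for k l
    unfolding cube_def[of k] by (rule collar_continuous_map)
  have HB: "?H \<in> B (cube ?n)" by (rule quasitopologyD(3)[OF qB H(1) cc])
  have fA: "f \<circ> collar n 1 \<in> A (cube ?n)" "g \<circ> collar n 1 \<in> A (cube ?n)"
    using f g by (auto intro!: quasitopologyD(3)[OF qA _ cc] simp: spheroids_def)
  have fa: "f x = a" "g x = a" if "x \<in> cube_boundary n" for x
    using f g that by (auto simp: spheroids_def)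
  \<comment> \<open>The three prescriptions overlap along the edges, where they agree because the
    collared \<open>f\<close> and \<open>g\<close> are already \<open>a\<close> near the sides; the
    order of the cases is therefore immaterial there.\<close>
  define g0 where "g0 y = (if y n < 1/4 then f (collar n 1 y) else if y n > 3/4 then g (collar n 1 y) else a)" for y
  let ?W = "near_boundary ?n"
  have g0a: "g0 y = a" if "i < n" "y i < 1/4 \<or> y i > 3/4" for y i
    using fa[OF collar_near_boundary[of i n y]] that by (simp add: g0_def)
  \<comment> \<open>Admissibility by gluing over three open pieces: near the bottom, near the top
    and near the sides. On each of them \<open>g0\<close> equals a family known to be
    admissible.\<close>
  have "g0 \<in> A (subtopology (cube ?n) ?W)"
  proof (rule quasitopologyD(4)[OF qA])
    let ?S1 = "{y \<in> cube_set ?n. y n \<in> {..<1/4}}" and ?S2 = "{y \<in> cube_set ?n. y n \<in> {3/4<..}}"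
      and ?S3 = "\<Union>i\<in>{..<n}. {x \<in> cube_set ?n. x i \<in> {..<1/4} \<union> {3/4<..}}"
    let ?C = "{?S1, ?S2, ?S3}"
    have op: "openin (cube ?n) ?S1" "openin (cube ?n) ?S2" "openin (cube ?n) ?S3"
      by (rule openin_cube_coordinate, simp, rule openin_cube_coordinate, simp)
        (rule openin_cube_coordinates, intro open_Un open_lessThan open_greaterThan)
    have un: "\<Union>?C = ?W" by (auto simp: near_boundary_def less_Suc_eq)
    have sub: "S \<subseteq> ?W" if "S \<in> ?C" for S using that un by blast
    have oW: "openin (cube ?n) ?W" by (rule near_boundary(1))
    show "\<Union>?C = topspace (subtopology (cube ?n) ?W)" using un openin_subset[OF oW] by auto
    fix S assume S: "S \<in> ?C"
    then show "openin (subtopology (cube ?n) ?W) S"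
      using op sub[OF S] openin_open_subtopology[OF oW] by auto
    have eq: "subtopology (subtopology (cube ?n) ?W) S = subtopology (cube ?n) S"
      using sub[OF S] by (simp add: subtopology_subtopology Int_absorb1)
    have res: "k \<in> A (subtopology (cube ?n) S)" if "k \<in> A (cube ?n)" for k
    proof -
      have "continuous_map (subtopology (cube ?n) S) (cube ?n) (\<lambda>x. x)" by (simp add: continuous_map_from_subtopology)
      from quasitopologyD(3)[OF qA that this] show ?thesis by (simp add: o_def)
    qed
    from S consider "S = ?S1" | "S = ?S2" | "S = ?S3" by blast
    then show "g0 \<in> A (subtopology (subtopology (cube ?n) ?W) S)"
      unfolding eq
    proof cases
      case 1
      show "g0 \<in> A (subtopology (cube ?n) S)"
        by (rule quasitopologyD(2)[OF qA res[OF fA(1)]]) (auto simp: 1 g0_def)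
    next
      case 2
      show "g0 \<in> A (subtopology (cube ?n) S)"
        by (rule quasitopologyD(2)[OF qA res[OF fA(2)]]) (auto simp: 2 g0_def)
    next
      case 3
      show "g0 \<in> A (subtopology (cube ?n) S)"
        by (rule quasitopologyD(2)[OF qA cA[OF a]]) (auto simp: 3 intro: g0a)
    qed
  qed
  moreover have "\<Psi> (g0 y) = ?H y" if y: "y \<in> ?W" for y
  proof (cases "\<exists>i<n. y i < 1/4 \<or> y i > 3/4")
    case True
    then obtain i where i: "i < n" "y i < 1/4 \<or> y i > 3/4" by blast
    have "collar n 1 y \<in> cube_boundary n" by (rule collar_near_boundary[of i n y]) (use i in auto)
    then have "?H y = \<Psi> a" unfolding o_def collar_Suc by (rule H(4)[OF _ clamp01])
    then show ?thesis using g0a[of i y] i by simp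
  next
    case False
    then consider "y n < 1/4" | "y n > 3/4" using y by (auto simp: near_boundary_def less_Suc_eq)
    then show ?thesis
    proof cases
      case 1
      then have "clamp01 ((1 + 1) * y n - 1 / 2) = 0" by (simp add: clamp01_def)
      then have "?H y = \<Psi> (f (collar n 1 y))"
        unfolding o_def collar_Suc using H(2)[OF collar_cube] cube_set_last[OF collar_cube] by simp
      then show ?thesis using 1 by (simp add: g0_def)
    next
      case 2
      then have "clamp01 ((1 + 1) * y n - 1 / 2) = 1" by (simp add: clamp01_def)
      then have "?H y = \<Psi> (g (collar n 1 y))"
        unfolding o_def collar_Suc using H(3)[OF collar_cube] by simp
      then show ?thesis using 2 by (simp add: g0_def)
    qed
  qed
  ultimately obtain G where G: "G \<in> A (cube ?n)" "\<And>y. y \<in> cube_boundary ?n \<Longrightarrow> G y = g0 y"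
    using LP[OF HB near_boundary(1) closedin_cube_boundary near_boundary(2)] by blast
  have bd: "x \<in> cube_boundary ?n" "x(n := 1) \<in> cube_boundary ?n" if "x \<in> cube_set n" for x
  proof -
    have "x n = 0" "x \<in> cube_set ?n" using that cube_set_Suc by (auto simp: cube_set_def)
    then show "x \<in> cube_boundary ?n" by (auto simp: cube_boundary_def)
    show "x(n := 1) \<in> cube_boundary ?n" using cube_update[OF that, of 1] by (auto simp: cube_boundary_def)
  qed
  have "(f \<circ> collar n 1, g \<circ> collar n 1) \<in> spheroid_homotopy A n a"
  proof (rule spheroid_homotopyI[OF collar_spheroid(1)[OF qA f] collar_spheroid(1)[OF qA g] G(1)])
    show "G x = (f \<circ> collar n 1) x" if "x \<in> cube_set n" for x
    proof -
      have "x n = 0" using that by (auto simp: cube_set_def)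
      then show ?thesis using G(2)[OF bd(1)[OF that]] by (simp add: g0_def)
    qed
    show "G (x(n := 1)) = (g \<circ> collar n 1) x" if "x \<in> cube_set n" for x
      using G(2)[OF bd(2)[OF that]] by (simp add: g0_def)
    show "G (x(n := t)) = a" if x: "x \<in> cube_boundary n" "0 \<le> t" "t \<le> 1" for x t
    proof -
      obtain i where i: "i < n" "x i = 0 \<or> x i = 1" and xc: "x \<in> cube_set n" using x(1) by (auto simp: cube_boundary_def)
      have "x(n := t) \<in> cube_boundary ?n"
        using cube_update[OF xc x(2,3)] i by (auto simp: cube_boundary_def intro!: exI[of _ i])
      then have "G (x(n := t)) = g0 (x(n := t))" by (rule G(2))
      also have "\<dots> = a" by (rule g0a[of i]) (use i in auto)
      finally show ?thesis .
    qed
  qed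
  \<comment> \<open>Each spheroid is homotopic to its collared version, so the collars can be
    removed again.\<close>
  then show ?thesis
    using spheroid_homotopy_trans[OF qA] spheroid_homotopy_sym[OF qA] collar_spheroid(2)[OF qA f] collar_spheroid(2)[OF qA g]
    by blast
qed

lemma Psi_spheroid_homotopy:
  assumes "(f, g) \<in> spheroid_homotopy A n a"
  shows "(\<Psi> \<circ> f, \<Psi> \<circ> g) \<in> spheroid_homotopy B n (\<Psi> a)"
  using assms
proof (rule spheroid_homotopyE)
  fix H assume H: "f \<in> spheroids A n a" "g \<in> spheroids A n a" "H \<in> A (cube (Suc n))"
    "\<And>x. x \<in> cube_set n \<Longrightarrow> H x = f x" "\<And>x. x \<in> cube_set n \<Longrightarrow> H (x(n := 1)) = g x"
    "\<And>x t. x \<in> cube_boundary n \<Longrightarrow> 0 \<le> t \<Longrightarrow> t \<le> 1 \<Longrightarrow> H (x(n := t)) = a"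
  have "\<Psi> \<circ> H \<in> B (cube (Suc n))" using qc H(3) by (simp add: quasi_continuous_def)
  then show ?thesis
    by (rule spheroid_homotopyI[OF Psi_spheroid[OF H(1)] Psi_spheroid[OF H(2)]]) (simp_all add: H(4-6))
qed

theorem weak_homotopy_equivalence_by_lifting: "weak_homotopy_equivalence X A Y B \<Psi>"
  unfolding weak_homotopy_equivalence_def
proof (intro conjI allI impI ballI)
  show "quasi_continuous X A Y B \<Psi>" by (rule qc)
  show "bij_betw (\<lambda>C. spheroid_homotopy B n (\<Psi> a) `` ((\<circ>) \<Psi> ` C)) (pi_n A n a) (pi_n B n (\<Psi> a))" if a: "a \<in> X" for n a
    unfolding pi_n_def
    by (rule bij_betw_quotient[OF equiv_spheroid_homotopy[OF qA] equiv_spheroid_homotopy[OF qB]])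
      (use Psi_spheroid_homotopy spheroid_lift_inj[OF _ _ a] spheroid_lift_surj[OF _ a] in blast)+
  have cY: "\<Psi> x \<in> Y" if "x \<in> X" for x using qc that by (auto simp: quasi_continuous_def)
  note pA = path_rel_iff[OF qA cA] and pB = path_rel_iff[OF qB cB]
  show "bij_betw (\<lambda>C. path_rel Y B `` (\<Psi> ` C)) (pi0 X A) (pi0 Y B)"
    unfolding pi0_def
  proof (rule bij_betw_quotient[OF equiv_path_rel[OF qA cA] equiv_path_rel[OF qB cB]])
    show "(\<Psi> x, \<Psi> y) \<in> path_rel Y B" if "(x, y) \<in> path_rel X A" for x y
    proof -
      have xy: "x \<in> X" "y \<in> X" "(\<lambda>_. x, \<lambda>_. y) \<in> spheroid_homotopy A 0 x" using that pA[of x y x] by auto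
      from Psi_spheroid_homotopy[OF xy(3)] show ?thesis using pB[of "\<Psi> x" "\<Psi> y" "\<Psi> x"] cY xy by (simp add: o_def)
    qed
    show "(x, y) \<in> path_rel X A" if x: "x \<in> X" and y: "y \<in> X" and xy: "(\<Psi> x, \<Psi> y) \<in> path_rel Y B" for x y
    proof -
      have "(\<lambda>_. \<Psi> x, \<lambda>_. \<Psi> y) \<in> spheroid_homotopy B 0 (\<Psi> x)" using xy pB[of "\<Psi> x" "\<Psi> y" "\<Psi> x"] by auto
      then have "(\<Psi> \<circ> (\<lambda>_. x), \<Psi> \<circ> (\<lambda>_. y)) \<in> spheroid_homotopy B 0 (\<Psi> x)" by (simp add: o_def)
      moreover have "(\<lambda>_. x) \<in> spheroids A 0 x" "(\<lambda>_. y) \<in> spheroids A 0 x"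
        using cA[OF x] cA[OF y] by (simp_all add: spheroids_def cube_boundary_def)
      ultimately have "(\<lambda>_. x, \<lambda>_. y) \<in> spheroid_homotopy A 0 x" using spheroid_lift_inj[OF _ _ x] by blast
      then show ?thesis using pA[of x y x] x y by blast
    qed
    show "\<exists>x\<in>X. (y, \<Psi> x) \<in> path_rel Y B" if y: "y \<in> Y" for y
    proof -
      \<comment> \<open>Surjectivity on components is lifting over the 0-cube with nothing
        prescribed; the prescribed lift lives over the empty set, so any function qualifies.\<close>
      have "undefined \<in> A (subtopology (cube 0) {})" by (rule quasitopology_empty[OF qA]) simp
      from LP[OF cB[OF y, of "cube 0"] openin_empty closedin_empty order_refl this]
      obtain g where g: "g \<in> A (cube 0)" "\<forall>x\<in>cube_set 0. \<Psi> (g x) = y" by auto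
      have "(\<lambda>_. 0) \<in> cube_set 0" by (simp add: cube_set_def)
      then have "g (\<lambda>_. 0) \<in> X" "\<Psi> (g (\<lambda>_. 0)) = y"
        using quasitopologyD(1)[OF qA g(1), of "\<lambda>_. 0"] g(2) by auto
      moreover have "(y, y) \<in> path_rel Y B"
        using equiv_path_rel[OF qB cB] y by (meson equiv_def refl_onD)
      ultimately show ?thesis by (intro bexI[of _ "g (\<lambda>_. 0)"]) simp_all
    qed
  qed
qed

end

lemma cube_topology:
  "compact_space (cube n)" "regular_space (cube n)" "second_countable (cube n)"
proof -
  \<comment> \<open>The cube is a product over all natural numbers whose factors are points from
    index \<open>n\<close> on, so its compactness is an instance of the Tychonoff theorem.\<close>
  have "compactin (product_topology (\<lambda>_. euclideanreal) UNIV) (PiE UNIV (\<lambda>i. if i < n then {0..1} else {0::real}))"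
    by (auto simp: compactin_PiE)
  moreover have "PiE UNIV (\<lambda>i. if i < n then {0..1} else {0::real}) = cube_set n"
  proof (rule set_eqI)
    fix x :: "nat \<Rightarrow> real"
    have "x i \<in> (if i < n then {0..1} else {0}) \<longleftrightarrow> (i < n \<longrightarrow> 0 \<le> x i \<and> x i \<le> 1) \<and> (n \<le> i \<longrightarrow> x i = 0)" for i
      by auto
    then show "x \<in> PiE UNIV (\<lambda>i. if i < n then {0..1} else {0}) \<longleftrightarrow> x \<in> cube_set n"
      unfolding PiE_iff cube_set_def by (simp add: extensional_def) blast
  qed
  ultimately have "compactin (product_topology (\<lambda>_. euclideanreal) UNIV) (cube_set n)" by (simp only:)
  then have "compactin euclidean (cube_set n)" unfolding euclidean_product_topology .
  then show "compact_space (cube n)" unfolding cube_def by (rule compact_space_subtopology)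
  show "regular_space (cube n)" unfolding cube_def by (intro regular_space_subtopology regular_space_euclidean)
  show "second_countable (cube n)" unfolding cube_def by (intro second_countable_subtopology second_countable_euclidean)
qed

context smooth_bundle
begin

lemma quasitopology_on_jets:
  assumes U: "openin TM U"
  shows "quasitopology_on (jet_sections M E p r U) (jet_quasitopology M E p r U :: ('z, _) quasitopology)"
  unfolding quasitopology_on_def
proof (intro conjI allI ballI impI; (elim conjE)?)
  fix Z :: "'z topology" and f assume "f \<in> jet_quasitopology M E p r U Z"
  from jet_quasitopologyD(2)[OF this] show "f ` topspace Z \<subseteq> jet_sections M E p r U" by blast
next
  fix Z :: "'z topology" and f g assume g: "g \<in> jet_quasitopology M E p r U Z" and eq: "\<forall>z\<in>topspace Z. f z = g z"
  note D = jet_quasitopologyD[OF g]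
  show "f \<in> jet_quasitopology M E p r U Z"
  proof (rule jet_quasitopologyI[OF U])
    show "continuous_map (param_topology U Z) (JS r) (\<lambda>(a, z). f z a)" by (rule continuous_map_eq[OF D(1)]) (use eq in auto)
  qed (use eq D in auto)
next
  fix Z Z' :: "'z topology" and \<phi> f assume f: "f \<in> jet_quasitopology M E p r U Z" and \<phi>: "continuous_map Z' Z \<phi>"
  note D = jet_quasitopologyD[OF f]
  have im: "\<phi> z \<in> topspace Z" if "z \<in> topspace Z'" for z
    using continuous_map_image_subset_topspace[OF \<phi>] that by blast
  show "f \<circ> \<phi> \<in> jet_quasitopology M E p r U Z'"
  proof (rule jet_quasitopologyI[OF U])
    have "continuous_map (param_topology U Z') (param_topology U Z) (\<lambda>(a, z). (a, \<phi> z))"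
      using \<phi> continuous_map_prod_top[of "subtopology TM U" Z' "subtopology TM U" Z "\<lambda>w. w" \<phi>] by simp
    from continuous_map_compose[OF this D(1)]
    show "continuous_map (param_topology U Z') (JS r) (\<lambda>(a, z). (f \<circ> \<phi>) z a)" by (simp add: o_def case_prod_unfold)
  qed (use im D in auto)
next
  fix Z :: "'z topology" and \<C> f
  assume C: "\<forall>C\<in>\<C>. openin Z C \<and> f \<in> jet_quasitopology M E p r U (subtopology Z C)" and un: "\<Union>\<C> = topspace Z"
  have D: "continuous_map (param_topology U (subtopology Z C)) (JS r) (\<lambda>(a, z). f z a)" "openin Z C"
     "\<And>z. z \<in> C \<Longrightarrow> f z \<in> extensional U" "\<And>z a. z \<in> C \<Longrightarrow> a \<in> U \<Longrightarrow> fst (f z a) = a" if "C \<in> \<C>" for C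
  proof -
    have "f \<in> jet_quasitopology M E p r U (subtopology Z C)" and o: "openin Z C" using C that by auto
    note d = jet_quasitopologyD[OF this(1)]
    show "continuous_map (param_topology U (subtopology Z C)) (JS r) (\<lambda>(a, z). f z a)" "openin Z C" by (rule d(1), rule o)
    show "f z \<in> extensional U" if "z \<in> C" for z using d(3)[of z] that openin_subset[OF o] by auto
    show "fst (f z a) = a" if "z \<in> C" "a \<in> U" for z a using d(4)[of a z] that openin_subset[OF o] by auto
  qed
  show "f \<in> jet_quasitopology M E p r U Z"
  proof (rule jet_quasitopologyI[OF U])
    show "continuous_map (param_topology U Z) (JS r) (\<lambda>(a, z). f z a)"
    proof (rule continuous_map_localI)
      fix y assume "y \<in> topspace (param_topology U Z)"
      then obtain a z where y: "y = (a, z)" "a \<in> U" "z \<in> topspace Z" by auto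
      then obtain C where C: "C \<in> \<C>" "z \<in> C" using un by blast
      have "openin (param_topology U Z) (U \<times> C)"
        using D(2)[OF C(1)] U by (auto simp: openin_prod_Times_iff openin_open_subtopology)
      moreover have "continuous_map (subtopology (param_topology U Z) (U \<times> C)) (JS r) (\<lambda>(a, z). f z a)"
        unfolding subtopology_box_right[OF U] by (rule D(1)[OF C(1)])
      ultimately show "\<exists>W. openin (param_topology U Z) W \<and> y \<in> W \<and> continuous_map (subtopology (param_topology U Z) W) (JS r) (\<lambda>(a, z). f z a)"
        using y C(2) by blast
    qed
    show "fst (f z a) = a" if "a \<in> U" "z \<in> topspace Z" for a z using that un D(4) by blast
    show "f z \<in> extensional U" if "z \<in> topspace Z" for z using that un D(3) by blast
  qed
next
  fix Z :: "'z topology" and C D f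
  assume CD: "closedin Z C" "closedin Z D" "C \<union> D = topspace Z"
    and f: "f \<in> jet_quasitopology M E p r U (subtopology Z C)" "f \<in> jet_quasitopology M E p r U (subtopology Z D)"
  note c = jet_quasitopologyD[OF f(1)] and d = jet_quasitopologyD[OF f(2)]
  show "f \<in> jet_quasitopology M E p r U Z"
  proof (rule jet_quasitopologyI[OF U])
    show "continuous_map (param_topology U Z) (JS r) (\<lambda>(a, z). f z a)"
    proof (rule pasting_lemma_closed[where I="{C, D}" and T="\<lambda>X. U \<times> X" and f="\<lambda>_ (a, z). f z a"])
      have "closedin (subtopology TM U) U" using topspace_sub[OF U] closedin_topspace[of "subtopology TM U"] by simp
      then show "closedin (param_topology U Z) (U \<times> X)" if "X \<in> {C, D}" for X
        using that CD by (auto simp: closedin_prod_Times_iff)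
      show "continuous_map (subtopology (param_topology U Z) (U \<times> X)) (JS r) (\<lambda>(a, z). f z a)" if "X \<in> {C, D}" for X
        unfolding subtopology_box_right[OF U] using that c(1) d(1) by blast
      show "\<exists>j. j \<in> {C, D} \<and> x \<in> U \<times> j \<and> (case x of (a, z) \<Rightarrow> f z a) = (case x of (a, z) \<Rightarrow> f z a)"
        if "x \<in> topspace (param_topology U Z)" for x
        using that CD(3) by auto
    qed auto
    show "fst (f z a) = a" if "a \<in> U" "z \<in> topspace Z" for a z using that CD(3) c(4)[of a z] d(4)[of a z] by auto
    show "f z \<in> extensional U" if "z \<in> topspace Z" for z using that CD(3) c(3)[of z] d(3)[of z] by auto
  qed
qed

lemma jet_const:
  assumes U: "openin TM U" and "\<sigma> \<in> jet_sections M E p r U"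
  shows "(\<lambda>_. \<sigma>) \<in> jet_quasitopology M E p r U Z"
proof (rule jet_quasitopologyI[OF U])
  have "continuous_map (subtopology TM U) (JS r) \<sigma>" using assms(2) by (simp add: jet_sections_def)
  from continuous_map_compose[OF continuous_map_fst this]
  show "continuous_map (param_topology U Z) (JS r) (\<lambda>(a, z). \<sigma> a)" by (simp add: o_def case_prod_unfold)
qed (use assms(2) in \<open>auto simp: jet_sections_def\<close>)

lemma Psi_quasi_continuous:
  assumes U: "openin TM U"
  shows "quasi_continuous (diag_sections M E p U) (diag_quasitopology M E p U) (jet_sections M E p r U)
    (jet_quasitopology M E p r U) (Psi M E p r U)"
  unfolding quasi_continuous_def
proof (intro conjI allI ballI)
  show "Psi M E p r U \<circ> g \<in> jet_quasitopology M E p r U Z" if "g \<in> diag_quasitopology M E p U Z" for g Z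
    using that Psi_family by (simp add: diag_quasitopology_def)
  have "Psi M E p r U \<gamma> \<in> jet_sections M E p r U" if "\<gamma> \<in> diag_sections M E p U" for \<gamma>
    using jet_quasitopologyD(2)[OF Psi_family[OF diag_family_const[OF U that, of "discrete_topology {()}"]], of "()" r] by simp
  then show "Psi M E p r U ` diag_sections M E p U \<subseteq> jet_sections M E p r U" by blast
qed

lemma Psi_sheaf_morphism:
  "sheaf_morphism TM (diag_sections M E p) (diag_quasitopology M E p)
     (jet_sections M E p r) (jet_quasitopology M E p r) (Psi M E p r)"
  unfolding sheaf_morphism_def
proof (intro conjI allI impI ballI)
  fix U V x assume "openin TM U \<and> openin TM V \<and> V \<subseteq> U"
  then have "U \<inter> V = V" by auto
  then show "Psi M E p r V (restrict x V) = restrict (Psi M E p r U x) V"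
    by (simp add: Psi_eq) (auto intro!: restrict_ext)
qed (rule Psi_quasi_continuous)

text \<open>Relative lifting over a cube becomes the extension problem on
  \<open>U \<times> cube_set n\<close>: the given lift is a partial lift on the open tube over
  \<open>W\<close>, and it is frozen on the closed tube over \<open>K\<close>.\<close>

lemma Psi_weak_equivalence:
  assumes U: "openin TM U"
  shows "weak_homotopy_equivalence (diag_sections M E p U) (diag_quasitopology M E p U)
    (jet_sections M E p r U) (jet_quasitopology M E p r U) (Psi M E p r U)"
proof (rule weak_homotopy_equivalence_by_lifting)
  show "quasitopology_on (diag_sections M E p U) (diag_quasitopology M E p U)" by (rule quasitopology_on_diag[OF U])
  show "quasitopology_on (jet_sections M E p r U) (jet_quasitopology M E p r U)" by (rule quasitopology_on_jets[OF U])
  show "quasi_continuous (diag_sections M E p U) (diag_quasitopology M E p U) (jet_sections M E p r U)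
    (jet_quasitopology M E p r U) (Psi M E p r U)" by (rule Psi_quasi_continuous[OF U])
  show "(\<lambda>_. \<gamma>) \<in> diag_quasitopology M E p U Z" if "\<gamma> \<in> diag_sections M E p U" for \<gamma> Z
    using diag_family_const[OF U that] by (simp add: diag_quasitopology_def)
  show "(\<lambda>_. \<sigma>) \<in> jet_quasitopology M E p r U Z" if "\<sigma> \<in> jet_sections M E p r U" for \<sigma> Z
    by (rule jet_const[OF U that])
  fix n f W K g0
  assume f: "f \<in> jet_quasitopology M E p r U (cube n)" and W: "openin (cube n) W" and K: "closedin (cube n) K" "K \<subseteq> W"
    and g0: "g0 \<in> diag_quasitopology M E p U (subtopology (cube n) W)"
    and eq: "\<And>x. x \<in> W \<Longrightarrow> Psi M E p r U (g0 x) = f x"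
  note tU = topspace_sub[OF U]
  have g0W: "diag_family M E p U (subtopology (cube n) W) g0" using g0 by (simp add: diag_quasitopology_def)
  have tW: "topspace (subtopology (cube n) W) = W" using openin_subset[OF W] by auto
  have ext0: "g0 z \<in> extensional U" if "z \<in> W" for z
    using diag_family_point[OF g0W] that tW by (auto simp: diag_sections_def)
  \<comment> \<open>A family over all of \<open>U\<close> and \<open>W\<close> is admissible on the
    box formed by \<open>U\<close> and \<open>W\<close> itself, so a single box serves all
    points.\<close>
  have pl: "partial_lift r (cube n) (\<lambda>(a, z). f z a) (U \<times> W) g0"
    unfolding partial_lift_def
  proof (intro conjI allI impI)
    fix a z assume az: "(a, z) \<in> U \<times> W"
    have "Psi M E p r U (g0 z) a = f z a" using eq az by auto
    then show "germ_jet r a (g0 z a) = (case (a, z) of (a, z) \<Rightarrow> f z a)" using az by (simp add: Psi_eq)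
    have "diag_family M E p U (subtopology (cube n) W) (\<lambda>z. \<lambda>a\<in>U. g0 z a)"
      by (rule diag_family_cong[OF g0W]) (use ext0 tW in \<open>simp add: extensional_restrict\<close>)
    then show "\<exists>N V. openin (cube n) N \<and> z \<in> N \<and> openin TM V \<and> a \<in> V \<and> V \<times> N \<subseteq> U \<times> W \<and>
      diag_family M E p V (subtopology (cube n) N) (\<lambda>z. \<lambda>a\<in>V. g0 z a)"
      using az W U by (intro exI[of _ W] exI[of _ U]) simp
  qed
  have oW: "openin (param_topology U (cube n)) (U \<times> W)"
    using W U by (auto simp: openin_prod_Times_iff openin_open_subtopology)
  have "closedin (subtopology TM U) U" using tU closedin_topspace[of "subtopology TM U"] by simp
  then have cK: "closedin (param_topology U (cube n)) (U \<times> K)" using K by (auto simp: closedin_prod_Times_iff)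
  have "U \<times> K \<subseteq> U \<times> W" using K by auto
  from lifting[OF cube_topology U f oW cK this pl] obtain \<gamma> where \<gamma>: "diag_family M E p U (cube n) \<gamma>" "\<forall>z\<in>topspace (cube n). \<forall>a\<in>U. germ_jet r a (\<gamma> z a) = f z a"
    "\<forall>(a, z)\<in>U \<times> K. \<gamma> z a = g0 z a" "\<forall>z. \<gamma> z \<in> extensional U"
    by (elim exE conjE)
  show "\<exists>g\<in>diag_quasitopology M E p U (cube n). (\<forall>x\<in>cube_set n. Psi M E p r U (g x) = f x) \<and> (\<forall>x\<in>K. g x = g0 x)"
  proof (intro bexI conjI ballI)
    show "\<gamma> \<in> diag_quasitopology M E p U (cube n)" using \<gamma>(1) by (simp add: diag_quasitopology_def)
    show "Psi M E p r U (\<gamma> x) = f x" if "x \<in> cube_set n" for x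
    proof (rule extensionalityI[of _ U])
      show "Psi M E p r U (\<gamma> x) \<in> extensional U" by (simp add: Psi_eq)
      show "f x \<in> extensional U" using jet_quasitopologyD(3)[OF f] that by simp
      show "Psi M E p r U (\<gamma> x) a = f x a" if "a \<in> U" for a using \<gamma>(2) \<open>x \<in> cube_set n\<close> that by (simp add: Psi_eq)
    qed
    show "\<gamma> x = g0 x" if "x \<in> K" for x
      by (rule extensionalityI[of _ U]) (use \<gamma>(3,4) ext0 K(2) that in auto)
  qed
qed

end

theorem proposition5p2:
  fixes M :: "('m, 'b::real_normed_vector) manifold"
    and E :: "('e, 'b \<times> 'c::real_normed_vector) manifold"
    and F :: "('f, 'c) manifold"
    and p :: "'e \<Rightarrow> 'm"
  assumes "smooth_fiber_bundle M E F p"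
  shows "(\<forall>r::nat.
      sheaf_morphism (mtop M)
        (diag_sections M E p)
        (diag_quasitopology M E p :: 'm set \<Rightarrow> ('z, 'm \<Rightarrow> ('m \<times> 'm \<Rightarrow> 'e) set) quasitopology)
        (jet_sections M E p r) (jet_quasitopology M E p r)
        (Psi M E p r) \<and>
      sheaf_weak_equivalence (mtop M)
        (diag_sections M E p) (diag_quasitopology M E p)
        (jet_sections M E p r) (jet_quasitopology M E p r)
        (Psi M E p r)) \<and>
    (\<forall>r>0. \<exists>\<Phi>.
      sheaf_weak_equivalence (mtop M)
        (diag_sections M E p) (diag_quasitopology M E p)
        (jet_sections M E p r) (jet_quasitopology M E p r) \<Phi>)"
proof -
  interpret smooth_bundle M E F p by unfold_locales (rule assms)
  have "sheaf_weak_equivalence (mtop M)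
        (diag_sections M E p) (diag_quasitopology M E p)
        (jet_sections M E p r) (jet_quasitopology M E p r)
        (Psi M E p r)" for r
    unfolding sheaf_weak_equivalence_def using Psi_sheaf_morphism Psi_weak_equivalence by blast
  \<comment> \<open>\<open>Psi M E p r\<close> itself is the witness for the second part.\<close>
  then show ?thesis using Psi_sheaf_morphism by blast
qed

end
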